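(* Let $(M^n,g)$ be a closed connected Riemannian manifold of dimension $n\ge 3$ and let $f$ be a proper isoparametric function on $M$. If $1<q<p_f$, there exists $\lambda_0>0$ such that if $\lambda\in(0,\lambda_0)$ and $u$ is a positive $f$-invariant solution of $$-\Delta_g u+\lambda u=\lambda u^q$$ on $M$, then $u=1$.
   Context: $\Delta_g$ is the Laplace–Beltrami operator, with the sign convention that $-\Delta_g$ is nonnegative. A smooth non-constant function $f:M\to[t_0,t_1]$ (onto) is called isoparametric if $|\nabla f|^2=b(f)$ and $\Delta_g f=a(f)$ for some smooth functions $a,b$ on $[t_0,t_1]$. The sets $M_1=f^{-1}(t_0)$ and $M_2=f^{-1}(t_1)$ are then smooth submanifolds, called the focal submanifolds; $d_i$ denotes the dimension of $M_i$. $f$ is called proper if $d_1,d_2\le n-2$. Set $d=\min\{d_1,d_2\}$ and $p_f=\frac{n-d+2}{n-d-2}$, with $p_f=\infty$ if $d=n-2$. Let $\mathbf d(x)=d_g(M_1,x)$ and $t^*=d_g(M_1,M_2)$. A function $u$ on $M$ is $f$-invariant if $u(x)=\phi(\mathbf d(x))$ for some function $\phi:[0,t^*]\to\mathbb R$ (equivalently, $u$ is constant on the level sets of $f$). Solutions are of class $C^{2,\alpha}$, for a fixed $\alpha\in(0,1)$. *)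

theory Defs
  imports "HOL-Analysis.Analysis"
begin

section \<open>Differentiability classes in normed spaces\<close>

text \<open>\<open>Ck_on k S f\<close> and \<open>Ck_holder_on k \<alpha> S f\<close> are meant for open \<open>S\<close> in a finite-dimensional space,
  where continuity (local Hoelder continuity) of all directional derivatives up to order \<open>k\<close>
  characterises the classes \<open>C^k\<close> and \<open>C^{k,\<alpha>}_loc\<close>.\<close>

primrec Ck_on :: "nat \<Rightarrow> 'a::real_normed_vector set \<Rightarrow> ('a \<Rightarrow> 'b::real_normed_vector) \<Rightarrow> bool" where
  "Ck_on 0 S f \<longleftrightarrow> continuous_on S f"
| "Ck_on (Suc k) S f \<longleftrightarrow>
     (\<forall>x\<in>S. f differentiable (at x)) \<and> (\<forall>v. Ck_on k S (\<lambda>x. frechet_derivative f (at x) v))"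

definition locally_holder_on :: "real \<Rightarrow> 'a::metric_space set \<Rightarrow> ('a \<Rightarrow> 'b::metric_space) \<Rightarrow> bool" where
  "locally_holder_on \<alpha> S f \<longleftrightarrow>
     (\<forall>x\<in>S. \<exists>r>0. \<exists>C. \<forall>y\<in>S \<inter> ball x r. \<forall>z\<in>S \<inter> ball x r. dist (f y) (f z) \<le> C * dist y z powr \<alpha>)"

primrec Ck_holder_on ::
  "nat \<Rightarrow> real \<Rightarrow> 'a::real_normed_vector set \<Rightarrow> ('a \<Rightarrow> 'b::real_normed_vector) \<Rightarrow> bool" where
  "Ck_holder_on 0 \<alpha> S f \<longleftrightarrow> locally_holder_on \<alpha> S f"
| "Ck_holder_on (Suc k) \<alpha> S f \<longleftrightarrow>
     (\<forall>x\<in>S. f differentiable (at x)) \<and> (\<forall>v. Ck_holder_on k \<alpha> S (\<lambda>x. frechet_derivative f (at x) v))"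

text \<open>On a set that is not open (such as a compact interval), smoothness means existence of a smooth
  extension to an open neighbourhood.\<close>

definition smooth_on :: "'a::real_normed_vector set \<Rightarrow> ('a \<Rightarrow> 'b::real_normed_vector) \<Rightarrow> bool" where
  "smooth_on S f \<longleftrightarrow>
     (\<exists>T F. open T \<and> S \<subseteq> T \<and> (\<forall>k. Ck_on k T F) \<and> (\<forall>x\<in>S. F x = f x))"


section \<open>Smooth manifolds\<close>

text \<open>The underlying set of the manifold is a type \<open>'m\<close>; its dimension is \<open>CARD('n)\<close>.
  A chart is a pair of a domain and a coordinate map, the latter being irrelevant off the domain.\<close>

type_synonym ('m, 'n) chart = "'m set \<times> ('m \<Rightarrow> real ^ 'n)"

definition chart_inv :: "('m, 'n) chart \<Rightarrow> real ^ 'n \<Rightarrow> 'm" where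
  "chart_inv c = inv_into (fst c) (snd c)"

definition is_chart :: "('m::topological_space, 'n::finite) chart \<Rightarrow> bool" where
  "is_chart c \<longleftrightarrow>
     open (fst c) \<and> open (snd c ` fst c) \<and> homeomorphism (fst c) (snd c ` fst c) (snd c) (chart_inv c)"

definition compatible_charts :: "('m, 'n::finite) chart \<Rightarrow> ('m, 'n) chart \<Rightarrow> bool" where
  "compatible_charts c c' \<longleftrightarrow>
     smooth_on (snd c ` (fst c \<inter> fst c')) (snd c' \<circ> chart_inv c) \<and>
     smooth_on (snd c' ` (fst c \<inter> fst c')) (snd c \<circ> chart_inv c')"

locale smooth_manifold =
  fixes A :: "('m::{t2_space, second_countable_topology}, 'n::finite) chart set"
  assumes charts: "c \<in> A \<Longrightarrow> is_chart c"
    and cover: "\<Union> (fst ` A) = UNIV"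
    and compatible: "c \<in> A \<Longrightarrow> c' \<in> A \<Longrightarrow> compatible_charts c c'"

definition chart_at :: "('m, 'n) chart set \<Rightarrow> 'm \<Rightarrow> ('m, 'n) chart" where
  "chart_at A p = (SOME c. c \<in> A \<and> p \<in> fst c)"

definition smooth_fun :: "('m, 'n::finite) chart set \<Rightarrow> ('m \<Rightarrow> real) \<Rightarrow> bool" where
  "smooth_fun A u \<longleftrightarrow> (\<forall>c\<in>A. smooth_on (snd c ` fst c) (u \<circ> chart_inv c))"

text \<open>On a compact manifold this local condition is equivalent to finiteness of the usual
  \<open>C^{k,\<alpha>}\<close> norm.\<close>

definition Ck_holder_fun :: "nat \<Rightarrow> real \<Rightarrow> ('m, 'n::finite) chart set \<Rightarrow> ('m \<Rightarrow> real) \<Rightarrow> bool" where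
  "Ck_holder_fun k \<alpha> A u \<longleftrightarrow> (\<forall>c\<in>A. Ck_holder_on k \<alpha> (snd c ` fst c) (u \<circ> chart_inv c))"

text \<open>Embedded submanifolds of pure dimension \<open>d\<close>, by slice charts of the smooth structure
  generated by \<open>A\<close>.\<close>

definition submanifold_of_dim ::
  "('m::topological_space, 'n::finite) chart set \<Rightarrow> 'm set \<Rightarrow> nat \<Rightarrow> bool" where
  "submanifold_of_dim A S d \<longleftrightarrow>
     (\<forall>p\<in>S. \<exists>c W. is_chart c \<and> (\<forall>c'\<in>A. compatible_charts c c') \<and> p \<in> fst c \<and>
        subspace W \<and> dim W = d \<and> snd c ` (fst c \<inter> S) = snd c ` fst c \<inter> W)"


section \<open>Riemannian metrics\<close>

text \<open>A metric is given by its coefficient matrices: \<open>g c x\<close> is the matrix of the components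
  \<open>g\<^sub>i\<^sub>j\<close> in the chart \<open>c\<close> at the coordinate point \<open>x\<close>. The last assumption is the
  transformation law of a covariant 2-tensor under change of charts.\<close>

locale riemannian_manifold = smooth_manifold A
  for A :: "('m::{t2_space, second_countable_topology}, 'n::finite) chart set" +
  fixes g :: "('m, 'n) chart \<Rightarrow> real ^ 'n \<Rightarrow> real ^ 'n ^ 'n"
  assumes metric_smooth: "c \<in> A \<Longrightarrow> smooth_on (snd c ` fst c) (g c)"
    and metric_sym: "c \<in> A \<Longrightarrow> x \<in> snd c ` fst c \<Longrightarrow> transpose (g c x) = g c x"
    and metric_pos: "c \<in> A \<Longrightarrow> x \<in> snd c ` fst c \<Longrightarrow> v \<noteq> 0 \<Longrightarrow> v \<bullet> (g c x *v v) > 0"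
    and metric_transform:
      "c \<in> A \<Longrightarrow> c' \<in> A \<Longrightarrow> p \<in> fst c \<inter> fst c' \<Longrightarrow>
       D = frechet_derivative (snd c' \<circ> chart_inv c) (at (snd c p)) \<Longrightarrow>
       v \<bullet> (g c (snd c p) *v w) = D v \<bullet> (g c' (snd c' p) *v D w)"

text \<open>Closed means compact; absence of boundary is built into the charts.\<close>

locale closed_connected_riemannian_manifold = riemannian_manifold A g
  for A :: "('m::{t2_space, second_countable_topology}, 'n::finite) chart set" and g +
  assumes compact_manifold: "compact (UNIV :: 'm set)"
    and connected_manifold: "connected (UNIV :: 'm set)"


subsection \<open>Gradient and Laplace--Beltrami operator\<close>

definition partial_deriv :: "'n::finite \<Rightarrow> (real ^ 'n \<Rightarrow> real) \<Rightarrow> real ^ 'n \<Rightarrow> real" where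
  "partial_deriv i F x = frechet_derivative F (at x) (axis i 1)"

definition coord_gradient ::
  "(real ^ 'n \<Rightarrow> real ^ 'n ^ 'n) \<Rightarrow> (real ^ 'n \<Rightarrow> real) \<Rightarrow> real ^ 'n \<Rightarrow> real ^ 'n::finite" where
  "coord_gradient G F x = matrix_inv (G x) *v (\<chi> j. partial_deriv j F x)"

definition coord_divergence ::
  "(real ^ 'n \<Rightarrow> real ^ 'n ^ 'n) \<Rightarrow> (real ^ 'n \<Rightarrow> real ^ 'n) \<Rightarrow> real ^ 'n::finite \<Rightarrow> real" where
  "coord_divergence G X x =
     (\<Sum>i\<in>UNIV. partial_deriv i (\<lambda>y. sqrt (det (G y)) * X y $ i) x) / sqrt (det (G x))"

text \<open>The quantities below are computed in one chart around the point; by the transformation law of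
  the metric their values do not depend on that chart.\<close>

definition gradient_norm_sq ::
  "('m, 'n::finite) chart set \<Rightarrow> (('m, 'n) chart \<Rightarrow> real ^ 'n \<Rightarrow> real ^ 'n ^ 'n) \<Rightarrow>
   ('m \<Rightarrow> real) \<Rightarrow> 'm \<Rightarrow> real" where
  "gradient_norm_sq A g u p =
     (let c = chart_at A p; x = snd c p; X = coord_gradient (g c) (u \<circ> chart_inv c) x
      in X \<bullet> (g c x *v X))"

definition laplace_beltrami ::
  "('m, 'n::finite) chart set \<Rightarrow> (('m, 'n) chart \<Rightarrow> real ^ 'n \<Rightarrow> real ^ 'n ^ 'n) \<Rightarrow>
   ('m \<Rightarrow> real) \<Rightarrow> 'm \<Rightarrow> real" where
  "laplace_beltrami A g u p =
     (let c = chart_at A p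
      in coord_divergence (g c) (coord_gradient (g c) (u \<circ> chart_inv c)) (snd c p))"


subsection \<open>Riemannian distance\<close>

definition C1_curve_on ::
  "('m::topological_space, 'n::finite) chart set \<Rightarrow> real \<Rightarrow> real \<Rightarrow> (real \<Rightarrow> 'm) \<Rightarrow> bool" where
  "C1_curve_on A a b \<gamma> \<longleftrightarrow>
     continuous_on {a..b} \<gamma> \<and>
     (\<forall>c\<in>A. \<exists>D. continuous_on {t\<in>{a..b}. \<gamma> t \<in> fst c} D \<and>
        (\<forall>t\<in>{a..b}. \<gamma> t \<in> fst c \<longrightarrow> ((snd c \<circ> \<gamma>) has_vector_derivative D t) (at t within {a..b})))"

text \<open>The library's \<open>piecewise_C1_differentiable_on\<close> allows the derivative to blow up at the break
  points; here the curve is \<open>C^1\<close> up to the end points of each closed piece.\<close>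

definition piecewise_C1_curve ::
  "('m::topological_space, 'n::finite) chart set \<Rightarrow> (real \<Rightarrow> 'm) \<Rightarrow> bool" where
  "piecewise_C1_curve A \<gamma> \<longleftrightarrow>
     continuous_on {0..1} \<gamma> \<and>
     (\<exists>T. finite T \<and>
        (\<forall>a b. 0 \<le> a \<and> a < b \<and> b \<le> 1 \<and> {a<..<b} \<inter> T = {} \<longrightarrow> C1_curve_on A a b \<gamma>))"

definition curve_speed ::
  "('m, 'n::finite) chart set \<Rightarrow> (('m, 'n) chart \<Rightarrow> real ^ 'n \<Rightarrow> real ^ 'n ^ 'n) \<Rightarrow>
   (real \<Rightarrow> 'm) \<Rightarrow> real \<Rightarrow> real" where
  "curve_speed A g \<gamma> t =
     (let c = chart_at A (\<gamma> t); v = vector_derivative (snd c \<circ> \<gamma>) (at t)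
      in sqrt (v \<bullet> (g c (snd c (\<gamma> t)) *v v)))"

definition curve_length ::
  "('m, 'n::finite) chart set \<Rightarrow> (('m, 'n) chart \<Rightarrow> real ^ 'n \<Rightarrow> real ^ 'n ^ 'n) \<Rightarrow>
   (real \<Rightarrow> 'm) \<Rightarrow> real" where
  "curve_length A g \<gamma> = integral {0..1} (curve_speed A g \<gamma>)"

definition riemannian_dist ::
  "('m::topological_space, 'n::finite) chart set \<Rightarrow>
   (('m, 'n) chart \<Rightarrow> real ^ 'n \<Rightarrow> real ^ 'n ^ 'n) \<Rightarrow> 'm \<Rightarrow> 'm \<Rightarrow> real" where
  "riemannian_dist A g p q =
     Inf {curve_length A g \<gamma> | \<gamma>. piecewise_C1_curve A \<gamma> \<and> \<gamma> 0 = p \<and> \<gamma> 1 = q}"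

definition riemannian_setdist ::
  "('m::topological_space, 'n::finite) chart set \<Rightarrow>
   (('m, 'n) chart \<Rightarrow> real ^ 'n \<Rightarrow> real ^ 'n ^ 'n) \<Rightarrow> 'm set \<Rightarrow> 'm \<Rightarrow> real" where
  "riemannian_setdist A g S p = Inf ((\<lambda>q. riemannian_dist A g q p) ` S)"


section \<open>Isoparametric functions\<close>

definition isoparametric ::
  "('m, 'n::finite) chart set \<Rightarrow> (('m, 'n) chart \<Rightarrow> real ^ 'n \<Rightarrow> real ^ 'n ^ 'n) \<Rightarrow>
   real \<Rightarrow> real \<Rightarrow> ('m \<Rightarrow> real) \<Rightarrow> bool" where
  "isoparametric A g t0 t1 f \<longleftrightarrow>
     smooth_fun A f \<and> \<not> f constant_on UNIV \<and> range f = {t0..t1} \<and>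
     (\<exists>a b. smooth_on {t0..t1} a \<and> smooth_on {t0..t1} b \<and>
        (\<forall>x. gradient_norm_sq A g f x = b (f x)) \<and>
        (\<forall>x. laplace_beltrami A g f x = a (f x)))"

text \<open>\<open>d1\<close> and \<open>d2\<close> are the dimensions of the focal submanifolds.\<close>

definition proper_isoparametric ::
  "('m::topological_space, 'n::finite) chart set \<Rightarrow>
   (('m, 'n) chart \<Rightarrow> real ^ 'n \<Rightarrow> real ^ 'n ^ 'n) \<Rightarrow>
   real \<Rightarrow> real \<Rightarrow> nat \<Rightarrow> nat \<Rightarrow> ('m \<Rightarrow> real) \<Rightarrow> bool" where
  "proper_isoparametric A g t0 t1 d1 d2 f \<longleftrightarrow>
     isoparametric A g t0 t1 f \<and>
     submanifold_of_dim A (f -` {t0}) d1 \<and> submanifold_of_dim A (f -` {t1}) d2 \<and>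
     d1 + 2 \<le> CARD('n) \<and> d2 + 2 \<le> CARD('n)"

text \<open>For \<open>d \<le> n - 2\<close>; the coercions avoid truncated subtraction.\<close>

definition critical_exponent :: "nat \<Rightarrow> nat \<Rightarrow> ereal" where
  "critical_exponent n d =
     (if n = d + 2 then \<infinity> else ereal ((real n - real d + 2) / (real n - real d - 2)))"

text \<open>Only the values of \<open>\<phi>\<close> on the range \<open>[0, t^*]\<close> of the distance to the focal set
  \<open>f -` {t0}\<close> matter.\<close>

definition f_invariant ::
  "('m::topological_space, 'n::finite) chart set \<Rightarrow>
   (('m, 'n) chart \<Rightarrow> real ^ 'n \<Rightarrow> real ^ 'n ^ 'n) \<Rightarrow>
   real \<Rightarrow> ('m \<Rightarrow> real) \<Rightarrow> ('m \<Rightarrow> real) \<Rightarrow> bool" where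
  "f_invariant A g t0 f u \<longleftrightarrow>
     (\<exists>\<phi> :: real \<Rightarrow> real. \<forall>x. u x = \<phi> (riemannian_setdist A g (f -` {t0}) x))"

end

(*
An f-invariant solution is u = \<psi> \<circ> f, because the distance to a focal set is a function of f: curves
cannot be shorter than the arclength \<integral> 1 / \<surd>b, and steepest descent attains it. The equation becomes
b \<psi>'' + a \<psi>' + \<lambda> (\<psi>^q - \<psi>) = 0 on (t0, t1), singular at both ends, where b has simple zeros. At a
focal point, the Hessian of f divided by b'(t0) / 2 is a projection whose kernel contains the tangent
space of the focal set, so a(t0) = k b'(t0) / 2 with 1 \<le> k \<le> n - d. Since q is subcritical for every such
k, a Pohozaev energy forces \<lambda> sup \<psi>^(q-1) to be small when \<lambda> is. Integrating the flux A \<psi>' from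
both ends then bounds the oscillation of \<psi> by a small multiple of sup \<bar>\<psi> - 1\<bar>, whence \<psi> = 1.
*)
theory Submission imports Defs begin

section \<open>The singular boundary value problem\<close>

text \<open>Nothing bounds \<open>\<psi>\<close> a priori, and near a singular end it could
  concentrate. The way in is the one-sided inequality x^q - x >= -1 for x > 0: the flux vanishes at
  both ends, so integrating from either side bounds it in the middle of the interval by a constant
  times lam. The mean value theorem for the flux then bounds \<open>\<psi>\<close> at one point,
  hence throughout the middle, which supplies the data at the outer edge of each end from which the
  energy argument starts. There only k <= K with K = n - d enters, and q < p_f is exactly K (q - 1)
  < 2 (q + 1). The bound k >= 1 is as important: it makes A decay at least like sqrt s, which
  matches the behaviour sqrt s * \<open>\<psi>1\<close> -> 0 of a C^2 function at the focal set. It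
  rests on a nonzero Hessian there, and this is where connectedness and the growth of sqrt (f - t0)
  come in. Steepest descent is realised without integral curves of the gradient, by maximising a
  difference of distance and arclength and moving along one short coordinate segment.\<close>

lemma at_right_0_mono_le:
  fixes z z' :: "real \<Rightarrow> real"
  assumes d: "\<And>s. 0 < s \<Longrightarrow> s < r \<Longrightarrow> (z has_real_derivative z' s) (at s)"
    and n: "\<And>s. 0 < s \<Longrightarrow> s < r \<Longrightarrow> z' s \<le> 0"
    and l: "(z \<longlongrightarrow> l) (at_right 0)" and s: "0 < s" "s < r"
  shows "z s \<le> l"
proof -
  have "z s \<le> z x" if x: "0 < x" "x < s" for x
    by (rule DERIV_nonpos_imp_nonincreasing)
      (use x s in \<open>force intro: exI[of _ "z' _"] d n\<close>)+
  then have "eventually (\<lambda>x. z s \<le> z x) (at_right 0)"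
    using s by (intro eventually_at_rightI[of 0 s]) auto
  then show ?thesis using l tendsto_lowerbound trivial_limit_at_right_real by blast
qed

lemma at_right_0_mono_ge:
  fixes z z' :: "real \<Rightarrow> real"
  assumes d: "\<And>s. 0 < s \<Longrightarrow> s < r \<Longrightarrow> (z has_real_derivative z' s) (at s)"
    and n: "\<And>s. 0 < s \<Longrightarrow> s < r \<Longrightarrow> z' s \<ge> 0"
    and l: "(z \<longlongrightarrow> l) (at_right 0)" and s: "0 < s" "s < r"
  shows "z s \<ge> l"
proof -
  have "- z s \<le> - l"
    by (rule at_right_0_mono_le[of r "\<lambda>s. - z s" "\<lambda>s. - z' s"])
      (use assms in \<open>auto intro!: derivative_eq_intros tendsto_intros\<close>)
  then show ?thesis by simp
qed

lemma mono_le_of_deriv_le: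
  fixes z z' :: "real \<Rightarrow> real"
  assumes "x \<le> y" and "\<And>s. x \<le> s \<Longrightarrow> s \<le> y \<Longrightarrow> (z has_real_derivative z' s) (at s)"
    and "\<And>s. x \<le> s \<Longrightarrow> s \<le> y \<Longrightarrow> z' s \<le> B"
  shows "z y \<le> z x + B * (y - x)"
proof -
  have "z y - B * y \<le> z x - B * x"
    by (rule DERIV_nonpos_imp_nonincreasing[OF assms(1)])
      (use assms in \<open>force intro!: derivative_eq_intros\<close>)
  then show ?thesis by (simp add: algebra_simps)
qed

text \<open>
  The integrating factor \<open>A\<close> of the equation behaves like \<open>s^(k/2)\<close>; geometrically, \<open>k\<close> is the
  rank of the Hessian of \<open>f\<close> on the focal set, at most its codimension.
\<close>

locale singular_end =
  fixes a b b' A :: "real \<Rightarrow> real" and \<beta> k \<delta> c0 C0 :: real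
  assumes beta: "0 < \<beta>" and k: "1 \<le> k" and delta: "0 < \<delta>" "\<delta> \<le> 1"
    and c0: "0 < c0" "c0 \<le> C0"
    and b_deriv: "0 < s \<Longrightarrow> s < \<delta> \<Longrightarrow> (b has_real_derivative b' s) (at s)"
    and A_deriv: "0 < s \<Longrightarrow> s < \<delta> \<Longrightarrow> (A has_real_derivative a s / b s * A s) (at s)"
    and A_lo: "0 < s \<Longrightarrow> s < \<delta> \<Longrightarrow> c0 * s powr (k/2) \<le> A s"
    and A_hi: "0 < s \<Longrightarrow> s < \<delta> \<Longrightarrow> A s \<le> C0 * s powr (k/2)"
    and b_lo: "0 < s \<Longrightarrow> s < \<delta> \<Longrightarrow> c0 * s \<le> b s"
    and b_hi: "0 < s \<Longrightarrow> s < \<delta> \<Longrightarrow> b s \<le> C0 * s"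
    and a_lim: "(a \<longlongrightarrow> k * \<beta> / 2) (at_right 0)"
    and b'_lim: "(b' \<longlongrightarrow> \<beta>) (at_right 0)"
begin

section \<open>Flux estimates at one singular end\<close>

lemma A_pos: "0 < s \<Longrightarrow> s < \<delta> \<Longrightarrow> 0 < A s"
  using A_lo[of s] c0 by (smt (verit) mult_pos_pos powr_gt_zero)

lemma b_pos: "0 < s \<Longrightarrow> s < \<delta> \<Longrightarrow> 0 < b s"
  using b_lo[of s] c0 by (smt (verit) mult_pos_pos)

text \<open>In divergence form the equation reads (A \<psi>')' = - (A / b) N, so A / b is the
  density against which the nonlinearity is integrated. The exponent k/2 - 1 exceeds -1, which makes
  it integrable at 0.\<close>

lemma weight_upper:
  assumes "0 < s" "s < \<delta>" shows "A s / b s \<le> C0 / c0 * s powr (k/2 - 1)"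
proof -
  have "A s / b s \<le> (C0 * s powr (k/2)) / (c0 * s)"
    using A_hi[OF assms] b_lo[OF assms] A_pos[OF assms] c0 assms by (intro frac_le) auto
  also have "\<dots> = C0 / c0 * s powr (k/2 - 1)"
    using assms by (simp add: powr_diff)
  finally show ?thesis .
qed

text \<open>Passing from k to a larger K only decreases the power, because s < \<delta> <= 1. The
  energy gain uses this weaker bound, so an upper bound for k is enough there.\<close>

lemma weight_lower:
  assumes "0 < s" "s < \<delta>" "k \<le> K" shows "c0 / C0 * s powr (K/2 - 1) \<le> A s / b s"
proof -
  have "c0 / C0 * s powr (K/2 - 1) \<le> c0 / C0 * s powr (k/2 - 1)"
    using c0 assms delta by (intro mult_left_mono powr_mono') auto
  also have "\<dots> = (c0 * s powr (k/2)) / (C0 * s)"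
    using assms by (simp add: powr_diff)
  also have "\<dots> \<le> A s / b s"
    using A_lo[of s] b_hi[of s] b_pos[of s] c0 assms A_pos[of s] by (intro frac_le) auto
  finally show ?thesis .
qed

text \<open>The factor that appears when the upper bound \<open>C0 / c0 * s powr (k/2 - 1)\<close>
  of the density is integrated from 0.\<close>

definition "C1 = 2 * C0 / (c0 * k)"

lemma C1_pos: "0 < C1"
  using c0 k by (auto simp: C1_def)

lemma powr_comparison_deriv:
  assumes "0 < s"
  shows "((\<lambda>s. B * C1 * s powr (k/2)) has_real_derivative B * (C0 / c0 * s powr (k/2 - 1))) (at s)"
  unfolding C1_def using assms k c0 by (auto intro!: derivative_eq_intros simp: field_simps)

lemma powr_half_lim: "((\<lambda>s. B * s powr (k/2)) \<longlongrightarrow> 0) (at_right 0)"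
proof -
  have "((\<lambda>s. B * s powr (k/2)) \<longlongrightarrow> B * 0 powr (k/2)) (at_right 0)"
    using k by (intro tendsto_intros) (auto simp: eventually_at_right_field intro!: exI[of _ 1])
  then show ?thesis by simp
qed

text \<open>Integration of the flux from the end, phrased by monotonicity: subtracting the primitive
  of the comparison density leaves a decreasing function with limit 0. The nonlinearity enters
  through a lower bound alone, and that is what every positive \<open>\<psi>\<close> satisfies
  before any estimate is known.\<close>

lemma flux_upper:
  assumes y: "\<And>s. 0 < s \<Longrightarrow> s < r \<Longrightarrow> (y has_real_derivative - (A s / b s) * N s) (at s)"
    and N: "\<And>s. 0 < s \<Longrightarrow> s < r \<Longrightarrow> - B \<le> N s" and B: "0 \<le> B" and r: "r \<le> \<delta>"
    and l: "(y \<longlongrightarrow> 0) (at_right 0)" and s: "0 < s" "s < r"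
  shows "y s \<le> B * C1 * s powr (k/2)"
proof -
  have "y s - B * C1 * s powr (k/2) \<le> 0"
  proof (rule at_right_0_mono_le[of r "\<lambda>s. y s - B * C1 * s powr (k/2)" "\<lambda>s. - (A s / b s) * N s - B * (C0 / c0 * s powr (k/2 - 1))"])
    fix s assume s: "0 < s" "s < r"
    show "((\<lambda>s. y s - B * C1 * s powr (k/2)) has_real_derivative
        - (A s / b s) * N s - B * (C0 / c0 * s powr (k/2 - 1))) (at s)"
      by (intro DERIV_diff y powr_comparison_deriv s)
    have "- (A s / b s) * N s \<le> A s / b s * B"
      using N[OF s] A_pos[of s] b_pos[of s] s r
        mult_left_mono[of "- N s" B "A s / b s"] by (auto simp: field_simps)
    also have "\<dots> \<le> C0 / c0 * s powr (k/2 - 1) * B"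
      using weight_upper[of s] s r B by (intro mult_right_mono) auto
    finally show "- (A s / b s) * N s - B * (C0 / c0 * s powr (k/2 - 1)) \<le> 0" by (simp add: mult_ac)
  next
    show "((\<lambda>s. y s - B * C1 * s powr (k/2)) \<longlongrightarrow> 0) (at_right 0)"
      using tendsto_diff[OF l powr_half_lim[of "B * C1"]] by simp
  qed (use s in auto)
  then show ?thesis by simp
qed

lemma flux_abs:
  assumes y: "\<And>s. 0 < s \<Longrightarrow> s < r \<Longrightarrow> (y has_real_derivative - (A s / b s) * N s) (at s)"
    and N: "\<And>s. 0 < s \<Longrightarrow> s < r \<Longrightarrow> \<bar>N s\<bar> \<le> B" and r: "r \<le> \<delta>"
    and l: "(y \<longlongrightarrow> 0) (at_right 0)" and s: "0 < s" "s < r"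
  shows "\<bar>y s\<bar> \<le> B * C1 * s powr (k/2)"
proof -
  have B: "0 \<le> B" using N[OF s] by linarith
  have "y s \<le> B * C1 * s powr (k/2)"
    by (rule flux_upper[OF y _ B r l s]) (use N in \<open>force\<close>)+
  moreover have "- y s \<le> B * C1 * s powr (k/2)"
  proof (rule flux_upper[where N = "\<lambda>s. - N s", OF _ _ B r _ s])
    show "((\<lambda>s. - y s) has_real_derivative - (A s / b s) * - N s) (at s)" if "0 < s" "s < r" for s
      using DERIV_minus[OF y[OF that]] by simp
    show "- B \<le> - N s" if "0 < s" "s < r" for s
      using N[OF that] by linarith
    show "((\<lambda>s. - y s) \<longlongrightarrow> 0) (at_right 0)" using tendsto_minus[OF l] by simp
  qed
  ultimately show ?thesis by linarith
qed


section \<open>The Pohozaev energy near one end\<close>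

text \<open>Since q + 1 > 2, the power dominates beyond the point where C x^2 = c x^(q+1), and up to
  that point the square is bounded. This disposes of the quadratic term in the derivative of the
  energy.\<close>

lemma square_le_power_absorb:
  fixes q c C :: real
  assumes "1 < q" "0 < c" "0 \<le> C"
  obtains C' where "0 \<le> C'" "\<And>x. 0 < x \<Longrightarrow> C * x\<^sup>2 \<le> c * x powr (q + 1) + C'"
proof
  let ?R = "(C / c) powr (1 / (q - 1))"
  show "0 \<le> C * ?R\<^sup>2" using assms by simp
  fix x :: real assume x: "0 < x"
  show "C * x\<^sup>2 \<le> c * x powr (q + 1) + C * ?R\<^sup>2"
  proof (cases "x \<le> ?R")
    case True
    then have "C * x\<^sup>2 \<le> C * ?R\<^sup>2" using x assms by (intro mult_left_mono power_mono) auto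
    moreover have "0 \<le> c * x powr (q + 1)" using assms by simp
    ultimately show ?thesis by linarith
  next
    case False
    then have "?R powr (q - 1) \<le> x powr (q - 1)" using assms by (intro powr_mono2) auto
    then have "C / c \<le> x powr (q - 1)" using assms by (simp add: powr_powr)
    then have "C * x\<^sup>2 \<le> c * x powr (q - 1) * x\<^sup>2"
      using assms by (intro mult_right_mono) (auto simp: field_simps)
    also have "\<dots> = c * x powr (q + 1)"
      using x powr_add[of x "q - 1" 2] by (simp add: mult.assoc add.commute)
    finally show ?thesis using assms by (smt (verit) mult_nonneg_nonneg zero_le_power2)
  qed
qed

text \<open>The Pohozaev energy; its derivative is bounded below for a suitable \<open>\<theta>\<close> exactly in the subcritical range.\<close>

definition pohozaev :: "real \<Rightarrow> real \<Rightarrow> real \<Rightarrow> (real \<Rightarrow> real) \<Rightarrow> (real \<Rightarrow> real) \<Rightarrow> real \<Rightarrow> real" where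
  "pohozaev q \<theta> lam \<psi> \<psi>1 s = A s * (b s * (\<psi>1 s)\<^sup>2 / 2
     + lam * (\<psi> s powr (q + 1) / (q + 1) - (\<psi> s)\<^sup>2 / 2) + \<theta> * \<psi> s * \<psi>1 s)"

text \<open>The cross terms cancel in two groups: the potential is a primitive of the nonlinearity,
  and \<open>A * \<psi>1\<close> has a derivative free of \<open>\<psi>1\<close>. What remains is a
  multiple of \<open>\<psi>1\<close> squared and a function of \<open>\<psi>\<close>, whose
  coefficients \<theta> shifts in opposite directions.\<close>

lemma pohozaev_deriv:
  fixes q \<theta> lam :: real
  assumes s: "0 < s" "s < \<delta>" and q: "1 < q" and pos: "0 < \<psi> s"
    and d1: "(\<psi> has_real_derivative \<psi>1 s) (at s)" and d2: "(\<psi>1 has_real_derivative \<psi>2) (at s)"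
    and ode: "b s * \<psi>2 + a s * \<psi>1 s + lam * (\<psi> s powr q - \<psi> s) = 0"
  shows "(pohozaev q \<theta> lam \<psi> \<psi>1 has_real_derivative
     A s * (((b' s - a s) / 2 + \<theta>) * (\<psi>1 s)\<^sup>2)
     + lam * (A s / b s) * ((a s / (q + 1) - \<theta>) * \<psi> s powr (q + 1) - (a s / 2 - \<theta>) * (\<psi> s)\<^sup>2)) (at s)"
proof -
  have b: "b s > 0" using b_pos s by blast
  have p: "\<psi> s powr (q + 1) = \<psi> s * \<psi> s powr q" using pos by (simp add: powr_add)
  have d: "((\<lambda>s. \<psi> s powr (q + 1)) has_real_derivative (q + 1) * \<psi> s powr q * \<psi>1 s) (at s)"
    using DERIV_chain2[OF has_real_derivative_powr[OF pos, of "q + 1"] d1] by simp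
  have e: "\<psi>2 = - (a s * \<psi>1 s + lam * (\<psi> s powr q - \<psi> s)) / b s"
    using ode b by (simp add: field_simps)
  have h1: "((\<lambda>s. b s * (\<psi>1 s)\<^sup>2) has_real_derivative b' s * (\<psi>1 s)\<^sup>2 + 2 * \<psi>1 s * \<psi>2 * b s) (at s)"
    by (auto intro!: derivative_eq_intros b_deriv[OF s] d2 simp: power2_eq_square algebra_simps)
  have h2: "((\<lambda>s. (\<psi> s)\<^sup>2) has_real_derivative 2 * \<psi> s * \<psi>1 s) (at s)"
    by (auto intro!: derivative_eq_intros d1)
  have h3: "((\<lambda>s. \<theta> * \<psi> s * \<psi>1 s) has_real_derivative \<theta> * \<psi>1 s * \<psi>1 s + \<theta> * \<psi> s * \<psi>2) (at s)"
    by (auto intro!: derivative_eq_intros d1 d2)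
  note D = DERIV_mult[OF A_deriv[OF s] DERIV_add[OF DERIV_add[OF DERIV_cdivide[OF h1,of 2]
    DERIV_cmult[OF DERIV_diff[OF DERIV_cdivide[OF d, of "q + 1"] DERIV_cdivide[OF h2, of 2]], of lam]] h3]]
  \<comment> \<open>The reciprocals become free variables, so that the claim is a polynomial
    identity up to multiples of b s * r - 1 and (q + 1) * w - 1, which vanish.\<close>
  define r w where "r = 1 / b s" and "w = 1 / (q + 1)"
  have rw: "b s * r = 1" "(q + 1) * w = 1" using b q by (auto simp: r_def w_def)
  have div: "x / b s = x * r" "x / (q + 1) = x * w" for x by (auto simp: r_def w_def)
  have ring: "a' * r * A' * (b0 * y\<^sup>2 / 2 + lam * (x * p * w - x\<^sup>2 / 2) + \<theta> * x * y)
      + ((b1 * y\<^sup>2 + 2 * y * (- (a' * y + lam * (p - x)) * r) * b0) / 2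
         + lam * ((q + 1) * p * y * w - 2 * x * y / 2)
         + (\<theta> * y * y + \<theta> * x * (- (a' * y + lam * (p - x)) * r))) * A'
    = A' * (((b1 - a') / 2 + \<theta>) * y\<^sup>2) + lam * (A' * r) * ((a' * w - \<theta>) * (x * p) - (a' / 2 - \<theta>) * x\<^sup>2)
      + (b0 * r - 1) * (a' * A' * y\<^sup>2 / 2 - A' * y * (a' * y + lam * (p - x)))
      + ((q + 1) * w - 1) * (lam * p * y * A')" for a' A' b0 b1 x y p
    by (simp add: field_simps power2_eq_square)
  show ?thesis
    unfolding pohozaev_def
    by (rule DERIV_cong[OF D]) (unfold p e div ring, simp add: rw)
qed

text \<open>At the end the coefficients of \<open>\<psi>1\<close> squared and of \<psi>^(q+1) tend
  to (2 - k) \<beta> / 4 + \<theta> and k \<beta> / (2 (q + 1)) - \<theta>. One \<theta> makes both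
  positive exactly when their sum, in which \<theta> cancels, is positive, and this is the
  subcritical inequality for k.\<close>

lemma pohozaev_monotone:
  fixes q :: real
  assumes q: "1 < q" and sub: "k * (q - 1) < 2 * (q + 1)"
  obtains \<theta> \<delta>' c C where "0 < \<delta>'" "\<delta>' < \<delta>" "0 < c" "0 \<le> C"
    "\<And>lam \<psi> \<psi>1 \<psi>2 s. 0 < lam \<Longrightarrow> 0 < s \<Longrightarrow> s \<le> \<delta>' \<Longrightarrow> 0 < \<psi> s \<Longrightarrow>
      (\<psi> has_real_derivative \<psi>1 s) (at s) \<Longrightarrow> (\<psi>1 has_real_derivative \<psi>2) (at s) \<Longrightarrow>
      b s * \<psi>2 + a s * \<psi>1 s + lam * (\<psi> s powr q - \<psi> s) = 0 \<Longrightarrow>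
      \<exists>D\<ge>lam * (A s / b s) * (c * \<psi> s powr (q + 1) - C).
        (pohozaev q \<theta> lam \<psi> \<psi>1 has_real_derivative D) (at s)"
proof -
  \<comment> \<open>Half of the sum of the two limiting coefficients; the choice of \<theta> below
    makes both of them equal to e.\<close>
  define e where "e = \<beta> * (2 * (q + 1) - k * (q - 1)) / (8 * (q + 1))"
  have e: "0 < e" using q sub beta by (auto simp: e_def)
  define \<theta> where "\<theta> = \<beta> * (k - 2) / 4 + e"
  have l1: "((\<lambda>s. (b' s - a s) / 2 + \<theta>) \<longlongrightarrow> (\<beta> - k * \<beta> / 2) / 2 + \<theta>) (at_right 0)"
    by (intro tendsto_intros a_lim b'_lim) auto
  have v1: "(\<beta> - k * \<beta> / 2) / 2 + \<theta> = e" by (simp add: \<theta>_def field_simps)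
  have l2: "((\<lambda>s. a s / (q + 1) - \<theta>) \<longlongrightarrow> k * \<beta> / 2 / (q + 1) - \<theta>) (at_right 0)"
    using q by (intro tendsto_intros a_lim) auto
  have v2: "k * \<beta> / 2 / (q + 1) - \<theta> = e"
    using q by (simp add: \<theta>_def e_def divide_simps) (simp add: algebra_simps)
  define C2 where "C2 = \<bar>k * \<beta> / 2 / 2 - \<theta>\<bar> + 1"
  have l3: "((\<lambda>s. a s / 2 - \<theta>) \<longlongrightarrow> k * \<beta> / 2 / 2 - \<theta>) (at_right 0)"
    by (intro tendsto_intros a_lim) auto
  have "\<forall>\<^sub>F s in at_right 0. (b' s - a s) / 2 + \<theta> > 0 \<and> a s / (q + 1) - \<theta> > e / 2 \<and> a s / 2 - \<theta> < C2"
  proof (intro eventually_conj)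
    show "\<forall>\<^sub>F s in at_right 0. (b' s - a s) / 2 + \<theta> > 0"
      using order_tendstoD(1)[OF l1, of 0] e v1 by linarith
    show "\<forall>\<^sub>F s in at_right 0. a s / (q + 1) - \<theta> > e / 2"
      using order_tendstoD(1)[OF l2, of "e/2"] e v2 by linarith
    show "\<forall>\<^sub>F s in at_right 0. a s / 2 - \<theta> < C2"
      by (rule order_tendstoD(2)[OF l3]) (simp add: C2_def)
  qed
  then obtain d where d: "d > 0" and
    D: "\<And>s. 0 < s \<Longrightarrow> s < d \<Longrightarrow> (b' s - a s) / 2 + \<theta> > 0 \<and> a s / (q + 1) - \<theta> > e / 2 \<and> a s / 2 - \<theta> < C2"
    unfolding eventually_at_right_field by auto
  obtain C3 where C3: "0 \<le> C3" "\<And>x. 0 < x \<Longrightarrow> C2 * x\<^sup>2 \<le> e / 4 * x powr (q + 1) + C3"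
    using square_le_power_absorb[of q "e/4" C2] q e by (auto simp: C2_def)
  show ?thesis
  proof (rule that[of "min d \<delta> / 2" "e / 4" C3 \<theta>])
    show "0 < min d \<delta> / 2" "min d \<delta> / 2 < \<delta>" "0 < e / 4" "0 \<le> C3" using d delta e C3 by auto
    fix lam \<psi> \<psi>1 \<psi>2 and s :: real
    assume lam: "0 < lam" and s: "0 < s" "s \<le> min d \<delta> / 2" and pos: "0 < \<psi> s"
      and d1: "(\<psi> has_real_derivative \<psi>1 s) (at s)" and d2: "(\<psi>1 has_real_derivative \<psi>2) (at s)"
      and ode: "b s * \<psi>2 + a s * \<psi>1 s + lam * (\<psi> s powr q - \<psi> s) = 0"
    have s': "s < \<delta>" "s < d" using s d delta by auto
    have bds: "(b' s - a s) / 2 + \<theta> > 0" "a s / (q + 1) - \<theta> > e / 2" "a s / 2 - \<theta> < C2"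
      using D s s' by auto
    have "e / 4 * \<psi> s powr (q + 1) - C3 \<le> e / 2 * \<psi> s powr (q + 1) - C2 * (\<psi> s)\<^sup>2"
      using C3(2)[OF pos] by (simp add: algebra_simps)
    also have "\<dots> \<le> (a s / (q + 1) - \<theta>) * \<psi> s powr (q + 1) - (a s / 2 - \<theta>) * (\<psi> s)\<^sup>2"
      using bds by (intro diff_mono mult_right_mono) auto
    finally have "lam * (A s / b s) * (e / 4 * \<psi> s powr (q + 1) - C3) \<le>
      lam * (A s / b s) * ((a s / (q + 1) - \<theta>) * \<psi> s powr (q + 1) - (a s / 2 - \<theta>) * (\<psi> s)\<^sup>2)"
      using lam A_pos[of s] b_pos[of s] s s' by (intro mult_left_mono) auto
    moreover have "0 \<le> A s * (((b' s - a s) / 2 + \<theta>) * (\<psi>1 s)\<^sup>2)"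
      using A_pos[of s] s s' bds by auto
    ultimately show "\<exists>D\<ge>lam * (A s / b s) * (e / 4 * \<psi> s powr (q + 1) - C3).
        (pohozaev q \<theta> lam \<psi> \<psi>1 has_real_derivative D) (at s)"
      using pohozaev_deriv[OF s(1) s'(1) q pos d1 d2 ode, of \<theta>]
      by (intro exI conjI) auto
  qed
qed


section \<open>Vanishing of flux and energy at the end\<close>

lemma flux_deriv:
  assumes s: "0 < s" "s < \<delta>" and d2: "(\<psi>1 has_real_derivative \<psi>2) (at s)"
    and ode: "b s * \<psi>2 + a s * \<psi>1 s + N = 0"
  shows "((\<lambda>s. A s * \<psi>1 s) has_real_derivative - (A s / b s) * N) (at s)"
proof -
  have "b s > 0" using b_pos s by blast
  then have e: "\<psi>2 = - (a s * \<psi>1 s + N) / b s"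
    using ode by (simp add: field_simps)
  show ?thesis
    using DERIV_mult[OF A_deriv[OF s] d2] \<open>b s > 0\<close> by (simp add: e field_simps)
qed

text \<open>Here 1 <= k is decisive: together with s < 1 it gives A = O(sqrt s), so the condition on
  \<open>sqrt s * \<psi>1\<close>, which allows an unbounded \<open>\<psi>1\<close>, already forces
  the flux to vanish.\<close>

lemma flux_lim:
  assumes l: "((\<lambda>s. sqrt s * \<psi>1 s) \<longlongrightarrow> 0) (at_right 0)"
  shows "((\<lambda>s. A s * \<psi>1 s) \<longlongrightarrow> 0) (at_right 0)"
proof (rule Lim_null_comparison)
  show "((\<lambda>s. C0 * \<bar>sqrt s * \<psi>1 s\<bar>) \<longlongrightarrow> 0) (at_right 0)"
    using tendsto_mult_right_zero[OF tendsto_rabs_zero[OF l]] by simp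
  have "norm (A s * \<psi>1 s) \<le> C0 * \<bar>sqrt s * \<psi>1 s\<bar>" if s: "0 < s" "s < \<delta>" for s
  proof -
    have "A s \<le> C0 * s powr (k/2)" using A_hi s by blast
    also have "\<dots> \<le> C0 * s powr (1/2)" using s delta c0 k by (intro mult_left_mono powr_mono') auto
    also have "\<dots> = C0 * sqrt s" using s by (simp add: powr_half_sqrt)
    finally have "A s * \<bar>\<psi>1 s\<bar> \<le> C0 * sqrt s * \<bar>\<psi>1 s\<bar>" by (intro mult_right_mono) auto
    then show ?thesis using A_pos[OF s] s by (simp add: abs_mult mult_ac)
  qed
  then show "\<forall>\<^sub>F s in at_right 0. norm (A s * \<psi>1 s) \<le> C0 * \<bar>sqrt s * \<psi>1 s\<bar>"
    using delta by (intro eventually_at_rightI[of 0 \<delta>]) auto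
qed

lemma A_lim: "(A \<longlongrightarrow> 0) (at_right 0)"
proof (rule Lim_null_comparison)
  show "((\<lambda>s. C0 * s powr (k/2)) \<longlongrightarrow> 0) (at_right 0)" by (rule powr_half_lim)
  show "\<forall>\<^sub>F s in at_right 0. norm (A s) \<le> C0 * s powr (k/2)"
    using delta A_hi A_pos by (intro eventually_at_rightI[of 0 \<delta>]) (auto simp: less_imp_le)
qed

text \<open>Every term is controlled by \<open>sqrt s * \<psi>1\<close>: the kinetic one because b =
  O(s), the mixed one because it is the flux times a bounded factor. The potential is bounded and
  carries the factor A.\<close>

lemma pohozaev_lim:
  assumes l: "((\<lambda>s. sqrt s * \<psi>1 s) \<longlongrightarrow> 0) (at_right 0)"
    and p: "(\<psi> \<longlongrightarrow> p) (at_right 0)" and "0 < p" "q > 0"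
  shows "(pohozaev q \<theta> lam \<psi> \<psi>1 \<longlongrightarrow> 0) (at_right 0)"
proof -
  have 1: "((\<lambda>s. b s * (\<psi>1 s)\<^sup>2) \<longlongrightarrow> 0) (at_right 0)"
  proof (rule Lim_null_comparison)
    show "((\<lambda>s. C0 * (sqrt s * \<psi>1 s)\<^sup>2) \<longlongrightarrow> 0) (at_right 0)"
      using tendsto_mult[OF tendsto_const tendsto_power[OF l, of 2], of C0] by simp
    have "norm (b s * (\<psi>1 s)\<^sup>2) \<le> C0 * (sqrt s * \<psi>1 s)\<^sup>2" if s: "0 < s" "s < \<delta>" for s
      using mult_right_mono[OF b_hi[OF s], of "(\<psi>1 s)\<^sup>2"] b_pos[OF s] s by (simp add: power_mult_distrib mult_ac)
    then show "\<forall>\<^sub>F s in at_right 0. norm (b s * (\<psi>1 s)\<^sup>2) \<le> C0 * (sqrt s * \<psi>1 s)\<^sup>2"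
      using delta by (intro eventually_at_rightI[of 0 \<delta>]) auto
  qed
  have "((\<lambda>s. A s * (b s * (\<psi>1 s)\<^sup>2 / 2 + lam * (\<psi> s powr (q + 1) / (q + 1) - (\<psi> s)\<^sup>2 / 2)) + \<theta> * \<psi> s * (A s * \<psi>1 s))
      \<longlongrightarrow> 0 * (0 / 2 + lam * (p powr (q + 1) / (q + 1) - p\<^sup>2 / 2)) + \<theta> * p * 0) (at_right 0)"
    using assms by (intro tendsto_intros 1 A_lim flux_lim l p) auto
  then show ?thesis by (simp add: pohozaev_def[abs_def] algebra_simps)
qed


text \<open>
  At a maximum \<open>M\<close> of \<open>\<psi>\<close> the flux estimate keeps \<open>\<psi> \<ge> M/2\<close> on an interval of length comparable to
  \<open>M^(1-q) / lam\<close>; the energy gained there exceeds the energy available at the right end unless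
  \<open>lam M^(q-1)\<close> is small.
\<close>

lemma sup_bound:
  fixes q :: real
  assumes q: "1 < q" and K: "k \<le> K" "2 \<le> K" and sub: "K * (q - 1) < 2 * (q + 1)"
  obtains \<delta>' where "0 < \<delta>'" "\<delta>' < \<delta>"
    "\<And>Cm \<epsilon>. 0 < Cm \<Longrightarrow> 0 < \<epsilon> \<Longrightarrow> \<exists>lam0>0. \<forall>lam \<psi> \<psi>1 \<psi>2. 0 < lam \<longrightarrow> lam < lam0 \<longrightarrow>
      continuous_on {0..\<delta>'} \<psi> \<longrightarrow> (\<forall>s\<in>{0..\<delta>'}. 0 < \<psi> s) \<longrightarrow>
      (\<forall>s. 0 < s \<longrightarrow> s \<le> \<delta>' \<longrightarrow> (\<psi> has_real_derivative \<psi>1 s) (at s) \<and> (\<psi>1 has_real_derivative \<psi>2 s) (at s)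
         \<and> b s * \<psi>2 s + a s * \<psi>1 s + lam * (\<psi> s powr q - \<psi> s) = 0) \<longrightarrow>
      ((\<lambda>s. sqrt s * \<psi>1 s) \<longlongrightarrow> 0) (at_right 0) \<longrightarrow>
      (\<forall>s\<in>{\<delta>'/2..\<delta>'}. \<psi> s \<le> Cm \<and> \<bar>\<psi>1 s\<bar> \<le> Cm * lam) \<longrightarrow>
      (\<forall>s\<in>{0..\<delta>'}. lam * \<psi> s powr (q - 1) \<le> \<epsilon>)"
proof -
  have sub': "k * (q - 1) < 2 * (q + 1)"
    using sub K q mult_right_mono[of k K "q - 1"] by linarith
  obtain \<theta> \<delta>' c C3 where d': "0 < \<delta>'" "\<delta>' < \<delta>" and c: "0 < c" and C3: "0 \<le> C3" and
    poh: "\<And>lam \<psi> \<psi>1 \<psi>2 s. 0 < lam \<Longrightarrow> 0 < s \<Longrightarrow> s \<le> \<delta>' \<Longrightarrow> 0 < \<psi> s \<Longrightarrow>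
      (\<psi> has_real_derivative \<psi>1 s) (at s) \<Longrightarrow> (\<psi>1 has_real_derivative \<psi>2) (at s) \<Longrightarrow>
      b s * \<psi>2 + a s * \<psi>1 s + lam * (\<psi> s powr q - \<psi> s) = 0 \<Longrightarrow>
      \<exists>D\<ge>lam * (A s / b s) * (c * \<psi> s powr (q + 1) - C3).
        (pohozaev q \<theta> lam \<psi> \<psi>1 has_real_derivative D) (at s)"
    by (rule pohozaev_monotone[OF q sub']) (rule that)
  show ?thesis
  proof (rule that[OF d'])
    fix Cm \<epsilon> :: real assume Cm: "0 < Cm" and eps: "0 < \<epsilon>"
    \<comment> \<open>C5 * lam bounds the corrected energy at \<open>\<delta>'\<close>, where
      \<open>\<psi>\<close> is at most Cm and \<open>\<psi>1\<close> at most Cm * lam in size. C6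
      serves for the slope bound to the right of the maximum and keeps the interval of length r
      inside the end. C7 collects the constants of the energy gain, \<gamma> is the power of M left
      in it, positive by subcriticality, and M0 solves C7 * M0^\<gamma> = C5.\<close>
    define C5 where "C5 = C0 * (C0 * Cm\<^sup>2 / 2 + Cm powr (q + 1) + \<bar>\<theta>\<bar> * Cm\<^sup>2) + C3 * C1"
    define C6 where "C6 = max (C1 / c0) (1 / (\<epsilon> * \<delta>'))"
    define C7 where "C7 = c0 / C0 * c * (1/2) powr (q + 1) * (2 / K) * (1 / (2 * C6)) powr (K/2)"
    define \<gamma> where "\<gamma> = q + 1 - (q - 1) * (K/2)"
    define M0 where "M0 = (C5 / C7) powr (1 / \<gamma>)"
    \<comment> \<open>The first bound, lam < 1, discards surplus powers of lam. The other two
      contradict lam * M^(q-1) > \<epsilon> as soon as the maximum M is known to be at most Cm or at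
      most M0.\<close>
    define lam0 where "lam0 = min 1 (min (\<epsilon> / Cm powr (q - 1)) (\<epsilon> / M0 powr (q - 1)))"
    have C6: "0 < C6" "C1 / c0 \<le> C6" "1 / (\<epsilon> * \<delta>') \<le> C6"
      using c0 C1_pos by (auto simp: C6_def less_max_iff_disj)
    have "0 < C0 * (C0 * Cm\<^sup>2 / 2 + Cm powr (q + 1) + \<bar>\<theta>\<bar> * Cm\<^sup>2)"
      using c0 Cm by (intro mult_pos_pos add_pos_nonneg add_pos_pos) auto
    then have C5: "0 < C5" using C3 C1_pos unfolding C5_def
      by (intro add_pos_nonneg mult_nonneg_nonneg) auto
    have C7: "0 < C7" using c0 c K C6 by (auto simp: C7_def)
    have gam: "0 < \<gamma>" using sub by (simp add: \<gamma>_def field_simps)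
    have M0: "0 < M0" using C5 C7 by (simp add: M0_def)
    have lam0: "0 < lam0" using eps Cm M0 by (simp add: lam0_def)
    have main: "lam * \<psi> s powr (q - 1) \<le> \<epsilon>"
      if lam: "0 < lam" "lam < lam0" and cont: "continuous_on {0..\<delta>'} \<psi>"
        and pos: "\<And>s. s \<in> {0..\<delta>'} \<Longrightarrow> 0 < \<psi> s"
        and d1: "\<And>s. 0 < s \<Longrightarrow> s \<le> \<delta>' \<Longrightarrow> (\<psi> has_real_derivative \<psi>1 s) (at s)"
        and d2: "\<And>s. 0 < s \<Longrightarrow> s \<le> \<delta>' \<Longrightarrow> (\<psi>1 has_real_derivative \<psi>2 s) (at s)"
        and ode: "\<And>s. 0 < s \<Longrightarrow> s \<le> \<delta>' \<Longrightarrow> b s * \<psi>2 s + a s * \<psi>1 s + lam * (\<psi> s powr q - \<psi> s) = 0"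
        and lim: "((\<lambda>s. sqrt s * \<psi>1 s) \<longlongrightarrow> 0) (at_right 0)"
        and mid: "\<And>s. s \<in> {\<delta>'/2..\<delta>'} \<Longrightarrow> \<psi> s \<le> Cm \<and> \<bar>\<psi>1 s\<bar> \<le> Cm * lam"
        and s: "s \<in> {0..\<delta>'}" for lam \<psi> \<psi>1 \<psi>2 and s :: real
    proof (rule ccontr)
      assume neg: "\<not> lam * \<psi> s powr (q - 1) \<le> \<epsilon>"
      obtain sm where sm: "sm \<in> {0..\<delta>'}" and max: "\<And>s. s \<in> {0..\<delta>'} \<Longrightarrow> \<psi> s \<le> \<psi> sm"
        using continuous_attains_sup[OF _ _ cont] d' by auto
      define M where "M = \<psi> sm"
      have M: "0 < M" using pos[OF sm] by (simp add: M_def)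
      have "lam * \<psi> s powr (q - 1) \<le> lam * M powr (q - 1)"
        using max[OF s] pos[OF s] lam q by (intro mult_left_mono powr_mono2) (auto simp: M_def)
      then have big: "\<epsilon> < lam * M powr (q - 1)" using neg by simp
      have lam1: "lam < 1" "lam < \<epsilon> / Cm powr (q - 1)" "lam < \<epsilon> / M0 powr (q - 1)"
        using lam by (auto simp: lam0_def)
      have sm2: "sm < \<delta>'/2"
      proof (rule ccontr)
        assume "\<not> sm < \<delta>'/2"
        then have "M \<le> Cm" using mid[of sm] sm by (auto simp: M_def)
        then have "lam * M powr (q - 1) \<le> lam * Cm powr (q - 1)"
          using lam M q by (intro mult_left_mono powr_mono2) auto
        then show False using lam1(2) big Cm by (simp add: field_simps)
      qed
      define B where "B = lam * M powr q"
      have B: "0 < B" using lam M by (simp add: B_def)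
      have MB: "B = lam * M powr (q - 1) * M" using M by (simp add: B_def powr_diff)
      have N: "lam * (\<psi> s powr q - \<psi> s) \<le> B" if "0 < s" "s \<le> \<delta>'" for s
      proof -
        have "\<psi> s powr q - \<psi> s \<le> M powr q"
          using max[of s] pos[of s] that q powr_mono2[of q "\<psi> s" M] by (auto simp: M_def)
        then show ?thesis using lam by (simp add: B_def)
      qed
      define y where "y = (\<lambda>s. A s * \<psi>1 s)"
      have yd: "(y has_real_derivative - (A s / b s) * (lam * (\<psi> s powr q - \<psi> s))) (at s)"
        if "0 < s" "s \<le> \<delta>'" for s
        unfolding y_def using that d' by (intro flux_deriv[OF _ _ d2 ode]) auto
      \<comment> \<open>To the right of the maximum point the flux starts from 0: by its limit if
        \<open>sm = 0\<close>, and by \<open>\<psi>1 sm = 0\<close> otherwise.\<close>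
      have y_lo: "- (B * C1 * s powr (k/2)) \<le> y s" if s: "sm < s" "s < \<delta>'" for s
      proof (cases "sm = 0")
        case True
        have "- y s \<le> B * C1 * s powr (k/2)"
        proof (rule flux_upper[where y = "\<lambda>s. - y s" and N = "\<lambda>s. - (lam * (\<psi> s powr q - \<psi> s))" and r = \<delta>'])
          show "((\<lambda>s. - y s) has_real_derivative - (A s / b s) * - (lam * (\<psi> s powr q - \<psi> s))) (at s)"
            if "0 < s" "s < \<delta>'" for s
            using DERIV_minus[OF yd[of s]] that by simp
          show "((\<lambda>s. - y s) \<longlongrightarrow> 0) (at_right 0)"
            using tendsto_minus[OF flux_lim[OF lim]] by (simp add: y_def)
        qed (use N B d' s True in force)+
        then show ?thesis by simp
      next
        case False
        then have sm0: "0 < sm" using sm by simp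
        have "\<psi>1 sm = 0"
        proof (rule DERIV_local_max[OF d1[of sm]])
          show "0 < min sm (\<delta>' - sm)" using sm0 sm2 d' by simp
          show "\<forall>y. \<bar>sm - y\<bar> < min sm (\<delta>' - sm) \<longrightarrow> \<psi> y \<le> \<psi> sm"
            by (intro allI impI max) (auto simp: abs_if split: if_splits)
        qed (use sm0 sm in auto)
        then have "y sm = 0" by (simp add: y_def)
        have "y sm + B * C1 * sm powr (k/2) \<le> y s + B * C1 * s powr (k/2)"
        proof (rule DERIV_nonneg_imp_nondecreasing[where f = "\<lambda>s. y s + B * C1 * s powr (k/2)"])
          show "sm \<le> s" using s by simp
          fix x assume x: "sm \<le> x" "x \<le> s"
          then have x': "0 < x" "x \<le> \<delta>'" "x < \<delta>" using sm0 s d' by auto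
          have "A x / b x * (lam * (\<psi> x powr q - \<psi> x)) \<le> A x / b x * B"
            using N[of x] x' A_pos[of x] b_pos[of x] by (intro mult_left_mono) auto
          also have "\<dots> \<le> C0 / c0 * x powr (k/2 - 1) * B"
            using weight_upper[of x] x' B by (intro mult_right_mono) auto
          finally have "0 \<le> - (A x / b x) * (lam * (\<psi> x powr q - \<psi> x)) + B * (C0 / c0 * x powr (k/2 - 1))"
            by (simp add: mult_ac)
          then show "\<exists>D. ((\<lambda>s. y s + B * C1 * s powr (k/2)) has_real_derivative D) (at x) \<and> 0 \<le> D"
            using DERIV_add[OF yd[OF x'(1,2)] powr_comparison_deriv[OF x'(1), of B]] by blast
        qed
        moreover have "0 \<le> B * C1 * sm powr (k/2)" using B C1_pos by simp
        ultimately show ?thesis using \<open>y sm = 0\<close> by simp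
      qed
      have \<psi>1_lo: "- (B * C6) \<le> \<psi>1 s" if s: "sm < s" "s < \<delta>'" for s
      proof -
        have s': "0 < s" "s < \<delta>" using s sm d' by auto
        have "- \<psi>1 s * A s \<le> B * C1 * s powr (k/2)" using y_lo[OF s] by (simp add: y_def mult_ac)
        also have "\<dots> \<le> B * C6 * c0 * s powr (k/2)"
          using B c0 C6(2) by (intro mult_right_mono) (auto simp: field_simps)
        also have "\<dots> \<le> B * C6 * A s"
          using mult_left_mono[OF A_lo[OF s'], of "B * C6"] B C6 by (simp add: mult_ac)
        finally have "- \<psi>1 s \<le> B * C6" using A_pos[OF s'] mult_le_cancel_right_pos by blast
        then show ?thesis by simp
      qed
      \<comment> \<open>On an interval of this length the slope bound B * C6 lowers
        \<open>\<psi>\<close> by at most M / 2.\<close>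
      define r where "r = M / (2 * C6 * B)"
      have r0: "0 < r" using M B C6 by (simp add: r_def)
      have "r = 1 / (2 * C6 * (lam * M powr (q - 1)))" using M lam by (simp add: r_def MB)
      also have "\<dots> \<le> 1 / (2 * C6 * \<epsilon>)" using big C6 eps lam M by (intro divide_left_mono mult_left_mono mult_pos_pos) auto
      also have "\<dots> \<le> \<delta>' / 2"
      proof -
        have "1 \<le> C6 * (\<epsilon> * \<delta>')" using C6(3) eps d' by (simp add: pos_divide_le_eq)
        then show ?thesis using C6(1) eps by (simp add: pos_divide_le_eq mult_ac)
      qed
      finally have r1: "sm + r < \<delta>'" using sm2 by simp
      have half: "M / 2 \<le> \<psi> s" if s: "sm < s" "s \<le> sm + r" for s
      proof -
        have "\<psi> sm + B * C6 * sm \<le> \<psi> s + B * C6 * s"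
        proof (rule DERIV_nonneg_imp_increasing_open[where f = "\<lambda>s. \<psi> s + B * C6 * s"])
          show "continuous_on {sm..s} (\<lambda>x. \<psi> x + B * C6 * x)"
            using sm s r1 by (intro continuous_intros continuous_on_subset[OF cont]) auto
          fix x assume x: "sm < x" "x < s"
          have "((\<lambda>x. \<psi> x + B * C6 * x) has_real_derivative \<psi>1 x + B * C6) (at x)"
            using x sm s r1 by (auto intro!: derivative_eq_intros d1)
          then show "\<exists>D. ((\<lambda>x. \<psi> x + B * C6 * x) has_real_derivative D) (at x) \<and> 0 \<le> D"
            using \<psi>1_lo[of x] x s r1 by (intro exI conjI) auto
        qed (use s in auto)
        then have "M - B * C6 * (s - sm) \<le> \<psi> s" by (simp add: M_def algebra_simps)
        moreover have "B * C6 * (s - sm) \<le> B * C6 * r" using B C6 s by (intro mult_left_mono) auto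
        moreover have "B * C6 * r = M / 2" using B C6 by (simp add: r_def)
        ultimately show ?thesis by linarith
      qed
      \<comment> \<open>The added term is a primitive of an upper bound for the error lam * C3 * A /
        b, so Z is increasing with limit 0 at the end.\<close>
      define Z where "Z = (\<lambda>s. pohozaev q \<theta> lam \<psi> \<psi>1 s + lam * C3 * C1 * s powr (k/2))"
      have Zd: "\<exists>D\<ge>lam * (A s / b s) * (c * \<psi> s powr (q + 1)). (Z has_real_derivative D) (at s)"
        if s: "0 < s" "s \<le> \<delta>'" for s
      proof -
        obtain D where D: "D \<ge> lam * (A s / b s) * (c * \<psi> s powr (q + 1) - C3)"
          "(pohozaev q \<theta> lam \<psi> \<psi>1 has_real_derivative D) (at s)"
          using poh[OF lam(1) s pos d1 d2 ode] s by auto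
        have "lam * C3 * (A s / b s) \<le> lam * C3 * (C0 / c0 * s powr (k/2 - 1))"
          using weight_upper[of s] s d' lam C3 by (intro mult_left_mono) auto
        then have "lam * (A s / b s) * (c * \<psi> s powr (q + 1)) \<le> D + lam * C3 * (C0 / c0 * s powr (k/2 - 1))"
          using D(1) by (simp add: algebra_simps)
        moreover have "(Z has_real_derivative D + lam * C3 * (C0 / c0 * s powr (k/2 - 1))) (at s)"
          unfolding Z_def by (intro DERIV_add D powr_comparison_deriv s)
        ultimately show ?thesis by blast
      qed
      then obtain Z' where Z': "\<And>s. 0 < s \<Longrightarrow> s \<le> \<delta>' \<Longrightarrow> Z' s \<ge> lam * (A s / b s) * (c * \<psi> s powr (q + 1))"
        "\<And>s. 0 < s \<Longrightarrow> s \<le> \<delta>' \<Longrightarrow> (Z has_real_derivative Z' s) (at s)"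
        by metis
      have Z'0: "0 \<le> Z' s" if "0 < s" "s \<le> \<delta>'" for s
      proof -
        have "0 \<le> lam * (A s / b s) * (c * \<psi> s powr (q + 1))"
          using that d' lam c A_pos[of s] b_pos[of s] by simp
        then show ?thesis using Z'(1)[OF that] by linarith
      qed
      have "(\<psi> \<longlongrightarrow> \<psi> 0) (at_right 0)"
        using cont d' by (auto simp: continuous_on_def intro: tendsto_within_subset filterlim_mono[OF _ order_refl]
          simp: at_within_Icc_at_right[symmetric])
      then have Zlim: "(Z \<longlongrightarrow> 0) (at_right 0)"
        unfolding Z_def using tendsto_add[OF pohozaev_lim[OF lim _ pos[of 0], where q = q and \<theta> = \<theta> and lam = lam] powr_half_lim[of "lam * C3 * C1"]] q d' by auto
      have Z0: "0 \<le> Z s" if "0 < s" "s < \<delta>'" for s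
        by (rule at_right_0_mono_ge[of \<delta>' Z Z']) (use Z' Z'0 Zlim that in auto)
      \<comment> \<open>The energy gained on the interval of length r is at least E * r^(K/2):
        \<open>\<psi>\<close> is at least M / 2 there, and 2 / K comes from integrating the density
        x^(K/2 - 1).\<close>
      define E where "E = lam * (c0 / C0) * c * (M/2) powr (q + 1) * (2/K)"
      have E: "0 < E" using lam c0 c M K by (simp add: E_def)
      have *: "- (E * h powr (K/2)) \<le> Z (sm + r) - E * r powr (K/2)" if h: "0 < h" "h < r" for h
      proof -
        have "Z (sm + h) - E * h powr (K/2) \<le> Z (sm + r) - E * r powr (K/2)"
        proof (rule DERIV_nonneg_imp_nondecreasing[where f = "\<lambda>h. Z (sm + h) - E * h powr (K/2)"])
          fix x assume x: "h \<le> x" "x \<le> r"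
          have x': "0 < x" "0 < sm + x" "sm + x \<le> \<delta>'" "sm + x < \<delta>" "x \<le> sm + x" using x h sm r1 d' by auto
          have d: "((\<lambda>h. Z (sm + h) - E * h powr (K/2)) has_real_derivative
              Z' (sm + x) - E * (K/2 * x powr (K/2 - 1))) (at x)"
            using x' by (auto intro!: derivative_eq_intros DERIV_chain2[OF Z'(2)])
          have "E * (K/2 * x powr (K/2 - 1)) = lam * (c0 / C0 * x powr (K/2 - 1)) * (c * (M/2) powr (q + 1))"
            using K by (simp add: E_def field_simps)
          \<comment> \<open>Since 2 <= K, the exponent K/2 - 1 is nonnegative and moving the
            argument from x to sm + x does not decrease the density.\<close>
          also have "\<dots> \<le> lam * (c0 / C0 * (sm + x) powr (K/2 - 1)) * (c * \<psi> (sm + x) powr (q + 1))"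
            using lam c0 c q M half[of "sm + x"] x x' K
            by (intro mult_mono powr_mono2 mult_nonneg_nonneg) auto
          also have "\<dots> \<le> lam * (A (sm + x) / b (sm + x)) * (c * \<psi> (sm + x) powr (q + 1))"
            using weight_lower[OF x'(2,4) K(1)] lam c by (intro mult_right_mono mult_left_mono) auto
          also have "\<dots> \<le> Z' (sm + x)" using Z'(1) x' by blast
          finally show "\<exists>y. ((\<lambda>h. Z (sm + h) - E * h powr (K/2)) has_real_derivative y) (at x) \<and> 0 \<le> y"
            using d by (intro exI conjI) auto
        qed (use h in auto)
        moreover have "0 \<le> Z (sm + h)" using Z0[of "sm + h"] h sm r1 by auto
        ultimately show ?thesis by linarith
      qed
      have "((\<lambda>h. - (E * h powr (K/2))) \<longlongrightarrow> - (E * 0 powr (K/2))) (at_right 0)"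
        using K by (intro tendsto_intros) (auto simp: eventually_at_right_field intro!: exI[of _ 1])
      then have "- (E * 0 powr (K/2)) \<le> Z (sm + r) - E * r powr (K/2)"
        by (rule tendsto_upperbound) (use * r0 in \<open>auto intro!: eventually_at_rightI[of 0 r]\<close>)
      then have Er: "E * r powr (K/2) \<le> Z (sm + r)" by simp
      also have "\<dots> \<le> Z \<delta>'"
      proof (rule DERIV_nonneg_imp_nondecreasing[where f = Z])
        show "sm + r \<le> \<delta>'" using r1 by simp
        fix x assume "sm + r \<le> x" "x \<le> \<delta>'"
        then have "0 < x" "x \<le> \<delta>'" using r0 sm by auto
        then show "\<exists>y. (Z has_real_derivative y) (at x) \<and> 0 \<le> y" using Z'(2) Z'0 by blast
      qed
      also have "\<dots> \<le> lam * C5"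
      proof -
        let ?p = "\<psi> \<delta>'" and ?p1 = "\<psi>1 \<delta>'"
        have m: "?p \<le> Cm" "\<bar>?p1\<bar> \<le> Cm * lam" "0 < ?p" using mid[of \<delta>'] d' pos[of \<delta>'] by auto
        have p1s: "?p1\<^sup>2 \<le> Cm\<^sup>2 * lam"
        proof -
          have "?p1\<^sup>2 \<le> (Cm * lam)\<^sup>2" using m by (metis abs_le_square_iff abs_of_nonneg Cm lam(1) less_imp_le mult_nonneg_nonneg)
          also have "\<dots> = Cm\<^sup>2 * lam * lam" by (simp add: power2_eq_square)
          also have "\<dots> \<le> Cm\<^sup>2 * lam * 1" using lam lam1 by (intro mult_left_mono) auto
          finally show ?thesis by simp
        qed
        have dle: "\<delta>' powr x \<le> 1" if "0 \<le> x" for x using d' delta that by (simp add: powr_le1)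
        have b1: "b \<delta>' \<le> C0" 
        proof -
          have "C0 * \<delta>' \<le> C0 * 1" using d' delta c0 by (intro mult_left_mono) auto
          then show ?thesis using b_hi[of \<delta>'] d' by linarith
        qed
        have A1: "A \<delta>' \<le> C0" 
        proof -
          have "C0 * \<delta>' powr (k/2) \<le> C0 * 1" using dle[of "k/2"] k c0 by (intro mult_left_mono) auto
          then show ?thesis using A_hi[of \<delta>'] d' by linarith
        qed
        have t1: "b \<delta>' * ?p1\<^sup>2 / 2 \<le> C0 * (Cm\<^sup>2 * lam) / 2"
          using b1 p1s c0 by (intro divide_right_mono mult_mono) auto
        have "?p powr (q + 1) / (q + 1) \<le> Cm powr (q + 1) / 1"
          using m q by (intro frac_le powr_mono2) auto
        then have t2: "lam * (?p powr (q + 1) / (q + 1) - ?p\<^sup>2 / 2) \<le> lam * Cm powr (q + 1)"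
          using lam by (intro mult_left_mono) (auto intro: order_trans[rotated])
        have "\<theta> * ?p * ?p1 \<le> \<bar>\<theta>\<bar> * \<bar>?p\<bar> * \<bar>?p1\<bar>" by (metis abs_ge_self abs_mult)
        also have "\<dots> \<le> \<bar>\<theta>\<bar> * Cm * (Cm * lam)" using m Cm by (intro mult_mono) auto
        finally have "b \<delta>' * ?p1\<^sup>2 / 2 + lam * (?p powr (q + 1) / (q + 1) - ?p\<^sup>2 / 2) + \<theta> * ?p * ?p1
            \<le> lam * (C0 * Cm\<^sup>2 / 2 + Cm powr (q + 1) + \<bar>\<theta>\<bar> * Cm\<^sup>2)"
          using t1 t2 by (simp add: algebra_simps power2_eq_square)
        then have "pohozaev q \<theta> lam \<psi> \<psi>1 \<delta>' \<le> A \<delta>' * (lam * (C0 * Cm\<^sup>2 / 2 + Cm powr (q + 1) + \<bar>\<theta>\<bar> * Cm\<^sup>2))"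
          unfolding pohozaev_def using A_pos[of \<delta>'] d' by (intro mult_left_mono) auto
        also have "\<dots> \<le> C0 * (lam * (C0 * Cm\<^sup>2 / 2 + Cm powr (q + 1) + \<bar>\<theta>\<bar> * Cm\<^sup>2))"
          using A1 lam c0 Cm by (intro mult_right_mono mult_nonneg_nonneg add_nonneg_nonneg) auto
        finally have "pohozaev q \<theta> lam \<psi> \<psi>1 \<delta>' \<le> lam * (C0 * (C0 * Cm\<^sup>2 / 2 + Cm powr (q + 1) + \<bar>\<theta>\<bar> * Cm\<^sup>2))"
          by (simp add: mult_ac)
        moreover have "lam * C3 * C1 * \<delta>' powr (k/2) \<le> lam * C3 * C1 * 1"
          using lam C3 C1_pos dle[of "k/2"] k by (intro mult_left_mono) auto
        ultimately show ?thesis by (simp add: Z_def C5_def algebra_simps)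
      qed
      finally have fin: "E * r powr (K/2) \<le> lam * C5" .
      have rr: "r = 1 / (2 * C6) * (1 / lam) * M powr (1 - q)"
        using M lam C6 by (simp add: r_def MB powr_diff)
      have "r powr (K/2) = (1 / (2 * C6)) powr (K/2) * (1 / lam) powr (K/2) * M powr ((1 - q) * (K/2))"
      proof -
        have "(u * v * m) powr e = u powr e * v powr e * m powr e" if "0 < u" "0 < v" "0 < m" for u v m e :: real
          using that by (simp add: powr_mult less_imp_le)
        from this[of "1 / (2 * C6)" "1 / lam" "M powr (1 - q)" "K/2"] show ?thesis
          unfolding rr powr_powr using C6 lam M by simp
      qed
      moreover have "(1 / lam) powr (K/2) \<ge> 1" using lam lam1 K by (intro ge_one_powr_ge_zero) auto
      moreover have "(1 / (2 * C6)) powr (K/2) * 1 * M powr ((1 - q) * (K/2))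
          \<le> (1 / (2 * C6)) powr (K/2) * (1 / lam) powr (K/2) * M powr ((1 - q) * (K/2))"
        using calculation(2) by (intro mult_right_mono mult_left_mono) auto
      ultimately have "r powr (K/2) \<ge> (1 / (2 * C6)) powr (K/2) * 1 * M powr ((1 - q) * (K/2))"
        by linarith
      then have "E * ((1 / (2 * C6)) powr (K/2) * M powr ((1 - q) * (K/2))) \<le> lam * C5"
        using fin E by (smt (verit) mult_left_mono mult_1_right)
      \<comment> \<open>Gain and available energy carry one factor lam each, so lam drops out and
        M^\<gamma> is compared with constants.\<close>
      moreover have "E * ((1 / (2 * C6)) powr (K/2) * M powr ((1 - q) * (K/2))) = lam * (C7 * M powr \<gamma>)"
      proof -
        have "(M/2) powr (q + 1) = M powr (q + 1) * (1/2) powr (q + 1)"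
          using M powr_mult[of M "1/2" "q + 1"] by simp
        moreover have "M powr \<gamma> = M powr (q + 1) * M powr ((1 - q) * (K/2))"
        proof -
          have "\<gamma> = (q + 1) + (1 - q) * (K/2)" by (simp add: \<gamma>_def field_simps)
          then show ?thesis by (simp only: powr_add)
        qed
        ultimately show ?thesis by (simp add: E_def C7_def)
      qed
      ultimately have "M powr \<gamma> \<le> C5 / C7" using lam C7 by (simp add: field_simps)
      then have "(M powr \<gamma>) powr (1 / \<gamma>) \<le> M0" unfolding M0_def using gam by (intro powr_mono2) auto
      then have "M \<le> M0" using gam M by (simp add: powr_powr)
      then have "lam * M powr (q - 1) \<le> lam * M0 powr (q - 1)"
        using lam M q by (intro mult_left_mono powr_mono2) auto
      then show False using lam1(3) big M0 by (simp add: field_simps)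
    qed
    show "\<exists>lam0>0. \<forall>lam \<psi> \<psi>1 \<psi>2. 0 < lam \<longrightarrow> lam < lam0 \<longrightarrow>
      continuous_on {0..\<delta>'} \<psi> \<longrightarrow> (\<forall>s\<in>{0..\<delta>'}. 0 < \<psi> s) \<longrightarrow>
      (\<forall>s. 0 < s \<longrightarrow> s \<le> \<delta>' \<longrightarrow> (\<psi> has_real_derivative \<psi>1 s) (at s) \<and> (\<psi>1 has_real_derivative \<psi>2 s) (at s)
         \<and> b s * \<psi>2 s + a s * \<psi>1 s + lam * (\<psi> s powr q - \<psi> s) = 0) \<longrightarrow>
      ((\<lambda>s. sqrt s * \<psi>1 s) \<longlongrightarrow> 0) (at_right 0) \<longrightarrow>
      (\<forall>s\<in>{\<delta>'/2..\<delta>'}. \<psi> s \<le> Cm \<and> \<bar>\<psi>1 s\<bar> \<le> Cm * lam) \<longrightarrow>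
      (\<forall>s\<in>{0..\<delta>'}. lam * \<psi> s powr (q - 1) \<le> \<epsilon>)"
    proof (intro exI[of _ lam0] conjI lam0 allI impI ballI)
      fix lam \<psi> \<psi>1 \<psi>2 and s :: real
      assume *: "0 < lam" "lam < lam0" "continuous_on {0..\<delta>'} \<psi>" "\<forall>s\<in>{0..\<delta>'}. 0 < \<psi> s"
        "\<forall>s. 0 < s \<longrightarrow> s \<le> \<delta>' \<longrightarrow> (\<psi> has_real_derivative \<psi>1 s) (at s) \<and> (\<psi>1 has_real_derivative \<psi>2 s) (at s)
         \<and> b s * \<psi>2 s + a s * \<psi>1 s + lam * (\<psi> s powr q - \<psi> s) = 0"
        "((\<lambda>s. sqrt s * \<psi>1 s) \<longlongrightarrow> 0) (at_right 0)"
        "\<forall>s\<in>{\<delta>'/2..\<delta>'}. \<psi> s \<le> Cm \<and> \<bar>\<psi>1 s\<bar> \<le> Cm * lam" "s \<in> {0..\<delta>'}"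
      show "lam * \<psi> s powr (q - 1) \<le> \<epsilon>"
        by (rule main[where \<psi> = \<psi> and ?\<psi>1.0 = \<psi>1 and ?\<psi>2.0 = \<psi>2 and s = s]) (use * in blast)+
    qed
  qed
qed

end

section \<open>Reflection, and elementary bounds for the nonlinearity\<close>

lemma DERIV_reflect:
  fixes f :: "real \<Rightarrow> real"
  assumes "(f has_real_derivative D) (at (L - s))"
  shows "((\<lambda>s. f (L - s)) has_real_derivative - D) (at s)"
proof -
  have "((\<lambda>s. L - s) has_real_derivative -1) (at s)" by (auto intro!: derivative_eq_intros)
  from DERIV_chain2[where f = f and g = "\<lambda>s. L - s", OF assms this] show ?thesis by simp
qed

text \<open>Mean value theorem between x and 1, where x^q - x vanishes. The factor |x - 1| is what
  the final contraction iterates on; the other factor becomes small after multiplication by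
  lam.\<close>

lemma abs_powr_diff_le:
  fixes x q :: real
  assumes "0 < x" "1 < q"
  shows "\<bar>x powr q - x\<bar> \<le> q * max (x powr (q - 1)) 1 * \<bar>x - 1\<bar>"
proof (cases "x = 1")
  case False
  let ?h = "\<lambda>x. x powr q - x" and ?h' = "\<lambda>x. q * x powr (q - 1) - 1"
  have d: "(?h has_real_derivative ?h' z) (at z)" if "0 < z" for z
    using that by (auto intro!: derivative_eq_intros)
  have "\<exists>z. min x 1 \<le> z \<and> z \<le> max x 1 \<and> ?h x - ?h 1 = (x - 1) * ?h' z"
  proof (cases "x < 1")
    case True
    from MVT2[OF True, of ?h ?h'] d assms obtain z where "x < z" "z < 1" "?h 1 - ?h x = (1 - x) * ?h' z" by auto
    then show ?thesis using True by (intro exI[of _ z]) (auto simp: algebra_simps)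
  next
    case False
    then have "1 < x" using \<open>x \<noteq> 1\<close> by simp
    from MVT2[OF this, of ?h ?h'] d assms obtain z where "1 < z" "z < x" "?h x - ?h 1 = (x - 1) * ?h' z" by auto
    then show ?thesis using False by (intro exI[of _ z]) auto
  qed
  then obtain z where z: "min x 1 \<le> z" "z \<le> max x 1" "?h x - ?h 1 = (x - 1) * ?h' z" by blast
  have "z powr (q - 1) \<le> (max x 1) powr (q - 1)" using z assms by (intro powr_mono2) auto
  also have "\<dots> = max (x powr (q - 1)) 1"
    using assms powr_mono2[of "q - 1" x 1] powr_mono2[of "q - 1" 1 x] by (auto simp: max_def)
  finally have "q * z powr (q - 1) \<le> q * max (x powr (q - 1)) 1" using assms by (intro mult_left_mono) auto
  moreover have "1 \<le> q * max (x powr (q - 1)) 1" using assms mult_mono[of 1 q 1 "max (x powr (q - 1)) 1"] by auto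
  moreover have "0 \<le> q * z powr (q - 1)" using assms by simp
  ultimately have "\<bar>?h' z\<bar> \<le> q * max (x powr (q - 1)) 1" by linarith
  moreover have "\<bar>?h x\<bar> = \<bar>?h' z\<bar> * \<bar>x - 1\<bar>" using z(3) by (simp add: abs_mult)
  ultimately show ?thesis by (simp add: mult_right_mono)
qed auto

lemma powr_less_self:
  fixes x :: real
  assumes "0 < x" "x < 1" "1 < q"
  shows "x powr q < x"
proof -
  have "ln x < 0" using assms by simp
  then have "q * ln x < ln x" using assms mult_strict_right_mono_neg[of 1 q "ln x"] by simp
  then have "exp (q * ln x) < exp (ln x)" by (simp only: exp_less_cancel_iff)
  also have "exp (ln x) = x" using assms by simp
  finally show ?thesis using assms(1) by (metis powr_def less_irrefl)
qed

text \<open>The one estimate of the nonlinearity that holds before the solution is bounded; it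
  starts the chain of flux estimates.\<close>

lemma powr_minus_self_ge: "0 < x \<Longrightarrow> 1 < q \<Longrightarrow> - 1 \<le> x powr q - (x::real)"
  by (smt (verit) ge_one_powr_ge_zero powr_gt_zero powr_mono powr_one)

text \<open>Beyond \<open>2 powr (1 / (q - 1))\<close> one has x^q >= 2 x, so x is at most x^q -
  x.\<close>

lemma powr_minus_self_bound:
  assumes "0 < x" "1 < q" "x powr q - x \<le> (C::real)"
  shows "x \<le> max (2 powr (1 / (q - 1))) C"
proof (cases "x \<le> 2 powr (1 / (q - 1))")
  case False
  then have "(2 powr (1 / (q - 1))) powr (q - 1) \<le> x powr (q - 1)" using assms by (intro powr_mono2) auto
  then have "2 \<le> x powr (q - 1)" using assms by (simp add: powr_powr)
  then have "2 * x \<le> x powr (q - 1) * x" using assms by (intro mult_right_mono) auto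
  also have "\<dots> = x powr q" using assms by (simp add: powr_diff)
  finally show ?thesis using assms by simp
qed simp

section \<open>Flux estimates across the whole interval\<close>

text \<open>Joins the quantitative conditions near 0 with qualitative ones on all of (0, L), so that
  the right end becomes an instance of the same locale after s is replaced by L - s.\<close>

locale left_end = singular_end +
  fixes L :: real
  assumes L: "0 < L" and delta_L: "\<delta> \<le> L"
    and A_deriv_L: "0 < s \<Longrightarrow> s < L \<Longrightarrow> (A has_real_derivative a s / b s * A s) (at s)"
    and A_pos_L: "0 < s \<Longrightarrow> s < L \<Longrightarrow> 0 < A s"
    and b_pos_L: "0 < s \<Longrightarrow> s < L \<Longrightarrow> 0 < b s"
    and b_cont_L: "0 < s \<Longrightarrow> s < L \<Longrightarrow> isCont b s"
begin

lemma flux_deriv_L: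
  assumes s: "0 < s" "s < L" and d2: "(\<psi>1 has_real_derivative \<psi>2) (at s)"
    and ode: "b s * \<psi>2 + a s * \<psi>1 s + N = 0"
  shows "((\<lambda>s. A s * \<psi>1 s) has_real_derivative - (A s / b s) * N) (at s)"
proof -
  have "b s > 0" using b_pos_L s by blast
  then have e: "\<psi>2 = - (a s * \<psi>1 s + N) / b s"
    using ode by (simp add: field_simps)
  show ?thesis
    using DERIV_mult[OF A_deriv_L[OF s] d2] \<open>b s > 0\<close> by (simp add: e field_simps)
qed

lemma weight_continuous_on:
  assumes "0 < r" "R < L"
  shows "continuous_on {r..R} (\<lambda>s. A s / b s)" "continuous_on {r..R} A"
proof -
  show *: "continuous_on {r..R} A"
    using assms by (intro continuous_at_imp_continuous_on ballI DERIV_isCont[OF A_deriv_L]) auto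
  show "continuous_on {r..R} (\<lambda>s. A s / b s)"
    using assms b_pos_L
    by (intro continuous_on_divide * continuous_at_imp_continuous_on ballI b_cont_L) (auto simp: less_imp_neq[symmetric])
qed

text \<open>Away from the ends the density A / b is bounded, so the estimate at r obtained from the
  singular end continues with at most linear growth up to R. C is fixed before y, N and B: it
  depends on the weight only.\<close>

lemma flux_interior:
  assumes r: "0 < r" "r < \<delta>" "r \<le> R" "R < L"
  obtains C where "0 < C"
    "\<forall>y N B. (\<forall>s. 0 < s \<longrightarrow> s < L \<longrightarrow> (y has_real_derivative - (A s / b s) * N s) (at s) \<and> - B \<le> N s) \<longrightarrow>
      0 \<le> B \<longrightarrow> (y \<longlongrightarrow> 0) (at_right 0) \<longrightarrow> (\<forall>s\<in>{r..R}. y s \<le> B * C)"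
proof -
  obtain x where x: "\<forall>s\<in>{r..R}. A s / b s \<le> A x / b x"
    using continuous_attains_sup[OF compact_Icc _ weight_continuous_on(1)[OF r(1,4)]] r(3) by (auto simp: Bex_def)
  define W where "W = A x / b x"
  have W: "A s / b s \<le> W" if "r \<le> s" "s \<le> R" for s using x that by (simp add: W_def)
  have W0: "0 \<le> W" using W[of r] r A_pos_L[of r] b_pos_L[of r] by (smt (verit) divide_nonneg_nonneg)
  show ?thesis
  proof (rule that[of "C1 * r powr (k/2) + W * (R - r)"])
    show "0 < C1 * r powr (k/2) + W * (R - r)" using C1_pos r W0 by (intro add_pos_nonneg) auto
    have key: "y s \<le> B * (C1 * r powr (k/2) + W * (R - r))"
      if y: "\<And>s. 0 < s \<Longrightarrow> s < L \<Longrightarrow> (y has_real_derivative - (A s / b s) * N s) (at s)"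
        and N: "\<And>s. 0 < s \<Longrightarrow> s < L \<Longrightarrow> - B \<le> N s" and B: "(0::real) \<le> B"
        and lim: "(y \<longlongrightarrow> 0) (at_right 0)" and s: "r \<le> s" "s \<le> R" for y N B s
    proof -
    have 1: "y r \<le> B * C1 * r powr (k/2)"
      by (rule flux_upper[of "min \<delta> L" y N B]) (use y N B lim r in auto)
    have 2: "y s \<le> y r + (B * W) * (s - r)"
    proof (rule mono_le_of_deriv_le[where z' = "\<lambda>s. - (A s / b s) * N s"])
      fix x assume x: "r \<le> x" "x \<le> s"
      have x': "0 < x" "x < L" using x r s by auto
      then show "(y has_real_derivative - (A x / b x) * N x) (at x)" by (rule y)
      have "- (A x / b x) * N x \<le> (A x / b x) * B"
        using mult_left_mono[OF N[OF x'], of "A x / b x"] A_pos_L[OF x'] b_pos_L[OF x'] by simp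
      also have "\<dots> \<le> W * B" using W[of x] x s B by (intro mult_right_mono) auto
      finally show "- (A x / b x) * N x \<le> B * W" by (simp add: mult.commute)
    qed (use s in simp)
    have "(B * W) * (s - r) \<le> (B * W) * (R - r)" using s B W0 by (intro mult_left_mono) auto
    then show ?thesis using 1 2 by (simp add: algebra_simps)
    qed
    show "\<forall>y N B. (\<forall>s. 0 < s \<longrightarrow> s < L \<longrightarrow> (y has_real_derivative - (A s / b s) * N s) (at s) \<and> - B \<le> N s) \<longrightarrow>
      0 \<le> B \<longrightarrow> (y \<longlongrightarrow> 0) (at_right 0) \<longrightarrow> (\<forall>s\<in>{r..R}. y s \<le> B * (C1 * r powr (k/2) + W * (R - r)))"
      by (intro allI impI ballI, rule key) auto
  qed
qed

end

text \<open>Reflection reverses the sign of first-order quantities, hence of \<open>a\<close> and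
  \<open>b'\<close> in the second instance, while \<open>b\<close> and \<open>A\<close> are merely
  reflected.\<close>

locale two_ended =
  lft: left_end a b b' A \<beta>0 k0 \<delta>0 c0 C0 L +
  rgt: left_end "\<lambda>s. - a (L - s)" "\<lambda>s. b (L - s)" "\<lambda>s. - b' (L - s)" "\<lambda>s. A (L - s)" \<beta>1 k1 \<delta>1 c1 C1' L
  for a b b' A :: "real \<Rightarrow> real" and \<beta>0 k0 \<delta>0 c0 C0 \<beta>1 k1 \<delta>1 c1 C1' L :: real
begin

text \<open>The two limits stand for a Neumann condition. The distance to a focal set is comparable
  to sqrt s there, so they say that the derivative with respect to this distance tends to 0.\<close>

definition solution :: "real \<Rightarrow> real \<Rightarrow> (real \<Rightarrow> real) \<Rightarrow> (real \<Rightarrow> real) \<Rightarrow> (real \<Rightarrow> real) \<Rightarrow> bool" where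
  "solution q lam \<psi> \<psi>1 \<psi>2 \<longleftrightarrow> continuous_on {0..L} \<psi> \<and> (\<forall>s\<in>{0..L}. 0 < \<psi> s) \<and>
     (\<forall>s. 0 < s \<longrightarrow> s < L \<longrightarrow> (\<psi> has_real_derivative \<psi>1 s) (at s) \<and> (\<psi>1 has_real_derivative \<psi>2 s) (at s)
        \<and> b s * \<psi>2 s + a s * \<psi>1 s + lam * (\<psi> s powr q - \<psi> s) = 0) \<and>
     ((\<lambda>s. sqrt s * \<psi>1 s) \<longlongrightarrow> 0) (at_right 0) \<and> ((\<lambda>s. sqrt s * \<psi>1 (L - s)) \<longlongrightarrow> 0) (at_right 0)"

text \<open>A lower bound of N bounds the flux from above when integrated from the left end and,
  with the orientation reversed, from below when integrated from the right end. One-sided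
  information thus gives a two-sided bound.\<close>

lemma flux_two_sided:
  assumes r: "0 < r" "r < \<delta>0" "r < \<delta>1" "r < L / 2"
  obtains C where "0 < C"
    "\<forall>y N B. (\<forall>s. 0 < s \<longrightarrow> s < L \<longrightarrow> (y has_real_derivative - (A s / b s) * N s) (at s) \<and> - B \<le> N s) \<longrightarrow>
      0 \<le> B \<longrightarrow> (y \<longlongrightarrow> 0) (at_right 0) \<longrightarrow> ((\<lambda>s. y (L - s)) \<longlongrightarrow> 0) (at_right 0) \<longrightarrow>
      (\<forall>s\<in>{r..L - r}. \<bar>y s\<bar> \<le> B * C)"
proof -
  have rL: "r \<le> L - r" "L - r < L" using r by auto
  obtain Ca where Ca: "0 < Ca"
    "\<forall>y N B. (\<forall>s. 0 < s \<longrightarrow> s < L \<longrightarrow> (y has_real_derivative - (A s / b s) * N s) (at s) \<and> - B \<le> N s) \<longrightarrow>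
      0 \<le> B \<longrightarrow> (y \<longlongrightarrow> 0) (at_right 0) \<longrightarrow> (\<forall>s\<in>{r..L - r}. y s \<le> B * Ca)"
    by (rule lft.flux_interior[OF r(1,2) rL])
  obtain Cb where Cb: "0 < Cb"
    "\<forall>y N B. (\<forall>s. 0 < s \<longrightarrow> s < L \<longrightarrow> (y has_real_derivative - (A (L - s) / b (L - s)) * N s) (at s) \<and> - B \<le> N s) \<longrightarrow>
      0 \<le> B \<longrightarrow> (y \<longlongrightarrow> 0) (at_right 0) \<longrightarrow> (\<forall>s\<in>{r..L - r}. y s \<le> B * Cb)"
    by (rule rgt.flux_interior[OF r(1,3) rL])
  have "\<bar>y s\<bar> \<le> B * max Ca Cb"
    if yN: "\<forall>s. 0 < s \<longrightarrow> s < L \<longrightarrow> (y has_real_derivative - (A s / b s) * N s) (at s) \<and> - B \<le> N s"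
      and B: "0 \<le> B" and lim: "(y \<longlongrightarrow> 0) (at_right 0)" "((\<lambda>s. y (L - s)) \<longlongrightarrow> 0) (at_right 0)"
      and s: "s \<in> {r..L - r}" for y N B s
  proof -
    have "y s \<le> B * Ca" using Ca(2) yN B lim(1) s by blast
    also have "\<dots> \<le> B * max Ca Cb" using B by (intro mult_left_mono) auto
    finally have 1: "y s \<le> B * max Ca Cb" .
    have "\<forall>s. 0 < s \<longrightarrow> s < L \<longrightarrow> ((\<lambda>s. - y (L - s)) has_real_derivative - (A (L - s) / b (L - s)) * N (L - s)) (at s)
        \<and> - B \<le> N (L - s)"
    proof (intro allI impI conjI)
      fix s assume "0 < s" "s < L"
      then show "((\<lambda>s. - y (L - s)) has_real_derivative - (A (L - s) / b (L - s)) * N (L - s)) (at s)"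
        using yN[rule_format, of "L - s"] by (auto intro!: derivative_eq_intros DERIV_chain2[where f = y])
    qed (use yN in auto)
    moreover have "((\<lambda>s. - y (L - s)) \<longlongrightarrow> 0) (at_right 0)" using tendsto_minus[OF lim(2)] by simp
    ultimately have "\<forall>s\<in>{r..L - r}. - y (L - s) \<le> B * Cb"
      using Cb(2)[THEN spec, of "\<lambda>s. - y (L - s)", THEN spec, of "\<lambda>s. N (L - s)"] B by blast
    from bspec[OF this, of "L - s"] s have "- y s \<le> B * Cb" by simp
    also have "\<dots> \<le> B * max Ca Cb" using B by (intro mult_left_mono) auto
    finally show ?thesis using 1 by linarith
  qed
  then show ?thesis using Ca(1) by (intro that[of "max Ca Cb"] allI impI) (auto simp: less_max_iff_disj)
qed

text \<open>
  Once \<open>lam \<psi>^(q-1) \<le> \<epsilon>\<close>, the flux estimate gives \<open>\<bar>\<psi>1\<bar> \<le> m / (2 L)\<close> for \<open>m = sup \<bar>\<psi> - 1\<bar>\<close>; as \<open>\<psi>\<close> takes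
  the value 1, this forces \<open>m = 0\<close>.
\<close>

lemma ode_rigidity:
  fixes q K :: real
  assumes q: "1 < q" and K: "k0 \<le> K" "k1 \<le> K" "2 \<le> K" and sub: "K * (q - 1) < 2 * (q + 1)"
  shows "\<exists>lam0>0. \<forall>lam \<psi> \<psi>1 \<psi>2. 0 < lam \<longrightarrow> lam < lam0 \<longrightarrow> solution q lam \<psi> \<psi>1 \<psi>2 \<longrightarrow> (\<forall>s\<in>{0..L}. \<psi> s = 1)"
proof -
  have L: "0 < L" by (rule lft.L)
  obtain e0 where e0: "0 < e0" "e0 < \<delta>0" and E0: "\<And>Cm \<epsilon>. 0 < Cm \<Longrightarrow> 0 < \<epsilon> \<Longrightarrow> \<exists>lam0>0. \<forall>lam \<psi> \<psi>1 \<psi>2. 0 < lam \<longrightarrow> lam < lam0 \<longrightarrow>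
      continuous_on {0..e0} \<psi> \<longrightarrow> (\<forall>s\<in>{0..e0}. 0 < \<psi> s) \<longrightarrow>
      (\<forall>s. 0 < s \<longrightarrow> s \<le> e0 \<longrightarrow> (\<psi> has_real_derivative \<psi>1 s) (at s) \<and> (\<psi>1 has_real_derivative \<psi>2 s) (at s)
         \<and> b s * \<psi>2 s + a s * \<psi>1 s + lam * (\<psi> s powr q - \<psi> s) = 0) \<longrightarrow>
      ((\<lambda>s. sqrt s * \<psi>1 s) \<longlongrightarrow> 0) (at_right 0) \<longrightarrow>
      (\<forall>s\<in>{e0/2..e0}. \<psi> s \<le> Cm \<and> \<bar>\<psi>1 s\<bar> \<le> Cm * lam) \<longrightarrow>
      (\<forall>s\<in>{0..e0}. lam * \<psi> s powr (q - 1) \<le> \<epsilon>)"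
    by (rule lft.sup_bound[OF q K(1,3) sub]) (rule that)
  obtain e1 where e1: "0 < e1" "e1 < \<delta>1" and E1: "\<And>Cm \<epsilon>. 0 < Cm \<Longrightarrow> 0 < \<epsilon> \<Longrightarrow> \<exists>lam0>0. \<forall>lam \<psi> \<psi>1 \<psi>2. 0 < lam \<longrightarrow> lam < lam0 \<longrightarrow>
      continuous_on {0..e1} \<psi> \<longrightarrow> (\<forall>s\<in>{0..e1}. 0 < \<psi> s) \<longrightarrow>
      (\<forall>s. 0 < s \<longrightarrow> s \<le> e1 \<longrightarrow> (\<psi> has_real_derivative \<psi>1 s) (at s) \<and> (\<psi>1 has_real_derivative \<psi>2 s) (at s)
         \<and> b (L - s) * \<psi>2 s + - a (L - s) * \<psi>1 s + lam * (\<psi> s powr q - \<psi> s) = 0) \<longrightarrow>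
      ((\<lambda>s. sqrt s * \<psi>1 s) \<longlongrightarrow> 0) (at_right 0) \<longrightarrow>
      (\<forall>s\<in>{e1/2..e1}. \<psi> s \<le> Cm \<and> \<bar>\<psi>1 s\<bar> \<le> Cm * lam) \<longrightarrow>
      (\<forall>s\<in>{0..e1}. lam * \<psi> s powr (q - 1) \<le> \<epsilon>)"
    by (rule rgt.sup_bound[OF q K(2,3) sub]) (rule that)
  have eL: "e0 < L" "e1 < L" using e0 e1 lft.delta_L rgt.delta_L by auto
  \<comment> \<open>Small enough for [e0/2, e0] and the reflected interval [L - e1, L - e1/2] to lie
    in [r, L - r]; this is where the interior bounds meet the hypotheses of the two end
    estimates.\<close>
  define r where "r = min (min (e0 / 2) (L - e0)) (min (min (e1 / 2) (L - e1)) (L / 4))"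
  have r0L: "r \<le> e0 / 2" "r \<le> L - e0" "r \<le> e1 / 2" "r \<le> L - e1" "r \<le> L / 4"
    unfolding r_def by (blast intro: min.coboundedI1 min.coboundedI2 order_refl)+
  have "0 < r" unfolding r_def min_less_iff_conj using e0 e1 L eL by auto
  then have r: "0 < r" "r \<le> e0 / 2" "r \<le> e1 / 2" "r \<le> L / 4" "r < \<delta>0" "r < \<delta>1" "r < L / 2"
    using r0L e0 e1 L by linarith+
  obtain C where C: "0 < C" and flux':
    "\<forall>y N B. (\<forall>s. 0 < s \<longrightarrow> s < L \<longrightarrow> (y has_real_derivative - (A s / b s) * N s) (at s) \<and> - B \<le> N s) \<longrightarrow>
      0 \<le> B \<longrightarrow> (y \<longlongrightarrow> 0) (at_right 0) \<longrightarrow> ((\<lambda>s. y (L - s)) \<longlongrightarrow> 0) (at_right 0) \<longrightarrow>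
      (\<forall>s\<in>{r..L - r}. \<bar>y s\<bar> \<le> B * C)"
    by (rule flux_two_sided[OF r(1,5,6,7)])
  have flux: "\<bar>y s\<bar> \<le> B * C"
    if "\<And>s. 0 < s \<Longrightarrow> s < L \<Longrightarrow> (y has_real_derivative - (A s / b s) * N s) (at s)"
      "\<And>s. 0 < s \<Longrightarrow> s < L \<Longrightarrow> - B \<le> N s" "0 \<le> B" "(y \<longlongrightarrow> 0) (at_right 0)"
      "((\<lambda>s. y (L - s)) \<longlongrightarrow> 0) (at_right 0)" "r \<le> s" "s \<le> L - r" for y N B s
  proof -
    have "\<forall>s. 0 < s \<longrightarrow> s < L \<longrightarrow> (y has_real_derivative - (A s / b s) * N s) (at s) \<and> - B \<le> N s"
      using that(1,2) by simp
    from flux'[THEN spec, THEN spec, THEN spec, THEN mp, OF this, THEN mp, OF that(3), THEN mp, OF that(4), THEN mp, OF that(5)]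
    show ?thesis using that(6,7) by simp
  qed
  have ne: "{r..L - r} \<noteq> {}" and rL: "L - r < L" using r by auto
  obtain wx where wx: "wx \<in> {r..L - r}" "\<And>s. s \<in> {r..L - r} \<Longrightarrow> A wx / b wx \<le> A s / b s"
    using continuous_attains_inf[OF compact_Icc ne lft.weight_continuous_on(1)[OF r(1) rL]] by blast
  define w where "w = A wx / b wx"
  have w: "0 < w" using wx(1) r lft.A_pos_L[of wx] lft.b_pos_L[of wx] by (simp add: w_def)
  obtain Ax where Ax: "Ax \<in> {r..L - r}" "\<And>s. s \<in> {r..L - r} \<Longrightarrow> A Ax \<le> A s"
    using continuous_attains_inf[OF compact_Icc ne lft.weight_continuous_on(2)[OF r(1) rL]] by blast
  define Am where "Am = A Ax"
  have Am: "0 < Am" using Ax(1) r lft.A_pos_L[of Ax] by (simp add: Am_def)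
  \<comment> \<open>Bound for \<open>\<psi>\<close> at the mean-value point of the flux on
    [r, L - r]: the flux changes by at most 2 * lam * C, the density is at least w, and lam cancels
    from the resulting bound on \<psi>^q - \<psi>.\<close>
  define Cp where "Cp = max (2 powr (1 / (q - 1))) (2 * C / (w * (L - 2 * r)))"
  have Cp: "0 < Cp" by (simp add: Cp_def less_max_iff_disj)
  define Cm where "Cm = Cp + C / Am * L + C / Am"
  have Cm: "0 < Cm" using Cp C Am L by (simp add: Cm_def add_pos_pos)
  define Cs where "Cs = max (lft.C1 / c0) (max (rgt.C1 / c1) (C / Am))"
  have Cs: "0 < Cs" using C Am by (simp add: Cs_def less_max_iff_disj)
  \<comment> \<open>Chosen so that the concluding estimate reads m <= m / 2.\<close>
  define \<epsilon> where "\<epsilon> = 1 / (2 * q * Cs * L)"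
  have eps: "0 < \<epsilon>" using q Cs L by (simp add: \<epsilon>_def)
  obtain l0 where l0: "0 < l0" and l0': "\<forall>lam \<psi> \<psi>1 \<psi>2. 0 < lam \<longrightarrow> lam < l0 \<longrightarrow>
      continuous_on {0..e0} \<psi> \<longrightarrow> (\<forall>s\<in>{0..e0}. 0 < \<psi> s) \<longrightarrow>
      (\<forall>s. 0 < s \<longrightarrow> s \<le> e0 \<longrightarrow> (\<psi> has_real_derivative \<psi>1 s) (at s) \<and> (\<psi>1 has_real_derivative \<psi>2 s) (at s)
         \<and> b s * \<psi>2 s + a s * \<psi>1 s + lam * (\<psi> s powr q - \<psi> s) = 0) \<longrightarrow>
      ((\<lambda>s. sqrt s * \<psi>1 s) \<longlongrightarrow> 0) (at_right 0) \<longrightarrow>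
      (\<forall>s\<in>{e0/2..e0}. \<psi> s \<le> Cm \<and> \<bar>\<psi>1 s\<bar> \<le> Cm * lam) \<longrightarrow>
      (\<forall>s\<in>{0..e0}. lam * \<psi> s powr (q - 1) \<le> \<epsilon>)" using E0[OF Cm eps] by blast
  obtain l1 where l1: "0 < l1" and l1': "\<forall>lam \<psi> \<psi>1 \<psi>2. 0 < lam \<longrightarrow> lam < l1 \<longrightarrow>
      continuous_on {0..e1} \<psi> \<longrightarrow> (\<forall>s\<in>{0..e1}. 0 < \<psi> s) \<longrightarrow>
      (\<forall>s. 0 < s \<longrightarrow> s \<le> e1 \<longrightarrow> (\<psi> has_real_derivative \<psi>1 s) (at s) \<and> (\<psi>1 has_real_derivative \<psi>2 s) (at s)
         \<and> b (L - s) * \<psi>2 s + - a (L - s) * \<psi>1 s + lam * (\<psi> s powr q - \<psi> s) = 0) \<longrightarrow>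
      ((\<lambda>s. sqrt s * \<psi>1 s) \<longlongrightarrow> 0) (at_right 0) \<longrightarrow>
      (\<forall>s\<in>{e1/2..e1}. \<psi> s \<le> Cm \<and> \<bar>\<psi>1 s\<bar> \<le> Cm * lam) \<longrightarrow>
      (\<forall>s\<in>{0..e1}. lam * \<psi> s powr (q - 1) \<le> \<epsilon>)" using E1[OF Cm eps] by blast
  define lam0 where "lam0 = min (min l0 l1) (min 1 (min \<epsilon> (\<epsilon> / Cm powr (q - 1))))"
  have lam0: "0 < lam0" using l0 l1 eps Cm by (simp add: lam0_def)
  have main: "\<psi> s = 1"
    if lam: "0 < lam" "lam < lam0" and sol: "solution q lam \<psi> \<psi>1 \<psi>2" and s: "s \<in> {0..L}" for lam \<psi> \<psi>1 \<psi>2 and s :: real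
  proof -
    have lam': "lam < l0" "lam < l1" "lam < 1" "lam < \<epsilon>" "lam < \<epsilon> / Cm powr (q - 1)"
      using lam by (auto simp: lam0_def)
    have cont: "continuous_on {0..L} \<psi>" and pos: "\<And>s. s \<in> {0..L} \<Longrightarrow> 0 < \<psi> s"
      and d1: "\<And>s. 0 < s \<Longrightarrow> s < L \<Longrightarrow> (\<psi> has_real_derivative \<psi>1 s) (at s)"
      and d2: "\<And>s. 0 < s \<Longrightarrow> s < L \<Longrightarrow> (\<psi>1 has_real_derivative \<psi>2 s) (at s)"
      and ode: "\<And>s. 0 < s \<Longrightarrow> s < L \<Longrightarrow> b s * \<psi>2 s + a s * \<psi>1 s + lam * (\<psi> s powr q - \<psi> s) = 0"
      and lim0: "((\<lambda>s. sqrt s * \<psi>1 s) \<longlongrightarrow> 0) (at_right 0)"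
      and lim1: "((\<lambda>s. sqrt s * \<psi>1 (L - s)) \<longlongrightarrow> 0) (at_right 0)"
      using sol by (auto simp: solution_def)
    define N where "N = (\<lambda>s. lam * (\<psi> s powr q - \<psi> s))"
    define y where "y = (\<lambda>s. A s * \<psi>1 s)"
    have yd: "(y has_real_derivative - (A s / b s) * N s) (at s)" if "0 < s" "s < L" for s
      unfolding y_def N_def by (rule lft.flux_deriv_L[OF that d2[OF that] ode[OF that]])
    have y0: "(y \<longlongrightarrow> 0) (at_right 0)" unfolding y_def by (rule lft.flux_lim[OF lim0])
    have y1: "((\<lambda>s. y (L - s)) \<longlongrightarrow> 0) (at_right 0)" unfolding y_def by (rule rgt.flux_lim[OF lim1])
    have Nlo: "- lam \<le> N s" if "0 < s" "s < L" for s
      using powr_minus_self_ge[OF pos q, of s] that lam mult_left_mono[of "-1" "\<psi> s powr q - \<psi> s" lam] by (auto simp: N_def)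
    have ymid: "\<bar>y s\<bar> \<le> lam * C" if "r \<le> s" "s \<le> L - r" for s
      by (rule flux[OF yd Nlo _ y0 y1 that]) (use lam in auto)
    have \<psi>1mid: "\<bar>\<psi>1 s\<bar> \<le> B * C / Am" if "r \<le> s" "s \<le> L - r" "\<bar>y s\<bar> \<le> B * C" for s B
    proof -
      have "Am * \<bar>\<psi>1 s\<bar> \<le> A s * \<bar>\<psi>1 s\<bar>" using Ax(2)[of s] that by (intro mult_right_mono) (auto simp: Am_def)
      also have "\<dots> = \<bar>y s\<bar>" using that r lft.A_pos_L[of s] by (simp add: y_def abs_mult)
      finally show ?thesis using that Am by (simp add: field_simps)
    qed
    have "r < L - r" using r by simp
    then obtain z where z: "r < z" "z < L - r" "y (L - r) - y r = (L - r - r) * (- (A z / b z) * N z)"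
      using MVT2[of r "L - r" y "\<lambda>s. - (A s / b s) * N s"] yd r by auto
    have zp: "0 < \<psi> z" using pos[of z] z r by auto
    have "\<psi> z \<le> Cp"
    proof (cases "N z \<le> 0")
      case True
      then have "\<psi> z powr q - \<psi> z \<le> 0" using lam by (simp add: N_def mult_le_0_iff)
      also have "0 \<le> 2 * C / (w * (L - 2 * r))" using C w r by simp
      finally show ?thesis using powr_minus_self_bound[OF zp q] by (simp add: Cp_def)
    next
      case False
      have "(L - 2 * r) * (w * N z) \<le> (L - 2 * r) * (A z / b z * N z)"
        using wx(2)[of z] z False r by (intro mult_left_mono mult_right_mono) (auto simp: w_def)
      also have "\<dots> = y r - y (L - r)" using z(3) by (simp add: algebra_simps)
      also have "\<dots> \<le> 2 * (lam * C)" using ymid[of r] ymid[of "L - r"] r by auto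
      finally have "lam * (w * (L - 2 * r) * (\<psi> z powr q - \<psi> z)) \<le> lam * (2 * C)" by (simp add: N_def mult_ac)
      then have "w * (L - 2 * r) * (\<psi> z powr q - \<psi> z) \<le> 2 * C" using lam by simp
      then have "\<psi> z powr q - \<psi> z \<le> 2 * C / (w * (L - 2 * r))" using w r by (simp add: field_simps)
      then show ?thesis using powr_minus_self_bound[OF zp q] by (simp add: Cp_def)
    qed
    have mid: "\<psi> s \<le> Cm" "\<bar>\<psi>1 s\<bar> \<le> Cm * lam" if s: "r \<le> s" "s \<le> L - r" for s
    proof -
      have g: "\<bar>\<psi>1 x\<bar> \<le> lam * C / Am" if "r \<le> x" "x \<le> L - r" for x
        using \<psi>1mid ymid that by blast
      have "lam * C / Am \<le> Cm * lam" using lam C Am Cp L by (simp add: Cm_def field_simps add_nonneg_nonneg)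
      then show "\<bar>\<psi>1 s\<bar> \<le> Cm * lam" using g[OF s] by linarith
      have "\<bar>\<psi> s - \<psi> z\<bar> \<le> lam * C / Am * \<bar>s - z\<bar>"
      proof -
        have "norm (\<psi> s - \<psi> z) \<le> lam * C / Am * norm (s - z)"
          by (rule field_differentiable_bound[of "{r..L - r}" \<psi> \<psi>1])
            (use g z s r in \<open>auto intro!: has_field_derivative_at_within[OF d1]\<close>)
        then show ?thesis by simp
      qed
      also have "\<dots> \<le> 1 * C / Am * L" using lam lam' C Am s z r by (intro mult_mono divide_right_mono) auto
      finally show "\<psi> s \<le> Cm" using \<open>\<psi> z \<le> Cp\<close> C Am by (simp add: Cm_def) (smt (verit) divide_pos_pos)
    qed
    have small0: "lam * \<psi> s powr (q - 1) \<le> \<epsilon>" if "s \<in> {0..e0}" for s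
    proof -
      have h1: "continuous_on {0..e0} \<psi>" using eL by (intro continuous_on_subset[OF cont]) auto
      have h2: "\<forall>s\<in>{0..e0}. 0 < \<psi> s" using pos eL by auto
      have h3: "\<forall>s. 0 < s \<longrightarrow> s \<le> e0 \<longrightarrow> (\<psi> has_real_derivative \<psi>1 s) (at s) \<and> (\<psi>1 has_real_derivative \<psi>2 s) (at s)
         \<and> b s * \<psi>2 s + a s * \<psi>1 s + lam * (\<psi> s powr q - \<psi> s) = 0" using d1 d2 ode eL by auto
      have "e0 \<le> L - r" using r0L by simp
      then have h5: "\<forall>s\<in>{e0/2..e0}. \<psi> s \<le> Cm \<and> \<bar>\<psi>1 s\<bar> \<le> Cm * lam" using mid r by auto
      from l0'[THEN spec, THEN spec, THEN spec, THEN spec, THEN mp, OF lam(1), THEN mp, OF lam'(1), THEN mp, OF h1,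
          THEN mp, OF h2, THEN mp, OF h3, THEN mp, OF lim0, THEN mp, OF h5]
      show ?thesis using that by blast
    qed
    have small1: "lam * \<psi> s powr (q - 1) \<le> \<epsilon>" if "s \<in> {L - e1..L}" for s
    proof -
      have h1: "continuous_on {0..e1} (\<lambda>s. \<psi> (L - s))"
        using eL by (intro continuous_on_compose2[OF cont] continuous_intros) auto
      have h2: "\<forall>s\<in>{0..e1}. 0 < \<psi> (L - s)" using pos eL by auto
      have h3: "\<forall>s. 0 < s \<longrightarrow> s \<le> e1 \<longrightarrow> ((\<lambda>s. \<psi> (L - s)) has_real_derivative - \<psi>1 (L - s)) (at s)
         \<and> ((\<lambda>s. - \<psi>1 (L - s)) has_real_derivative \<psi>2 (L - s)) (at s)
         \<and> b (L - s) * \<psi>2 (L - s) + - a (L - s) * - \<psi>1 (L - s) + lam * (\<psi> (L - s) powr q - \<psi> (L - s)) = 0"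
      proof (intro allI impI conjI)
        fix s assume "0 < s" "s \<le> e1"
        then have s: "0 < L - s" "L - s < L" using eL by auto
        show "((\<lambda>s. \<psi> (L - s)) has_real_derivative - \<psi>1 (L - s)) (at s)"
          by (rule DERIV_reflect[OF d1[OF s]])
        show "((\<lambda>s. - \<psi>1 (L - s)) has_real_derivative \<psi>2 (L - s)) (at s)"
          using DERIV_minus[OF DERIV_reflect[OF d2[OF s]]] by simp
        show "b (L - s) * \<psi>2 (L - s) + - a (L - s) * - \<psi>1 (L - s) + lam * (\<psi> (L - s) powr q - \<psi> (L - s)) = 0"
          using ode[OF s] by simp
      qed
      have h4: "((\<lambda>s. sqrt s * - \<psi>1 (L - s)) \<longlongrightarrow> 0) (at_right 0)" using tendsto_minus[OF lim1] by simp
      have "e1 \<le> L - r" using r0L by simp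
      then have h5: "\<forall>s\<in>{e1/2..e1}. \<psi> (L - s) \<le> Cm \<and> \<bar>- \<psi>1 (L - s)\<bar> \<le> Cm * lam" using mid r by auto
      from l1'[THEN spec, THEN spec, THEN spec, THEN spec, THEN mp, OF lam(1), THEN mp, OF lam'(2), THEN mp, OF h1,
          THEN mp, OF h2, THEN mp, OF h3, THEN mp, OF h4, THEN mp, OF h5]
      have "\<forall>s\<in>{0..e1}. lam * \<psi> (L - s) powr (q - 1) \<le> \<epsilon>" .
      from bspec[OF this, of "L - s"] show ?thesis using that by auto
    qed
    have small: "lam * \<psi> s powr (q - 1) \<le> \<epsilon>" if s: "s \<in> {0..L}" for s
    proof -
      consider "s \<in> {0..e0}" | "s \<in> {L - e1..L}" | "r \<le> s" "s \<le> L - r" using s r e0 e1 by force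
      then show ?thesis
      proof cases
        case 3
        have "lam * \<psi> s powr (q - 1) \<le> lam * Cm powr (q - 1)"
          using mid(1)[OF 3] pos[OF s] q lam by (intro mult_left_mono powr_mono2) auto
        also have "\<dots> \<le> \<epsilon>" using lam'(5) Cm by (simp add: field_simps)
        finally show ?thesis .
      qed (use small0 small1 in auto)
    qed
    have cont1: "continuous_on {0..L} (\<lambda>s. \<bar>\<psi> s - 1\<bar>)" by (intro continuous_intros cont)
    obtain x where x: "x \<in> {0..L}" "\<And>s. s \<in> {0..L} \<Longrightarrow> \<bar>\<psi> s - 1\<bar> \<le> \<bar>\<psi> x - 1\<bar>"
      using continuous_attains_sup[OF compact_Icc _ cont1] L by auto
    define m where "m = \<bar>\<psi> x - 1\<bar>"
    \<comment> \<open>B bounds the nonlinearity. The maximum of \<psi>^(q-1) and 1 in its Lipschitz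
      factor calls both for the sup bound and for lam < \<epsilon>.\<close>
    define B where "B = q * \<epsilon> * m"
    have Nb: "\<bar>N s\<bar> \<le> B" if s: "s \<in> {0..L}" for s
    proof -
      have "\<bar>N s\<bar> \<le> lam * (q * max (\<psi> s powr (q - 1)) 1 * \<bar>\<psi> s - 1\<bar>)"
        using abs_powr_diff_le[OF pos[OF s] q] lam by (simp add: N_def abs_mult)
      also have "\<dots> = q * (lam * max (\<psi> s powr (q - 1)) 1) * \<bar>\<psi> s - 1\<bar>" by simp
      also have "\<dots> \<le> q * \<epsilon> * m"
        using small[OF s] lam' q x(2)[OF s] eps lam by (intro mult_mono mult_left_mono) (auto simp: m_def max_def)
      finally show ?thesis by (simp add: B_def)
    qed
    have B0: "0 \<le> B" using q eps by (simp add: B_def m_def)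
    \<comment> \<open>Near an end the flux bound and the lower bound for A carry the same power of
      the distance to that end, so it cancels and the slope is bounded up to the end.\<close>
    have \<psi>1b: "\<bar>\<psi>1 s\<bar> \<le> B * Cs" if s: "0 < s" "s < L" for s
    proof -
      consider "s < e0" | "L - s < e1" | "r \<le> s" "s \<le> L - r" using s r e0 e1 by force
      then have "\<bar>\<psi>1 s\<bar> \<le> B * (lft.C1 / c0) \<or> \<bar>\<psi>1 s\<bar> \<le> B * (rgt.C1 / c1) \<or> \<bar>\<psi>1 s\<bar> \<le> B * (C / Am)"
      proof cases
        case 1
        have s': "s < \<delta>0" using 1 e0 by simp
        have "\<bar>y s\<bar> \<le> B * lft.C1 * s powr (k0/2)"
          by (rule lft.flux_abs[of \<delta>0 y N B]) (use yd Nb y0 s s' lft.delta_L in auto)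
        moreover have "c0 * s powr (k0/2) * \<bar>\<psi>1 s\<bar> \<le> \<bar>y s\<bar>"
          using mult_right_mono[OF lft.A_lo[OF s(1) s'], of "\<bar>\<psi>1 s\<bar>"] lft.A_pos_L[OF s] by (simp add: y_def abs_mult)
        ultimately have "s powr (k0/2) * (c0 * \<bar>\<psi>1 s\<bar>) \<le> s powr (k0/2) * (B * lft.C1)" by (simp add: mult_ac)
        then have "c0 * \<bar>\<psi>1 s\<bar> \<le> B * lft.C1" using s by simp
        then show ?thesis using lft.c0 by (simp add: field_simps)
      next
        case 2
        have s': "L - s < \<delta>1" "0 < L - s" using 2 e1 s by auto
        have "\<bar>(\<lambda>s. - y (L - s)) (L - s)\<bar> \<le> B * rgt.C1 * (L - s) powr (k1/2)"
        proof (rule rgt.flux_abs[where r = \<delta>1 and N = "\<lambda>s. N (L - s)"])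
          show "((\<lambda>s. - y (L - s)) has_real_derivative - (A (L - s) / b (L - s)) * N (L - s)) (at s)"
            if "0 < s" "s < \<delta>1" for s
            using yd[of "L - s"] that rgt.delta_L
            by (auto intro!: derivative_eq_intros DERIV_chain2[where f = y])
          show "((\<lambda>s. - y (L - s)) \<longlongrightarrow> 0) (at_right 0)" using tendsto_minus[OF y1] by simp
        qed (use Nb s' rgt.delta_L in auto)
        moreover have "c1 * (L - s) powr (k1/2) * \<bar>\<psi>1 s\<bar> \<le> \<bar>y s\<bar>"
          using mult_right_mono[OF rgt.A_lo[OF s'(2,1)], of "\<bar>\<psi>1 s\<bar>"] lft.A_pos_L[OF s] by (simp add: y_def abs_mult)
        ultimately have "(L - s) powr (k1/2) * (c1 * \<bar>\<psi>1 s\<bar>) \<le> (L - s) powr (k1/2) * (B * rgt.C1)" by (simp add: mult_ac)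
        then have "c1 * \<bar>\<psi>1 s\<bar> \<le> B * rgt.C1" using s by simp
        then show ?thesis using rgt.c0 by (simp add: field_simps)
      next
        case 3
        have "\<bar>y s\<bar> \<le> B * C"
          by (rule flux[OF yd _ B0 y0 y1 3]) (use Nb in \<open>auto simp: abs_le_iff minus_le_iff\<close>)
        then show ?thesis using \<psi>1mid[OF 3] by simp
      qed
      then show ?thesis using B0 mult_left_mono[of "lft.C1 / c0" Cs B] mult_left_mono[of "rgt.C1 / c1" Cs B]
          mult_left_mono[of "C / Am" Cs B] by (force simp: Cs_def)
    qed
    \<comment> \<open>Otherwise N has a constant sign g. The flux is then monotone with limit 0 at
      both ends, hence zero, and so is its derivative - (A / b) N.\<close>
    have "\<exists>p\<in>{0..L}. \<psi> p = 1"
    proof (rule ccontr)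
      assume no: "\<not> (\<exists>p\<in>{0..L}. \<psi> p = 1)"
      have y0ge: "y s = 0" if sg: "(\<forall>s\<in>{0..L}. 0 < g * N s)" and g: "g = 1 \<or> g = -1" and s: "0 < s" "s < L" for g s :: real
      proof -
        have neg: "- (A s / b s) * (g * N s) \<le> 0" if "0 < s" "s < L" for s
          using sg that lft.A_pos_L[OF that] lft.b_pos_L[OF that]
          by (auto intro!: mult_nonneg_nonneg simp: less_imp_le)
        have "g * y s \<le> 0"
        proof (rule at_right_0_mono_le[of L "\<lambda>s. g * y s" "\<lambda>s. - (A s / b s) * (g * N s)"])
          show "((\<lambda>s. g * y s) has_real_derivative - (A s / b s) * (g * N s)) (at s)" if "0 < s" "s < L" for s
            using DERIV_cmult[OF yd[OF that], of g] by (simp add: mult_ac)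
          show "((\<lambda>s. g * y s) \<longlongrightarrow> 0) (at_right 0)" using tendsto_mult_right_zero[OF y0] by simp
        qed (use neg s in auto)
        moreover have "- g * y (L - (L - s)) \<le> 0"
        proof (rule at_right_0_mono_le[of L "\<lambda>s. - g * y (L - s)" "\<lambda>s. - (A (L - s) / b (L - s)) * (g * N (L - s))"])
          show "((\<lambda>s. - g * y (L - s)) has_real_derivative - (A (L - s) / b (L - s)) * (g * N (L - s))) (at s)"
            if "0 < s" "s < L" for s
            using yd[of "L - s"] that
            by (auto intro!: derivative_eq_intros DERIV_chain2[where f = y] simp: mult_ac)
          show "((\<lambda>s. - g * y (L - s)) \<longlongrightarrow> 0) (at_right 0)" using tendsto_minus[OF tendsto_mult_right_zero[OF y1, of g]] by simp
        qed (use neg s in auto)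
        ultimately show ?thesis using g by auto
      qed
      have "(\<forall>s\<in>{0..L}. 1 < \<psi> s) \<or> (\<forall>s\<in>{0..L}. \<psi> s < 1)"
      proof (rule ccontr)
        assume "\<not> ?thesis"
        then obtain u v where "u \<in> {0..L}" "\<psi> u \<le> 1" "v \<in> {0..L}" "1 \<le> \<psi> v" by force
        then have "1 \<in> \<psi> ` {0..L}"
          using connected_contains_Icc[OF connected_continuous_image[OF cont connected_Icc], of "\<psi> u" "\<psi> v"] by auto
        then show False using no by auto
      qed
      then obtain g :: real where g: "g = 1 \<or> g = -1" "\<forall>s\<in>{0..L}. 0 < g * N s"
      proof
        assume *: "\<forall>s\<in>{0..L}. 1 < \<psi> s"
        have "0 < 1 * N s" if "s \<in> {0..L}" for s
          using powr_less_mono[of 1 q "\<psi> s"] * that lam q by (auto simp: N_def)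
        then show thesis using that by blast
      next
        assume *: "\<forall>s\<in>{0..L}. \<psi> s < 1"
        have "0 < -1 * N s" if "s \<in> {0..L}" for s
          using powr_less_self[OF pos[OF that] _ q] * that lam by (auto simp: N_def mult_less_0_iff)
        then show thesis using that by blast
      qed
      have z0: "0 < z" "z < L" using z r by auto
      have "(y has_real_derivative 0) (at z)"
        by (rule has_field_derivative_transform_within_open[of "\<lambda>_. 0" 0 z "{0<..<L}"])
          (use y0ge[OF g(2,1)] z0 in auto)
      then have "- (A z / b z) * N z = 0" using yd[OF z0] DERIV_unique by blast
      then have "N z = 0" using lft.A_pos_L[OF z0] lft.b_pos_L[OF z0] by simp
      moreover have "0 < g * N z" using g(2) z0 by auto
      ultimately show False by simp
    qed
    then obtain p where p: "p \<in> {0..L}" "\<psi> p = 1" by blast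
    have osc: "\<bar>\<psi> u - \<psi> v\<bar> \<le> B * Cs * L" if uv: "u \<in> {0..L}" "v \<in> {0..L}" "u < v" for u v
    proof -
      obtain l \<xi> where \<xi>: "u < \<xi>" "\<xi> < v" "(\<psi> has_real_derivative l) (at \<xi>)" "\<psi> v - \<psi> u = (v - u) * l"
      proof -
        have "continuous_on {u..v} \<psi>" using uv by (intro continuous_on_subset[OF cont]) auto
        moreover have "\<psi> differentiable at x" if "u < x" "x < v" for x
          using d1[of x] that uv by (auto simp: real_differentiable_def)
        ultimately show ?thesis using MVT[OF uv(3), of \<psi>] that by blast
      qed
      have "l = \<psi>1 \<xi>" using \<xi> d1[of \<xi>] uv by (auto intro: DERIV_unique)
      then have "\<bar>l\<bar> \<le> B * Cs" using \<psi>1b[of \<xi>] \<xi> uv by auto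
      then have "\<bar>v - u\<bar> * \<bar>l\<bar> \<le> L * (B * Cs)" using uv by (intro mult_mono) auto
      moreover have "\<bar>\<psi> u - \<psi> v\<bar> = \<bar>v - u\<bar> * \<bar>l\<bar>" using \<xi>(4) by (metis abs_minus_commute abs_mult)
      ultimately show ?thesis by (simp add: mult_ac)
    qed
    have "\<bar>\<psi> x - \<psi> p\<bar> \<le> B * Cs * L"
    proof (cases x p rule: linorder_cases)
      case less then show ?thesis using osc[OF x(1) p(1)] by blast
    next
      case equal then show ?thesis using B0 Cs L by simp
    next
      case greater then show ?thesis using osc[OF p(1) x(1)] by (subst abs_minus_commute) blast
    qed
    then have "m \<le> q * \<epsilon> * m * Cs * L" using p by (simp add: m_def B_def)
    also have "\<dots> = m / 2" using q Cs L by (simp add: \<epsilon>_def)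
    finally have "m \<le> 0" by simp
    then show "\<psi> s = 1" using x(2)[OF s] by (simp add: m_def)
  qed
  show ?thesis using lam0 main by blast
qed

end

text \<open>The Lipschitz bounds give b = \<beta> s + O(s^2) and a = k \<beta> / 2 + O(s), hence (ln
  A)' = a / b = k / (2 s) + O(1). Therefore ln A - (k/2) ln s stays bounded near 0, which is the
  required power behaviour of A.\<close>

lemma left_end_exists:
  fixes a b b' A :: "real \<Rightarrow> real"
  assumes L: "0 < L" and beta: "0 < \<beta>" and k: "1 \<le> k" and Ca: "0 \<le> Ca"
    and A: "\<And>s. 0 < s \<Longrightarrow> s < L \<Longrightarrow> (A has_real_derivative a s / b s * A s) (at s)"
    and Apos: "\<And>s. 0 < s \<Longrightarrow> s < L \<Longrightarrow> 0 < A s"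
    and bpos: "\<And>s. 0 < s \<Longrightarrow> s < L \<Longrightarrow> 0 < b s"
    and b: "\<And>s. 0 < s \<Longrightarrow> s < L \<Longrightarrow> (b has_real_derivative b' s) (at s)"
    and b0: "(b \<longlongrightarrow> 0) (at_right 0)"
    and a_lip: "\<And>s. 0 < s \<Longrightarrow> s < L \<Longrightarrow> \<bar>a s - k * \<beta> / 2\<bar> \<le> Ca * s"
    and b'_lip: "\<And>s. 0 < s \<Longrightarrow> s < L \<Longrightarrow> \<bar>b' s - \<beta>\<bar> \<le> Ca * s"
  shows "\<exists>\<delta> c0 C0. left_end a b b' A \<beta> k \<delta> c0 C0 L"
proof -
  have quad: "\<bar>b s - \<beta> * s\<bar> \<le> Ca * s\<^sup>2" if s: "0 < s" "s < L" for s
  proof -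
    have lim: "((\<lambda>s. g * (b s - \<beta> * s) - Ca * s\<^sup>2) \<longlongrightarrow> g * (0 - \<beta> * 0) - Ca * 0\<^sup>2) (at_right 0)" for g
      by (intro tendsto_intros b0)
    have "g * (b s - \<beta> * s) - Ca * s\<^sup>2 \<le> 0" if g: "g = 1 \<or> g = -1" for g :: real
    proof (rule at_right_0_mono_le[of L "\<lambda>s. g * (b s - \<beta> * s) - Ca * s\<^sup>2" "\<lambda>s. g * (b' s - \<beta>) - Ca * (2 * s)"])
      show "((\<lambda>s. g * (b s - \<beta> * s) - Ca * s\<^sup>2) has_real_derivative g * (b' s - \<beta>) - Ca * (2 * s)) (at s)"
        if "0 < s" "s < L" for s
        by (auto intro!: derivative_eq_intros b that)
      show "g * (b' s - \<beta>) - Ca * (2 * s) \<le> 0" if "0 < s" "s < L" for s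
      proof -
        have "g * (b' s - \<beta>) \<le> Ca * s" using b'_lip[OF that] g by (auto simp: abs_le_iff)
        moreover have "0 \<le> Ca * s" using Ca that by simp
        ultimately show ?thesis by (simp add: algebra_simps)
      qed
      show "((\<lambda>s. g * (b s - \<beta> * s) - Ca * s\<^sup>2) \<longlongrightarrow> 0) (at_right 0)" using lim by simp
    qed (use s in auto)
    from this[of 1] this[of "-1"] show ?thesis by (simp add: abs_le_iff)
  qed
  \<comment> \<open>Makes the quadratic error Ca * s^2 at most half of \<beta> * s.\<close>
  define \<delta> where "\<delta> = min 1 (min (L/2) (\<beta> / (2 * (Ca + 1))))"
  have d: "0 < \<delta>" "\<delta> \<le> 1" "\<delta> < L" using L beta Ca by (auto simp: \<delta>_def min_less_iff_disj)
  have "\<delta> \<le> \<beta> / (2 * (Ca + 1))" by (simp add: \<delta>_def)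
  then have "\<delta> * (2 * (Ca + 1)) \<le> \<beta>" using Ca by (simp add: pos_le_divide_eq)
  then have Cd: "Ca * \<delta> \<le> \<beta> / 2" using d by (simp add: algebra_simps)
  have bb: "\<beta> / 2 * s \<le> b s" "b s \<le> 2 * \<beta> * s" if s: "0 < s" "s \<le> \<delta>" for s
  proof -
    have "Ca * s\<^sup>2 = Ca * s * s" by (simp add: power2_eq_square)
    also have "\<dots> \<le> Ca * \<delta> * s" using s Ca by (intro mult_right_mono mult_left_mono) auto
    also have "\<dots> \<le> \<beta> / 2 * s" using Cd s by (intro mult_right_mono) auto
    finally have "\<bar>b s - \<beta> * s\<bar> \<le> \<beta> / 2 * s" using quad[of s] s d by simp
    moreover have "\<beta> / 2 * s = \<beta> * s / 2" "0 < \<beta> * s" using beta s by auto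
    ultimately show "\<beta> / 2 * s \<le> b s" "b s \<le> 2 * \<beta> * s" by linarith+
  qed
  define G where "G = (\<lambda>s. ln (A s) - (k/2) * ln s)"
  \<comment> \<open>Bound for the derivative of G: its numerator is at most (2 + k) * Ca * s^2 and
    its denominator 2 * s * b s at least \<beta> * s^2.\<close>
  define D where "D = (2 + k) * Ca / \<beta>"
  have D0: "0 \<le> D" using k Ca beta by (simp add: D_def)
  have Gd: "(G has_real_derivative a s / b s - k / (2 * s)) (at s)" if s: "0 < s" "s \<le> \<delta>" for s
    unfolding G_def using A[of s] Apos[of s] s d by (auto intro!: derivative_eq_intros simp: field_simps)
  have Gb: "\<bar>a s / b s - k / (2 * s)\<bar> \<le> D" if s: "0 < s" "s \<le> \<delta>" for s
  proof -
    have bp: "0 < b s" using bpos s d by simp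
    have sL: "s < L" using s d by simp
    have e: "a s / b s - k / (2 * s) = (2 * s * (a s - k * \<beta> / 2) - k * (b s - \<beta> * s)) / (2 * s * b s)"
      using bp s by (simp add: field_simps)
    have "\<bar>2 * s * (a s - k * \<beta> / 2)\<bar> \<le> 2 * s * (Ca * s)"
      unfolding abs_mult using a_lip[OF s(1) sL] s by (intro mult_mono) auto
    moreover have "\<bar>k * (b s - \<beta> * s)\<bar> \<le> k * (Ca * s\<^sup>2)"
      unfolding abs_mult using quad[OF s(1) sL] k by (intro mult_mono) auto
    ultimately have "\<bar>2 * s * (a s - k * \<beta> / 2) - k * (b s - \<beta> * s)\<bar> \<le> (2 + k) * Ca * s\<^sup>2"
      by (simp add: algebra_simps power2_eq_square)
    also have "\<dots> = D * (\<beta> * s\<^sup>2)" using beta by (simp add: D_def)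
    also have "\<dots> \<le> D * (2 * s * b s)"
      using bb(1)[OF s] D0 s by (intro mult_left_mono) (auto simp: power2_eq_square)
    finally show ?thesis unfolding e abs_divide using bp s by (simp add: pos_divide_le_eq)
  qed
  have Gbound: "\<bar>G s - G \<delta>\<bar> \<le> D" if s: "0 < s" "s \<le> \<delta>" for s
  proof -
    have "norm (G s - G \<delta>) \<le> D * norm (s - \<delta>)"
      by (rule field_differentiable_bound[of "{s..\<delta>}" G "\<lambda>s. a s / b s - k / (2 * s)"])
        (use Gb s in \<open>auto intro!: has_field_derivative_at_within[OF Gd]\<close>)
    also have "\<dots> \<le> D * 1" using s d D0 by (intro mult_left_mono) auto
    finally show ?thesis by simp
  qed
  have Aexp: "A s = exp (G s) * s powr (k/2)" if "0 < s" "s \<le> \<delta>" for s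
    using that Apos[of s] d by (simp add: G_def powr_def exp_diff)
  define c0 where "c0 = min (exp (G \<delta> - D)) (\<beta> / 2)"
  define C0 where "C0 = max (exp (G \<delta> + D)) (2 * \<beta>)"
  have cC: "c0 \<le> \<beta> / 2" "2 * \<beta> \<le> C0" "c0 \<le> exp (G \<delta> - D)" "exp (G \<delta> + D) \<le> C0"
    by (auto simp: c0_def C0_def)
  have alim: "(a \<longlongrightarrow> k * \<beta> / 2) (at_right 0)"
  proof (rule Lim_transform2[OF tendsto_const Lim_null_comparison])
    show "((\<lambda>s. Ca * s) \<longlongrightarrow> 0) (at_right 0)" by (auto intro!: tendsto_eq_intros)
    show "\<forall>\<^sub>F s in at_right 0. norm (k * \<beta> / 2 - a s) \<le> Ca * s"
      using L a_lip by (intro eventually_at_rightI[of 0 L]) (auto simp: abs_minus_commute)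
  qed
  have blim: "(b' \<longlongrightarrow> \<beta>) (at_right 0)"
  proof (rule Lim_transform2[OF tendsto_const Lim_null_comparison])
    show "((\<lambda>s. Ca * s) \<longlongrightarrow> 0) (at_right 0)" by (auto intro!: tendsto_eq_intros)
    show "\<forall>\<^sub>F s in at_right 0. norm (\<beta> - b' s) \<le> Ca * s"
      using L b'_lip by (intro eventually_at_rightI[of 0 L]) (auto simp: abs_minus_commute)
  qed
  have "left_end a b b' A \<beta> k \<delta> c0 C0 L"
  proof
    show "0 < \<beta>" "1 \<le> k" "0 < \<delta>" "\<delta> \<le> 1" "0 < L" "\<delta> \<le> L" using beta k d L by auto
    show "0 < c0" using beta by (simp add: c0_def)
    show "c0 \<le> C0" using cC(1,2) beta by linarith
    show "(a \<longlongrightarrow> k * \<beta> / 2) (at_right 0)" "(b' \<longlongrightarrow> \<beta>) (at_right 0)" by (fact alim blim)+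
    fix s :: real assume s: "0 < s"
    show "isCont b s" if "s < L" using b[OF s that] DERIV_isCont by blast
    assume s\<delta>: "s < \<delta>"
    have G: "G \<delta> - D \<le> G s" "G s \<le> G \<delta> + D" using Gbound[of s] s s\<delta> by (auto simp: abs_le_iff)
    have "c0 \<le> exp (G s)" "exp (G s) \<le> C0"
      using cC(3,4) G by (meson exp_le_cancel_iff order_trans)+
    then show "c0 * s powr (k/2) \<le> A s" "A s \<le> C0 * s powr (k/2)"
      using s s\<delta> by (auto simp: Aexp intro!: mult_right_mono)
    have "c0 * s \<le> \<beta> / 2 * s" "2 * \<beta> * s \<le> C0 * s"
      using cC(1,2) s by (intro mult_right_mono; simp)+
    then show "c0 * s \<le> b s" "b s \<le> C0 * s"
      using bb[OF s less_imp_le[OF s\<delta>]] by linarith+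
  qed (use A Apos bpos b d in auto)
  then show ?thesis by blast
qed

section \<open>Calculus and linear algebra\<close>

lemma Ck_on_cong:
  assumes "open S" "S \<subseteq> T" "\<And>x. x \<in> S \<Longrightarrow> F x = f x" "Ck_on k T F"
  shows "Ck_on k S f"
  using assms(3,4)
proof (induction k arbitrary: F f)
  case 0
  then show ?case using assms(2) by (auto intro: continuous_on_eq continuous_on_subset)
next
  case (Suc k)
  have d: "F differentiable (at x)" if "x \<in> S" for x using Suc.prems(2) that assms(2) by auto
  have D: "f differentiable (at x) \<and> frechet_derivative F (at x) = frechet_derivative f (at x)" if x: "x \<in> S" for x
  proof -
    have "(f has_derivative frechet_derivative F (at x)) (at x)"
      using has_derivative_transform_within_open[OF _ assms(1) x, of F] d[OF x] Suc.prems(1)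
      by (auto simp: frechet_derivative_works)
    then show ?thesis by (auto simp: differentiable_def frechet_derivative_at)
  qed
  have "Ck_on k S (\<lambda>x. frechet_derivative f (at x) v)" for v
    by (rule Suc.IH[of "\<lambda>x. frechet_derivative F (at x) v"]) (use Suc.prems D in auto)
  then show ?case using D by simp
qed

lemma smooth_on_imp_Ck_on: "smooth_on S f \<Longrightarrow> open S \<Longrightarrow> Ck_on k S f"
  unfolding smooth_on_def by (blast intro: Ck_on_cong)

lemma locally_holder_on_imp_continuous_on:
  assumes "locally_holder_on \<alpha> S f" "0 < \<alpha>"
  shows "continuous_on S f"
  unfolding continuous_on_def
proof
  fix x assume x: "x \<in> S"
  then obtain r C where r: "r > 0" and C: "\<And>y z. y \<in> S \<inter> ball x r \<Longrightarrow> z \<in> S \<inter> ball x r \<Longrightarrow>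
      dist (f y) (f z) \<le> C * dist y z powr \<alpha>"
    using assms(1) unfolding locally_holder_on_def by meson
  have "((\<lambda>y. dist (f y) (f x)) \<longlongrightarrow> 0) (at x within S)"
  proof (rule Lim_null_comparison)
    have "((\<lambda>y. dist y x) \<longlongrightarrow> dist x x) (at x within S)" by (intro tendsto_intros)
    then have "((\<lambda>y. dist y x powr \<alpha>) \<longlongrightarrow> 0) (at x within S)"
      using assms(2) by (intro tendsto_zero_powrI[where b = \<alpha>]) auto
    then show "((\<lambda>y. C * dist y x powr \<alpha>) \<longlongrightarrow> 0) (at x within S)" by (rule tendsto_mult_right_zero)
    have "norm (dist (f y) (f x)) \<le> C * dist y x powr \<alpha>" if "y \<in> S" "dist y x < r" for y
      using C[of y x] that x r by (auto simp: dist_commute)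
    then show "\<forall>\<^sub>F y in at x within S. norm (dist (f y) (f x)) \<le> C * dist y x powr \<alpha>"
      using r by (auto simp: eventually_at)
  qed
  then show "(f \<longlongrightarrow> f x) (at x within S)" by (rule tendsto_dist_iff[THEN iffD2])
qed

lemma Ck_holder_on_imp_Ck_on: "Ck_holder_on k \<alpha> S f \<Longrightarrow> 0 < \<alpha> \<Longrightarrow> Ck_on k S f"
  by (induction k arbitrary: f) (auto intro: locally_holder_on_imp_continuous_on)

text \<open>The second difference \<Delta> over the parallelogram with sides t v and t w is
  symmetric in v and w. The mean value theorem in direction v reduces it to a difference of first
  derivatives, and differentiability of these at x yields t^2 * Dv w + o(t^2).\<close>

lemma second_derivative_symmetric:
  fixes F :: "'a::real_normed_vector \<Rightarrow> real"
  assumes S: "open S" "x \<in> S" and F: "\<And>y. y \<in> S \<Longrightarrow> (F has_derivative F' y) (at y)"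
    and v: "((\<lambda>y. F' y v) has_derivative Dv) (at x)" and w: "((\<lambda>y. F' y w) has_derivative Dw) (at x)"
  shows "Dv w = Dw v"
proof -
  define \<Delta> where "\<Delta> = (\<lambda>(v, w) t. F (x + t *\<^sub>R v + t *\<^sub>R w) - F (x + t *\<^sub>R v) - F (x + t *\<^sub>R w) + F x)"
  have diff: "\<exists>d>0. \<forall>t. 0 < t \<longrightarrow> t < d \<longrightarrow> \<bar>\<Delta> (v, w) t - t\<^sup>2 * D w\<bar> \<le> e * t\<^sup>2"
    if D: "((\<lambda>y. F' y v) has_derivative D) (at x)" and e: "0 < e" for v w D e
  proof -
    define N where "N = norm v + norm w + 1"
    have N: "0 < N" "norm v \<le> N" "norm v + norm w \<le> N" unfolding N_def using norm_ge_zero[of v] norm_ge_zero[of w] by linarith+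
    have lin: "linear D" using D by (simp add: has_derivative_linear)
    obtain d1 where d1: "0 < d1" "\<And>y. norm (y - x) < d1 \<Longrightarrow> \<bar>F' y v - F' x v - D (y - x)\<bar> \<le> e / (2 * N) * norm (y - x)"
      using D e N unfolding has_derivative_at_alt by (metis divide_pos_pos mult_pos_pos real_norm_def zero_less_numeral)
    obtain r where r: "0 < r" "ball x r \<subseteq> S" using S openE by blast
    define d where "d = min d1 r / N"
    have "\<bar>\<Delta> (v, w) t - t\<^sup>2 * D w\<bar> \<le> e * t\<^sup>2" if t: "0 < t" "t < d" for t
    proof -
      have tN: "t * N < d1" "t * N < r" using t N by (auto simp: d_def pos_less_divide_eq)
      have nb: "norm (s *\<^sub>R v + q *\<^sub>R w) \<le> t * N" if "0 \<le> s" "s \<le> t" "0 \<le> q" "q \<le> t" for s q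
      proof -
        have "norm (s *\<^sub>R v + q *\<^sub>R w) \<le> s * norm v + q * norm w"
          using norm_triangle_ineq[of "s *\<^sub>R v" "q *\<^sub>R w"] that by simp
        also have "\<dots> \<le> t * norm v + t * norm w" using that by (intro add_mono mult_right_mono) auto
        also have "\<dots> \<le> t * N" using N(3) t by (simp add: distrib_left[symmetric])
        finally show ?thesis .
      qed
      have inS: "x + s *\<^sub>R v + q *\<^sub>R w \<in> S" if "0 \<le> s" "s \<le> t" "0 \<le> q" "q \<le> t" for s q
      proof -
        have "dist x (x + s *\<^sub>R v + q *\<^sub>R w) = norm (s *\<^sub>R v + q *\<^sub>R w)"
          unfolding dist_commute[of x] by (simp add: dist_norm add.assoc)
        then show ?thesis using nb[OF that] tN(2) r(2) by auto
      qed
      have gd: "((\<lambda>s. F (x + s *\<^sub>R v + q *\<^sub>R w)) has_real_derivative F' (x + s *\<^sub>R v + q *\<^sub>R w) v) (at s)"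
        if "0 \<le> s" "s \<le> t" "0 \<le> q" "q \<le> t" for s q
      proof -
        have "((\<lambda>s. x + s *\<^sub>R v + q *\<^sub>R w) has_derivative (\<lambda>s. s *\<^sub>R v)) (at s)"
          by (auto intro!: derivative_eq_intros)
        from diff_chain_at[OF this F[OF inS[OF that]]]
        have "((\<lambda>s. F (x + s *\<^sub>R v + q *\<^sub>R w)) has_derivative (\<lambda>c. F' (x + s *\<^sub>R v + q *\<^sub>R w) (c *\<^sub>R v))) (at s)"
          by (simp add: o_def)
        moreover have "F' (x + s *\<^sub>R v + q *\<^sub>R w) (c *\<^sub>R v) = F' (x + s *\<^sub>R v + q *\<^sub>R w) v * c" for c
          using F[OF inS[OF that]] has_derivative_linear linear_cmul by fastforce
        ultimately show ?thesis by (simp add: has_field_derivative_def)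
      qed
      define g where "g = (\<lambda>s. F (x + s *\<^sub>R v + t *\<^sub>R w) - F (x + s *\<^sub>R v + 0 *\<^sub>R w))"
      have "\<exists>z. 0 < z \<and> z < t \<and> g t - g 0 = (t - 0) * (F' (x + z *\<^sub>R v + t *\<^sub>R w) v - F' (x + z *\<^sub>R v + 0 *\<^sub>R w) v)"
        unfolding g_def using t by (intro MVT2 DERIV_diff gd) auto
      then obtain z where z: "0 < z" "z < t" "g t - g 0 = t * (F' (x + z *\<^sub>R v + t *\<^sub>R w) v - F' (x + z *\<^sub>R v) v)"
        by auto
      have est: "\<bar>F' (x + (z *\<^sub>R v + q *\<^sub>R w)) v - F' x v - D (z *\<^sub>R v + q *\<^sub>R w)\<bar> \<le> e / 2 * t" if "0 \<le> q" "q \<le> t" for q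
      proof -
        have n: "norm (z *\<^sub>R v + q *\<^sub>R w) \<le> t * N" using nb that z by simp
        have "\<bar>F' (x + (z *\<^sub>R v + q *\<^sub>R w)) v - F' x v - D (z *\<^sub>R v + q *\<^sub>R w)\<bar> \<le> e / (2 * N) * norm (z *\<^sub>R v + q *\<^sub>R w)"
          using d1(2)[of "x + (z *\<^sub>R v + q *\<^sub>R w)"] n tN(1) by simp
        also have "\<dots> \<le> e / (2 * N) * (t * N)" using n e N by (intro mult_left_mono) auto
        also have "\<dots> = e / 2 * t" using N by simp
        finally show ?thesis .
      qed
      have Dlin: "D (z *\<^sub>R v + t *\<^sub>R w) = D (z *\<^sub>R v) + t * D w"
        using lin by (simp add: linear_add linear_cmul)
      have "\<bar>F' (x + z *\<^sub>R v + t *\<^sub>R w) v - F' (x + z *\<^sub>R v) v - t * D w\<bar> \<le> e * t"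
      proof -
        have "\<bar>F' (x + z *\<^sub>R v + t *\<^sub>R w) v - F' x v - (D (z *\<^sub>R v) + t * D w)\<bar> \<le> e / 2 * t"
          using est[of t] t unfolding Dlin by (simp add: add.assoc)
        moreover have "\<bar>F' (x + z *\<^sub>R v) v - F' x v - D (z *\<^sub>R v)\<bar> \<le> e / 2 * t"
          using est[of 0] t by simp
        moreover have "e * t = e / 2 * t + e / 2 * t" by simp
        ultimately show ?thesis by linarith
      qed
      then have "t * \<bar>F' (x + z *\<^sub>R v + t *\<^sub>R w) v - F' (x + z *\<^sub>R v) v - t * D w\<bar> \<le> t * (e * t)"
        using t by (intro mult_left_mono) auto
      moreover have "\<Delta> (v, w) t - t\<^sup>2 * D w = t * (F' (x + z *\<^sub>R v + t *\<^sub>R w) v - F' (x + z *\<^sub>R v) v - t * D w)"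
        using z(3) by (simp add: \<Delta>_def g_def algebra_simps power2_eq_square)
      ultimately show ?thesis using t by (simp add: abs_mult power2_eq_square mult_ac)
    qed
    moreover have "0 < d" using d1 r N by (simp add: d_def)
    ultimately show ?thesis by blast
  qed
  have sym: "\<Delta> (v, w) t = \<Delta> (w, v) t" for t by (simp add: \<Delta>_def algebra_simps)
  have le: "\<bar>Dv w - Dw v\<bar> \<le> e" if e: "0 < e" for e
  proof -
    obtain d where d: "0 < d" "\<And>t. 0 < t \<Longrightarrow> t < d \<Longrightarrow> \<bar>\<Delta> (v, w) t - t\<^sup>2 * Dv w\<bar> \<le> e / 2 * t\<^sup>2"
      using diff[OF v, of "e/2" w] e by auto
    obtain d' where d': "0 < d'" "\<And>t. 0 < t \<Longrightarrow> t < d' \<Longrightarrow> \<bar>\<Delta> (w, v) t - t\<^sup>2 * Dw v\<bar> \<le> e / 2 * t\<^sup>2"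
      using diff[OF w, of "e/2" v] e by auto
    define t where "t = min d d' / 2"
    have t: "0 < t" "t < d" "t < d'" using d(1) d'(1) by (auto simp: t_def)
    have "\<bar>t\<^sup>2 * Dv w - t\<^sup>2 * Dw v\<bar> \<le> e * t\<^sup>2"
    proof -
      have "e * t\<^sup>2 = e / 2 * t\<^sup>2 + e / 2 * t\<^sup>2" by simp
      then show ?thesis using d(2)[OF t(1,2)] d'(2)[OF t(1,3)] unfolding sym[of t] by linarith
    qed
    then have "t\<^sup>2 * \<bar>Dv w - Dw v\<bar> \<le> t\<^sup>2 * e"
    proof -
      have "t\<^sup>2 * Dv w - t\<^sup>2 * Dw v = t\<^sup>2 * (Dv w - Dw v)" by (simp add: right_diff_distrib)
      then show ?thesis using \<open>\<bar>t\<^sup>2 * Dv w - t\<^sup>2 * Dw v\<bar> \<le> e * t\<^sup>2\<close> by (simp only: abs_mult) (simp add: mult.commute)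
    qed
    then show ?thesis using t by simp
  qed
  show ?thesis
  proof (rule ccontr)
    assume "Dv w \<noteq> Dw v"
    then show False using le[of "\<bar>Dv w - Dw v\<bar> / 2"] by simp
  qed
qed

text \<open>Along the line x + t w the function F is strictly increasing near x. Close to F x the
  profile p is therefore u composed with the local inverse of F along this line, and it inherits
  differentiability from u.\<close>

lemma has_real_derivative_factor_pos:
  fixes F u :: "'a::real_normed_vector \<Rightarrow> real" and p :: "real \<Rightarrow> real"
  assumes V: "open V" "x \<in> V" and F: "\<And>y. y \<in> V \<Longrightarrow> (F has_derivative F' y) (at y)"
    and c: "continuous_on V (\<lambda>y. F' y w)" and pos: "0 < F' x w"
    and u: "(u has_derivative u') (at x)" and uF: "\<And>y. y \<in> V \<Longrightarrow> u y = p (F y)"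
  shows "(p has_real_derivative u' w / F' x w) (at (F x))"
proof -
  define l where "l = (\<lambda>t::real. x + t *\<^sub>R w)"
  have lc: "(l \<longlongrightarrow> x) (nhds 0)" unfolding l_def by (auto intro!: tendsto_eq_intros filterlim_ident)
  have "\<forall>\<^sub>F y in nhds x. y \<in> V \<and> 0 < F' y w"
  proof -
    have "\<forall>\<^sub>F y in nhds x. y \<in> V" using V by (rule eventually_nhds_in_open)
    moreover have "\<forall>\<^sub>F y in nhds x. 0 < F' y w"
    proof -
      have "((\<lambda>y. F' y w) \<longlongrightarrow> F' x w) (nhds x)"
        using c V tendsto_at_iff_tendsto_nhds[of "\<lambda>y. F' y w" x]
        by (auto simp: continuous_on_eq_continuous_at isCont_def)
      then show ?thesis using pos by (rule order_tendstoD(1))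
    qed
    ultimately show ?thesis by (rule eventually_conj)
  qed
  then have "\<forall>\<^sub>F t in nhds 0. l t \<in> V \<and> 0 < F' (l t) w" using lc by (rule eventually_compose_filterlim)
  then obtain \<tau> where tau: "0 < \<tau>" "\<And>t. \<bar>t\<bar> < \<tau> \<Longrightarrow> l t \<in> V \<and> 0 < F' (l t) w"
    by (auto simp: eventually_nhds_metric)
  define h where "h = (\<lambda>t. F (l t))"
  have hd: "(h has_real_derivative F' (l t) w) (at t)" if t: "\<bar>t\<bar> < \<tau>" for t
  proof -
    have "(l has_derivative (\<lambda>s. s *\<^sub>R w)) (at t)" unfolding l_def by (auto intro!: derivative_eq_intros)
    from diff_chain_at[OF this F] tau(2)[OF t]
    have "(h has_derivative (\<lambda>c. F' (l t) (c *\<^sub>R w))) (at t)" by (simp add: o_def h_def)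
    moreover have "F' (l t) (c *\<^sub>R w) = F' (l t) w * c" for c
      using F[of "l t"] tau(2)[OF t] has_derivative_linear linear_cmul by fastforce
    ultimately show ?thesis by (simp add: has_field_derivative_def)
  qed
  have mono: "h s < h t" if "- \<tau> < s" "s < t" "t < \<tau>" for s t
    by (rule DERIV_pos_imp_increasing[OF that(2)]) (use hd tau that in \<open>metis abs_less_iff minus_less_iff order_le_less_trans order_less_le_trans\<close>)
  have inj: "inj_on h {- \<tau><..<\<tau>}" by (rule linorder_inj_onI) (use mono in force)+
  define k where "k = inv_into {- \<tau><..<\<tau>} h"
  have kh: "k (h t) = t" if "t \<in> {- \<tau><..<\<tau>}" for t unfolding k_def using inj that by simp
  have hcont: "continuous_on {- \<tau><..<\<tau>} h"
    by (intro continuous_at_imp_continuous_on ballI DERIV_isCont[OF hd]) auto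
  have "(k has_derivative (\<lambda>s. s / F' x w)) (at (h 0))"
  proof (rule has_derivative_inverse_strong[of "{- \<tau><..<\<tau>}" 0 h k "\<lambda>s. s * F' x w"])
    show "(h has_derivative (\<lambda>s. s * F' x w)) (at 0)"
      using hd[of 0] tau(1) by (simp add: has_field_derivative_def l_def mult.commute[of _ "F' x w"])
    show "(\<lambda>s. s * F' x w) \<circ> (\<lambda>s. s / F' x w) = id" using pos by (auto simp: fun_eq_iff)
  qed (use tau kh hcont in auto)
  then have "((\<lambda>s. u (l (k s))) has_derivative (\<lambda>s. u' ((s / F' x w) *\<^sub>R w))) (at (h 0))"
  proof -
    assume k: "(k has_derivative (\<lambda>s. s / F' x w)) (at (h 0))"
    have "((\<lambda>s. l (k s)) has_derivative (\<lambda>s. (s / F' x w) *\<^sub>R w)) (at (h 0))"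
      unfolding l_def by (rule derivative_eq_intros k refl)+ simp
    moreover have "l (k (h 0)) = x" using kh[of 0] tau(1) by (simp add: l_def)
    ultimately show ?thesis using diff_chain_at[of "\<lambda>s. l (k s)" _ "h 0" u u'] u by (simp add: o_def)
  qed
  moreover have "(\<lambda>s. u' ((s / F' x w) *\<^sub>R w)) = (*) (u' w / F' x w)"
    using linear_cmul[OF has_derivative_linear[OF u], of _ w] by (auto simp: fun_eq_iff)
  ultimately have D1: "((\<lambda>s. u (l (k s))) has_real_derivative u' w / F' x w) (at (h 0))"
    by (simp add: has_field_derivative_def)
  have D2: "u (l (k s)) = p s" if s: "s \<in> {h (- \<tau>/2)<..<h (\<tau>/2)}" for s
  proof -
    have "\<exists>t\<ge>- \<tau>/2. t \<le> \<tau>/2 \<and> h t = s"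
      using s tau(1) by (intro IVT' continuous_on_subset[OF hcont]) auto
    then obtain t where t: "- \<tau>/2 \<le> t" "t \<le> \<tau>/2" "h t = s" by blast
    then have "\<bar>t\<bar> < \<tau>" "- \<tau> < t" "t < \<tau>" using tau(1) by auto
    then have "l t \<in> V" "k s = t" using tau(2) kh[of t] t(3) by auto
    then show ?thesis using uF[of "l t"] t(3) by (simp add: h_def)
  qed
  have D3: "h 0 \<in> {h (- \<tau>/2)<..<h (\<tau>/2)}" using mono[of "- \<tau>/2" 0] mono[of 0 "\<tau>/2"] tau(1) by auto
  have "(p has_real_derivative u' w / F' x w) (at (h 0))"
    by (rule has_field_derivative_transform_within_open[OF D1 open_greaterThanLessThan D3]) (rule D2)
  then show ?thesis by (simp add: h_def l_def)
qed

lemma has_real_derivative_factor: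
  fixes F u :: "'a::real_normed_vector \<Rightarrow> real" and p :: "real \<Rightarrow> real"
  assumes V: "open V" "x \<in> V" and F: "\<And>y. y \<in> V \<Longrightarrow> (F has_derivative F' y) (at y)"
    and c: "continuous_on V (\<lambda>y. F' y w)" and nz: "F' x w \<noteq> 0"
    and u: "(u has_derivative u') (at x)" and uF: "\<And>y. y \<in> V \<Longrightarrow> u y = p (F y)"
  shows "(p has_real_derivative u' w / F' x w) (at (F x))"
proof (cases "0 < F' x w")
  case True
  then show ?thesis using assms by (intro has_real_derivative_factor_pos[of V x F F' w u u' p])
next
  case False
  have F'm: "F' y (- w) = - F' y w" if "y \<in> V" for y
    using F[OF that] has_derivative_linear linear_neg by blast
  have "continuous_on V (\<lambda>y. F' y (- w))"
    using continuous_on_minus[OF c] F'm by (simp cong: continuous_on_cong)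
  moreover have "0 < F' x (- w)" using False nz F'm V by simp
  ultimately have "(p has_real_derivative u' (- w) / F' x (- w)) (at (F x))"
    using assms by (intro has_real_derivative_factor_pos[of V x F F' "- w" u u' p])
  moreover have "u' (- w) = - u' w" using u has_derivative_linear linear_neg by blast
  ultimately show ?thesis using F'm V by simp
qed

section \<open>Positive definite matrices and the trace of a projection\<close>

definition spd :: "real ^ 'n ^ 'n \<Rightarrow> bool" where
  "spd G \<longleftrightarrow> transpose G = G \<and> (\<forall>v. v \<noteq> 0 \<longrightarrow> 0 < v \<bullet> (G *v v))"

lemma spd_commute: "spd G \<Longrightarrow> v \<bullet> (G *v w) = w \<bullet> (G *v v)"
  unfolding spd_def by (metis dot_lmul_matrix inner_commute transpose_matrix_vector)

lemma spd_nonneg: "spd G \<Longrightarrow> 0 \<le> v \<bullet> (G *v v)"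
  unfolding spd_def by (cases "v = 0") (auto simp: less_imp_le)

lemma spd_invertible:
  fixes G :: "real ^ 'n ^ 'n"
  assumes "spd G" shows "invertible G"
proof -
  have "x = 0" if "G *v x = 0" for x
    using assms that unfolding spd_def by (metis inner_zero_right less_irrefl)
  then show ?thesis
    using invertible_left_inverse matrix_left_invertible_ker by blast
qed

lemma spd_det: "spd (G :: real ^ 'n ^ 'n) \<Longrightarrow> det G \<noteq> 0"
  using spd_invertible invertible_det_nz by blast

lemma matrix_inv_cancel:
  fixes G :: "real ^ 'n ^ 'n"
  assumes "invertible G" shows "G ** matrix_inv G = mat 1" "matrix_inv G ** G = mat 1"
proof -
  have "G ** matrix_inv G = mat 1 \<and> matrix_inv G ** G = mat 1"
    unfolding matrix_inv_def by (rule someI_ex) (use assms in \<open>simp add: invertible_def\<close>)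
  then show "G ** matrix_inv G = mat 1" "matrix_inv G ** G = mat 1" by auto
qed

lemma spd_cauchy_schwarz:
  assumes "spd G" shows "(v \<bullet> (G *v w))\<^sup>2 \<le> (v \<bullet> (G *v v)) * (w \<bullet> (G *v w))"
proof (cases "w = 0")
  case False
  define c where "c = w \<bullet> (G *v w)"
  have c: "0 < c" using assms False by (simp add: spd_def c_def)
  define e where "e = v \<bullet> (G *v w)"
  have "0 \<le> (v - (e / c) *\<^sub>R w) \<bullet> (G *v (v - (e / c) *\<^sub>R w))" using spd_nonneg[OF assms] .
  also have "\<dots> = v \<bullet> (G *v v) - 2 * (e / c) * e + (e / c)\<^sup>2 * c"
    using spd_commute[OF assms, of w v]
    by (simp add: matrix_vector_mult_diff_distrib matrix_vector_mult_scaleR inner_diff_left inner_diff_right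
        c_def[symmetric] e_def[symmetric] power2_eq_square algebra_simps)
  also have "\<dots> = v \<bullet> (G *v v) - e\<^sup>2 / c" using c by (simp add: power2_eq_square field_simps)
  finally show ?thesis using c by (simp add: e_def c_def pos_divide_le_eq)
qed simp

lemma trace_orthonormal:
  fixes P :: "real ^ 'n ^ 'n"
  assumes B: "finite B" "pairwise orthogonal B" "\<And>b. b \<in> B \<Longrightarrow> norm b = 1" "span B = UNIV"
  shows "trace P = (\<Sum>b\<in>B. b \<bullet> (P *v b))"
proof -
  have "trace P = (\<Sum>i\<in>UNIV. axis i 1 \<bullet> (P *v axis i 1))"
    by (simp add: trace_def inner_axis' matrix_vector_mult_basis column_def)
  also have "\<dots> = (\<Sum>i\<in>UNIV. \<Sum>b\<in>B. (b $ i) * ((P *v b) $ i))"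
  proof (rule sum.cong[OF refl])
    fix i :: 'n
    have e: "axis i 1 = (\<Sum>b\<in>B. (axis i 1 \<bullet> b) *\<^sub>R b)"
      using orthonormal_basis_expand[OF B(2,3) _ B(1), of "axis i 1"] B(4) by simp
    have "axis i 1 \<bullet> (P *v axis i 1) = axis i 1 \<bullet> (P *v (\<Sum>b\<in>B. (axis i 1 \<bullet> b) *\<^sub>R b))"
      using e by simp
    also have "\<dots> = (\<Sum>b\<in>B. (axis i 1 \<bullet> b) * (axis i 1 \<bullet> (P *v b)))"
      by (simp add: linear_sum[OF matrix_vector_mul_linear] matrix_vector_mult_scaleR inner_sum_right)
    finally show "axis i 1 \<bullet> (P *v axis i 1) = (\<Sum>b\<in>B. (b $ i) * ((P *v b) $ i))"
      by (simp add: inner_axis')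
  qed
  also have "\<dots> = (\<Sum>b\<in>B. b \<bullet> (P *v b))"
    by (subst sum.swap) (simp add: inner_vec_def)
  finally show ?thesis .
qed

text \<open>In an orthonormal basis adapted to the kernel of P and its orthogonal complement, kernel
  vectors contribute 0. A vector b of the complement contributes 1, because P b - b lies in the
  kernel. P is in general not a symmetric matrix here: the Hessian is symmetric only with respect to
  the metric.\<close>

lemma trace_idempotent:
  fixes P :: "real ^ 'n ^ 'n"
  assumes "P ** P = P"
  shows "trace P + real (dim {v. P *v v = 0}) = real CARD('n)"
proof -
  define K where "K = {v. P *v v = 0}"
  define K' where "K' = {y \<in> UNIV. \<forall>x\<in>K. orthogonal x y}"
  have K: "subspace K"
    unfolding K_def by (auto simp: subspace_def matrix_vector_right_distrib matrix_vector_mult_scaleR)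
  have K': "subspace K'"
    by (auto simp: K'_def subspace_def orthogonal_def inner_add_right)
  have d: "dim K' + dim K = CARD('n)"
    using dim_subspace_orthogonal_to_vectors[OF K subspace_UNIV] by (simp add: K'_def)
  obtain B1 where B1: "B1 \<subseteq> K" "pairwise orthogonal B1" "\<And>x. x \<in> B1 \<Longrightarrow> norm x = 1"
    "independent B1" "card B1 = dim K" "span B1 = K" using orthonormal_basis_subspace[OF K] by blast
  obtain B2 where B2: "B2 \<subseteq> K'" "pairwise orthogonal B2" "\<And>x. x \<in> B2 \<Longrightarrow> norm x = 1"
    "independent B2" "card B2 = dim K'" "span B2 = K'" using orthonormal_basis_subspace[OF K'] by blast
  have orth: "orthogonal x y" if "x \<in> B1" "y \<in> B2" for x y using B1(1) B2(1) that by (auto simp: K'_def)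
  have disj: "B1 \<inter> B2 = {}"
    using orth B1(3) by (metis disjoint_iff norm_zero orthogonal_self zero_neq_one)
  have fin: "finite B1" "finite B2" using B1(4) B2(4) independent_imp_finite by auto
  have pw: "pairwise orthogonal (B1 \<union> B2)"
    using B1(2) B2(2) orth orth[THEN orthogonal_commute[THEN iffD1]] by (auto simp: pairwise_def)
  have n1: "norm x = 1" if "x \<in> B1 \<union> B2" for x using that B1(3) B2(3) by auto
  have "0 \<notin> B1 \<union> B2" using n1 by fastforce
  then have "independent (B1 \<union> B2)" using pairwise_orthogonal_independent[OF pw] by blast
  moreover have "card (B1 \<union> B2) = CARD('n)" using card_Un_disjoint[OF fin disj] B1(5) B2(5) d by simp
  ultimately have sp: "span (B1 \<union> B2) = UNIV"
    using card_ge_dim_independent[of "B1 \<union> B2" UNIV] by auto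
  have "trace P = (\<Sum>b\<in>B1 \<union> B2. b \<bullet> (P *v b))"
    using fin by (intro trace_orthonormal pw n1 sp) auto
  also have "\<dots> = (\<Sum>b\<in>B1. b \<bullet> (P *v b)) + (\<Sum>b\<in>B2. b \<bullet> (P *v b))"
    by (rule sum.union_disjoint[OF fin disj])
  also have "(\<Sum>b\<in>B1. b \<bullet> (P *v b)) = 0" using B1(1) by (intro sum.neutral) (auto simp: K_def)
  also have "(\<Sum>b\<in>B2. b \<bullet> (P *v b)) = (\<Sum>b\<in>B2. 1)"
  proof (rule sum.cong[OF refl])
    fix b assume b: "b \<in> B2"
    have "P *v (P *v b - b) = 0"
      using assms by (simp add: matrix_vector_mult_diff_distrib matrix_vector_mul_assoc)
    then have "b \<bullet> (P *v b - b) = 0" using b B2(1) by (auto simp: K'_def K_def orthogonal_def inner_commute)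
    then have "b \<bullet> (P *v b) = b \<bullet> b" by (simp add: inner_diff_right)
    then show "b \<bullet> (P *v b) = 1" using B2(3)[OF b] by (simp add: norm_eq_1)
  qed
  finally have "trace P = real (dim K')" using B2(5) by simp
  then show ?thesis using d by (simp add: K_def[symmetric])
qed

section \<open>Gradients in coordinates\<close>

lemma frechet_derivative_partials:
  fixes F :: "real ^ 'n \<Rightarrow> real"
  assumes "F differentiable (at x)"
  shows "frechet_derivative F (at x) w = (\<chi> j. partial_deriv j F x) \<bullet> w"
proof -
  have lin: "linear (frechet_derivative F (at x))" using assms linear_frechet_derivative by blast
  have "frechet_derivative F (at x) (\<Sum>i\<in>UNIV. (w $ i) *s axis i 1) = (\<Sum>i\<in>UNIV. (w $ i) * partial_deriv i F x)"
    using lin by (simp add: linear_sum linear_cmul partial_deriv_def scalar_mult_eq_scaleR)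
  then show ?thesis by (simp add: basis_expansion inner_vec_def mult.commute)
qed

text \<open>The gradient as the metric dual of the differential. Together with the uniqueness in
  \<open>coord_gradient_eqI\<close> it takes the place of calculations with the inverse
  matrix.\<close>

lemma coord_gradient_inner:
  fixes F :: "real ^ 'n \<Rightarrow> real"
  assumes "F differentiable (at x)" "spd (G x)"
  shows "w \<bullet> (G x *v coord_gradient G F x) = frechet_derivative F (at x) w"
proof -
  have "G x *v coord_gradient G F x = (\<chi> j. partial_deriv j F x)"
    using matrix_inv_cancel(1)[OF spd_invertible[OF assms(2)]]
    by (simp add: coord_gradient_def matrix_vector_mul_assoc)
  then show ?thesis using frechet_derivative_partials[OF assms(1)] by (simp add: inner_commute)
qed

lemma spd_inner_eqI:
  fixes G :: "real ^ 'n ^ 'n"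
  assumes "spd G" "\<And>w. w \<bullet> (G *v X) = w \<bullet> (G *v Y)" shows "X = Y"
proof -
  have "(X - Y) \<bullet> (G *v (X - Y)) = 0"
    using assms(2)[of "X - Y"] by (simp add: matrix_vector_mult_diff_distrib inner_diff_right)
  then show ?thesis using assms(1) unfolding spd_def by (metis eq_iff_diff_eq_0 less_irrefl)
qed

lemma coord_gradient_eqI:
  fixes F :: "real ^ 'n \<Rightarrow> real"
  assumes "F differentiable (at x)" "spd (G x)" "\<And>w. w \<bullet> (G x *v X) = frechet_derivative F (at x) w"
  shows "coord_gradient G F x = X"
  using assms(3) coord_gradient_inner[of F x G, OF assms(1,2)] by (intro spd_inner_eqI[of "G x", OF assms(2)]) simp

lemma differentiable_prod_real:
  fixes f :: "'i \<Rightarrow> 'a::real_normed_vector \<Rightarrow> real"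
  assumes "\<And>i. i \<in> I \<Longrightarrow> f i differentiable (at x)"
  shows "(\<lambda>x. \<Prod>i\<in>I. f i x) differentiable (at x)"
  using assms by (induction I rule: infinite_finite_induct) auto

lemma differentiable_det:
  fixes M :: "'a::real_normed_vector \<Rightarrow> real ^ 'n ^ 'n"
  assumes "\<And>i j. (\<lambda>x. M x $ i $ j) differentiable (at x)"
  shows "(\<lambda>x. det (M x)) differentiable (at x)"
  unfolding det_def
  using assms by (intro differentiable_sum) (auto intro!: differentiable_mult differentiable_prod_real)

lemma differentiable_vec_nth:
  fixes M :: "'a::real_normed_vector \<Rightarrow> ('b::real_normed_vector) ^ 'n"
  assumes "M differentiable (at x)" shows "(\<lambda>x. M x $ i) differentiable (at x)"
  using assms bounded_linear.has_derivative[OF bounded_linear_vec_nth] unfolding differentiable_def by blast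

lemma differentiable_vecI:
  fixes X :: "'a::real_normed_vector \<Rightarrow> real ^ 'n"
  assumes "\<And>i. (\<lambda>x. X x $ i) differentiable (at x)" shows "X differentiable (at x)"
proof -
  obtain D where D: "\<And>i. ((\<lambda>x. X x $ i) has_derivative D i) (at x)"
    using assms unfolding differentiable_def by metis
  have "(X has_derivative (\<lambda>h. \<chi> i. D i h)) (at x)"
    unfolding has_derivative_componentwise_within[of X]
    using D by (auto simp: Basis_vec_def inner_axis)
  then show ?thesis by (auto simp: differentiable_def)
qed

text \<open>Cramer's rule writes each component as a quotient of determinants, so the inverse matrix
  itself is never differentiated.\<close>

lemma differentiable_coord_gradient:
  fixes F :: "real ^ 'n \<Rightarrow> real"
  assumes V: "open V" "x \<in> V" and G: "G differentiable (at x)" and spd: "\<And>y. y \<in> V \<Longrightarrow> spd (G y)"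
    and F: "\<And>j. (\<lambda>y. partial_deriv j F y) differentiable (at x)"
  shows "coord_gradient G F differentiable (at x)"
proof (rule differentiable_vecI)
  fix k
  let ?M = "\<lambda>y. (\<chi> i j. if j = k then partial_deriv i F y else G y $ i $ j) :: real ^ 'n ^ 'n"
  have Gij: "(\<lambda>y. G y $ i $ j) differentiable (at x)" for i j
    by (intro differentiable_vec_nth G)
  have "(\<lambda>y. det (?M y) / det (G y)) differentiable (at x)"
  proof (intro differentiable_divide differentiable_det)
    show "det (G x) \<noteq> 0" using spd_det[OF spd[OF V(2)]] .
    show "(\<lambda>y. ?M y $ i $ j) differentiable (at x)" for i j
      using F Gij by (cases "j = k") auto
  qed (rule Gij)
  moreover have "det (?M y) / det (G y) = coord_gradient G F y $ k" if "y \<in> V" for y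
  proof -
    have "G y *v coord_gradient G F y = (\<chi> j. partial_deriv j F y)"
      using matrix_inv_cancel(1)[OF spd_invertible[OF spd[OF that]]]
      by (simp add: coord_gradient_def matrix_vector_mul_assoc)
    then show ?thesis using cramer[OF spd_det[OF spd[OF that]]] by (simp cong: if_cong)
  qed
  ultimately show "(\<lambda>y. coord_gradient G F y $ k) differentiable (at x)"
    using V unfolding differentiable_def
    by (metis (no_types, lifting) has_derivative_transform_within_open)
qed

lemma has_vector_derivative_chain:
  assumes f: "(f has_vector_derivative D) (at t within S)" and F: "(F has_derivative J) (at (f t))"
  shows "((\<lambda>t. F (f t)) has_vector_derivative J D) (at t within S)"
  using vector_derivative_diff_chain_within[OF f has_derivative_at_withinI[OF F]] by (simp add: o_def)

section \<open>Charts, curves and the Riemannian distance\<close>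

context smooth_manifold
begin

lemma chart_open:
  assumes "c \<in> A" shows "open (fst c)" "open (snd c ` fst c)"
  using charts[OF assms] by (auto simp: is_chart_def)

lemma chart_continuous:
  assumes "c \<in> A" shows "continuous_on (fst c) (snd c)" "continuous_on (snd c ` fst c) (chart_inv c)"
  using charts[OF assms] by (auto simp: is_chart_def homeomorphism_def)

lemma chart_inv_left: "c \<in> A \<Longrightarrow> p \<in> fst c \<Longrightarrow> chart_inv c (snd c p) = p"
  using charts by (auto simp: is_chart_def homeomorphism_def)

lemma chart_inv_right:
  assumes "c \<in> A" "x \<in> snd c ` fst c" shows "chart_inv c x \<in> fst c" "snd c (chart_inv c x) = x"
  using charts[OF assms(1)] assms(2) by (auto simp: is_chart_def homeomorphism_def)

lemma chart_at: "chart_at A p \<in> A" "p \<in> fst (chart_at A p)"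
proof -
  have "\<exists>c. c \<in> A \<and> p \<in> fst c" using cover by (metis UNIV_I UnionE imageE)
  then have "chart_at A p \<in> A \<and> p \<in> fst (chart_at A p)"
    unfolding chart_at_def by (rule someI_ex)
  then show "chart_at A p \<in> A" "p \<in> fst (chart_at A p)" by auto
qed

lemma open_chart_image:
  assumes "c \<in> A" "open S" "S \<subseteq> fst c" shows "open (snd c ` S)"
proof -
  have "snd c ` S = (snd c ` fst c) \<inter> chart_inv c -` S"
    using assms chart_inv_left[OF assms(1)] chart_inv_right[OF assms(1)] by (force simp: image_iff)
  then show ?thesis
    using continuous_open_preimage[OF chart_continuous(2)[OF assms(1)] chart_open(2)[OF assms(1)] assms(2)] by simp
qed

lemma open_overlap: "c \<in> A \<Longrightarrow> c' \<in> A \<Longrightarrow> open (snd c ` (fst c \<inter> fst c'))"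
  by (intro open_chart_image) (auto intro: chart_open)

lemma transition_Ck: "c \<in> A \<Longrightarrow> c' \<in> A \<Longrightarrow> Ck_on k (snd c ` (fst c \<inter> fst c')) (snd c' \<circ> chart_inv c)"
  using compatible[of c c'] open_overlap[of c c'] unfolding compatible_charts_def
  by (blast intro: smooth_on_imp_Ck_on)

lemma transition_derivative:
  assumes "c \<in> A" "c' \<in> A" "p \<in> fst c" "p \<in> fst c'"
  shows "((snd c' \<circ> chart_inv c) has_derivative frechet_derivative (snd c' \<circ> chart_inv c) (at (snd c p))) (at (snd c p))"
  using transition_Ck[OF assms(1,2), of "Suc 0"] assms(3,4) by (auto simp: frechet_derivative_works)

lemma transition_inverse:
  assumes "c \<in> A" "c' \<in> A" "p \<in> fst c" "p \<in> fst c'"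
  shows "frechet_derivative (snd c' \<circ> chart_inv c) (at (snd c p))
           (frechet_derivative (snd c \<circ> chart_inv c') (at (snd c' p)) w) = w"
proof -
  have "((snd c' \<circ> chart_inv c) has_derivative frechet_derivative (snd c' \<circ> chart_inv c) (at (snd c p)))
      (at ((snd c \<circ> chart_inv c') (snd c' p)))"
    using transition_derivative[OF assms] chart_inv_left[OF assms(2,4)] by simp
  from diff_chain_at[OF transition_derivative[OF assms(2,1,4,3)] this]
  have "(((snd c' \<circ> chart_inv c) \<circ> (snd c \<circ> chart_inv c')) has_derivative
     (frechet_derivative (snd c' \<circ> chart_inv c) (at (snd c p)) \<circ> frechet_derivative (snd c \<circ> chart_inv c') (at (snd c' p)))) (at (snd c' p))" .
  then have "((\<lambda>x. x) has_derivative
     (frechet_derivative (snd c' \<circ> chart_inv c) (at (snd c p)) \<circ> frechet_derivative (snd c \<circ> chart_inv c') (at (snd c' p)))) (at (snd c' p))"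
    by (rule has_derivative_transform_within_open[OF _ open_overlap[OF assms(2,1)]])
      (use assms chart_inv_left[OF assms(1)] chart_inv_left[OF assms(2)] in auto)
  then show ?thesis using has_derivative_unique[OF has_derivative_ident] by (metis comp_apply)
qed

lemma change_chart_function:
  assumes "c \<in> A" "c' \<in> A" "p \<in> fst c" "p \<in> fst c'" and d: "(u \<circ> chart_inv c') differentiable (at (snd c' p))"
  shows "(u \<circ> chart_inv c) differentiable (at (snd c p))"
    "frechet_derivative (u \<circ> chart_inv c) (at (snd c p)) w =
       frechet_derivative (u \<circ> chart_inv c') (at (snd c' p)) (frechet_derivative (snd c' \<circ> chart_inv c) (at (snd c p)) w)"
proof -
  have "((u \<circ> chart_inv c') has_derivative frechet_derivative (u \<circ> chart_inv c') (at (snd c' p)))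
      (at ((snd c' \<circ> chart_inv c) (snd c p)))"
    using d chart_inv_left[OF assms(1,3)] by (simp add: frechet_derivative_works)
  from diff_chain_at[OF transition_derivative[OF assms(1-4)] this]
  have D: "((u \<circ> chart_inv c) has_derivative (frechet_derivative (u \<circ> chart_inv c') (at (snd c' p)) \<circ>
      frechet_derivative (snd c' \<circ> chart_inv c) (at (snd c p)))) (at (snd c p))"
    by (rule has_derivative_transform_within_open[OF _ open_overlap[OF assms(1,2)]])
      (use assms chart_inv_left[OF assms(1)] chart_inv_left[OF assms(2)] in auto)
  show "(u \<circ> chart_inv c) differentiable (at (snd c p))" using D by (auto simp: differentiable_def)
  show "frechet_derivative (u \<circ> chart_inv c) (at (snd c p)) w =
       frechet_derivative (u \<circ> chart_inv c') (at (snd c' p)) (frechet_derivative (snd c' \<circ> chart_inv c) (at (snd c p)) w)"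
    using frechet_derivative_at[OF D] by (metis comp_apply)
qed

end

section \<open>The metric norm and independence of the chart\<close>

context riemannian_manifold
begin

lemma metric_spd: "c \<in> A \<Longrightarrow> x \<in> snd c ` fst c \<Longrightarrow> spd (g c x)"
  using metric_sym metric_pos by (auto simp: spd_def)

lemma metric_differentiable: "c \<in> A \<Longrightarrow> x \<in> snd c ` fst c \<Longrightarrow> g c differentiable (at x)"
  using smooth_on_imp_Ck_on[OF metric_smooth chart_open(2), of c "Suc 0"] by auto

lemma metric_continuous: "c \<in> A \<Longrightarrow> continuous_on (snd c ` fst c) (g c)"
  using smooth_on_imp_Ck_on[OF metric_smooth chart_open(2), of c 0] by auto

definition mnorm :: "('m, 'n) chart \<Rightarrow> real ^ 'n \<Rightarrow> real ^ 'n \<Rightarrow> real" where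
  "mnorm c x v = sqrt (v \<bullet> (g c x *v v))"

lemma mnorm_nonneg: "c \<in> A \<Longrightarrow> x \<in> snd c ` fst c \<Longrightarrow> 0 \<le> mnorm c x v"
  unfolding mnorm_def using spd_nonneg[OF metric_spd] by simp

lemma mnorm_scaleR: "mnorm c x (r *\<^sub>R v) = \<bar>r\<bar> * mnorm c x v"
proof -
  have "(r *\<^sub>R v) \<bullet> (g c x *v (r *\<^sub>R v)) = r\<^sup>2 * (v \<bullet> (g c x *v v))"
    by (simp add: matrix_vector_mult_scaleR power2_eq_square)
  then show ?thesis by (simp add: mnorm_def real_sqrt_mult)
qed

lemma mnorm_continuous:
  fixes x v :: "'t::topological_space \<Rightarrow> real ^ 'n"
  assumes "c \<in> A" "continuous_on S x" "continuous_on S v" "x ` S \<subseteq> snd c ` fst c"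
  shows "continuous_on S (\<lambda>t. mnorm c (x t) (v t))"
proof -
  have "continuous_on S (\<lambda>t. g c (x t))"
    using continuous_on_compose2[OF metric_continuous[OF assms(1)] assms(2,4)] .
  then have "continuous_on S (\<lambda>t. v t \<bullet> (g c (x t) *v v t))"
    unfolding matrix_vector_mult_def inner_vec_def
    by (intro continuous_intros assms(3)) 
  then show ?thesis unfolding mnorm_def by (rule continuous_on_real_sqrt)
qed

lemma mnorm_change_chart:
  assumes "c \<in> A" "c' \<in> A" "p \<in> fst c" "p \<in> fst c'"
  shows "mnorm c' (snd c' p) (frechet_derivative (snd c' \<circ> chart_inv c) (at (snd c p)) v) = mnorm c (snd c p) v"
  unfolding mnorm_def using metric_transform[OF assms(1,2) _ refl, of p v v] assms(3,4) by simp

lemma differential_le_mnorm: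
  assumes c: "c \<in> A" "x \<in> snd c ` fst c" and d: "F differentiable (at x)"
  shows "\<bar>frechet_derivative F (at x) v\<bar> \<le>
    sqrt (coord_gradient (g c) F x \<bullet> (g c x *v coord_gradient (g c) F x)) * mnorm c x v"
proof -
  have "(frechet_derivative F (at x) v)\<^sup>2 \<le> (v \<bullet> (g c x *v v)) * (coord_gradient (g c) F x \<bullet> (g c x *v coord_gradient (g c) F x))"
    using spd_cauchy_schwarz[OF metric_spd[OF c]] coord_gradient_inner[of F x "g c" v, OF d metric_spd[OF c]] by metis
  then have "sqrt ((frechet_derivative F (at x) v)\<^sup>2) \<le>
      sqrt ((v \<bullet> (g c x *v v)) * (coord_gradient (g c) F x \<bullet> (g c x *v coord_gradient (g c) F x)))"
    by (rule real_sqrt_le_mono)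
  then show ?thesis by (simp add: mnorm_def real_sqrt_mult mult.commute)
qed

text \<open>\<open>gradient_norm_sq\<close> is computed in one chosen chart; this frees it from the
  choice. The derivative of the transition map carries one coordinate gradient to the other, since
  both are dual to the same differential.\<close>

lemma gradient_norm_sq_chart:
  assumes c: "c \<in> A" "p \<in> fst c" and d: "(u \<circ> chart_inv c) differentiable (at (snd c p))"
  defines "X \<equiv> coord_gradient (g c) (u \<circ> chart_inv c) (snd c p)"
  shows "gradient_norm_sq A g u p = X \<bullet> (g c (snd c p) *v X)"
proof -
  define c' where "c' = chart_at A p"
  have c': "c' \<in> A" "p \<in> fst c'" using chart_at by (auto simp: c'_def)
  define J where "J = frechet_derivative (snd c' \<circ> chart_inv c) (at (snd c p))"
  have x: "snd c p \<in> snd c ` fst c" "snd c' p \<in> snd c' ` fst c'" using c c' by auto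
  have d': "(u \<circ> chart_inv c') differentiable (at (snd c' p))"
    by (rule change_chart_function(1)[OF c'(1) c(1) c'(2) c(2) d])
  have "coord_gradient (g c') (u \<circ> chart_inv c') (snd c' p) = J X"
  proof (rule coord_gradient_eqI[where G = "g c'" and x = "snd c' p" and F = "u \<circ> chart_inv c'", OF d' metric_spd[OF c'(1) x(2)]])
    fix w
    define w0 where "w0 = frechet_derivative (snd c \<circ> chart_inv c') (at (snd c' p)) w"
    have w: "w = J w0" unfolding J_def w0_def by (rule transition_inverse[OF c(1) c'(1) c(2) c'(2), symmetric])
    have "w \<bullet> (g c' (snd c' p) *v J X) = w0 \<bullet> (g c (snd c p) *v X)"
      using metric_transform[OF c(1) c'(1) _ refl, of p w0 X] c c' by (simp add: w J_def)
    also have "\<dots> = frechet_derivative (u \<circ> chart_inv c) (at (snd c p)) w0"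
      unfolding X_def by (rule coord_gradient_inner[where G = "g c" and x = "snd c p", OF d metric_spd[OF c(1) x(1)]])
    also have "\<dots> = frechet_derivative (u \<circ> chart_inv c') (at (snd c' p)) w"
      unfolding w J_def by (rule change_chart_function(2)[OF c(1) c'(1) c(2) c'(2) d'])
    finally show "w \<bullet> (g c' (snd c' p) *v J X) = frechet_derivative (u \<circ> chart_inv c') (at (snd c' p)) w" .
  qed
  moreover have "J X \<bullet> (g c' (snd c' p) *v J X) = X \<bullet> (g c (snd c p) *v X)"
    using metric_transform[OF c(1) c'(1) _ refl, of p X X] c c' by (simp add: J_def)
  ultimately show ?thesis by (simp add: gradient_norm_sq_def Let_def c'_def[symmetric])
qed

text \<open>The chart used by \<open>curve_speed\<close> may jump with t. Continuity of the speed
  becomes visible only after passing to one chart that is kept fixed near a parameter.\<close>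

lemma curve_speed_chart:
  assumes c: "c \<in> A" "\<gamma> t \<in> fst c" and cont: "isCont \<gamma> t"
    and d: "((snd c \<circ> \<gamma>) has_vector_derivative D) (at t)"
  shows "curve_speed A g \<gamma> t = mnorm c (snd c (\<gamma> t)) D"
proof -
  define c' where "c' = chart_at A (\<gamma> t)"
  have c': "c' \<in> A" "\<gamma> t \<in> fst c'" using chart_at by (auto simp: c'_def)
  define J where "J = frechet_derivative (snd c' \<circ> chart_inv c) (at (snd c (\<gamma> t)))"
  have J: "((snd c' \<circ> chart_inv c) has_derivative J) (at ((snd c \<circ> \<gamma>) t))"
    using transition_derivative[OF c(1) c'(1) c(2) c'(2)] by (simp add: J_def)
  have *: "((\<lambda>t. (snd c' \<circ> chart_inv c) ((snd c \<circ> \<gamma>) t)) has_vector_derivative J D) (at t)"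
    by (rule has_vector_derivative_chain[OF d J])
  have "\<forall>\<^sub>F s in nhds t. \<gamma> s \<in> fst c"
    using cont tendsto_at_iff_tendsto_nhds[of \<gamma> t] chart_open(1)[OF c(1)] c(2)
    by (auto simp: isCont_def intro: topological_tendstoD)
  then obtain T where T: "open T" "t \<in> T" "\<And>s. s \<in> T \<Longrightarrow> \<gamma> s \<in> fst c" by (auto simp: eventually_nhds)
  have "((snd c' \<circ> \<gamma>) has_vector_derivative J D) (at t)"
    by (rule has_vector_derivative_transform_within_open[OF * T(1,2)]) (use T chart_inv_left[OF c(1)] in auto)
  then have "vector_derivative (snd c' \<circ> \<gamma>) (at t) = J D" by (rule vector_derivative_at)
  then show ?thesis
    unfolding curve_speed_def Let_def c'_def[symmetric] mnorm_change_chart[OF c(1) c'(1) c(2) c'(2), symmetric]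
    by (simp add: mnorm_def J_def)
qed

end

text \<open>The one-sided intervals next to t avoid the break points even when t is itself one; on
  both sides together this holds off the break points. Open intervals match the form in which
  piecewise C^1 curves are defined.\<close>

lemma finite_gap:
  fixes t :: real
  assumes "finite T"
  obtains d where "0 < d" "\<And>u v. t - d \<le> u \<Longrightarrow> v \<le> t \<Longrightarrow> {u<..<v} \<inter> T = {}"
    "\<And>u v. t \<le> u \<Longrightarrow> v \<le> t + d \<Longrightarrow> {u<..<v} \<inter> T = {}"
    "t \<notin> T \<Longrightarrow> {t - d<..<t + d} \<inter> T = {}"
proof -
  obtain d where d: "0 < d" "\<And>x. x \<in> T \<Longrightarrow> x \<noteq> t \<Longrightarrow> d \<le> dist t x"
    using finite_set_avoid[OF assms, of t] by blast
  have *: "x = t \<or> x \<le> t - d \<or> t + d \<le> x" if "x \<in> T" for x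
    using d(2)[OF that] by (auto simp: dist_real_def abs_if split: if_splits)
  show ?thesis
  proof (rule that[OF d(1)])
    show "{u<..<v} \<inter> T = {}" if "t - d \<le> u" "v \<le> t" for u v using that d(1) by (force dest: *)
    show "{u<..<v} \<inter> T = {}" if "t \<le> u" "v \<le> t + d" for u v using that d(1) by (force dest: *)
    show "{t - d<..<t + d} \<inter> T = {}" if "t \<notin> T" using that * by fastforce
  qed
qed

section \<open>Lengths of piecewise C^1 curves\<close>

context riemannian_manifold
begin

lemma curve_speed_nonneg: "0 \<le> curve_speed A g \<gamma> t"
proof -
  have "snd (chart_at A (\<gamma> t)) (\<gamma> t) \<in> snd (chart_at A (\<gamma> t)) ` fst (chart_at A (\<gamma> t))"
    using chart_at(2) by blast
  from spd_nonneg[OF metric_spd[OF chart_at(1) this]] show ?thesis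
    unfolding curve_speed_def Let_def by simp
qed

text \<open>Valid for arbitrary maps: a speed that is not integrable has integral 0 by
  convention.\<close>

lemma curve_length_nonneg: "0 \<le> curve_length A g \<gamma>"
  unfolding curve_length_def using curve_speed_nonneg
  by (cases "curve_speed A g \<gamma> integrable_on {0..1}") (auto simp: integral_nonneg not_integrable_integral)

lemma C1_curve_interior:
  assumes "C1_curve_on A a b \<gamma>" "a < t" "t < b"
  shows "isCont \<gamma> t" "c \<in> A \<Longrightarrow> \<gamma> t \<in> fst c \<Longrightarrow> \<exists>D. ((snd c \<circ> \<gamma>) has_vector_derivative D) (at t)"
proof -
  have at: "at t within {a..b} = at t" using assms by (simp add: at_within_Icc_at)
  have "continuous_on {a..b} \<gamma>" using assms(1) by (simp add: C1_curve_on_def)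
  then show "isCont \<gamma> t" using assms(2,3) continuous_on_interior by fastforce
  assume c: "c \<in> A" "\<gamma> t \<in> fst c"
  then obtain D where "\<forall>t\<in>{a..b}. \<gamma> t \<in> fst c \<longrightarrow> ((snd c \<circ> \<gamma>) has_vector_derivative D t) (at t within {a..b})"
    using assms(1) unfolding C1_curve_on_def by blast
  then have "((snd c \<circ> \<gamma>) has_vector_derivative D t) (at t within {a..b})" using assms(2,3) c(2) by simp
  then show "\<exists>D. ((snd c \<circ> \<gamma>) has_vector_derivative D) (at t)" unfolding at by blast
qed

text \<open>Integrability is local. Near each parameter the curve stays in one chart, and there the
  speed agrees with a continuous function.\<close>

lemma C1_curve_speed_integrable:
  assumes C: "C1_curve_on A a b \<gamma>"
  shows "curve_speed A g \<gamma> integrable_on {a..b}"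
proof -
  have "\<exists>d>0. \<forall>u v. x \<in> cbox u v \<and> cbox u v \<subseteq> ball x d \<and> cbox u v \<subseteq> cbox a b \<longrightarrow>
    curve_speed A g \<gamma> integrable_on cbox u v" if x: "x \<in> cbox a b" for x
  proof -
    define c where "c = chart_at A (\<gamma> x)"
    have c: "c \<in> A" "\<gamma> x \<in> fst c" using chart_at by (auto simp: c_def)
    have cont: "continuous_on {a..b} \<gamma>" using C by (auto simp: C1_curve_on_def)
    obtain D where D: "continuous_on {t\<in>{a..b}. \<gamma> t \<in> fst c} D"
      "\<And>t. t \<in> {a..b} \<Longrightarrow> \<gamma> t \<in> fst c \<Longrightarrow> ((snd c \<circ> \<gamma>) has_vector_derivative D t) (at t within {a..b})"
      using C c(1) unfolding C1_curve_on_def by blast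
    have "\<forall>\<^sub>F t in at x within {a..b}. \<gamma> t \<in> fst c"
      using cont x c chart_open(1)[OF c(1)] by (auto simp: continuous_on_def intro: topological_tendstoD)
    then obtain d where d: "0 < d" "\<And>t. t \<in> {a..b} \<Longrightarrow> t \<noteq> x \<Longrightarrow> dist t x < d \<Longrightarrow> \<gamma> t \<in> fst c"
      by (auto simp: eventually_at)
    have "curve_speed A g \<gamma> integrable_on cbox u v"
      if uv: "x \<in> cbox u v" "cbox u v \<subseteq> ball x d" "cbox u v \<subseteq> cbox a b" for u v
    proof -
      have S: "t \<in> {a..b} \<and> \<gamma> t \<in> fst c" if "t \<in> {u..v}" for t
      proof -
        have "t \<in> {a..b}" "dist t x < d" using that uv by (auto simp: dist_commute)
        then show ?thesis using d(2)[of t] c by (cases "t = x") auto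
      qed
      have "continuous_on {u..v} (\<lambda>t. mnorm c (snd c (\<gamma> t)) (D t))"
      proof (rule mnorm_continuous[OF c(1)])
        show "continuous_on {u..v} (\<lambda>t. snd c (\<gamma> t))"
          by (rule continuous_on_compose2[OF chart_continuous(1)[OF c(1)] continuous_on_subset[OF cont]]) (use S in auto)
        show "continuous_on {u..v} D" by (rule continuous_on_subset[OF D(1)]) (use S in auto)
      qed (use S in auto)
      then have i: "(\<lambda>t. mnorm c (snd c (\<gamma> t)) (D t)) integrable_on {u..v}" by (rule integrable_continuous_interval)
      \<comment> \<open>At a and b the curve has one-sided derivatives only, while
        \<open>curve_speed\<close> takes the two-sided one, so these two points are
        excepted.\<close>
      have "curve_speed A g \<gamma> integrable_on {u..v}"
      proof (rule integrable_spike_finite[OF _ _ i])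
        show "finite {a, b}" by simp
        fix t assume t: "t \<in> {u..v} - {a, b}"
        then have t': "a < t" "t < b" "\<gamma> t \<in> fst c" "t \<in> {a..b}" using S[of t] by auto
        show "curve_speed A g \<gamma> t = mnorm c (snd c (\<gamma> t)) (D t)"
          using D(2)[OF t'(4,3)] at_within_Icc_at[OF t'(1,2)]
          by (intro curve_speed_chart[OF c(1) t'(3) C1_curve_interior(1)[OF C t'(1,2)]]) simp
      qed
      then show ?thesis by simp
    qed
    then show ?thesis using d(1) by blast
  qed
  then have "curve_speed A g \<gamma> integrable_on cbox a b" by (intro integrable_on_little_subintervals) blast
  then show ?thesis by simp
qed

lemma piecewise_speed_integrable:
  assumes "piecewise_C1_curve A \<gamma>"
  shows "curve_speed A g \<gamma> integrable_on {0..1}"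
proof -
  obtain T where T: "finite T" "\<And>a b. 0 \<le> a \<Longrightarrow> a < b \<Longrightarrow> b \<le> 1 \<Longrightarrow> {a<..<b} \<inter> T = {} \<Longrightarrow> C1_curve_on A a b \<gamma>"
    using assms unfolding piecewise_C1_curve_def by blast
  have piece: "curve_speed A g \<gamma> integrable_on {u..v}" if "0 \<le> u" "v \<le> 1" "{u<..<v} \<inter> T = {}" for u v
  proof (cases "u < v")
    case True
    then show ?thesis using T(2) that by (intro C1_curve_speed_integrable) auto
  next
    case False
    then show ?thesis using integrable_on_refl[of "curve_speed A g \<gamma>" u] by (cases "u = v") auto
  qed
  have "\<exists>d>0. \<forall>u v. x \<in> cbox u v \<and> cbox u v \<subseteq> ball x d \<and> cbox u v \<subseteq> cbox 0 1 \<longrightarrow>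
    curve_speed A g \<gamma> integrable_on cbox u v" for x
  proof -
    obtain d where d: "0 < d" "\<And>u v. x - d \<le> u \<Longrightarrow> v \<le> x \<Longrightarrow> {u<..<v} \<inter> T = {}"
      "\<And>u v. x \<le> u \<Longrightarrow> v \<le> x + d \<Longrightarrow> {u<..<v} \<inter> T = {}"
      using finite_gap[OF T(1), of x] by metis
    have "curve_speed A g \<gamma> integrable_on cbox u v"
      if uv: "x \<in> cbox u v" "cbox u v \<subseteq> ball x d" "cbox u v \<subseteq> cbox 0 1" for u v
    proof -
      have le: "u \<le> x" "x \<le> v" using uv by auto
      then have "u \<in> cbox u v" "v \<in> cbox u v" by auto
      then have "u \<in> ball x d" "v \<in> ball x d" "u \<in> cbox 0 1" "v \<in> cbox 0 1" using uv(2,3) by blast+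
      then have "x - d \<le> u" "v \<le> x + d" "0 \<le> u" "v \<le> 1"
        using le by (auto simp: dist_real_def)
      then have "curve_speed A g \<gamma> integrable_on {u..x}" "curve_speed A g \<gamma> integrable_on {x..v}"
        using piece[OF _ _ d(2)[of u x]] piece[OF _ _ d(3)[of x v]] le by simp_all
      then show ?thesis using Henstock_Kurzweil_Integration.integrable_combine[OF le] by simp
    qed
    then show ?thesis using d(1) by blast
  qed
  then have "curve_speed A g \<gamma> integrable_on cbox 0 1" by (intro integrable_on_little_subintervals) blast
  then show ?thesis by simp
qed

lemma piecewise_interior:
  assumes "piecewise_C1_curve A \<gamma>"
  obtains T where "finite T"
    "\<And>t. 0 < t \<Longrightarrow> t < 1 \<Longrightarrow> t \<notin> T \<Longrightarrow> isCont \<gamma> t"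
    "\<And>t c. 0 < t \<Longrightarrow> t < 1 \<Longrightarrow> t \<notin> T \<Longrightarrow> c \<in> A \<Longrightarrow> \<gamma> t \<in> fst c \<Longrightarrow>
       \<exists>D. ((snd c \<circ> \<gamma>) has_vector_derivative D) (at t)"
proof -
  obtain T where T: "finite T" "\<And>a b. 0 \<le> a \<Longrightarrow> a < b \<Longrightarrow> b \<le> 1 \<Longrightarrow> {a<..<b} \<inter> T = {} \<Longrightarrow> C1_curve_on A a b \<gamma>"
    using assms unfolding piecewise_C1_curve_def by blast
  have ex: "\<exists>a b. a < t \<and> t < b \<and> C1_curve_on A a b \<gamma>" if t: "0 < t" "t < 1" "t \<notin> T" for t
  proof -
    obtain d where d: "0 < d" "t \<notin> T \<Longrightarrow> {t - d<..<t + d} \<inter> T = {}" using finite_gap[OF T(1), of t] by metis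
    have "C1_curve_on A (max 0 (t - d)) (min 1 (t + d)) \<gamma>"
    proof (rule T(2))
      have "{max 0 (t - d)<..<min 1 (t + d)} \<subseteq> {t - d<..<t + d}" by auto
      then show "{max 0 (t - d)<..<min 1 (t + d)} \<inter> T = {}" using d(2)[OF t(3)] by blast
    qed (use t d(1) in auto)
    then show ?thesis using t d(1) by (intro exI[of _ "max 0 (t - d)"] exI[of _ "min 1 (t + d)"]) auto
  qed
  show ?thesis
  proof (rule that[OF T(1)])
    show "isCont \<gamma> t" if "0 < t" "t < 1" "t \<notin> T" for t
      using ex[OF that] C1_curve_interior(1) by blast
    show "\<exists>D. ((snd c \<circ> \<gamma>) has_vector_derivative D) (at t)"
      if "0 < t" "t < 1" "t \<notin> T" "c \<in> A" "\<gamma> t \<in> fst c" for t c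
      using ex[OF that(1-3)] C1_curve_interior(2) that(4,5) by blast
  qed
qed

lemma differentiable_charts_continuous:
  assumes "\<And>c p. c \<in> A \<Longrightarrow> p \<in> fst c \<Longrightarrow> (H \<circ> chart_inv c) differentiable (at (snd c p))"
  shows "continuous_on UNIV H"
proof -
  have "isCont H p" for p
  proof -
    define c where "c = chart_at A p"
    have c: "c \<in> A" "p \<in> fst c" using chart_at by (auto simp: c_def)
    have "isCont (H \<circ> chart_inv c) (snd c p)" using assms[OF c] differentiable_imp_continuous_within by blast
    moreover have "isCont (snd c) p"
      using chart_continuous(1)[OF c(1)] c(2) continuous_on_eq_continuous_at[OF chart_open(1)[OF c(1)]] by blast
    ultimately have "isCont ((H \<circ> chart_inv c) \<circ> snd c) p" by (rule continuous_at_compose[rotated])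
    moreover have "\<forall>\<^sub>F q in nhds p. ((H \<circ> chart_inv c) \<circ> snd c) q = H q"
      using chart_open(1)[OF c(1)] c chart_inv_left[OF c(1)] by (auto simp: eventually_nhds intro!: exI[of _ "fst c"])
    ultimately show ?thesis by (subst isCont_cong[symmetric])
  qed
  then show ?thesis by (simp add: continuous_on_eq_continuous_at)
qed

text \<open>A function whose differential is bounded by the metric norm grows along a curve by at
  most the length: the fundamental theorem of calculus off finitely many points, followed by a
  comparison of integrands.\<close>

lemma curve_length_lower_bound:
  assumes d: "\<And>c p. c \<in> A \<Longrightarrow> p \<in> fst c \<Longrightarrow> (H \<circ> chart_inv c) differentiable (at (snd c p))"
    and le: "\<And>c p w. c \<in> A \<Longrightarrow> p \<in> fst c \<Longrightarrow> frechet_derivative (H \<circ> chart_inv c) (at (snd c p)) w \<le> mnorm c (snd c p) w"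
    and \<gamma>: "piecewise_C1_curve A \<gamma>"
  shows "H (\<gamma> 1) - H (\<gamma> 0) \<le> curve_length A g \<gamma>"
proof -
  obtain T where T: "finite T" "\<And>t. 0 < t \<Longrightarrow> t < 1 \<Longrightarrow> t \<notin> T \<Longrightarrow> isCont \<gamma> t"
    "\<And>t c. 0 < t \<Longrightarrow> t < 1 \<Longrightarrow> t \<notin> T \<Longrightarrow> c \<in> A \<Longrightarrow> \<gamma> t \<in> fst c \<Longrightarrow>
       \<exists>D. ((snd c \<circ> \<gamma>) has_vector_derivative D) (at t)" using piecewise_interior[OF \<gamma>] by blast
  have ex: "\<exists>D\<le>curve_speed A g \<gamma> t. ((H \<circ> \<gamma>) has_vector_derivative D) (at t)" if t: "0 < t" "t < 1" "t \<notin> T" for t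
  proof -
    define c where "c = chart_at A (\<gamma> t)"
    have c: "c \<in> A" "\<gamma> t \<in> fst c" using chart_at by (auto simp: c_def)
    obtain D where D: "((snd c \<circ> \<gamma>) has_vector_derivative D) (at t)" using T(3)[OF t c] by blast
    define J where "J = frechet_derivative (H \<circ> chart_inv c) (at (snd c (\<gamma> t)))"
    have J: "((H \<circ> chart_inv c) has_derivative J) (at ((snd c \<circ> \<gamma>) t))"
      using d[OF c] by (simp add: J_def frechet_derivative_works)
    have *: "((\<lambda>t. (H \<circ> chart_inv c) ((snd c \<circ> \<gamma>) t)) has_vector_derivative J D) (at t)"
      by (rule has_vector_derivative_chain[OF D J])
    have "\<forall>\<^sub>F s in nhds t. \<gamma> s \<in> fst c"
      using T(2)[OF t] tendsto_at_iff_tendsto_nhds[of \<gamma> t] chart_open(1)[OF c(1)] c(2)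
      by (auto simp: isCont_def intro: topological_tendstoD)
    then obtain N where N: "open N" "t \<in> N" "\<And>s. s \<in> N \<Longrightarrow> \<gamma> s \<in> fst c" by (auto simp: eventually_nhds)
    have "((H \<circ> \<gamma>) has_vector_derivative J D) (at t)"
      by (rule has_vector_derivative_transform_within_open[OF * N(1,2)]) (use N chart_inv_left[OF c(1)] in auto)
    moreover have "J D \<le> curve_speed A g \<gamma> t"
      using le[OF c] curve_speed_chart[OF c T(2)[OF t] D] by (simp add: J_def)
    ultimately show ?thesis by blast
  qed
  then obtain f' where f': "\<And>t. 0 < t \<Longrightarrow> t < 1 \<Longrightarrow> t \<notin> T \<Longrightarrow> f' t \<le> curve_speed A g \<gamma> t \<and> ((H \<circ> \<gamma>) has_vector_derivative f' t) (at t)"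
    by metis
  \<comment> \<open>At the exceptional points the value 0 keeps h below the nonnegative
    speed.\<close>
  define h where "h = (\<lambda>t. if 0 < t \<and> t < 1 \<and> t \<notin> T then f' t else 0)"
  have "(h has_integral ((H \<circ> \<gamma>) 1 - (H \<circ> \<gamma>) 0)) {0..1}"
  proof (rule fundamental_theorem_of_calculus_interior_strong[OF T(1)])
    show "continuous_on {0..1} (H \<circ> \<gamma>)"
      using \<gamma> differentiable_charts_continuous[OF d] unfolding piecewise_C1_curve_def
      by (intro continuous_on_compose) (auto intro: continuous_on_subset)
  qed (use f' in \<open>auto simp: h_def o_def\<close>)
  moreover have "(curve_speed A g \<gamma> has_integral curve_length A g \<gamma>) {0..1}"
    unfolding curve_length_def by (rule integrable_integral[OF piecewise_speed_integrable[OF \<gamma>]])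
  ultimately have "(H \<circ> \<gamma>) 1 - (H \<circ> \<gamma>) 0 \<le> curve_length A g \<gamma>"
    by (rule has_integral_le) (use f' curve_speed_nonneg in \<open>auto simp: h_def\<close>)
  then show ?thesis by simp
qed


section \<open>Coordinate segments and concatenation\<close>

text \<open>Coordinate segments are the building blocks of all curves constructed here. Their
  coordinate velocity is the constant y - x, so a bound for its metric norm bounds the
  length.\<close>

lemma segment_curve:
  fixes x y :: "real ^ 'n"
  assumes c: "c \<in> A" and seg: "\<And>t. 0 \<le> t \<Longrightarrow> t \<le> 1 \<Longrightarrow> x + t *\<^sub>R (y - x) \<in> snd c ` fst c"
  defines "\<gamma> \<equiv> \<lambda>t. chart_inv c (x + t *\<^sub>R (y - x))"
  shows "piecewise_C1_curve A \<gamma>"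
    and "\<And>B. (\<And>t. 0 \<le> t \<Longrightarrow> t \<le> 1 \<Longrightarrow> mnorm c (x + t *\<^sub>R (y - x)) (y - x) \<le> B) \<Longrightarrow> curve_length A g \<gamma> \<le> B"
proof -
  let ?l = "\<lambda>t. x + t *\<^sub>R (y - x)"
  have ld: "(?l has_vector_derivative (y - x)) (at t within S)" for t S
    by (auto intro!: derivative_eq_intros)
  have V: "open (snd c ` fst c)" by (rule chart_open(2)[OF c])
  have inU: "\<gamma> t \<in> fst c" "snd c (\<gamma> t) = ?l t" if "0 \<le> t" "t \<le> 1" for t
    using chart_inv_right[OF c seg[OF that]] by (auto simp: \<gamma>_def)
  have cont: "continuous_on {0..1} \<gamma>"
    unfolding \<gamma>_def by (rule continuous_on_compose2[OF chart_continuous(2)[OF c]])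
      (use seg in \<open>auto intro!: continuous_intros\<close>)
  have C1: "C1_curve_on A a b \<gamma>" if ab: "0 \<le> a" "b \<le> 1" for a b
    unfolding C1_curve_on_def
  proof (intro conjI ballI)
    show "continuous_on {a..b} \<gamma>" using ab by (intro continuous_on_subset[OF cont]) auto
    \<comment> \<open>The curve has to be C^1 in every chart, so its velocity is transported by the
      derivative of the transition map.\<close>
    fix c' assume c': "c' \<in> A"
    define J where "J = (\<lambda>z. frechet_derivative (snd c' \<circ> chart_inv c) (at z) (y - x))"
    have Jc: "continuous_on (snd c ` (fst c \<inter> fst c')) J"
      using transition_Ck[OF c c', of "Suc 0"] by (auto simp: J_def)
    have sub: "?l t \<in> snd c ` (fst c \<inter> fst c')" if "t \<in> {a..b}" "\<gamma> t \<in> fst c'" for t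
      using inU[of t] that ab by (auto intro!: image_eqI[of _ _ "\<gamma> t"])
    show "\<exists>D. continuous_on {t \<in> {a..b}. \<gamma> t \<in> fst c'} D \<and>
        (\<forall>t\<in>{a..b}. \<gamma> t \<in> fst c' \<longrightarrow> ((snd c' \<circ> \<gamma>) has_vector_derivative D t) (at t within {a..b}))"
    proof (intro exI conjI ballI impI)
      show "continuous_on {t \<in> {a..b}. \<gamma> t \<in> fst c'} (\<lambda>t. J (?l t))"
        by (rule continuous_on_compose2[OF Jc]) (use sub in \<open>auto intro!: continuous_intros\<close>)
      fix t assume t: "t \<in> {a..b}" "\<gamma> t \<in> fst c'"
      have "((snd c' \<circ> chart_inv c) has_derivative frechet_derivative (snd c' \<circ> chart_inv c) (at (?l t))) (at (?l t))"
        using transition_derivative[OF c c', of "\<gamma> t"] inU[of t] t ab by auto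
      from has_vector_derivative_chain[OF ld this]
      show "((snd c' \<circ> \<gamma>) has_vector_derivative J (?l t)) (at t within {a..b})"
        by (simp add: J_def \<gamma>_def o_def)
    qed
  qed
  show pw: "piecewise_C1_curve A \<gamma>"
    unfolding piecewise_C1_curve_def using cont C1 by (intro conjI exI[of _ "{}"]) auto
  fix B assume B: "\<And>t. 0 \<le> t \<Longrightarrow> t \<le> 1 \<Longrightarrow> mnorm c (x + t *\<^sub>R (y - x)) (y - x) \<le> B"
  have sp: "curve_speed A g \<gamma> t \<le> B" if t: "0 \<le> t" "t \<le> 1" for t
  proof -
    have lc: "((\<lambda>t. ?l t) \<longlongrightarrow> ?l t) (nhds t)" by (auto intro!: tendsto_eq_intros filterlim_ident)
    have "\<forall>\<^sub>F z in nhds (?l t). z \<in> snd c ` fst c" using V seg[OF t] by (rule eventually_nhds_in_open)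
    then have ev: "\<forall>\<^sub>F s in nhds t. ?l s \<in> snd c ` fst c" using lc by (rule eventually_compose_filterlim)
    then obtain N where N: "open N" "t \<in> N" "\<And>s. s \<in> N \<Longrightarrow> ?l s \<in> snd c ` fst c" by (auto simp: eventually_nhds)
    have "isCont (chart_inv c) (?l t)"
      using chart_continuous(2)[OF c] continuous_on_eq_continuous_at[OF V] seg[OF t] by blast
    moreover have "isCont ?l t" by (intro continuous_intros)
    ultimately have ic: "isCont \<gamma> t" unfolding \<gamma>_def using isCont_o2[where f = ?l and g = "chart_inv c"] by blast
    have d: "((snd c \<circ> \<gamma>) has_vector_derivative (y - x)) (at t)"
      by (rule has_vector_derivative_transform_within_open[OF ld N(1,2)])
        (use N chart_inv_right[OF c] in \<open>auto simp: \<gamma>_def\<close>)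
    show ?thesis using curve_speed_chart[where \<gamma> = \<gamma> and t = t, OF c inU(1)[OF t] ic d] inU(2)[OF t] B[OF t] by simp
  qed
  have "integral {0..1} (curve_speed A g \<gamma>) \<le> integral {0..1} (\<lambda>_::real. B)"
    by (rule integral_le[OF piecewise_speed_integrable[OF pw]]) (use sp in auto)
  then show "curve_length A g \<gamma> \<le> B" by (simp add: curve_length_def)
qed

lemma C1_curve_affine:
  assumes C: "C1_curve_on A (m * a + k) (m * b + k) \<gamma>1" and m: "0 < m"
    and eq: "\<And>t. a \<le> t \<Longrightarrow> t \<le> b \<Longrightarrow> \<gamma> t = \<gamma>1 (m * t + k)"
  shows "C1_curve_on A a b \<gamma>"
proof -
  let ?h = "\<lambda>t. m * t + k"
  have h: "?h t \<in> {?h a..?h b}" if "t \<in> {a..b}" for t using that m by auto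
  have cont1: "continuous_on {?h a..?h b} \<gamma>1" using C by (simp add: C1_curve_on_def)
  have "continuous_on {a..b} (\<lambda>t. \<gamma>1 (?h t))"
    by (rule continuous_on_compose2[OF cont1]) (use h in \<open>auto intro!: continuous_intros\<close>)
  then have cont: "continuous_on {a..b} \<gamma>" by (rule continuous_on_eq) (use eq in auto)
  have "\<exists>D. continuous_on {t \<in> {a..b}. \<gamma> t \<in> fst c} D \<and>
        (\<forall>t\<in>{a..b}. \<gamma> t \<in> fst c \<longrightarrow> ((snd c \<circ> \<gamma>) has_vector_derivative D t) (at t within {a..b}))" if c: "c \<in> A" for c
  proof -
    obtain D where D: "continuous_on {t \<in> {?h a..?h b}. \<gamma>1 t \<in> fst c} D"
        "\<And>t. t \<in> {?h a..?h b} \<Longrightarrow> \<gamma>1 t \<in> fst c \<Longrightarrow> ((snd c \<circ> \<gamma>1) has_vector_derivative D t) (at t within {?h a..?h b})"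
      using C c unfolding C1_curve_on_def by blast
    show ?thesis
    proof (intro exI conjI ballI impI)
      show "continuous_on {t \<in> {a..b}. \<gamma> t \<in> fst c} (\<lambda>t. m *\<^sub>R D (?h t))"
        by (intro continuous_intros continuous_on_compose2[OF D(1)]) (use h eq in auto)
      fix t assume t: "t \<in> {a..b}" "\<gamma> t \<in> fst c"
      have 1: "(?h has_vector_derivative m) (at t within {a..b})" by (auto intro!: derivative_eq_intros)
      have "((snd c \<circ> \<gamma>1) has_vector_derivative D (?h t)) (at (?h t) within ?h ` {a..b})"
        by (rule has_vector_derivative_within_subset[OF D(2)]) (use t h eq in auto)
      from vector_diff_chain_within[OF 1 this]
      have "((snd c \<circ> \<gamma>1 \<circ> ?h) has_vector_derivative m *\<^sub>R D (?h t)) (at t within {a..b})" .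
      then show "((snd c \<circ> \<gamma>) has_vector_derivative m *\<^sub>R D (?h t)) (at t within {a..b})"
        by (rule has_vector_derivative_transform[OF t(1), rotated]) (use eq in auto)
    qed
  qed
  then show ?thesis using cont by (simp add: C1_curve_on_def)
qed

lemma curve_speed_affine:
  assumes c: "isCont \<gamma>1 (m * t + k)" and N: "open N" "t \<in> N" "\<And>s. s \<in> N \<Longrightarrow> \<gamma> s = \<gamma>1 (m * s + k)"
    and d: "\<And>c. c \<in> A \<Longrightarrow> \<gamma>1 (m * t + k) \<in> fst c \<Longrightarrow> \<exists>D. ((snd c \<circ> \<gamma>1) has_vector_derivative D) (at (m * t + k))"
  shows "curve_speed A g \<gamma> t = \<bar>m\<bar> * curve_speed A g \<gamma>1 (m * t + k)"
proof -
  let ?h = "\<lambda>t. m * t + k"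
  define c where "c = chart_at A (\<gamma> t)"
  have ch: "c \<in> A" "\<gamma> t \<in> fst c" using chart_at by (auto simp: c_def)
  have e: "\<gamma> t = \<gamma>1 (?h t)" using N by blast
  obtain D where D: "((snd c \<circ> \<gamma>1) has_vector_derivative D) (at (?h t))" using d[OF ch(1)] ch(2) e by auto
  have "(?h has_vector_derivative m) (at t)" by (auto intro!: derivative_eq_intros)
  from vector_diff_chain_at[OF this D]
  have "((snd c \<circ> \<gamma>) has_vector_derivative m *\<^sub>R D) (at t)"
    by (rule has_vector_derivative_transform_within_open[OF _ N(1,2)]) (use N(3) in auto)
  moreover have "isCont \<gamma> t"
  proof -
    have "isCont ?h t" by (intro continuous_intros)
    then have "isCont (\<lambda>t. \<gamma>1 (?h t)) t" using c isCont_o2[where f = ?h and g = \<gamma>1] by blast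
    moreover have "\<forall>\<^sub>F s in nhds t. \<gamma>1 (?h s) = \<gamma> s" using N by (auto simp: eventually_nhds)
    ultimately show ?thesis using isCont_cong[where f = "\<lambda>s. \<gamma>1 (?h s)" and g = \<gamma> and x = t] by simp
  qed
  ultimately have "curve_speed A g \<gamma> t = mnorm c (snd c (\<gamma> t)) (m *\<^sub>R D)"
    using curve_speed_chart[where \<gamma> = \<gamma> and t = t, OF ch] by blast
  moreover have "curve_speed A g \<gamma>1 (?h t) = mnorm c (snd c (\<gamma> t)) D"
    using curve_speed_chart[where \<gamma> = \<gamma>1 and t = "?h t", OF ch(1) _ c D] ch(2) e by simp
  ultimately show ?thesis by (simp add: mnorm_scaleR)
qed

text \<open>Both curves run at double speed on half of the interval, which preserves lengths; 1/2
  joins the break points.\<close>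

lemma join_curves:
  assumes g1: "piecewise_C1_curve A \<gamma>1" "\<gamma>1 0 = p" "\<gamma>1 1 = q"
    and g2: "piecewise_C1_curve A \<gamma>2" "\<gamma>2 0 = q" "\<gamma>2 1 = r"
  obtains \<gamma> where "piecewise_C1_curve A \<gamma>" "\<gamma> 0 = p" "\<gamma> 1 = r"
    "curve_length A g \<gamma> = curve_length A g \<gamma>1 + curve_length A g \<gamma>2"
proof -
  \<comment> \<open>The summands 0 and -1 are spelled out so that both halves have the affine form m
    * t + k.\<close>
  define \<gamma> where "\<gamma> = (\<lambda>t::real. if t \<le> 1/2 then \<gamma>1 (2 * t + 0) else \<gamma>2 (2 * t + -1))"
  have e1: "\<gamma> t = \<gamma>1 (2 * t + 0)" if "t \<le> 1/2" for t using that by (simp add: \<gamma>_def)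
  have e2: "\<gamma> t = \<gamma>2 (2 * t + -1)" if "1/2 \<le> t" for t
  proof (cases "t = 1/2")
    case True
    show ?thesis unfolding True using g1(3) g2(2) by (simp add: \<gamma>_def)
  qed (use that in \<open>simp add: \<gamma>_def\<close>)
  obtain T1 where T1: "finite T1" "\<And>a b. 0 \<le> a \<Longrightarrow> a < b \<Longrightarrow> b \<le> 1 \<Longrightarrow> {a<..<b} \<inter> T1 = {} \<Longrightarrow> C1_curve_on A a b \<gamma>1"
    using g1(1) unfolding piecewise_C1_curve_def by blast
  obtain T2 where T2: "finite T2" "\<And>a b. 0 \<le> a \<Longrightarrow> a < b \<Longrightarrow> b \<le> 1 \<Longrightarrow> {a<..<b} \<inter> T2 = {} \<Longrightarrow> C1_curve_on A a b \<gamma>2"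
    using g2(1) unfolding piecewise_C1_curve_def by blast
  define T where "T = (\<lambda>t. t / 2) ` T1 \<union> (\<lambda>t. (t + 1) / 2) ` T2 \<union> {1/2}"
  have c1: "continuous_on {0..1} \<gamma>1" and c2: "continuous_on {0..1} \<gamma>2"
    using g1(1) g2(1) by (auto simp: piecewise_C1_curve_def)
  have "continuous_on ({0..1/2} \<union> {1/2..1}) \<gamma>"
  proof (rule continuous_on_closed_Un)
    have "continuous_on {0..1/2} (\<lambda>t. \<gamma>1 (2 * t + 0))"
      by (rule continuous_on_compose2[OF c1]) (auto intro!: continuous_intros)
    then show "continuous_on {0..1/2} \<gamma>" by (rule continuous_on_eq) (use e1 in auto)
    have "continuous_on {1/2..1} (\<lambda>t. \<gamma>2 (2 * t + -1))"
      by (rule continuous_on_compose2[OF c2]) (auto intro!: continuous_intros)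
    then show "continuous_on {1/2..1} \<gamma>" by (rule continuous_on_eq) (use e2 in auto)
  qed auto
  moreover have "{0..1/2} \<union> {1/2..1} = {0..1::real}" by auto
  ultimately have cont: "continuous_on {0..1} \<gamma>" by simp
  have C1: "C1_curve_on A a b \<gamma>" if ab: "0 \<le> a" "a < b" "b \<le> 1" "{a<..<b} \<inter> T = {}" for a b
  proof (cases "b \<le> 1/2")
    case True
    show ?thesis
    proof (rule C1_curve_affine[of 2 a 0 b \<gamma>1])
      have "{2 * a + 0<..<2 * b + 0} \<inter> T1 = {}"
      proof (rule equals0I)
        fix z assume "z \<in> {2 * a + 0<..<2 * b + 0} \<inter> T1"
        then have "z / 2 \<in> {a<..<b} \<inter> T" by (auto simp: T_def)
        then show False using ab(4) by simp
      qed
      then show "C1_curve_on A (2 * a + 0) (2 * b + 0) \<gamma>1" using ab True by (intro T1(2)) auto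
    qed (use e1 True in auto)
  next
    case False
    have a: "1/2 \<le> a"
    proof (rule ccontr)
      assume "\<not> 1/2 \<le> a"
      then have "1/2 \<in> {a<..<b} \<inter> T" using False by (auto simp: T_def)
      then show False using ab(4) by simp
    qed
    show ?thesis
    proof (rule C1_curve_affine[of 2 a "-1" b \<gamma>2])
      have "{2 * a + -1<..<2 * b + -1} \<inter> T2 = {}"
      proof (rule equals0I)
        fix z assume "z \<in> {2 * a + -1<..<2 * b + -1} \<inter> T2"
        then have "(z + 1) / 2 \<in> {a<..<b} \<inter> T" by (auto simp: T_def)
        then show False using ab(4) by simp
      qed
      then show "C1_curve_on A (2 * a + -1) (2 * b + -1) \<gamma>2" using ab a by (intro T2(2)) auto
    qed (use e2 a in auto)
  qed
  have pw: "piecewise_C1_curve A \<gamma>"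
    unfolding piecewise_C1_curve_def using cont C1 T1(1) T2(1) by (intro conjI exI[of _ T]) (auto simp: T_def)
  have len: "(curve_speed A g \<gamma> has_integral curve_length A g \<eta>) {u..v}"
    if \<eta>: "piecewise_C1_curve A \<eta>" and uv: "2 * u + k = 0" "2 * v + k = 1"
      and e: "\<And>t. u < t \<Longrightarrow> t < v \<Longrightarrow> \<gamma> t = \<eta> (2 * t + k)" for \<eta> u v k
  proof -
    obtain S where S: "finite S" "\<And>t. 0 < t \<Longrightarrow> t < 1 \<Longrightarrow> t \<notin> S \<Longrightarrow> isCont \<eta> t"
      "\<And>t c. 0 < t \<Longrightarrow> t < 1 \<Longrightarrow> t \<notin> S \<Longrightarrow> c \<in> A \<Longrightarrow> \<eta> t \<in> fst c \<Longrightarrow>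
       \<exists>D. ((snd c \<circ> \<eta>) has_vector_derivative D) (at t)" using piecewise_interior[OF \<eta>] by blast
    have "(curve_speed A g \<eta> has_integral curve_length A g \<eta>) (cbox 0 1)"
      unfolding curve_length_def using integrable_integral[OF piecewise_speed_integrable[OF \<eta>]] by simp
    from has_integral_affinity[OF this, of 2 k]
    have "((\<lambda>t. curve_speed A g \<eta> (2 * t + k)) has_integral curve_length A g \<eta> / 2)
        ((\<lambda>t. 1 / 2 * t + - (1 / 2 * k)) ` {0..1})" by simp
    moreover have "(\<lambda>t. 1 / 2 * t + - (1 / 2 * k)) ` {0..1} = {u..v}"
      using uv by (subst image_affinity_atLeastAtMost) (auto simp: field_simps)
    ultimately have "((\<lambda>t. curve_speed A g \<eta> (2 * t + k)) has_integral curve_length A g \<eta> / 2) {u..v}" by simp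
    from has_integral_mult_right[OF this, of 2]
    have "((\<lambda>t. 2 * curve_speed A g \<eta> (2 * t + k)) has_integral curve_length A g \<eta>) {u..v}" by simp
    then show ?thesis
    proof (rule has_integral_spike_finite[rotated 2])
      show "finite ((\<lambda>t. (t - k) / 2) ` S \<union> {u, v})" using S(1) by simp
      fix t assume t: "t \<in> {u..v} - ((\<lambda>t. (t - k) / 2) ` S \<union> {u, v})"
      have "2 * t + k \<notin> S"
      proof
        assume "2 * t + k \<in> S"
        then have "(2 * t + k - k) / 2 \<in> (\<lambda>t. (t - k) / 2) ` S" by (rule imageI)
        then show False using t by simp
      qed
      moreover have tuv: "u < t" "t < v" using t by auto
      moreover have "0 < 2 * t + k" "2 * t + k < 1" using tuv uv by linarith+
      ultimately have St: "isCont \<eta> (2 * t + k)"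
        "\<And>c. c \<in> A \<Longrightarrow> \<eta> (2 * t + k) \<in> fst c \<Longrightarrow> \<exists>D. ((snd c \<circ> \<eta>) has_vector_derivative D) (at (2 * t + k))"
        using S(2,3) by blast+
      have "curve_speed A g \<gamma> t = \<bar>2\<bar> * curve_speed A g \<eta> (2 * t + k)"
        by (rule curve_speed_affine[where N = "{u<..<v}"]) (use St tuv e in auto)
      then show "curve_speed A g \<gamma> t = 2 * curve_speed A g \<eta> (2 * t + k)" by simp
    qed
  qed
  have "(curve_speed A g \<gamma> has_integral curve_length A g \<gamma>1) {0..1/2}"
    by (rule len[OF g1(1), where k = 0]) (use e1 in auto)
  moreover have "(curve_speed A g \<gamma> has_integral curve_length A g \<gamma>2) {1/2..1}"
    by (rule len[OF g2(1), where k = "-1"]) (use e2 in auto)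
  ultimately have "(curve_speed A g \<gamma> has_integral (curve_length A g \<gamma>1 + curve_length A g \<gamma>2)) {0..1}"
    by (intro has_integral_combine[of 0 "1/2" 1]) auto
  then have "curve_length A g \<gamma> = curve_length A g \<gamma>1 + curve_length A g \<gamma>2"
    unfolding curve_length_def[of A g \<gamma>] by (rule integral_unique)
  moreover have "\<gamma> 0 = p" "\<gamma> 1 = r" using g1(2) g2(3) by (auto simp: \<gamma>_def)
  ultimately show ?thesis using that pw by blast
qed


text \<open>Compactness of the ball times the unit sphere, then homogeneity of the metric norm in
  v.\<close>

lemma chart_ball:
  assumes c: "c \<in> A" "p \<in> fst c"
  obtains r B where "0 < r" "0 < B" "cball (snd c p) r \<subseteq> snd c ` fst c"
    "\<And>x v. x \<in> cball (snd c p) r \<Longrightarrow> mnorm c x v \<le> B * norm v"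
proof -
  obtain r where r: "0 < r" "cball (snd c p) r \<subseteq> snd c ` fst c"
    using chart_open(2)[OF c(1)] c(2) open_contains_cball by (metis imageI)
  let ?K = "cball (snd c p) r \<times> sphere (0::real^'n) 1"
  have cont: "continuous_on ?K (\<lambda>z. mnorm c (fst z) (snd z))"
    by (rule mnorm_continuous[OF c(1)]) (use r in \<open>auto intro!: continuous_intros\<close>)
  have comp: "compact ?K" by (intro compact_Times compact_cball compact_sphere)
  have ne: "?K \<noteq> {}" using r by (auto simp: vector_choose_size intro!: exI[of _ "axis undefined 1"])
  obtain z where z: "z \<in> ?K" "\<And>w. w \<in> ?K \<Longrightarrow> mnorm c (fst w) (snd w) \<le> mnorm c (fst z) (snd z)"
    using continuous_attains_sup[OF comp ne cont] by blast
  define B where "B = \<bar>mnorm c (fst z) (snd z)\<bar> + 1"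
  have "mnorm c x v \<le> B * norm v" if x: "x \<in> cball (snd c p) r" for x v
  proof (cases "v = 0")
    case True
    then show ?thesis by (simp add: mnorm_def)
  next
    case False
    have "mnorm c x (v /\<^sub>R norm v) \<le> B" using z(2)[of "(x, v /\<^sub>R norm v)"] x False by (simp add: B_def)
    then have "norm v * mnorm c x (v /\<^sub>R norm v) \<le> norm v * B" by (intro mult_left_mono) auto
    moreover have "norm v * mnorm c x (v /\<^sub>R norm v) = mnorm c x v"
      using mnorm_scaleR[of c x "norm v" "v /\<^sub>R norm v"] False by simp
    ultimately show ?thesis by (simp add: mult.commute)
  qed
  then show ?thesis using that[of r B] r by (simp add: B_def)
qed

lemma chart_ball_curve:
  assumes c: "c \<in> A" and r: "cball z r \<subseteq> snd c ` fst c"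
    and B: "\<And>x v. x \<in> cball z r \<Longrightarrow> mnorm c x v \<le> B * norm v"
    and xy: "x \<in> cball z r" "y \<in> cball z r"
  obtains \<gamma> where "piecewise_C1_curve A \<gamma>" "\<gamma> 0 = chart_inv c x" "\<gamma> 1 = chart_inv c y"
    "curve_length A g \<gamma> \<le> B * norm (y - x)"
proof -
  have seg: "x + t *\<^sub>R (y - x) \<in> cball z r" if "0 \<le> t" "t \<le> 1" for t
  proof -
    have "x + t *\<^sub>R (y - x) = (1 - t) *\<^sub>R x + t *\<^sub>R y" by (simp add: algebra_simps)
    then show ?thesis using convexD_alt[OF convex_cball xy that] by simp
  qed
  have "piecewise_C1_curve A (\<lambda>t. chart_inv c (x + t *\<^sub>R (y - x)))"
    by (rule segment_curve(1)[OF c]) (use seg r in blast)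
  moreover have "curve_length A g (\<lambda>t. chart_inv c (x + t *\<^sub>R (y - x))) \<le> B * norm (y - x)"
    by (rule segment_curve(2)[OF c]) (use seg r B in blast)+
  ultimately show ?thesis by (intro that) auto
qed

lemma dist_le_length:
  "piecewise_C1_curve A \<gamma> \<Longrightarrow> \<gamma> 0 = p \<Longrightarrow> \<gamma> 1 = q \<Longrightarrow> riemannian_dist A g p q \<le> curve_length A g \<gamma>"
  unfolding riemannian_dist_def by (rule cInf_lower) (auto intro!: bdd_belowI[of _ 0] curve_length_nonneg)

end

section \<open>The Riemannian distance and the distance to a set\<close>

context closed_connected_riemannian_manifold
begin

text \<open>The set reachable from p is open with open complement, since chart balls are joined by
  segments and curves can be concatenated. It makes the infimum that defines the distance range over
  a nonempty set.\<close>

lemma piecewise_connected: "\<exists>\<gamma>. piecewise_C1_curve A \<gamma> \<and> \<gamma> 0 = p \<and> \<gamma> 1 = q"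
proof -
  define R where "R = {q. \<exists>\<gamma>. piecewise_C1_curve A \<gamma> \<and> \<gamma> 0 = p \<and> \<gamma> 1 = q}"
  have nbhd: "\<exists>N. open N \<and> q \<in> N \<and> (\<forall>x\<in>N. \<forall>y\<in>N. \<exists>\<gamma>. piecewise_C1_curve A \<gamma> \<and> \<gamma> 0 = x \<and> \<gamma> 1 = y)" for q
  proof -
    define c where "c = chart_at A q"
    have c: "c \<in> A" "q \<in> fst c" using chart_at by (auto simp: c_def)
    obtain r B where r: "0 < r" "cball (snd c q) r \<subseteq> snd c ` fst c"
      "\<And>x v. x \<in> cball (snd c q) r \<Longrightarrow> mnorm c x v \<le> B * norm v" using chart_ball[OF c] by metis
    define N where "N = fst c \<inter> snd c -` ball (snd c q) r"
    have "open N" unfolding N_def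
      by (rule continuous_open_preimage[OF chart_continuous(1)[OF c(1)] chart_open(1)[OF c(1)]]) simp
    moreover have "q \<in> N" using c r by (simp add: N_def)
    moreover have "\<exists>\<gamma>. piecewise_C1_curve A \<gamma> \<and> \<gamma> 0 = x \<and> \<gamma> 1 = y" if "x \<in> N" "y \<in> N" for x y
    proof -
      have "snd c x \<in> cball (snd c q) r" "snd c y \<in> cball (snd c q) r" using that by (auto simp: N_def)
      from chart_ball_curve[OF c(1) r(2,3) this] show ?thesis
        using that chart_inv_left[OF c(1)] by (metis IntD1 N_def)
    qed
    ultimately show ?thesis by blast
  qed
  have step: "y \<in> R" if "x \<in> R" "piecewise_C1_curve A \<gamma>" "\<gamma> 0 = x" "\<gamma> 1 = y" for x y \<gamma>
    using that join_curves unfolding R_def by (smt (verit) mem_Collect_eq)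
  have "open R"
  proof (subst open_subopen, intro ballI)
    fix x assume x: "x \<in> R"
    obtain N where N: "open N" "x \<in> N" "\<And>y z. y \<in> N \<Longrightarrow> z \<in> N \<Longrightarrow> \<exists>\<gamma>. piecewise_C1_curve A \<gamma> \<and> \<gamma> 0 = y \<and> \<gamma> 1 = z"
      using nbhd[of x] by blast
    then show "\<exists>T. open T \<and> x \<in> T \<and> T \<subseteq> R" using step[OF x] by blast
  qed
  moreover have "open (- R)"
  proof (subst open_subopen, intro ballI)
    fix x assume x: "x \<in> - R"
    obtain N where N: "open N" "x \<in> N" "\<And>y z. y \<in> N \<Longrightarrow> z \<in> N \<Longrightarrow> \<exists>\<gamma>. piecewise_C1_curve A \<gamma> \<and> \<gamma> 0 = y \<and> \<gamma> 1 = z"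
      using nbhd[of x] by blast
    have "N \<subseteq> - R" using step N(2,3) x by blast
    then show "\<exists>T. open T \<and> x \<in> T \<and> T \<subseteq> - R" using N by blast
  qed
  moreover have "p \<in> R"
  proof -
    obtain N where N: "open N" "p \<in> N" "\<And>y z. y \<in> N \<Longrightarrow> z \<in> N \<Longrightarrow> \<exists>\<gamma>. piecewise_C1_curve A \<gamma> \<and> \<gamma> 0 = y \<and> \<gamma> 1 = z"
      using nbhd[of p] by blast
    then show ?thesis by (auto simp: R_def)
  qed
  ultimately have "R = UNIV"
    using connectedD[OF connected_manifold, of R "- R"] by blast
  then show ?thesis by (auto simp: R_def)
qed

lemma dist_approx:
  assumes "0 < e"
  obtains \<gamma> where "piecewise_C1_curve A \<gamma>" "\<gamma> 0 = p" "\<gamma> 1 = q" "curve_length A g \<gamma> < riemannian_dist A g p q + e"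
proof -
  let ?L = "{curve_length A g \<gamma> | \<gamma>. piecewise_C1_curve A \<gamma> \<and> \<gamma> 0 = p \<and> \<gamma> 1 = q}"
  have ne: "?L \<noteq> {}" using piecewise_connected by blast
  have "Inf ?L < riemannian_dist A g p q + e" using assms by (simp add: riemannian_dist_def)
  from cInf_lessD[OF ne this] obtain l where "l \<in> ?L" "l < riemannian_dist A g p q + e" by (elim bexE)
  then show ?thesis by (elim CollectE exE conjE) (rule that, simp_all)
qed

lemma riemannian_dist_nonneg: "0 \<le> riemannian_dist A g p q"
proof (rule ccontr)
  assume "\<not> ?thesis"
  then obtain \<gamma> where "curve_length A g \<gamma> < riemannian_dist A g p q + - riemannian_dist A g p q"
    using dist_approx[of "- riemannian_dist A g p q" p q] by auto
  then show False using curve_length_nonneg[of \<gamma>] by simp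
qed

lemma riemannian_dist_triangle: "riemannian_dist A g p r \<le> riemannian_dist A g p q + riemannian_dist A g q r"
proof (rule field_le_epsilon)
  fix e :: real assume e: "0 < e"
  obtain \<gamma>1 where 1: "piecewise_C1_curve A \<gamma>1" "\<gamma>1 0 = p" "\<gamma>1 1 = q" "curve_length A g \<gamma>1 < riemannian_dist A g p q + e/2"
    using dist_approx[of "e/2" p q] e by auto
  obtain \<gamma>2 where 2: "piecewise_C1_curve A \<gamma>2" "\<gamma>2 0 = q" "\<gamma>2 1 = r" "curve_length A g \<gamma>2 < riemannian_dist A g q r + e/2"
    using dist_approx[of "e/2" q r] e by auto
  obtain \<gamma> where "piecewise_C1_curve A \<gamma>" "\<gamma> 0 = p" "\<gamma> 1 = r"
    "curve_length A g \<gamma> = curve_length A g \<gamma>1 + curve_length A g \<gamma>2" using join_curves[OF 1(1-3) 2(1-3)] .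
  then have "riemannian_dist A g p r \<le> curve_length A g \<gamma>1 + curve_length A g \<gamma>2" using dist_le_length by metis
  then show "riemannian_dist A g p r \<le> riemannian_dist A g p q + riemannian_dist A g q r + e" using 1(4) 2(4) by simp
qed

lemma riemannian_dist_chart_ball:
  assumes c: "c \<in> A" and r: "cball z r \<subseteq> snd c ` fst c"
    and B: "\<And>x v. x \<in> cball z r \<Longrightarrow> mnorm c x v \<le> B * norm v"
    and xy: "x \<in> cball z r" "y \<in> cball z r"
  shows "riemannian_dist A g (chart_inv c x) (chart_inv c y) \<le> B * norm (y - x)"
  using chart_ball_curve[OF assms] dist_le_length by (smt (verit))

lemma setdist_le: "q \<in> S \<Longrightarrow> riemannian_setdist A g S p \<le> riemannian_dist A g q p"
  unfolding riemannian_setdist_def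
  by (rule cInf_lower) (auto intro!: bdd_belowI[of _ 0] riemannian_dist_nonneg)

lemma setdist_greatest:
  "S \<noteq> {} \<Longrightarrow> (\<And>q. q \<in> S \<Longrightarrow> l \<le> riemannian_dist A g q p) \<Longrightarrow> l \<le> riemannian_setdist A g S p"
  unfolding riemannian_setdist_def by (rule cInf_greatest) auto

lemma setdist_triangle:
  assumes "S \<noteq> {}"
  shows "riemannian_setdist A g S p \<le> riemannian_setdist A g S q + riemannian_dist A g q p"
proof -
  have "riemannian_setdist A g S p - riemannian_dist A g q p \<le> riemannian_setdist A g S q"
    by (rule setdist_greatest[OF assms])
      (use setdist_le riemannian_dist_triangle in \<open>smt (verit)\<close>)
  then show ?thesis by simp
qed

text \<open>H acts as a calibration: no curve from S to x is shorter than the increase of H along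
  it.\<close>

lemma setdist_lower_bound:
  assumes "S \<noteq> {}" and H: "\<And>p. p \<in> S \<Longrightarrow> H p \<le> h0"
    and "\<And>c p. c \<in> A \<Longrightarrow> p \<in> fst c \<Longrightarrow> (H \<circ> chart_inv c) differentiable (at (snd c p))"
    and "\<And>c p w. c \<in> A \<Longrightarrow> p \<in> fst c \<Longrightarrow> frechet_derivative (H \<circ> chart_inv c) (at (snd c p)) w \<le> mnorm c (snd c p) w"
  shows "H x - h0 \<le> riemannian_setdist A g S x"
proof (rule setdist_greatest[OF assms(1)])
  fix q assume q: "q \<in> S"
  show "H x - h0 \<le> riemannian_dist A g q x"
  proof (rule field_le_epsilon)
    fix e :: real assume "0 < e"
    then obtain \<gamma> where \<gamma>: "piecewise_C1_curve A \<gamma>" "\<gamma> 0 = q" "\<gamma> 1 = x" "curve_length A g \<gamma> < riemannian_dist A g q x + e"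
      using dist_approx by blast
    have "H (\<gamma> 1) - H (\<gamma> 0) \<le> curve_length A g \<gamma>"
      by (rule curve_length_lower_bound[OF assms(3,4) \<gamma>(1)])
    then show "H x - h0 \<le> riemannian_dist A g q x + e" using \<gamma> H[OF q] by simp
  qed
qed

text \<open>The triangle inequality and coordinate segments make the distance Lipschitz in a chart
  ball. The conclusion concerns the topology of the manifold, where the compactness arguments take
  place.\<close>

lemma setdist_continuous:
  assumes S: "S \<noteq> {}"
  shows "continuous_on UNIV (riemannian_setdist A g S)"
proof -
  have "isCont (riemannian_setdist A g S) p" for p
  proof -
    define c where "c = chart_at A p"
    have c: "c \<in> A" "p \<in> fst c" using chart_at by (auto simp: c_def)
    obtain r B where r: "0 < r" "0 < B" "cball (snd c p) r \<subseteq> snd c ` fst c"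
      "\<And>x v. x \<in> cball (snd c p) r \<Longrightarrow> mnorm c x v \<le> B * norm v" using chart_ball[OF c] by metis
    have ic: "isCont (snd c) p"
      using chart_continuous(1)[OF c(1)] c(2) continuous_on_eq_continuous_at[OF chart_open(1)[OF c(1)]] by blast
    then have lc: "(snd c \<longlongrightarrow> snd c p) (at p)" by (simp add: isCont_def)
    have "((\<lambda>q. riemannian_setdist A g S q - riemannian_setdist A g S p) \<longlongrightarrow> 0) (at p)"
    proof (rule Lim_null_comparison)
      have "((\<lambda>q. B * norm (snd c q - snd c p)) \<longlongrightarrow> B * norm (snd c p - snd c p)) (at p)"
        by (intro tendsto_intros lc)
      then show "((\<lambda>q. B * norm (snd c q - snd c p)) \<longlongrightarrow> 0) (at p)" by simp
      have "\<forall>\<^sub>F q in at p. q \<in> fst c" using chart_open(1)[OF c(1)] c(2) by (rule eventually_at_in_open')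
      moreover have "\<forall>\<^sub>F q in at p. dist (snd c q) (snd c p) < r" using lc r(1) by (rule tendstoD)
      ultimately show "\<forall>\<^sub>F q in at p. norm (riemannian_setdist A g S q - riemannian_setdist A g S p) \<le> B * norm (snd c q - snd c p)"
      proof eventually_elim
        case (elim q)
        have b: "snd c q \<in> cball (snd c p) r" "snd c p \<in> cball (snd c p) r" using elim r by (auto simp: dist_commute)
        have "riemannian_dist A g q p \<le> B * norm (snd c q - snd c p)"
          using riemannian_dist_chart_ball[OF c(1) r(3,4) b] elim chart_inv_left[OF c(1)] c(2) by (simp add: norm_minus_commute)
        moreover have "riemannian_dist A g p q \<le> B * norm (snd c q - snd c p)"
          using riemannian_dist_chart_ball[OF c(1) r(3,4) b(2,1)] elim chart_inv_left[OF c(1)] c(2) by simp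
        ultimately show ?case
          using setdist_triangle[OF S, of p q] setdist_triangle[OF S, of q p] by (simp add: abs_le_iff)
      qed
    qed
    then show ?thesis by (simp add: isCont_def LIM_zero_iff)
  qed
  then show ?thesis by (simp add: continuous_on_eq_continuous_at)
qed

text \<open>The degenerate coordinate segment at p has length 0.\<close>

lemma setdist_self: "p \<in> S \<Longrightarrow> riemannian_setdist A g S p = 0"
proof -
  assume p: "p \<in> S"
  define c where "c = chart_at A p"
  have c: "c \<in> A" "p \<in> fst c" using chart_at by (auto simp: c_def)
  obtain r B where r: "0 < r" "0 < B" "cball (snd c p) r \<subseteq> snd c ` fst c"
    "\<And>x v. x \<in> cball (snd c p) r \<Longrightarrow> mnorm c x v \<le> B * norm v" using chart_ball[OF c] by metis
  have "riemannian_dist A g p p \<le> 0"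
    using riemannian_dist_chart_ball[OF c(1) r(3,4), of "snd c p" "snd c p"] r(1) chart_inv_left[OF c] by simp
  moreover have "0 \<le> riemannian_setdist A g S p" using p by (intro setdist_greatest riemannian_dist_nonneg) auto
  ultimately show ?thesis using setdist_le[OF p, of p] by simp
qed

end

section \<open>Isoparametric functions\<close>

lemma Ck_on_uminus:
  assumes "open S" "Ck_on k S f" shows "Ck_on k S (\<lambda>x. - f x)"
  using assms(2)
proof (induction k arbitrary: f)
  case 0
  then show ?case by (auto intro: continuous_intros)
next
  case (Suc k)
  have D: "((\<lambda>x. - f x) has_derivative (\<lambda>v. - frechet_derivative f (at x) v)) (at x)" if "x \<in> S" for x
    using Suc.prems that by (auto intro!: has_derivative_minus simp: frechet_derivative_works)
  have "Ck_on k S (\<lambda>x. frechet_derivative (\<lambda>x. - f x) (at x) v)" for v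
  proof (rule Ck_on_cong[OF assms(1) order_refl])
    show "Ck_on k S (\<lambda>x. - frechet_derivative f (at x) v)" using Suc by auto
    show "- frechet_derivative f (at x) v = frechet_derivative (\<lambda>x. - f x) (at x) v" if "x \<in> S" for x
      using frechet_derivative_at[OF D[OF that]] by metis
  qed
  then show ?case using D by (auto simp: differentiable_def)
qed

text \<open>The product rule div (h X) = h div X + dh(X). It serves for the Laplacian of \<psi> o f,
  with h the derivative of \<psi> along f, and for the passage to - f, with h = -1.\<close>

lemma coord_divergence_scale:
  fixes G :: "real ^ 'n \<Rightarrow> real ^ 'n ^ 'n" and X Y :: "real ^ 'n \<Rightarrow> real ^ 'n"
  assumes V: "open V" "x \<in> V" and Y: "\<And>y. y \<in> V \<Longrightarrow> Y y = h y *\<^sub>R X y"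
    and X: "\<And>i. (\<lambda>y. sqrt (det (G y)) * X y $ i) differentiable (at x)"
    and h: "h differentiable (at x)" and G: "det (G x) \<noteq> 0"
  shows "coord_divergence G Y x = h x * coord_divergence G X x + frechet_derivative h (at x) (X x)"
proof -
  let ?q = "\<lambda>i y. sqrt (det (G y)) * X y $ i"
  have "partial_deriv i (\<lambda>y. sqrt (det (G y)) * Y y $ i) x =
     h x * partial_deriv i (?q i) x + frechet_derivative h (at x) (axis i 1) * ?q i x" for i
  proof -
    have "((\<lambda>y. h y * ?q i y) has_derivative
       (\<lambda>v. h x * frechet_derivative (?q i) (at x) v + frechet_derivative h (at x) v * ?q i x)) (at x)"
      using has_derivative_mult[of h "frechet_derivative h (at x)" x UNIV "?q i" "frechet_derivative (?q i) (at x)"] h X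
      by (simp add: frechet_derivative_works)
    then have "((\<lambda>y. sqrt (det (G y)) * Y y $ i) has_derivative
       (\<lambda>v. h x * frechet_derivative (?q i) (at x) v + frechet_derivative h (at x) v * ?q i x)) (at x)"
      by (rule has_derivative_transform_within_open[OF _ V]) (simp add: Y)
    from frechet_derivative_at[OF this, symmetric] show ?thesis by (simp add: partial_deriv_def)
  qed
  then have "coord_divergence G Y x = (\<Sum>i\<in>UNIV. h x * partial_deriv i (?q i) x
      + frechet_derivative h (at x) (axis i 1) * ?q i x) / sqrt (det (G x))"
    by (simp add: coord_divergence_def)
  also have "\<dots> = h x * coord_divergence G X x
      + (\<Sum>i\<in>UNIV. frechet_derivative h (at x) (axis i 1) * ?q i x) / sqrt (det (G x))"
    by (simp add: coord_divergence_def sum.distrib sum_distrib_left add_divide_distrib)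
  also have "(\<Sum>i\<in>UNIV. frechet_derivative h (at x) (axis i 1) * ?q i x) =
      sqrt (det (G x)) * frechet_derivative h (at x) (X x)"
    using frechet_derivative_partials[OF h, of "X x"]
    by (simp add: inner_vec_def partial_deriv_def sum_distrib_left mult_ac)
  finally show ?thesis using G by simp
qed

text \<open>Squaring h removes the absolute values: h^2 * exp (- 2 K t) is nonincreasing and starts
  at 0.\<close>

lemma gronwall_zero:
  fixes h h' :: "real \<Rightarrow> real"
  assumes d: "\<And>t. 0 \<le> t \<Longrightarrow> t \<le> 1 \<Longrightarrow> (h has_real_derivative h' t) (at t)"
    and le: "\<And>t. 0 \<le> t \<Longrightarrow> t \<le> 1 \<Longrightarrow> \<bar>h' t\<bar> \<le> K * \<bar>h t\<bar>" and 0: "h 0 = 0"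
  shows "h 1 = 0"
proof -
  have "(h 1)\<^sup>2 * exp (- (2 * K) * 1) \<le> (h 0)\<^sup>2 * exp (- (2 * K) * 0)"
  proof (rule DERIV_nonpos_imp_nonincreasing[where f = "\<lambda>t. (h t)\<^sup>2 * exp (- (2 * K) * t)"])
    fix t :: real assume t: "0 \<le> t" "t \<le> 1"
    have "((\<lambda>t. (h t)\<^sup>2 * exp (- (2 * K) * t)) has_real_derivative
        2 * (h t * h' t - K * (h t)\<^sup>2) * exp (- (2 * K) * t)) (at t)"
      by (auto intro!: derivative_eq_intros d[OF t] simp: algebra_simps)
    moreover have "h t * h' t \<le> K * (h t)\<^sup>2"
    proof -
      have "h t * h' t \<le> \<bar>h t\<bar> * \<bar>h' t\<bar>" by (metis abs_ge_self abs_mult)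
      also have "\<dots> \<le> \<bar>h t\<bar> * (K * \<bar>h t\<bar>)" using le[OF t] by (intro mult_left_mono) auto
      also have "\<dots> = K * (h t)\<^sup>2" by (simp add: power2_eq_square abs_mult_self_eq mult_ac)
      finally show ?thesis .
    qed
    ultimately show "\<exists>y. ((\<lambda>t. (h t)\<^sup>2 * exp (- (2 * K) * t)) has_real_derivative y) (at t) \<and> y \<le> 0"
      by (intro exI conjI) (auto simp: mult_le_0_iff)
  qed simp
  then have "(h 1)\<^sup>2 * exp (- (2 * K)) \<le> 0" using 0 by simp
  then show ?thesis by (simp add: mult_le_0_iff)
qed

context riemannian_manifold
begin

lemma C2_differentiable:
  assumes "Ck_on (Suc (Suc 0)) V F" "x \<in> V"
  shows "F differentiable (at x)" "(\<lambda>y. frechet_derivative F (at y) v) differentiable (at x)"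
  using assms by auto

lemma gradient_differentiable:
  assumes c: "c \<in> A" "x \<in> snd c ` fst c" and F: "Ck_on (Suc (Suc 0)) (snd c ` fst c) F"
  shows "coord_gradient (g c) F differentiable (at x)"
    "(\<lambda>y. sqrt (det (g c y))) differentiable (at x)"
    "(\<lambda>y. sqrt (det (g c y)) * coord_gradient (g c) F y $ i) differentiable (at x)"
proof -
  show X: "coord_gradient (g c) F differentiable (at x)"
    by (rule differentiable_coord_gradient[OF chart_open(2)[OF c(1)] c(2) metric_differentiable[OF c] metric_spd[OF c(1)]])
      (use F c in \<open>auto simp: partial_deriv_def\<close>)
  have "(\<lambda>y. det (g c y)) differentiable (at x)"
    by (intro differentiable_det differentiable_vec_nth metric_differentiable c)
  moreover have nz: "det (g c x) \<noteq> 0" by (rule spd_det[OF metric_spd[OF c]])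
  \<comment> \<open>The real square root is extended as an odd function, so a nonzero determinant
    already gives differentiability, whatever its sign.\<close>
  moreover have "sqrt differentiable (at (det (g c x)))"
  proof -
    have "(sqrt has_real_derivative (if 0 < det (g c x) then inverse (sqrt (det (g c x))) / 2
        else - inverse (sqrt (det (g c x))) / 2)) (at (det (g c x)))"
      by (rule DERIV_real_sqrt_generic[OF nz]) auto
    then show ?thesis unfolding real_differentiable_def by blast
  qed
  ultimately show s: "(\<lambda>y. sqrt (det (g c y))) differentiable (at x)"
    using differentiable_chain_at[of "\<lambda>y. det (g c y)" x sqrt] by (simp add: o_def)
  show "(\<lambda>y. sqrt (det (g c y)) * coord_gradient (g c) F y $ i) differentiable (at x)"
    by (intro differentiable_mult s differentiable_vec_nth X)
qed

end

text \<open>Collects the consequences of smoothness that enter: f is C^2 in charts, while a and the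
  derivative of b are Lipschitz up to the end points. The conditions are stable under passing to -
  f, so each statement at t0 transfers to t1.\<close>

locale isopar = closed_connected_riemannian_manifold A g
  for A :: "('m::{t2_space, second_countable_topology}, 'n::finite) chart set" and g +
  fixes f :: "'m \<Rightarrow> real" and t0 t1 :: real and a b b' :: "real \<Rightarrow> real" and Cl :: real
  assumes t01: "t0 < t1" and range_f: "range f = {t0..t1}"
    and f_C2: "c \<in> A \<Longrightarrow> Ck_on (Suc (Suc 0)) (snd c ` fst c) (f \<circ> chart_inv c)"
    and grad_f: "gradient_norm_sq A g f p = b (f p)"
    and lap_f: "laplace_beltrami A g f p = a (f p)"
    and b_deriv: "t0 \<le> s \<Longrightarrow> s \<le> t1 \<Longrightarrow> (b has_real_derivative b' s) (at s within {t0..t1})"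
    and b'_lip: "t0 \<le> s \<Longrightarrow> s \<le> t1 \<Longrightarrow> t0 \<le> r \<Longrightarrow> r \<le> t1 \<Longrightarrow> \<bar>b' s - b' r\<bar> \<le> Cl * \<bar>s - r\<bar>"
    and a_lip: "t0 \<le> s \<Longrightarrow> s \<le> t1 \<Longrightarrow> t0 \<le> r \<Longrightarrow> r \<le> t1 \<Longrightarrow> \<bar>a s - a r\<bar> \<le> Cl * \<bar>s - r\<bar>"
begin

section \<open>Size of the gradient and simple zeros of b\<close>

lemma f_bounds: "t0 \<le> f p" "f p \<le> t1"
  using range_f by (metis atLeastAtMost_iff rangeI)+

lemma f_surj: "t0 \<le> s \<Longrightarrow> s \<le> t1 \<Longrightarrow> \<exists>p. f p = s"
  using range_f by (metis atLeastAtMost_iff imageE)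

lemma f_diff: "c \<in> A \<Longrightarrow> x \<in> snd c ` fst c \<Longrightarrow> (f \<circ> chart_inv c) differentiable (at x)"
  using C2_differentiable(1)[OF f_C2] .

lemma f_diff': "c \<in> A \<Longrightarrow> p \<in> fst c \<Longrightarrow> (f \<circ> chart_inv c) differentiable (at (snd c p))"
  using f_diff by blast

lemma f_cont: "continuous_on UNIV f"
  by (rule differentiable_charts_continuous[OF f_diff'])

lemma f_frechet:
  "c \<in> A \<Longrightarrow> x \<in> snd c ` fst c \<Longrightarrow>
    ((f \<circ> chart_inv c) has_derivative frechet_derivative (f \<circ> chart_inv c) (at x)) (at x)"
  using f_diff by (simp add: frechet_derivative_works)

lemma f_line:
  assumes "c \<in> A" "x + t *\<^sub>R v \<in> snd c ` fst c"
  shows "((\<lambda>t. (f \<circ> chart_inv c) (x + t *\<^sub>R v)) has_real_derivative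
    frechet_derivative (f \<circ> chart_inv c) (at (x + t *\<^sub>R v)) v) (at t)"
proof -
  have "((\<lambda>t. x + t *\<^sub>R v) has_vector_derivative v) (at t)" by (auto intro!: derivative_eq_intros)
  from has_vector_derivative_chain[OF this f_frechet[OF assms]]
  show ?thesis by (simp add: has_real_derivative_iff_has_vector_derivative)
qed

lemma gradient_identity:
  assumes c: "c \<in> A" "x \<in> snd c ` fst c"
  defines "X \<equiv> coord_gradient (g c) (f \<circ> chart_inv c) x"
  shows "X \<bullet> (g c x *v X) = b ((f \<circ> chart_inv c) x)"
    "frechet_derivative (f \<circ> chart_inv c) (at x) X = b ((f \<circ> chart_inv c) x)"
    "mnorm c x X = sqrt (b ((f \<circ> chart_inv c) x))"
proof -
  have p: "chart_inv c x \<in> fst c" "snd c (chart_inv c x) = x" using chart_inv_right[OF c] by auto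
  show 1: "X \<bullet> (g c x *v X) = b ((f \<circ> chart_inv c) x)"
    using gradient_norm_sq_chart[OF c(1) p(1), of f] grad_f f_diff[OF c] p(2) by (simp add: X_def)
  show "frechet_derivative (f \<circ> chart_inv c) (at x) X = b ((f \<circ> chart_inv c) x)"
    using coord_gradient_inner[where G = "g c" and w = X, OF f_diff[OF c] metric_spd[OF c]] 1 by (simp add: X_def)
  show "mnorm c x X = sqrt (b ((f \<circ> chart_inv c) x))" using 1 by (simp add: mnorm_def)
qed

lemma differential_bound:
  assumes c: "c \<in> A" "x \<in> snd c ` fst c"
  shows "\<bar>frechet_derivative (f \<circ> chart_inv c) (at x) v\<bar> \<le> sqrt (b ((f \<circ> chart_inv c) x)) * mnorm c x v"
  using differential_le_mnorm[OF c f_diff[OF c]] gradient_identity(1)[OF c] by simp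

lemma b_nonneg: "t0 \<le> s \<Longrightarrow> s \<le> t1 \<Longrightarrow> 0 \<le> b s"
proof -
  assume "t0 \<le> s" "s \<le> t1"
  then obtain p where p: "f p = s" using f_surj by blast
  define c where "c = chart_at A p"
  have c: "c \<in> A" "p \<in> fst c" using chart_at by (auto simp: c_def)
  show "0 \<le> b s" using gradient_identity(1)[OF c(1), of "snd c p"] spd_nonneg[OF metric_spd[OF c(1), of "snd c p"]] c p chart_inv_left[OF c]
    by (metis comp_apply imageI)
qed

lemma Cl_nonneg: "0 \<le> Cl"
proof -
  have "0 \<le> Cl * \<bar>t0 - t1\<bar>" using b'_lip[of t0 t1] t01 by (meson abs_ge_zero less_imp_le order_refl order_trans)
  then show ?thesis using t01 by (simp add: zero_le_mult_iff)
qed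

lemma b_taylor:
  assumes "t0 \<le> s" "s \<le> t1" "t0 \<le> r" "r \<le> t1"
  shows "\<bar>b r - b s - b' s * (r - s)\<bar> \<le> Cl * (r - s)\<^sup>2"
proof -
  let ?I = "{min r s..max r s}"
  note Cl = Cl_nonneg
  have "norm ((b r - b' s * r) - (b s - b' s * s)) \<le> (Cl * \<bar>r - s\<bar>) * norm (r - s)"
  proof (rule field_differentiable_bound[of ?I _ "\<lambda>x. b' x - b' s"])
    fix x assume x: "x \<in> ?I"
    have "(b has_real_derivative b' x) (at x within ?I)"
      by (rule DERIV_subset[OF b_deriv]) (use x assms in auto)
    then show "((\<lambda>r. b r - b' s * r) has_real_derivative b' x - b' s) (at x within ?I)"
      by (auto intro!: derivative_eq_intros)
    have "\<bar>b' x - b' s\<bar> \<le> Cl * \<bar>x - s\<bar>" using x assms by (intro b'_lip) auto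
    also have "\<dots> \<le> Cl * \<bar>r - s\<bar>" using x Cl by (intro mult_left_mono) auto
    finally show "norm (b' x - b' s) \<le> Cl * \<bar>r - s\<bar>" by simp
  qed auto
  then show ?thesis by (simp add: algebra_simps power2_eq_square abs_mult_self_eq mult.assoc flip: abs_mult)
qed

lemma b_t0: "b t0 = 0"
proof -
  obtain p where p: "f p = t0" using f_surj[of t0] t01 by auto
  define c where "c = chart_at A p"
  have c: "c \<in> A" "p \<in> fst c" using chart_at by (auto simp: c_def)
  have x: "snd c p \<in> snd c ` fst c" using c by blast
  have "frechet_derivative (f \<circ> chart_inv c) (at (snd c p)) = (\<lambda>h. 0)"
    by (rule has_derivative_local_min[OF f_frechet[OF c(1) x]])
      (use f_bounds(1) p chart_inv_left[OF c] in auto)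
  then show ?thesis using gradient_identity(2)[OF c(1) x] p chart_inv_left[OF c] by simp
qed

text \<open>If b were at most quadratic at s0, then |df| <= const * |f - s0|, and Gronwall along
  coordinate segments would make the level s0 open. It is closed and nonempty as well, so f would be
  constant. This rules out interior zeros of b and degenerate zeros at the end points.\<close>

lemma not_quadratic:
  assumes c0: "t0 \<le> s0" "s0 \<le> t1" and q: "\<And>s. t0 \<le> s \<Longrightarrow> s \<le> t1 \<Longrightarrow> b s \<le> C * (s - s0)\<^sup>2"
  shows False
proof -
  define N where "N = {p. f p = s0}"
  have "\<exists>U. open U \<and> p \<in> U \<and> U \<subseteq> N" if p: "p \<in> N" for p
  proof -
    define c where "c = chart_at A p"
    have c: "c \<in> A" "p \<in> fst c" using chart_at by (auto simp: c_def)
    obtain r B where r: "0 < r" "0 < B" "cball (snd c p) r \<subseteq> snd c ` fst c"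
      "\<And>x v. x \<in> cball (snd c p) r \<Longrightarrow> mnorm c x v \<le> B * norm v" using chart_ball[OF c] by metis
    define U where "U = fst c \<inter> snd c -` ball (snd c p) r"
    have "open U" unfolding U_def
      by (rule continuous_open_preimage[OF chart_continuous(1)[OF c(1)] chart_open(1)[OF c(1)]]) simp
    moreover have "p \<in> U" using c r by (simp add: U_def)
    moreover have "f y = s0" if y: "y \<in> U" for y
    proof -
      let ?F = "f \<circ> chart_inv c" and ?v = "snd c y - snd c p"
      have seg: "snd c p + t *\<^sub>R ?v \<in> cball (snd c p) r" if "0 \<le> t" "t \<le> 1" for t
      proof -
        have "dist (snd c p) (snd c p + t *\<^sub>R ?v) = t * norm ?v" using that by (simp add: dist_norm)
        also have "\<dots> \<le> 1 * norm ?v" using that by (intro mult_right_mono) auto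
        also have "\<dots> \<le> r" using y by (auto simp: U_def dist_norm norm_minus_commute)
        finally show ?thesis by simp
      qed
      have "(\<lambda>t. ?F (snd c p + t *\<^sub>R ?v) - s0) 1 = 0"
      proof (rule gronwall_zero)
        fix t :: real assume t: "0 \<le> t" "t \<le> 1"
        let ?z = "snd c p + t *\<^sub>R ?v"
        have z: "?z \<in> snd c ` fst c" using seg[OF t] r(3) by blast
        show "((\<lambda>t. ?F (snd c p + t *\<^sub>R ?v) - s0) has_real_derivative frechet_derivative ?F (at ?z) ?v) (at t)"
          using DERIV_diff[OF f_line[OF c(1) z] DERIV_const[of s0]] by simp
        have "b (?F ?z) \<le> C * (?F ?z - s0)\<^sup>2" using q f_bounds by simp
        then have "sqrt (b (?F ?z)) \<le> sqrt (C * (?F ?z - s0)\<^sup>2)" by simp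
        also have "\<dots> \<le> sqrt \<bar>C\<bar> * \<bar>?F ?z - s0\<bar>" by (simp add: real_sqrt_mult mult_right_mono)
        finally have 1: "sqrt (b (?F ?z)) \<le> sqrt \<bar>C\<bar> * \<bar>?F ?z - s0\<bar>" .
        have 2: "mnorm c ?z ?v \<le> B * norm ?v" using r(4)[OF seg[OF t]] .
        have "\<bar>frechet_derivative ?F (at ?z) ?v\<bar> \<le> sqrt (b (?F ?z)) * mnorm c ?z ?v"
          by (rule differential_bound[OF c(1) z])
        also have "\<dots> \<le> (sqrt \<bar>C\<bar> * \<bar>?F ?z - s0\<bar>) * (B * norm ?v)"
          using 1 2 mnorm_nonneg[OF c(1) z] by (intro mult_mono) auto
        finally show "\<bar>frechet_derivative ?F (at ?z) ?v\<bar> \<le> sqrt \<bar>C\<bar> * (B * norm ?v) * \<bar>?F ?z - s0\<bar>"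
          by (simp add: mult_ac)
      next
        show "?F (snd c p + 0 *\<^sub>R ?v) - s0 = 0" using p chart_inv_left[OF c] by (simp add: N_def)
      qed
      then show ?thesis using y chart_inv_left[OF c(1)] by (simp add: U_def)
    qed
    ultimately show ?thesis by (auto simp: N_def)
  qed
  then have "open N" by (subst open_subopen) blast
  moreover have "open (- N)"
  proof -
    have "- N = f -` (- {s0})" by (auto simp: N_def)
    then show ?thesis using open_vimage[OF open_Compl[OF closed_singleton] f_cont] by simp
  qed
  moreover have "N \<noteq> {}" using f_surj[OF c0] by (auto simp: N_def)
  ultimately have "- N = {}" using connectedD[OF connected_manifold, of N "- N"] by blast
  then have "f p = s0" for p by (auto simp: N_def)
  then show False using f_surj[of t0] f_surj[of t1] t01 by (metis less_irrefl order_refl less_imp_le)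
qed

text \<open>An interior zero is a minimum of the nonnegative function b, hence at least a double
  zero.\<close>

lemma b_pos: "t0 < s \<Longrightarrow> s < t1 \<Longrightarrow> 0 < b s"
proof (rule ccontr)
  assume s: "t0 < s" "s < t1" and "\<not> 0 < b s"
  then have bs: "b s = 0" using b_nonneg[of s] by simp
  have d: "(b has_real_derivative b' s) (at s)"
    using b_deriv[of s] s by (simp add: at_within_Icc_at)
  have "b' s = 0"
  proof (rule DERIV_local_min[OF d])
    show "0 < min (s - t0) (t1 - s)" using s by simp
    show "\<forall>y. \<bar>s - y\<bar> < min (s - t0) (t1 - s) \<longrightarrow> b s \<le> b y"
      using b_nonneg bs by (auto simp: abs_if split: if_splits)
  qed
  then have "b r \<le> Cl * (r - s)\<^sup>2" if "t0 \<le> r" "r \<le> t1" for r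
    using b_taylor[of s r] that s bs by simp
  then show False using not_quadratic[of s Cl] s by simp
qed

lemma b'_t0: "0 < b' t0"
proof (rule ccontr)
  assume "\<not> 0 < b' t0"
  then have le: "b' t0 * (r - t0) \<le> 0" if "t0 \<le> r" for r using that by (simp add: mult_le_0_iff)
  have "b r \<le> Cl * (r - t0)\<^sup>2" if "t0 \<le> r" "r \<le> t1" for r
    using b_taylor[of t0 r] that t01 b_t0 le[of r] by (simp add: abs_le_iff)
  then show False using not_quadratic[of t0 Cl] t01 by simp
qed

text \<open>The Laplacian is odd in f and the squared gradient even, which dictates the signs of the
  transformed coefficients.\<close>

lemma uminus_isopar:
  "isopar A g (\<lambda>p. - f p) (- t1) (- t0) (\<lambda>s. - a (- s)) (\<lambda>s. b (- s)) (\<lambda>s. - b' (- s)) Cl"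
proof
  have comp: "(\<lambda>p. - f p) \<circ> chart_inv c = (\<lambda>x. - (f \<circ> chart_inv c) x)" for c by auto
  have part: "partial_deriv j (\<lambda>x. - (f \<circ> chart_inv c) x) x = - partial_deriv j (f \<circ> chart_inv c) x"
    if "c \<in> A" "x \<in> snd c ` fst c" for j c x
    using frechet_derivative_at[OF has_derivative_minus[OF f_frechet[OF that]]] unfolding partial_deriv_def by metis
  have cg: "coord_gradient (g c) (\<lambda>x. - (f \<circ> chart_inv c) x) x = (-1) *\<^sub>R coord_gradient (g c) (f \<circ> chart_inv c) x"
    if "c \<in> A" "x \<in> snd c ` fst c" for c x
  proof -
    have "(\<chi> j. partial_deriv j (\<lambda>x. - (f \<circ> chart_inv c) x) x) = (-1) *\<^sub>R (\<chi> j. partial_deriv j (f \<circ> chart_inv c) x)"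
      by (simp add: vec_eq_iff part[OF that] del: o_apply)
    then show ?thesis unfolding coord_gradient_def by (simp only: matrix_vector_mult_scaleR)
  qed
  show "- t1 < - t0" using t01 by simp
  have "range (\<lambda>p. - f p) = uminus ` range f" by auto
  then show "range (\<lambda>p. - f p) = {- t1..- t0}" by (simp add: range_f)
  show "Ck_on (Suc (Suc 0)) (snd c ` fst c) ((\<lambda>p. - f p) \<circ> chart_inv c)" if "c \<in> A" for c
    unfolding comp by (rule Ck_on_uminus[OF chart_open(2)[OF that] f_C2[OF that]])
  fix p
  define c where "c = chart_at A p"
  have c: "c \<in> A" "snd c p \<in> snd c ` fst c" using chart_at by (auto simp: c_def)
  show "gradient_norm_sq A g (\<lambda>p. - f p) p = b (- (- f p))"
    using grad_f[of p] unfolding gradient_norm_sq_def Let_def c_def[symmetric] comp cg[OF c]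
    by (simp only: matrix_vector_mult_scaleR inner_scaleR_left inner_scaleR_right) simp
  have "coord_divergence (g c) (coord_gradient (g c) (\<lambda>x. - (f \<circ> chart_inv c) x)) (snd c p)
     = (-1) * coord_divergence (g c) (coord_gradient (g c) (f \<circ> chart_inv c)) (snd c p)
       + frechet_derivative (\<lambda>_. -1) (at (snd c p)) (coord_gradient (g c) (f \<circ> chart_inv c) (snd c p))"
    by (rule coord_divergence_scale[OF chart_open(2)[OF c(1)] c(2) cg[OF c(1)]
        gradient_differentiable(3)[OF c f_C2[OF c(1)]] _ spd_det[OF metric_spd[OF c]]]) auto
  then show "laplace_beltrami A g (\<lambda>p. - f p) p = - a (- (- f p))"
    using lap_f[of p] unfolding laplace_beltrami_def Let_def c_def[symmetric] comp by simp
next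
  fix s :: real assume s: "- t1 \<le> s" "s \<le> - t0"
  have "((b \<circ> uminus) has_real_derivative b' (- s) * -1) (at s within {- t1..- t0})"
  proof (rule DERIV_image_chain)
    show "(b has_real_derivative b' (- s)) (at (- s) within uminus ` {- t1..- t0})"
      using b_deriv[of "- s"] s by simp
  qed (auto intro!: derivative_eq_intros)
  then show "((\<lambda>s. b (- s)) has_real_derivative - b' (- s)) (at s within {- t1..- t0})" by (simp add: o_def)
next
  fix s r :: real assume s: "- t1 \<le> s" "s \<le> - t0" "- t1 \<le> r" "r \<le> - t0"
  show "\<bar>- b' (- s) - - b' (- r)\<bar> \<le> Cl * \<bar>s - r\<bar>"
    using b'_lip[of "- r" "- s"] s by (auto simp: abs_minus_commute)
next
  fix s r :: real assume s: "- t1 \<le> s" "s \<le> - t0" "- t1 \<le> r" "r \<le> - t0"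
  show "\<bar>- a (- s) - - a (- r)\<bar> \<le> Cl * \<bar>s - r\<bar>"
    using a_lip[of "- r" "- s"] s by (auto simp: abs_minus_commute)
qed


subsection \<open>The distance to the focal set is constant on levels\<close>

abbreviation (input) \<rho> :: "'m \<Rightarrow> real" where "\<rho> \<equiv> riemannian_setdist A g (f -` {t0})"

lemma focal_nonempty: "f -` {t0} \<noteq> {}"
  using f_surj[of t0] t01 by auto

lemma b_continuous: "continuous_on {t0..t1} b"
  unfolding continuous_on_eq_continuous_within by (auto intro!: DERIV_continuous[OF b_deriv])

text \<open>The shift by \<open>e\<close> keeps the arclength \<open>\<integral> 1 / \<surd>b\<close> differentiable up to the focal values, where \<open>b\<close> vanishes.\<close>

lemma regularized_arclength:
  assumes "0 < e"
  obtains D where "\<And>s. t0 \<le> s \<Longrightarrow> s \<le> t1 \<Longrightarrow> (D has_real_derivative 1 / sqrt (b s + e)) (at s)"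
proof -
  \<comment> \<open>Clamping extends the integrand continuously to the line, so that D has two-sided
    derivatives at t0 and t1 too.\<close>
  define cl where "cl = (\<lambda>s. max t0 (min t1 s))"
  have cl: "t0 \<le> cl s" "cl s \<le> t1" for s using t01 by (auto simp: cl_def)
  have bc: "continuous_on UNIV (\<lambda>s. b (cl s))"
    by (rule continuous_on_compose2[OF b_continuous]) (use cl in \<open>auto simp: cl_def intro!: continuous_intros\<close>)
  have p: "0 < b (cl s) + e" for s using b_nonneg[OF cl, of s] assms by simp
  have "continuous_on UNIV (\<lambda>s. 1 / sqrt (b (cl s) + e))"
    using p by (intro continuous_intros bc) (auto simp: less_imp_neq[symmetric])
  then have "isCont (\<lambda>s. 1 / sqrt (b (cl s) + e)) s" for s by (simp add: continuous_on_eq_continuous_at)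
  then obtain D where D: "\<And>s. (D has_vector_derivative 1 / sqrt (b (cl s) + e)) (at s)"
    using einterval_antiderivative[of "-\<infinity>" "\<infinity>" "\<lambda>s. 1 / sqrt (b (cl s) + e)"] by auto
  have "(D has_real_derivative 1 / sqrt (b s + e)) (at s)" if "t0 \<le> s" "s \<le> t1" for s
  proof -
    have "cl s = s" using that by (simp add: cl_def)
    then show ?thesis using D[of s] by (simp add: has_real_derivative_iff_has_vector_derivative)
  qed
  then show ?thesis by (rule that)
qed

text \<open>\<open>D \<circ> f\<close> is a calibration: its differential is at most sqrt b / sqrt
  (b + e) <= 1 times the metric norm.\<close>

lemma arclength_le_setdist:
  assumes e: "0 < e" and D: "\<And>s. t0 \<le> s \<Longrightarrow> s \<le> t1 \<Longrightarrow> (D has_real_derivative 1 / sqrt (b s + e)) (at s)"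
  shows "D (f x) - D t0 \<le> \<rho> x"
proof -
  have ch: "((D \<circ> f \<circ> chart_inv c) has_derivative
      (\<lambda>w. 1 / sqrt (b (f p) + e) * frechet_derivative (f \<circ> chart_inv c) (at (snd c p)) w)) (at (snd c p))"
    if c: "c \<in> A" "p \<in> fst c" for c p
  proof -
    have x: "snd c p \<in> snd c ` fst c" using c by blast
    have "(D has_derivative (\<lambda>w. 1 / sqrt (b (f p) + e) * w)) (at ((f \<circ> chart_inv c) (snd c p)))"
      using D[OF f_bounds, of p] unfolding has_field_derivative_def o_apply chart_inv_left[OF c] .
    from diff_chain_at[OF f_frechet[OF c(1) x] this] show ?thesis by (simp add: o_def)
  qed
  have "(D \<circ> f) x - D t0 \<le> \<rho> x"
  proof (rule setdist_lower_bound[OF focal_nonempty])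
    show "(D \<circ> f) p \<le> D t0" if "p \<in> f -` {t0}" for p using that by simp
    fix c p assume c: "c \<in> A" "p \<in> fst c"
    have x: "snd c p \<in> snd c ` fst c" using c by blast
    show "(D \<circ> f \<circ> chart_inv c) differentiable (at (snd c p))" using ch[OF c] by (auto simp: differentiable_def)
    fix w
    have bp: "0 \<le> b (f p)" using b_nonneg f_bounds by blast
    have "frechet_derivative (D \<circ> f \<circ> chart_inv c) (at (snd c p)) w =
        1 / sqrt (b (f p) + e) * frechet_derivative (f \<circ> chart_inv c) (at (snd c p)) w"
      using frechet_derivative_at[OF ch[OF c]] by metis
    also have "\<dots> \<le> 1 / sqrt (b (f p) + e) * (sqrt (b (f p)) * mnorm c (snd c p) w)"
      using differential_bound[OF c(1) x, of w] chart_inv_left[OF c] bp e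
      by (intro mult_left_mono) (auto simp: abs_le_iff)
    also have "\<dots> = sqrt (b (f p)) / sqrt (b (f p) + e) * mnorm c (snd c p) w" by simp
    also have "\<dots> \<le> 1 * mnorm c (snd c p) w"
      using bp e mnorm_nonneg[OF c(1) x] by (intro mult_right_mono) (auto simp: divide_le_eq_1_pos)
    finally show "frechet_derivative (D \<circ> f \<circ> chart_inv c) (at (snd c p)) w \<le> mnorm c (snd c p) w" by simp
  qed
  then show ?thesis by simp
qed

text \<open>Compactness: f attains a minimum where the distance is at least z, and this minimum
  exceeds t0 because the distance vanishes on the focal set.\<close>

lemma setdist_small_near_focal:
  assumes "0 < z" obtains \<tau> where "0 < \<tau>" "\<And>x. f x \<le> t0 + \<tau> \<Longrightarrow> \<rho> x \<le> z"
proof (cases "{x. z \<le> \<rho> x} = {}")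
  case True
  then have "\<rho> x \<le> z" for x using linear[of z "\<rho> x"] by auto
  then show ?thesis using that[of 1] by simp
next
  case False
  have "closed {x. z \<le> \<rho> x}"
    by (intro closed_Collect_le continuous_intros setdist_continuous[OF focal_nonempty])
  then have "compact {x. z \<le> \<rho> x}" using compact_manifold compact_Int_closed[of UNIV] by simp
  from continuous_attains_inf[OF this False continuous_on_subset[OF f_cont subset_UNIV]]
  obtain y where y: "z \<le> \<rho> y" "\<And>x. z \<le> \<rho> x \<Longrightarrow> f y \<le> f x" by auto
  have "f y \<noteq> t0" using y(1) setdist_self[of y "f -` {t0}"] assms by auto
  then have "t0 < f y" using f_bounds(1)[of y] by simp
  moreover have "\<rho> x \<le> z" if "f x \<le> t0 + (f y - t0) / 2" for x
  proof (rule ccontr)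
    assume "\<not> \<rho> x \<le> z"
    then have "f y \<le> f x" using y(2) by simp
    then show False using that \<open>t0 < f y\<close> by (simp add: field_simps)
  qed
  ultimately show ?thesis using that[of "(f y - t0) / 2"] by simp
qed

text \<open>A short coordinate segment along the negative gradient pays for its length by the
  decrease of \<open>D \<circ> f\<close>, up to the factor m. The slack m > 1 absorbs both the shift
  e and the variation of the metric along the segment.\<close>

lemma gradient_descent_step:
  assumes z: "t0 < f z" "f z < t1" and m: "1 < m" and e: "0 < e" "b (f z) + e < m\<^sup>2 * b (f z)"
    and D: "\<And>s. t0 \<le> s \<Longrightarrow> s \<le> t1 \<Longrightarrow> (D has_real_derivative 1 / sqrt (b s + e)) (at s)"
  shows "\<exists>w. D (f w) < D (f z) \<and> riemannian_dist A g w z < m * (D (f z) - D (f w))"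
proof -
  define c where "c = chart_at A z"
  have c: "c \<in> A" "z \<in> fst c" using chart_at by (auto simp: c_def)
  let ?F = "f \<circ> chart_inv c"
  define x where "x = snd c z"
  have x: "x \<in> snd c ` fst c" using c by (simp add: x_def)
  have Fx: "?F x = f z" using chart_inv_left[OF c] by (simp add: x_def)
  define X where "X = coord_gradient (g c) ?F x"
  define \<beta> where "\<beta> = b (f z)"
  have beta: "0 < \<beta>" using b_pos[OF z] by (simp add: \<beta>_def)
  have mX: "mnorm c x X = sqrt \<beta>" using gradient_identity(3)[OF c(1) x] Fx by (simp add: X_def \<beta>_def)
  define \<delta> where "\<delta> = \<beta> / sqrt (\<beta> + e)"
  have "sqrt (\<beta> + e) < sqrt (m\<^sup>2 * \<beta>)" using e by (simp add: \<beta>_def)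
  then have "sqrt (\<beta> + e) < m * sqrt \<beta>" using m by (simp add: real_sqrt_mult)
  then have "sqrt \<beta> * sqrt (\<beta> + e) < sqrt \<beta> * (m * sqrt \<beta>)" using beta by simp
  also have "\<dots> = m * \<beta>" using beta by simp
  finally have "sqrt \<beta> < m * \<delta>" using beta e by (simp add: \<delta>_def field_simps)
  \<comment> \<open>sqrt \<beta> is the metric norm of the gradient X and \<delta> the rate at which
    D decreases along - X. The gap between sqrt \<beta> and m * \<delta> leaves room for nearby
    points and difference quotients.\<close>
  then obtain \<kappa> where \<kappa>: "sqrt \<beta> < \<kappa>" "\<kappa> < m * \<delta>" using dense by blast
  have \<kappa>0: "0 < \<kappa>" using \<kappa>(1) beta by (smt (verit) real_sqrt_gt_zero)
  have l0: "((\<lambda>t. x + t *\<^sub>R (- X)) \<longlongrightarrow> x) (nhds 0)" by (auto intro!: tendsto_eq_intros filterlim_ident)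
  have "continuous_on (snd c ` fst c) (\<lambda>y. mnorm c y X)"
    by (rule mnorm_continuous[OF c(1)]) (auto intro!: continuous_intros)
  then have "isCont (\<lambda>y. mnorm c y X) x" using x continuous_on_eq_continuous_at[OF chart_open(2)[OF c(1)]] by blast
  then have "((\<lambda>y. mnorm c y X) \<longlongrightarrow> mnorm c x X) (nhds x)"
    using tendsto_at_iff_tendsto_nhds[of "\<lambda>y. mnorm c y X" x] by (simp add: isCont_def)
  then have "\<forall>\<^sub>F y in nhds x. mnorm c y X < \<kappa>" by (rule order_tendstoD(2)) (simp add: mX \<kappa>(1))
  then have "\<forall>\<^sub>F y in nhds x. mnorm c y X < \<kappa> \<and> y \<in> snd c ` fst c"
    using eventually_nhds_in_open[OF chart_open(2)[OF c(1)] x] by (rule eventually_conj)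
  then have "\<forall>\<^sub>F t in nhds 0. mnorm c (x + t *\<^sub>R (- X)) X < \<kappa> \<and> x + t *\<^sub>R (- X) \<in> snd c ` fst c"
    using l0 by (rule eventually_compose_filterlim)
  then obtain \<tau> where \<tau>: "0 < \<tau>" "\<And>t. \<bar>t\<bar> < \<tau> \<Longrightarrow> mnorm c (x + t *\<^sub>R (- X)) X < \<kappa> \<and> x + t *\<^sub>R (- X) \<in> snd c ` fst c"
    by (auto simp: eventually_nhds_metric)
  have Fd: "((\<lambda>t. ?F (x + t *\<^sub>R (- X))) has_real_derivative - \<beta>) (at 0)"
  proof -
    have "frechet_derivative ?F (at x) (- X) = - \<beta>"
      using gradient_identity(2)[OF c(1) x] Fx linear_neg[OF has_derivative_linear[OF f_frechet[OF c(1) x]], of X]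
      by (simp add: X_def \<beta>_def)
    then show ?thesis using f_line[OF c(1), of x 0 "- X"] x by simp
  qed
  have "((\<lambda>t. D (?F (x + t *\<^sub>R (- X)))) has_real_derivative 1 / sqrt (\<beta> + e) * - \<beta>) (at 0)"
    by (rule DERIV_chain2[OF _ Fd]) (use D[OF f_bounds, of z] Fx in \<open>simp add: \<beta>_def\<close>)
  then have Dd: "((\<lambda>t. D (?F (x + t *\<^sub>R (- X)))) has_real_derivative - \<delta>) (at 0)" by (simp add: \<delta>_def)
  have "((\<lambda>t. (D (?F (x + t *\<^sub>R (- X))) - D (?F (x + 0 *\<^sub>R (- X)))) / (t - 0)) \<longlongrightarrow> - \<delta>) (at 0)"
    using Dd unfolding has_field_derivative_iff by simp
  moreover have "- \<delta> < - (\<kappa> / m)" using \<kappa>(2) m by (simp add: field_simps)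
  ultimately have "\<forall>\<^sub>F t in at 0. (D (?F (x + t *\<^sub>R (- X))) - D (?F (x + 0 *\<^sub>R (- X)))) / (t - 0) < - (\<kappa> / m)"
    by (rule order_tendstoD(2))
  then obtain \<sigma> where \<sigma>: "0 < \<sigma>" "\<And>t. t \<noteq> 0 \<Longrightarrow> \<bar>t\<bar> < \<sigma> \<Longrightarrow> (D (?F (x + t *\<^sub>R (- X))) - D (?F x)) / t < - (\<kappa> / m)"
    by (auto simp: eventually_at)
  define t where "t = min \<tau> \<sigma> / 2"
  have t: "0 < t" "t < \<tau>" "t < \<sigma>" using \<tau>(1) \<sigma>(1) by (auto simp: t_def)
  define y where "y = x + t *\<^sub>R (- X)"
  define w where "w = chart_inv c y"
  have "(D (?F y) - D (?F x)) / t < - (\<kappa> / m)" using \<sigma>(2)[of t] t by (simp add: y_def)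
  then have "D (f w) - D (f z) < - (\<kappa> / m) * t" using t Fx by (simp add: w_def pos_divide_less_eq)
  then have gap: "\<kappa> * t < m * (D (f z) - D (f w))" using m by (simp add: field_simps)
  have seg: "y + s *\<^sub>R (x - y) = x + (t * (1 - s)) *\<^sub>R (- X)" for s by (simp add: y_def algebra_simps)
  have st: "\<bar>t * (1 - s)\<bar> < \<tau>" if "0 \<le> s" "s \<le> 1" for s
  proof -
    have "t * (1 - s) \<le> t * 1" using t that by (intro mult_left_mono) auto
    moreover have "0 \<le> t * (1 - s)" using t that by simp
    ultimately show ?thesis using t(2) by linarith
  qed
  have xy: "x - y = t *\<^sub>R X" by (simp add: y_def)
  define \<gamma> where "\<gamma> = (\<lambda>s. chart_inv c (y + s *\<^sub>R (x - y)))"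
  have inV: "y + s *\<^sub>R (x - y) \<in> snd c ` fst c" if "0 \<le> s" "s \<le> 1" for s
    unfolding seg using \<tau>(2)[OF st[OF that]] by simp
  have len: "mnorm c (y + s *\<^sub>R (x - y)) (x - y) \<le> \<kappa> * t" if s: "0 \<le> s" "s \<le> 1" for s
  proof -
    have "mnorm c (y + s *\<^sub>R (x - y)) X \<le> \<kappa>" unfolding seg using \<tau>(2)[OF st[OF s]] by simp
    then have "t * mnorm c (y + s *\<^sub>R (x - y)) X \<le> t * \<kappa>" using t by (intro mult_left_mono) auto
    moreover have "mnorm c (y + s *\<^sub>R (x - y)) (x - y) = t * mnorm c (y + s *\<^sub>R (x - y)) X"
      unfolding xy mnorm_scaleR using t by simp
    ultimately show ?thesis by (simp add: mult.commute)
  qed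
  have "piecewise_C1_curve A \<gamma>" unfolding \<gamma>_def by (rule segment_curve(1)[OF c(1) inV])
  moreover have "curve_length A g \<gamma> \<le> \<kappa> * t" unfolding \<gamma>_def by (rule segment_curve(2)[OF c(1) inV len])
  moreover have "\<gamma> 0 = w" "\<gamma> 1 = z" using chart_inv_left[OF c] by (auto simp: \<gamma>_def w_def x_def)
  ultimately have "riemannian_dist A g w z \<le> \<kappa> * t" using dist_le_length by fastforce
  then have d: "riemannian_dist A g w z < m * (D (f z) - D (f w))" using gap by linarith
  have "0 < \<kappa> * t" using \<kappa>0 t by simp
  then have "0 < m * (D (f z) - D (f w))" using gap by linarith
  then have "D (f w) < D (f z)" using m by (simp add: zero_less_mult_iff)
  then show ?thesis using d by blast
qed

text \<open>Maximise the distance minus m times \<open>D \<circ> f\<close> over the points of level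
  at most f x. A descent step excludes a maximum away from the focal set, and near it the distance
  is at most z. This bounds the distance of x by m * (D (f x) - D t0) + z, while the calibration
  bounds D (f y) - D t0 by the distance of y; then m tends to 1 and z to 0. The hypothesis f x < t1
  keeps b positive on the range of descent.\<close>

lemma setdist_mono:
  assumes x: "f x < t1" and xy: "f x \<le> f y"
  shows "\<rho> x \<le> \<rho> y"
proof -
  have \<rho>0: "0 \<le> \<rho> p" for p by (intro setdist_greatest focal_nonempty riemannian_dist_nonneg)
  have key: "\<rho> x \<le> m * \<rho> y + z" if m: "1 < m" and z: "0 < z" for m z
  proof -
    obtain \<tau> where \<tau>: "0 < \<tau>" "\<And>x. f x \<le> t0 + \<tau> \<Longrightarrow> \<rho> x \<le> z" using setdist_small_near_focal[OF z] by blast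
    show ?thesis
    proof (cases "f x \<le> t0 + \<tau>")
      case True
      then have "\<rho> x \<le> z" by (rule \<tau>(2))
      moreover have "0 \<le> m * \<rho> y" using m \<rho>0 by simp
      ultimately show ?thesis by linarith
    next
      case False
      let ?I = "{t0 + \<tau>..f x}"
      have "continuous_on ?I b" using \<tau>(1) x by (intro continuous_on_subset[OF b_continuous]) auto
      moreover have "?I \<noteq> {}" using False by simp
      ultimately obtain s0 where s0: "s0 \<in> ?I" "\<And>s. s \<in> ?I \<Longrightarrow> b s0 \<le> b s"
        using continuous_attains_inf[OF compact_Icc] by metis
      have bs0: "0 < b s0" using s0(1) \<tau>(1) x by (intro b_pos) auto
      \<comment> \<open>With this shift b + e < m^2 * b holds on the whole interval, as a descent
        step demands.\<close>
      define e where "e = b s0 * (m\<^sup>2 - 1) / 2"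
      have m2: "1 < m\<^sup>2" using m by (simp add: one_less_power)
      have e0: "0 < e" using bs0 m2 by (simp add: e_def)
      have e: "b s + e < m\<^sup>2 * b s" if "s \<in> ?I" for s
      proof -
        have "e < b s0 * (m\<^sup>2 - 1)" using bs0 m2 by (simp add: e_def)
        also have "\<dots> \<le> b s * (m\<^sup>2 - 1)" using s0(2)[OF that] m2 by (intro mult_right_mono) auto
        finally show ?thesis by (simp add: algebra_simps)
      qed
      obtain D where D: "\<And>s. t0 \<le> s \<Longrightarrow> s \<le> t1 \<Longrightarrow> (D has_real_derivative 1 / sqrt (b s + e)) (at s)"
        using regularized_arclength[OF e0] by blast
      have Dmono: "D s < D r" if "t0 \<le> s" "s < r" "r \<le> t1" for s r
      proof (rule DERIV_pos_imp_increasing[OF that(2)])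
        fix u assume "s \<le> u" "u \<le> r"
        then have u: "t0 \<le> u" "u \<le> t1" using that by auto
        then have "0 < 1 / sqrt (b u + e)" using b_nonneg[OF u] e0 by simp
        then show "\<exists>y. (D has_real_derivative y) (at u) \<and> 0 < y" using D[OF u] by blast
      qed
      have Dcont: "continuous_on {t0..t1} D"
        using D by (intro continuous_at_imp_continuous_on) (auto intro!: DERIV_isCont[OF D])
      let ?K = "{p. f p \<le> f x}"
      have "closed ?K" by (intro closed_Collect_le f_cont continuous_on_const)
      then have K: "compact ?K" using compact_manifold compact_Int_closed[of UNIV] by simp
      have "continuous_on ?K (\<lambda>p. \<rho> p - m * D (f p))"
        using f_bounds
        by (intro continuous_intros continuous_on_subset[OF setdist_continuous[OF focal_nonempty]]
            continuous_on_compose2[OF Dcont continuous_on_subset[OF f_cont]]) auto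
      then obtain w where w: "w \<in> ?K" "\<And>p. p \<in> ?K \<Longrightarrow> \<rho> p - m * D (f p) \<le> \<rho> w - m * D (f w)"
        using continuous_attains_sup[OF K] by blast
      have fw: "f w \<le> t0 + \<tau>"
      proof (rule ccontr)
        assume "\<not> f w \<le> t0 + \<tau>"
        then have fw: "f w \<in> ?I" "t0 < f w" "f w < t1" using w(1) \<tau>(1) x by auto
        obtain v where v: "D (f v) < D (f w)" "riemannian_dist A g v w < m * (D (f w) - D (f v))"
          using gradient_descent_step[OF fw(2,3) m e0 e[OF fw(1)] D] by blast
        have "f v \<le> f w"
        proof (rule ccontr)
          assume "\<not> f v \<le> f w"
          then show False using Dmono[of "f w" "f v"] f_bounds v(1) by auto
        qed
        then have "\<rho> v - m * D (f v) \<le> \<rho> w - m * D (f w)" using w by auto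
        moreover have "\<rho> w \<le> \<rho> v + riemannian_dist A g v w" by (rule setdist_triangle[OF focal_nonempty])
        ultimately show False using v(2) by (simp add: algebra_simps)
      qed
      have "\<rho> x - m * D (f x) \<le> \<rho> w - m * D (f w)" using w(2) by simp
      moreover have "\<rho> w \<le> z" using \<tau>(2)[OF fw] .
      moreover have "D t0 \<le> D (f w)" using Dmono[of t0 "f w"] f_bounds[of w] by (cases "f w = t0") auto
      moreover have "D (f x) \<le> D (f y)" using Dmono[of "f x" "f y"] f_bounds xy by (cases "f x = f y") auto
      moreover have "D (f y) - D t0 \<le> \<rho> y" by (rule arclength_le_setdist[OF e0 D])
      ultimately have "m * (D (f x) - D (f w)) \<le> m * \<rho> y" using m by (intro mult_left_mono) auto
      then show ?thesis using \<open>\<rho> x - m * D (f x) \<le> \<rho> w - m * D (f w)\<close> \<open>\<rho> w \<le> z\<close>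
        by (simp add: algebra_simps)
    qed
  qed
  show ?thesis
  proof (rule field_le_epsilon)
    fix e :: real assume e: "0 < e"
    define m where "m = 1 + e / (2 * (\<rho> y + 1))"
    have "1 < m" using e \<rho>0[of y] by (simp add: m_def)
    from key[OF this, of "e/2"] e have "\<rho> x \<le> m * \<rho> y + e/2" by simp
    moreover have "(m - 1) * \<rho> y \<le> e/2"
    proof -
      have "(m - 1) * \<rho> y \<le> (m - 1) * (\<rho> y + 1)" using \<open>1 < m\<close> by (intro mult_left_mono) auto
      also have "\<dots> = e/2" using \<rho>0[of y] by (simp add: m_def field_simps)
      finally show ?thesis .
    qed
    ultimately show "\<rho> x \<le> \<rho> y + e" by (simp add: algebra_simps)
  qed
qed

end

section \<open>The Hessian at the focal set\<close>

text \<open>L'Hopital's rule reduces the limit to a difference quotient of the first derivative at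
  0, the one place where a second derivative is given.\<close>

lemma second_order_limit:
  fixes \<phi> \<phi>' :: "real \<Rightarrow> real"
  assumes r: "0 < r" and d: "\<And>t. \<bar>t\<bar> < r \<Longrightarrow> (\<phi> has_real_derivative \<phi>' t) (at t)"
    and 0: "\<phi>' 0 = 0" and d2: "(\<phi>' has_real_derivative m) (at 0)"
  shows "((\<lambda>t. (\<phi> t - \<phi> 0) / t\<^sup>2) \<longlongrightarrow> m / 2) (at_right 0)"
proof (rule lhopital_right_0[where f' = \<phi>' and g' = "\<lambda>t. 2 * t"])
  have "isCont \<phi> 0" using d[of 0] r by (auto intro: DERIV_isCont)
  then have "(\<phi> \<longlongrightarrow> \<phi> 0) (at_right 0)" by (simp add: isCont_def filterlim_at_split)
  then show "((\<lambda>t. \<phi> t - \<phi> 0) \<longlongrightarrow> 0) (at_right 0)" by (simp add: LIM_zero_iff)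
  show "((\<lambda>t::real. t\<^sup>2) \<longlongrightarrow> 0) (at_right 0)" by (auto intro!: tendsto_eq_intros)
  show "\<forall>\<^sub>F t in at_right 0. t\<^sup>2 \<noteq> (0::real)" "\<forall>\<^sub>F t in at_right 0. 2 * t \<noteq> (0::real)"
    by (auto simp: eventually_at_right_field intro!: exI[of _ 1])
  show "\<forall>\<^sub>F t in at_right 0. ((\<lambda>t. \<phi> t - \<phi> 0) has_real_derivative \<phi>' t) (at t)"
    using r by (auto intro!: eventually_at_rightI[of 0 r] derivative_eq_intros d)
  show "\<forall>\<^sub>F t in at_right 0. ((\<lambda>t::real. t\<^sup>2) has_real_derivative 2 * t) (at t)"
    by (auto intro!: always_eventually derivative_eq_intros)
  have "((\<lambda>t. (\<phi>' t - \<phi>' 0) / (t - 0)) \<longlongrightarrow> m) (at 0)" using d2 unfolding has_field_derivative_iff .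
  then have "((\<lambda>t. \<phi>' t / t) \<longlongrightarrow> m) (at_right 0)" using 0 by (simp add: filterlim_at_split)
  then have "((\<lambda>t. \<phi>' t / t / 2) \<longlongrightarrow> m / 2) (at_right 0)" by (intro tendsto_intros) auto
  then show "((\<lambda>t. \<phi>' t / (2 * t)) \<longlongrightarrow> m / 2) (at_right 0)" by (simp add: mult.commute)
qed

lemma linear_axis_bound:
  fixes l :: "real ^ 'n \<Rightarrow> real"
  assumes l: "linear l" and e: "\<And>i. \<bar>l (axis i 1)\<bar> \<le> e"
  shows "\<bar>l w\<bar> \<le> real CARD('n) * e * norm w"
proof -
  have "l w = l (\<Sum>i\<in>UNIV. (w $ i) *s axis i 1)" by (simp add: basis_expansion)
  also have "\<dots> = (\<Sum>i\<in>UNIV. (w $ i) * l (axis i 1))"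
    using l by (simp add: linear_sum linear_cmul scalar_mult_eq_scaleR)
  finally have "\<bar>l w\<bar> \<le> (\<Sum>i\<in>UNIV. \<bar>w $ i\<bar> * \<bar>l (axis i 1)\<bar>)" by (simp add: sum_abs abs_mult[symmetric])
  also have "\<dots> \<le> (\<Sum>i\<in>(UNIV::'n set). norm w * e)"
    by (intro sum_mono mult_mono component_le_norm_cart e) auto
  finally show ?thesis by (simp add: mult_ac)
qed

lemma has_derivative_vec_nth: "(X has_derivative X') F \<Longrightarrow> ((\<lambda>y. X y $ i) has_derivative (\<lambda>v. X' v $ i)) F"
  by (rule bounded_linear.has_derivative[OF bounded_linear_vec_nth])

text \<open>At a zero of X the derivative of G drops out of the product rule. Hence derivatives of
  the metric do not appear in the Hessian at a focal point.\<close>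

lemma has_derivative_matrix_vector_zero:
  fixes G :: "'a::real_normed_vector \<Rightarrow> real ^ 'n ^ 'm"
  assumes G: "G differentiable (at x)" and X: "(X has_derivative X') (at x)" and 0: "X x = 0"
  shows "((\<lambda>y. w \<bullet> (G y *v X y)) has_derivative (\<lambda>v. w \<bullet> (G x *v X' v))) (at x)"
proof -
  obtain G' where G': "(G has_derivative G') (at x)" using G by (auto simp: differentiable_def)
  have "((\<lambda>y. \<Sum>i\<in>UNIV. w $ i * (\<Sum>j\<in>UNIV. G y $ i $ j * X y $ j)) has_derivative
      (\<lambda>v. \<Sum>i\<in>UNIV. w $ i * (\<Sum>j\<in>UNIV. G x $ i $ j * X' v $ j + G' v $ i $ j * X x $ j))) (at x)"
    by (intro has_derivative_sum has_derivative_mult_right has_derivative_mult has_derivative_vec_nth G' X)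
  then show ?thesis using 0 by (simp add: inner_vec_def matrix_vector_mult_def)
qed

context riemannian_manifold
begin

lemma chart_ball_lower:
  assumes c: "c \<in> A" and r: "cball z r \<subseteq> snd c ` fst c" "0 < r"
  obtains b0 where "0 < b0" "\<And>x v. x \<in> cball z r \<Longrightarrow> b0 * norm v \<le> mnorm c x v"
proof -
  let ?K = "cball z r \<times> sphere (0::real^'n) 1"
  have cont: "continuous_on ?K (\<lambda>z. mnorm c (fst z) (snd z))"
    by (rule mnorm_continuous[OF c]) (use r in \<open>auto intro!: continuous_intros\<close>)
  have comp: "compact ?K" by (intro compact_Times compact_cball compact_sphere)
  have ne: "?K \<noteq> {}" using r by (auto simp: vector_choose_size intro!: exI[of _ "axis undefined 1"])
  obtain w where w: "w \<in> ?K" "\<And>y. y \<in> ?K \<Longrightarrow> mnorm c (fst w) (snd w) \<le> mnorm c (fst y) (snd y)"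
    using continuous_attains_inf[OF comp ne cont] by blast
  define b0 where "b0 = mnorm c (fst w) (snd w)"
  have wV: "fst w \<in> snd c ` fst c" "snd w \<noteq> 0" using w(1) r by auto
  have "0 < b0" unfolding b0_def mnorm_def using metric_pos[OF c wV] by simp
  moreover have "b0 * norm v \<le> mnorm c x v" if x: "x \<in> cball z r" for x v
  proof (cases "v = 0")
    case True
    then show ?thesis by (simp add: mnorm_def)
  next
    case False
    have "b0 \<le> mnorm c x (v /\<^sub>R norm v)" using w(2)[of "(x, v /\<^sub>R norm v)"] x False by (simp add: b0_def)
    then have "norm v * b0 \<le> norm v * mnorm c x (v /\<^sub>R norm v)" by (intro mult_left_mono) auto
    moreover have "norm v * mnorm c x (v /\<^sub>R norm v) = mnorm c x v"
      using mnorm_scaleR[of c x "norm v" "v /\<^sub>R norm v"] False by simp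
    ultimately show ?thesis by (simp add: mult.commute)
  qed
  ultimately show ?thesis by (rule that)
qed

end

section \<open>The Hessian at a focal point as a multiple of a projection\<close>

context isopar
begin

definition f_gradient :: "('m, 'n) chart \<Rightarrow> real ^ 'n \<Rightarrow> real ^ 'n" where
  "f_gradient c = coord_gradient (g c) (f \<circ> chart_inv c)"

text \<open>At a critical point the derivative of the gradient field is the Hessian with one index
  raised by the metric; no connection terms enter there.\<close>

definition focal_hessian :: "('m, 'n) chart \<Rightarrow> 'm \<Rightarrow> real ^ 'n ^ 'n" where
  "focal_hessian c p = matrix (frechet_derivative (f_gradient c) (at (snd c p)))"

lemma f_gradient_zero:
  assumes c: "c \<in> A" "x \<in> snd c ` fst c" and "(f \<circ> chart_inv c) x = t0"
  shows "f_gradient c x = 0" "frechet_derivative (f \<circ> chart_inv c) (at x) w = 0"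
proof -
  have "f_gradient c x \<bullet> (g c x *v f_gradient c x) = 0"
    using gradient_identity(1)[OF c] assms(3) b_t0 by (simp add: f_gradient_def)
  then show z: "f_gradient c x = 0" using metric_spd[OF c] unfolding spd_def by (metis less_irrefl)
  show "frechet_derivative (f \<circ> chart_inv c) (at x) w = 0"
    using coord_gradient_inner[where G = "g c" and w = w, OF f_diff[OF c] metric_spd[OF c]] z by (simp add: f_gradient_def)
qed

context
  fixes c :: "('m, 'n) chart" and p :: 'm
  assumes c: "c \<in> A" "p \<in> fst c" and p: "f p = t0"
begin

lemma focal_x: "snd c p \<in> snd c ` fst c" "(f \<circ> chart_inv c) (snd c p) = t0"
  using c p chart_inv_left[OF c] by auto

lemma f_gradient_derivative: "(f_gradient c has_derivative (\<lambda>v. focal_hessian c p *v v)) (at (snd c p))"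
proof -
  have "f_gradient c differentiable (at (snd c p))"
    unfolding f_gradient_def by (rule gradient_differentiable(1)[OF c(1) focal_x(1) f_C2[OF c(1)]])
  then have d: "(f_gradient c has_derivative frechet_derivative (f_gradient c) (at (snd c p))) (at (snd c p))"
    by (simp add: frechet_derivative_works)
  have "focal_hessian c p *v v = frechet_derivative (f_gradient c) (at (snd c p)) v" for v
    unfolding focal_hessian_def using has_derivative_linear[OF d]
    by (intro matrix_works) (simp add: linear_matrix_vector_mul_eq)
  then show ?thesis using d by simp
qed

lemma hessian_derivative:
  "((\<lambda>y. frechet_derivative (f \<circ> chart_inv c) (at y) w) has_derivative
     (\<lambda>v. w \<bullet> (g c (snd c p) *v (focal_hessian c p *v v)))) (at (snd c p))"
proof (rule has_derivative_transform_within_open[OF _ chart_open(2)[OF c(1)] focal_x(1)])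
  show "((\<lambda>y. w \<bullet> (g c y *v f_gradient c y)) has_derivative
     (\<lambda>v. w \<bullet> (g c (snd c p) *v (focal_hessian c p *v v)))) (at (snd c p))"
    by (rule has_derivative_matrix_vector_zero[OF metric_differentiable[OF c(1) focal_x(1)] f_gradient_derivative
        f_gradient_zero(1)[OF c(1) focal_x]])
  show "w \<bullet> (g c y *v f_gradient c y) = frechet_derivative (f \<circ> chart_inv c) (at y) w" if "y \<in> snd c ` fst c" for y
    unfolding f_gradient_def by (rule coord_gradient_inner[where G = "g c", OF f_diff[OF c(1) that] metric_spd[OF c(1) that]])
qed

lemma hessian_symmetric:
  "w \<bullet> (g c (snd c p) *v (focal_hessian c p *v v)) = v \<bullet> (g c (snd c p) *v (focal_hessian c p *v w))"
  using second_derivative_symmetric[OF chart_open(2)[OF c(1)] focal_x(1) f_frechet[OF c(1)]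
      hessian_derivative[of w] hessian_derivative[of v]] by simp

lemma focal_line:
  obtains r where "0 < r" "\<And>t. \<bar>t\<bar> < r \<Longrightarrow> snd c p + t *\<^sub>R v \<in> snd c ` fst c"
proof -
  have l0: "((\<lambda>t. snd c p + t *\<^sub>R v) \<longlongrightarrow> snd c p) (nhds 0)" by (auto intro!: tendsto_eq_intros filterlim_ident)
  have "\<forall>\<^sub>F y in nhds (snd c p). y \<in> snd c ` fst c"
    by (rule eventually_nhds_in_open[OF chart_open(2)[OF c(1)] focal_x(1)])
  then have "\<forall>\<^sub>F t in nhds 0. snd c p + t *\<^sub>R v \<in> snd c ` fst c" using l0 by (rule eventually_compose_filterlim)
  then show ?thesis using that by (auto simp: eventually_nhds_metric)
qed

lemma hessian_line:
  "((\<lambda>t. frechet_derivative (f \<circ> chart_inv c) (at (snd c p + t *\<^sub>R v)) v) has_real_derivative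
     v \<bullet> (g c (snd c p) *v (focal_hessian c p *v v))) (at 0)"
proof -
  have "((\<lambda>t. snd c p + t *\<^sub>R v) has_vector_derivative v) (at 0)" by (auto intro!: derivative_eq_intros)
  from has_vector_derivative_chain[OF this, of "\<lambda>y. frechet_derivative (f \<circ> chart_inv c) (at y) v"] hessian_derivative[of v]
  show ?thesis by (simp add: has_real_derivative_iff_has_vector_derivative)
qed

lemma focal_quadratic_limit:
  "((\<lambda>t. ((f \<circ> chart_inv c) (snd c p + t *\<^sub>R v) - t0) / t\<^sup>2) \<longlongrightarrow>
     (v \<bullet> (g c (snd c p) *v (focal_hessian c p *v v))) / 2) (at_right 0)"
proof -
  obtain r where r: "0 < r" "\<And>t. \<bar>t\<bar> < r \<Longrightarrow> snd c p + t *\<^sub>R v \<in> snd c ` fst c" using focal_line by blast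
  have z: "frechet_derivative (f \<circ> chart_inv c) (at (snd c p + 0 *\<^sub>R v)) v = 0"
    using f_gradient_zero(2)[OF c(1) focal_x] by simp
  show ?thesis
    using second_order_limit[OF r(1) f_line[OF c(1) r(2)] z hessian_line] focal_x(2) by simp
qed

text \<open>The second-order expansion of \<open>\<bar>\<nabla>f\<bar>\<^sup>2 = b(f)\<close> at a focal point.\<close>

lemma hessian_square_form:
  "(focal_hessian c p *v v) \<bullet> (g c (snd c p) *v (focal_hessian c p *v v)) =
     b' t0 / 2 * (v \<bullet> (g c (snd c p) *v (focal_hessian c p *v v)))"
proof -
  let ?P = "focal_hessian c p *v v" and ?x = "snd c p"
  let ?l = "\<lambda>t::real. snd c p + t *\<^sub>R v" and ?F = "f \<circ> chart_inv c"
  obtain r where r: "0 < r" "\<And>t. \<bar>t\<bar> < r \<Longrightarrow> ?l t \<in> snd c ` fst c" using focal_line by blast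
  define q where "q = (\<lambda>t. (?F (?l t) - t0) / t\<^sup>2)"
  define m where "m = (v \<bullet> (g c ?x *v ?P)) / 2"
  have q: "(q \<longlongrightarrow> m) (at_right 0)" unfolding q_def m_def by (rule focal_quadratic_limit)
  \<comment> \<open>Along the line f - t0 is O(t^2), so the error of the expansion of b, quadratic
    in f - t0, is O(t^4) and negligible against t^2.\<close>
  have "((\<lambda>t. (b (?F (?l t)) - b' t0 * (?F (?l t) - t0)) / t\<^sup>2) \<longlongrightarrow> 0) (at_right 0)"
  proof (rule Lim_null_comparison)
    have "((\<lambda>t. Cl * (q t * t)\<^sup>2) \<longlongrightarrow> Cl * (m * 0)\<^sup>2) (at_right 0)" by (intro tendsto_intros q)
    then show "((\<lambda>t. Cl * (q t * t)\<^sup>2) \<longlongrightarrow> 0) (at_right 0)" by simp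
    have "norm ((b (?F (?l t)) - b' t0 * (?F (?l t) - t0)) / t\<^sup>2) \<le> Cl * (q t * t)\<^sup>2" if "0 < t" for t
    proof -
      have "\<bar>b (?F (?l t)) - b' t0 * (?F (?l t) - t0)\<bar> \<le> Cl * (?F (?l t) - t0)\<^sup>2"
        using b_taylor[of t0 "?F (?l t)"] f_bounds t01 b_t0 by simp
      also have "\<dots> = Cl * (q t * t)\<^sup>2 * t\<^sup>2" using that by (simp add: q_def power2_eq_square)
      finally show ?thesis using that by (simp add: pos_divide_le_eq)
    qed
    then show "\<forall>\<^sub>F t in at_right 0. norm ((b (?F (?l t)) - b' t0 * (?F (?l t) - t0)) / t\<^sup>2) \<le> Cl * (q t * t)\<^sup>2"
      by (auto intro!: eventually_at_rightI[of 0 1])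
  qed
  from tendsto_add[OF this tendsto_mult[OF tendsto_const[of "b' t0"] q]]
  have "((\<lambda>t. (b (?F (?l t)) - b' t0 * (?F (?l t) - t0)) / t\<^sup>2 + b' t0 * q t) \<longlongrightarrow> b' t0 * m) (at_right 0)" by simp
  moreover have "(b (?F (?l t)) - b' t0 * (?F (?l t) - t0)) / t\<^sup>2 + b' t0 * q t = b (?F (?l t)) / t\<^sup>2" for t
    unfolding q_def times_divide_eq_right add_divide_distrib[symmetric] by simp
  ultimately have L1: "((\<lambda>t. b (?F (?l t)) / t\<^sup>2) \<longlongrightarrow> b' t0 * m) (at_right 0)" by simp
  have Xi: "((\<lambda>t. f_gradient c (?l t) $ i / t) \<longlongrightarrow> ?P $ i) (at_right 0)" for i
  proof -
    have "((\<lambda>t. snd c p + t *\<^sub>R v) has_vector_derivative v) (at 0)" by (auto intro!: derivative_eq_intros)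
    from has_vector_derivative_chain[OF this, of "\<lambda>y. f_gradient c y $ i"] has_derivative_vec_nth[OF f_gradient_derivative, of i]
    have "((\<lambda>t. f_gradient c (?l t) $ i) has_real_derivative ?P $ i) (at 0)"
      by (simp add: has_real_derivative_iff_has_vector_derivative)
    then have "((\<lambda>t. (f_gradient c (?l t) $ i - f_gradient c (?l 0) $ i) / (t - 0)) \<longlongrightarrow> ?P $ i) (at 0)"
      unfolding has_field_derivative_iff .
    then show ?thesis using f_gradient_zero(1)[OF c(1) focal_x] by (simp add: filterlim_at_split)
  qed
  have Gij: "((\<lambda>t. g c (?l t) $ i $ j) \<longlongrightarrow> g c ?x $ i $ j) (at_right 0)" for i j
  proof -
    have "isCont (g c) (?l 0)" using differentiable_imp_continuous_within[OF metric_differentiable[OF c(1) focal_x(1)]] by simp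
    moreover have "isCont ?l 0" by (intro continuous_intros)
    ultimately have "isCont (\<lambda>t. g c (?l t)) 0" using isCont_o2[where f = ?l and g = "g c"] by blast
    then have "((\<lambda>t. g c (?l t)) \<longlongrightarrow> g c ?x) (at_right 0)" by (simp add: isCont_def filterlim_at_split)
    then show ?thesis by (intro tendsto_vec_nth)
  qed
  \<comment> \<open>The same quotient computed from the squared norm of the gradient, where the
    gradient divided by t tends to the Hessian applied to v.\<close>
  have "((\<lambda>t. \<Sum>i\<in>UNIV. f_gradient c (?l t) $ i / t * (\<Sum>j\<in>UNIV. g c (?l t) $ i $ j * (f_gradient c (?l t) $ j / t)))
      \<longlongrightarrow> (\<Sum>i\<in>UNIV. ?P $ i * (\<Sum>j\<in>UNIV. g c ?x $ i $ j * ?P $ j))) (at_right 0)"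
    by (intro tendsto_intros Xi Gij)
  moreover have "(\<Sum>i\<in>UNIV. ?P $ i * (\<Sum>j\<in>UNIV. g c ?x $ i $ j * ?P $ j)) = ?P \<bullet> (g c ?x *v ?P)"
    by (simp add: inner_vec_def matrix_vector_mult_def)
  moreover have "\<forall>\<^sub>F t in at_right 0. (\<Sum>i\<in>UNIV. f_gradient c (?l t) $ i / t * (\<Sum>j\<in>UNIV. g c (?l t) $ i $ j * (f_gradient c (?l t) $ j / t)))
      = b (?F (?l t)) / t\<^sup>2"
  proof (rule eventually_at_rightI[OF _ r(1)])
    fix t assume t: "t \<in> {0<..<r}"
    have "(\<Sum>i\<in>UNIV. f_gradient c (?l t) $ i / t * (\<Sum>j\<in>UNIV. g c (?l t) $ i $ j * (f_gradient c (?l t) $ j / t)))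
       = (f_gradient c (?l t) \<bullet> (g c (?l t) *v f_gradient c (?l t))) / t\<^sup>2"
      by (simp add: inner_vec_def matrix_vector_mult_def sum_divide_distrib power2_eq_square sum_distrib_left)
    then show "(\<Sum>i\<in>UNIV. f_gradient c (?l t) $ i / t * (\<Sum>j\<in>UNIV. g c (?l t) $ i $ j * (f_gradient c (?l t) $ j / t)))
      = b (?F (?l t)) / t\<^sup>2"
      using gradient_identity(1)[OF c(1) r(2)[of t]] t by (simp add: f_gradient_def)
  qed
  ultimately have "((\<lambda>t. b (?F (?l t)) / t\<^sup>2) \<longlongrightarrow> ?P \<bullet> (g c ?x *v ?P)) (at_right 0)"
    using Lim_transform_eventually by fastforce
  from tendsto_unique[OF _ this L1] show ?thesis by (simp add: m_def)
qed

text \<open>Polarisation of the quadratic identity. The symmetry of the metric and that of the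
  Hessian with respect to it combine the mixed terms, and nondegeneracy of the metric turns the
  forms into an operator identity.\<close>

lemma hessian_idempotent: "focal_hessian c p ** focal_hessian c p = (b' t0 / 2) *\<^sub>R focal_hessian c p"
proof -
  let ?P = "focal_hessian c p" and ?G = "g c (snd c p)"
  have spd: "spd ?G" by (rule metric_spd[OF c(1) focal_x(1)])
  have polar: "(?P *v u) \<bullet> (?G *v (?P *v v)) = b' t0 / 2 * (u \<bullet> (?G *v (?P *v v)))" for u v
  proof -
    have "(?P *v (u + v)) \<bullet> (?G *v (?P *v (u + v))) = b' t0 / 2 * ((u + v) \<bullet> (?G *v (?P *v (u + v))))"
      by (rule hessian_square_form)
    moreover have "(?P *v v) \<bullet> (?G *v (?P *v u)) = (?P *v u) \<bullet> (?G *v (?P *v v))" by (rule spd_commute[OF spd])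
    moreover have "v \<bullet> (?G *v (?P *v u)) = u \<bullet> (?G *v (?P *v v))" by (rule hessian_symmetric)
    ultimately have "2 * ((?P *v u) \<bullet> (?G *v (?P *v v))) = 2 * (b' t0 / 2 * (u \<bullet> (?G *v (?P *v v))))"
      using hessian_square_form[of u] hessian_square_form[of v]
      by (simp only: matrix_vector_right_distrib inner_add_left inner_add_right distrib_left)
    then show ?thesis by linarith
  qed
  have "?P *v (?P *v v) = (b' t0 / 2) *\<^sub>R (?P *v v)" for v
  proof (rule spd_inner_eqI[OF spd])
    fix u
    have "u \<bullet> (?G *v (?P *v (?P *v v))) = (?P *v v) \<bullet> (?G *v (?P *v u))" by (rule hessian_symmetric)
    also have "\<dots> = (?P *v u) \<bullet> (?G *v (?P *v v))" by (rule spd_commute[OF spd])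
    finally show "u \<bullet> (?G *v (?P *v (?P *v v))) = u \<bullet> (?G *v ((b' t0 / 2) *\<^sub>R (?P *v v)))"
      using polar[of u v] by (simp only: matrix_vector_mult_scaleR inner_scaleR_right)
  qed
  then have "(?P ** ?P) *v v = ((b' t0 / 2) *\<^sub>R ?P) *v v" for v
    by (simp only: matrix_vector_mul_assoc[symmetric] scaleR_matrix_vector_assoc[symmetric])
  then show ?thesis by (simp add: matrix_eq)
qed

lemma hessian_trace:
  "trace (focal_hessian c p) = b' t0 / 2 * (real CARD('n) - real (dim {v. focal_hessian c p *v v = 0}))"
proof -
  let ?P = "focal_hessian c p"
  define e where "e = 2 / b' t0"
  have e: "e \<noteq> 0" "e * (b' t0 / 2) = 1" using b'_t0 by (auto simp: e_def)
  have ev: "(e *\<^sub>R ?P) *v v = e *\<^sub>R (?P *v v)" for v by (simp only: scaleR_matrix_vector_assoc)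
  have "((e *\<^sub>R ?P) ** (e *\<^sub>R ?P)) *v v = (e *\<^sub>R ?P) *v v" for v
  proof -
    have "?P *v (?P *v v) = (b' t0 / 2) *\<^sub>R (?P *v v)"
      using hessian_idempotent by (metis matrix_vector_mul_assoc scaleR_matrix_vector_assoc)
    then show ?thesis using e(2)
      by (simp only: matrix_vector_mul_assoc[symmetric] ev matrix_vector_mult_scaleR scaleR_scaleR mult_1_right)
  qed
  then have "(e *\<^sub>R ?P) ** (e *\<^sub>R ?P) = e *\<^sub>R ?P" by (simp add: matrix_eq)
  from trace_idempotent[OF this] have "trace (e *\<^sub>R ?P) = real CARD('n) - real (dim {v. ?P *v v = 0})"
    using e(1) by (simp add: ev)
  moreover have "trace (e *\<^sub>R ?P) = e * trace ?P" by (simp add: trace_def sum_distrib_left)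
  ultimately show ?thesis using e by (metis mult.assoc mult.commute mult_1_right)
qed

lemma hessian_positive_direction:
  assumes "focal_hessian c p \<noteq> 0" obtains v where "0 < v \<bullet> (g c (snd c p) *v (focal_hessian c p *v v))"
proof -
  obtain v where v: "focal_hessian c p *v v \<noteq> 0" using assms by (metis matrix_eq matrix_vector_mult_0)
  then have "0 < (focal_hessian c p *v v) \<bullet> (g c (snd c p) *v (focal_hessian c p *v v))"
    by (rule metric_pos[OF c(1) focal_x(1)])
  then have "0 < v \<bullet> (g c (snd c p) *v (focal_hessian c p *v v))"
    unfolding hessian_square_form using b'_t0 by (simp add: zero_less_mult_iff)
  then show ?thesis by (rule that)
qed

text \<open>In a slice chart the focal set is a piece of the subspace W, and the gradient of f
  vanishes on it. Differentiating the gradient along lines in W puts the image of W under the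
  injective transition derivative into the kernel.\<close>

lemma focal_kernel_dim:
  assumes S: "submanifold_of_dim A (f -` {t0}) d1"
  shows "d1 \<le> dim {v. focal_hessian c p *v v = 0}"
proof -
  \<comment> \<open>The slice chart is only known to be compatible with A, so its inverse and its
    transition maps are derived from compatibility.\<close>
  obtain e W where e: "is_chart e" "\<And>c'. c' \<in> A \<Longrightarrow> compatible_charts e c'" "p \<in> fst e"
    and W: "subspace W" "dim W = d1" "snd e ` (fst e \<inter> f -` {t0}) = snd e ` fst e \<inter> W"
    using S p unfolding submanifold_of_dim_def by blast
  have h: "homeomorphism (fst e) (snd e ` fst e) (snd e) (chart_inv e)" using e(1) by (simp add: is_chart_def)
  have oe: "open (fst e)" "open (snd e ` fst e)" using e(1) by (auto simp: is_chart_def)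
  have inv: "chart_inv e (snd e q) = q" if "q \<in> fst e" for q using h that by (auto simp: homeomorphism_def)
  have cont: "continuous_on (snd e ` fst e) (chart_inv e)" using h by (auto simp: homeomorphism_def)
  let ?U = "fst e \<inter> fst c"
  have im: "snd e ` ?U = snd e ` fst e \<inter> chart_inv e -` (fst c)" using inv by (force simp: image_iff)
  have oU: "open (snd e ` ?U)"
    unfolding im by (rule continuous_open_preimage[OF cont oe(2) chart_open(1)[OF c(1)]])
  have oU': "open (snd c ` ?U)" by (rule open_chart_image[OF c(1)]) (use oe chart_open(1)[OF c(1)] in auto)
  have sm: "smooth_on (snd e ` ?U) (snd c \<circ> chart_inv e)" "smooth_on (snd c ` ?U) (snd e \<circ> chart_inv c)"
    using e(2)[OF c(1)] by (auto simp: compatible_charts_def)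
  define y where "y = snd e p"
  have y: "y \<in> snd e ` ?U" "snd c p \<in> snd c ` ?U" using c(2) e(3) by (auto simp: y_def)
  have "(snd c \<circ> chart_inv e) differentiable (at y)" "(snd e \<circ> chart_inv c) differentiable (at (snd c p))"
    using smooth_on_imp_Ck_on[OF sm(1) oU, of "Suc 0"] smooth_on_imp_Ck_on[OF sm(2) oU', of "Suc 0"] y by auto
  then obtain J J' where J: "((snd c \<circ> chart_inv e) has_derivative J) (at y)"
    and J': "((snd e \<circ> chart_inv c) has_derivative J') (at (snd c p))" by (auto simp: differentiable_def)
  have J'': "((snd e \<circ> chart_inv c) has_derivative J') (at ((snd c \<circ> chart_inv e) y))" using J' inv[OF e(3)] by (simp add: y_def)
  have "((snd e \<circ> chart_inv c) \<circ> (snd c \<circ> chart_inv e) has_derivative J' \<circ> J) (at y)"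
    by (rule diff_chain_at[OF J J''])
  then have "((\<lambda>z. z) has_derivative J' \<circ> J) (at y)"
    by (rule has_derivative_transform_within_open[OF _ oU y(1)]) (use inv chart_inv_left[OF c(1)] in auto)
  then have JJ: "J' (J w) = w" for w using has_derivative_unique[OF has_derivative_ident] by (metis comp_apply)
  have linJ: "linear J" using J has_derivative_linear by blast
  have injJ: "inj J" by (rule inj_on_inverseI[of _ J']) (use JJ in auto)
  have yW: "y \<in> W" using W(3) e(3) p by (auto simp: y_def)
  have ker: "focal_hessian c p *v J w = 0" if w: "w \<in> W" for w
  proof -
    let ?\<theta> = "\<lambda>t::real. (snd c \<circ> chart_inv e) (y + t *\<^sub>R w)"
    have l0: "((\<lambda>t. y + t *\<^sub>R w) \<longlongrightarrow> y) (nhds 0)" by (auto intro!: tendsto_eq_intros filterlim_ident)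
    have "\<forall>\<^sub>F t in nhds 0. y + t *\<^sub>R w \<in> snd e ` ?U"
      using eventually_nhds_in_open[OF oU y(1)] l0 by (rule eventually_compose_filterlim)
    then obtain N where N: "open N" "0 \<in> N" "\<And>t. t \<in> N \<Longrightarrow> y + t *\<^sub>R w \<in> snd e ` ?U" by (auto simp: eventually_nhds)
    have z: "f_gradient c (?\<theta> t) = 0" if "t \<in> N" for t
    proof -
      obtain q where q: "q \<in> ?U" "y + t *\<^sub>R w = snd e q" using N(3)[OF \<open>t \<in> N\<close>] by blast
      have "snd e q \<in> W" using yW w W(1) q(2) by (metis subspace_add subspace_scale)
      then have "snd e q \<in> snd e ` (fst e \<inter> f -` {t0})" using W(3) q(1) by blast
      then obtain q' where "q' \<in> fst e" "f q' = t0" "snd e q = snd e q'" by auto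
      then have "f q = t0" using inv q(1) by (metis IntD1)
      then show ?thesis using q chart_inv_left[OF c(1), of q] inv[of q] by (intro f_gradient_zero(1)[OF c(1)]) auto
    qed
    have l: "((\<lambda>t. y + t *\<^sub>R w) has_vector_derivative w) (at 0)" by (auto intro!: derivative_eq_intros)
    have th: "(?\<theta> has_vector_derivative J w) (at 0)"
      by (rule has_vector_derivative_chain[OF l]) (use J in \<open>simp add: o_def\<close>)
    have "((\<lambda>t. f_gradient c (?\<theta> t)) has_vector_derivative focal_hessian c p *v J w) (at 0)"
      by (rule has_vector_derivative_chain[OF th]) (use f_gradient_derivative inv[OF e(3)] in \<open>simp add: y_def\<close>)
    moreover have "((\<lambda>t. f_gradient c (?\<theta> t)) has_vector_derivative 0) (at 0)"
      by (rule has_vector_derivative_transform_within_open[where f = "\<lambda>_. 0", OF has_vector_derivative_const N(1,2)]) (use z in \<open>simp add: o_def\<close>)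
    ultimately show ?thesis using vector_derivative_unique_at by blast
  qed
  have "d1 = dim (J ` W)" using dim_image_eq[OF linJ, of W] injJ W(2) by (simp add: inj_on_subset)
  also have "\<dots> \<le> dim {v. focal_hessian c p *v v = 0}" by (rule dim_subset) (use ker in auto)
  finally show ?thesis .
qed

end

section \<open>The Hessian does not vanish on the focal set\<close>

text \<open>In the divergence, the derivative of sqrt (det g) is multiplied by the gradient, which
  is zero at p. Only the trace of the derivative of the gradient remains.\<close>

lemma laplacian_focal:
  assumes p: "f p = t0"
  shows "a t0 = trace (focal_hessian (chart_at A p) p)"
proof -
  define c where "c = chart_at A p"
  have c: "c \<in> A" "p \<in> fst c" using chart_at by (auto simp: c_def)
  let ?x = "snd c p"
  note x = focal_x[OF c p]
  have det: "det (g c ?x) \<noteq> 0" by (rule spd_det[OF metric_spd[OF c(1) x(1)]])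
  define s where "s = (\<lambda>y. sqrt (det (g c y)))"
  obtain s' where s': "(s has_derivative s') (at ?x)"
    using gradient_differentiable(2)[OF c(1) x(1) f_C2[OF c(1)]] by (auto simp: differentiable_def s_def)
  have "partial_deriv i (\<lambda>y. s y * f_gradient c y $ i) ?x = s ?x * focal_hessian c p $ i $ i" for i
  proof -
    have "((\<lambda>y. s y * f_gradient c y $ i) has_derivative (\<lambda>v. s ?x * (focal_hessian c p *v v) $ i + s' v * f_gradient c ?x $ i)) (at ?x)"
      by (rule has_derivative_mult[OF s' has_derivative_vec_nth[OF f_gradient_derivative[OF c p]]])
    from frechet_derivative_at[OF this, symmetric] show ?thesis
      using f_gradient_zero(1)[OF c(1) x] by (simp add: partial_deriv_def matrix_vector_mult_basis column_def)
  qed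
  then have "coord_divergence (g c) (f_gradient c) ?x = trace (focal_hessian c p)"
    using det by (simp add: coord_divergence_def s_def trace_def sum_distrib_left[symmetric])
  then show ?thesis
    using lap_f[of p] p by (simp add: laplace_beltrami_def Let_def c_def[symmetric] f_gradient_def)
qed

text \<open>Minimise sqrt (f - t0) plus a penalty proportional to the distance from the centre. At a
  point inside the ball a step along the negative gradient lowers this sum, since near the focal set
  sqrt (f - t0) has slope bounded below. The minimum thus lies on the sphere, where the penalty
  alone is \<kappa> * R.\<close>

lemma focal_lower_ball:
  assumes c: "c \<in> A" and R: "0 < R" "cball z R \<subseteq> snd c ` fst c"
    and pos: "\<And>y. y \<in> ball z R \<Longrightarrow> t0 < (f \<circ> chart_inv c) y"
    and near: "\<And>y. y \<in> cball z R \<Longrightarrow> Cl * ((f \<circ> chart_inv c) y - t0) \<le> b' t0 / 2"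
    and b0: "0 < b0" "\<And>y v. y \<in> cball z R \<Longrightarrow> b0 * norm v \<le> mnorm c y v"
  shows "(b0 * sqrt (b' t0 / 2) / 4 * R)\<^sup>2 \<le> (f \<circ> chart_inv c) z - t0"
proof -
  let ?F = "f \<circ> chart_inv c"
  define \<beta> where "\<beta> = b' t0 / 2"
  have beta: "0 < \<beta>" using b'_t0 by (simp add: \<beta>_def)
  \<comment> \<open>The metric slope of sqrt (f - t0) is at least sqrt \<beta> / 2. Half of it,
    converted to the Euclidean norm by b0, leaves a strict decrease.\<close>
  define \<kappa> where "\<kappa> = b0 * sqrt \<beta> / 4"
  have \<kappa>: "0 < \<kappa>" using b0 beta by (simp add: \<kappa>_def)
  have Fc: "continuous_on (cball z R) ?F"
    using R(2) f_diff[OF c] by (intro continuous_at_imp_continuous_on ballI differentiable_imp_continuous_within) auto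
  have "continuous_on (cball z R) (\<lambda>y. sqrt (?F y - t0) + \<kappa> * norm (y - z))" by (intro continuous_intros Fc)
  moreover have "cball z R \<noteq> {}" using R(1) by simp
  ultimately obtain y where y: "y \<in> cball z R"
    "\<And>w. w \<in> cball z R \<Longrightarrow> sqrt (?F y - t0) + \<kappa> * norm (y - z) \<le> sqrt (?F w - t0) + \<kappa> * norm (w - z)"
    using continuous_attains_inf[OF compact_cball] by blast
  have yV: "y \<in> snd c ` fst c" using y(1) R(2) by blast
  have "R \<le> norm (y - z)"
  proof (rule ccontr)
    assume "\<not> R \<le> norm (y - z)"
    then have yR: "norm (y - z) < R" by simp
    then have Fy: "t0 < ?F y" using pos by (simp add: dist_norm norm_minus_commute)
    define \<sigma> where "\<sigma> = ?F y - t0"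
    have sig: "0 < \<sigma>" using Fy by (simp add: \<sigma>_def)
    define X where "X = coord_gradient (g c) ?F y"
    define B where "B = b (?F y)"
    have "2 * \<beta> * \<sigma> - Cl * \<sigma>\<^sup>2 \<le> B"
      using b_taylor[of t0 "?F y"] f_bounds t01 b_t0 by (simp add: \<beta>_def \<sigma>_def B_def abs_le_iff)
    moreover have "Cl * \<sigma>\<^sup>2 \<le> \<beta> * \<sigma>"
      using mult_right_mono[OF near[OF y(1)], of \<sigma>] sig by (simp add: \<beta>_def \<sigma>_def power2_eq_square mult.assoc)
    ultimately have B: "\<beta> * \<sigma> \<le> B" by linarith
    then have B0: "0 < B" using beta sig by (smt (verit) mult_pos_pos)
    have nX: "b0 * norm X \<le> sqrt B" using b0(2)[OF y(1), of X] gradient_identity(3)[OF c yV] by (simp add: X_def B_def)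
    define w where "w = sqrt \<sigma>"
    have w: "0 < w" using sig by (simp add: w_def)
    have Fd: "((\<lambda>t. ?F (y + t *\<^sub>R (- X))) has_real_derivative - B) (at 0)"
    proof -
      have "frechet_derivative ?F (at y) (- X) = - B"
        using gradient_identity(2)[OF c yV] linear_neg[OF has_derivative_linear[OF f_frechet[OF c yV]], of X]
        by (simp add: X_def B_def)
      then show ?thesis using f_line[OF c, of y 0 "- X"] yV by simp
    qed
    have e: "?F (y + 0 *\<^sub>R (- X)) - t0 = \<sigma>" by (simp add: \<sigma>_def)
    have "((\<lambda>t. ?F (y + t *\<^sub>R (- X)) - t0) has_real_derivative - B) (at 0)" using DERIV_diff[OF Fd DERIV_const[of t0]] by simp
    from DERIV_chain2[where f = sqrt, OF _ this, unfolded e, OF DERIV_real_sqrt[OF sig]]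
    have "((\<lambda>t. sqrt (?F (y + t *\<^sub>R (- X)) - t0)) has_real_derivative inverse (sqrt \<sigma>) / 2 * - B) (at 0)" .
    from DERIV_add[OF this DERIV_cmult_Id[of "\<kappa> * norm X"]]
    have d: "((\<lambda>t. sqrt (?F (y + t *\<^sub>R (- X)) - t0) + \<kappa> * norm X * t) has_real_derivative
        inverse (sqrt \<sigma>) / 2 * - B + \<kappa> * norm X) (at 0)" .
    have "\<kappa> * norm X = sqrt \<beta> / 4 * (b0 * norm X)" by (simp add: \<kappa>_def)
    also have "\<dots> \<le> sqrt \<beta> / 4 * sqrt B" using nX beta by (intro mult_left_mono) auto
    also have "\<dots> < sqrt \<beta> / 2 * sqrt B" using beta B0 by simp
    also have "\<dots> \<le> B / (2 * w)"
    proof -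
      have "sqrt \<beta> * w \<le> sqrt B" using B by (simp add: w_def real_sqrt_mult[symmetric])
      then have "sqrt \<beta> * w * sqrt B \<le> sqrt B * sqrt B" using B0 by (intro mult_right_mono) auto
      then show ?thesis using w B0 by (simp add: field_simps)
    qed
    finally have "inverse (sqrt \<sigma>) / 2 * - B + \<kappa> * norm X < 0" by (simp add: w_def field_simps)
    from DERIV_neg_dec_right[OF d this] obtain \<epsilon> where \<epsilon>: "0 < \<epsilon>"
      "\<And>h. 0 < h \<Longrightarrow> h < \<epsilon> \<Longrightarrow> sqrt (?F (y + h *\<^sub>R (- X)) - t0) + \<kappa> * norm X * h < w"
      by (auto simp: w_def \<sigma>_def)
    define h where "h = min (\<epsilon> / 2) ((R - norm (y - z)) / (norm X + 1))"
    have h: "0 < h" "h < \<epsilon>" using \<epsilon>(1) yR by (auto simp: h_def add_nonneg_pos)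
    have hX: "h * norm X \<le> R - norm (y - z)"
    proof -
      have "h * norm X \<le> (R - norm (y - z)) / (norm X + 1) * (norm X + 1)"
        using h yR by (intro mult_mono) (auto simp: h_def add_nonneg_pos)
      also have "\<dots> = R - norm (y - z)" by (smt (verit) nonzero_eq_divide_eq norm_ge_zero)
      finally show ?thesis .
    qed
    let ?y = "y + h *\<^sub>R (- X)"
    have n: "norm (?y - z) \<le> norm (y - z) + h * norm X"
      using norm_triangle_ineq4[of "y - z" "h *\<^sub>R X"] h(1) by (simp add: algebra_simps)
    then have "?y \<in> cball z R" using hX by (simp add: dist_norm norm_minus_commute)
    from y(2)[OF this] have "w + \<kappa> * norm (y - z) \<le> sqrt (?F ?y - t0) + \<kappa> * norm (?y - z)" by (simp add: w_def \<sigma>_def)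
    also have "\<kappa> * norm (?y - z) \<le> \<kappa> * (norm (y - z) + h * norm X)" using n \<kappa> by (intro mult_left_mono) auto
    finally have "w \<le> sqrt (?F ?y - t0) + \<kappa> * norm X * h" by (simp add: algebra_simps)
    then show False using \<epsilon>(2)[OF h] by simp
  qed
  then have "\<kappa> * R \<le> \<kappa> * norm (y - z)" using \<kappa> by simp
  also have "\<dots> \<le> sqrt (?F y - t0) + \<kappa> * norm (y - z)" using f_bounds by simp
  also have "\<dots> \<le> sqrt (?F z - t0)" using y(2)[of z] R(1) by simp
  finally have "(\<kappa> * R)\<^sup>2 \<le> (sqrt (?F z - t0))\<^sup>2" using \<kappa> R(1) by (intro power_mono) auto
  then show ?thesis using f_bounds by (simp add: \<kappa>_def \<beta>_def)
qed

lemma focal_boundary: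
  obtains p where "f p = t0" "\<And>U. open U \<Longrightarrow> p \<in> U \<Longrightarrow> \<exists>y\<in>U. t0 < f y"
proof -
  let ?S = "f -` {t0}"
  have "closed ?S" by (rule closed_vimage[OF closed_singleton f_cont])
  have "\<not> open ?S"
  proof
    assume "open ?S"
    moreover have "open (- ?S)" using \<open>closed ?S\<close> by (rule open_Compl)
    ultimately have "- ?S = {}"
      using connectedD[OF connected_manifold, of ?S "- ?S"] focal_nonempty by simp
    then have "f p = t0" for p by auto
    then show False using f_surj[of t1] t01 by auto
  qed
  then have "interior ?S \<noteq> ?S" using open_interior[of ?S] by metis
  then obtain p where p: "p \<in> ?S" "p \<notin> interior ?S" using interior_subset[of ?S] by (metis subsetI subset_antisym)
  have "\<exists>y\<in>U. t0 < f y" if U: "open U" "p \<in> U" for U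
  proof (rule ccontr)
    assume no: "\<not> (\<exists>y\<in>U. t0 < f y)"
    have "U \<subseteq> ?S"
    proof
      fix y assume "y \<in> U"
      then have "\<not> t0 < f y" using no by metis
      then show "y \<in> ?S" using f_bounds(1)[of y] by simp
    qed
    then have "U \<subseteq> interior ?S" by (rule interior_maximal[OF _ U(1)])
    then show False using U(2) p(2) by auto
  qed
  then show ?thesis using p(1) by (intro that[of p]) auto
qed

text \<open>
  If the Hessian vanished at a boundary point of the focal set, \<open>\<surd>(f - t0)\<close> would grow linearly in the
  radius of coordinate balls that miss the focal set, while the second derivatives of \<open>f\<close> there are small.
\<close>

lemma focal_laplacian_nonzero: "a t0 \<noteq> 0"
proof
  assume a0: "a t0 = 0"
  obtain p where p: "f p = t0" "\<And>U. open U \<Longrightarrow> p \<in> U \<Longrightarrow> \<exists>y\<in>U. t0 < f y" by (rule focal_boundary) (rule that)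
  define c where "c = chart_at A p"
  have c: "c \<in> A" "p \<in> fst c" using chart_at by (auto simp: c_def)
  let ?F = "f \<circ> chart_inv c" and ?x = "snd c p"
  let ?dF = "\<lambda>y w. frechet_derivative ?F (at y) w"
  note x = focal_x[OF c p(1)]
  \<comment> \<open>The trace is b' t0 / 2 times the rank, so a t0 = 0 leaves rank zero.\<close>
  have "dim {v. focal_hessian c p *v v = 0} = CARD('n)"
    using hessian_trace[OF c p(1)] laplacian_focal[OF p(1)] a0 b'_t0 by (simp add: c_def)
  moreover have "subspace {v. focal_hessian c p *v v = 0}"
    by (auto simp: subspace_def matrix_vector_right_distrib matrix_vector_mult_scaleR)
  ultimately have "{v. focal_hessian c p *v v = 0} = UNIV"
    using subspace_dim_equal[of "{v. focal_hessian c p *v v = 0}" UNIV] by simp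
  then have H0: "focal_hessian c p *v v = 0" for v by auto
  obtain r where r: "0 < r" "cball ?x r \<subseteq> snd c ` fst c"
    using chart_open(2)[OF c(1)] x(1) open_contains_cball by metis
  obtain b0 where b0: "0 < b0" "\<And>y v. y \<in> cball ?x r \<Longrightarrow> b0 * norm v \<le> mnorm c y v"
    using chart_ball_lower[OF c(1) r(2,1)] by blast
  define \<kappa> where "\<kappa> = b0 * sqrt (b' t0 / 2) / 4"
  have \<kappa>: "0 < \<kappa>" using b0(1) b'_t0 by (simp add: \<kappa>_def)
  define n where "n = real CARD('n)"
  have n: "0 < n" by (simp add: n_def)
  \<comment> \<open>Two integrations of second derivatives of size e, each costing a factor n, bound
    f - t0 by n^2 * e * R^2, which is half of the lower bound (\<kappa> * R)^2.\<close>
  define e where "e = \<kappa>\<^sup>2 / (2 * n * n)"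
  have e: "0 < e" using \<kappa> n by (simp add: e_def)
  have ev: "\<forall>\<^sub>F y in nhds ?x. \<forall>i\<in>UNIV. \<forall>j\<in>UNIV. \<bar>frechet_derivative (\<lambda>y. ?dF y (axis j 1)) (at y) (axis i 1)\<bar> < e"
  proof (intro eventually_ball_finite finite ballI)
    fix i j :: 'n
    let ?h = "\<lambda>y. frechet_derivative (\<lambda>y. ?dF y (axis j 1)) (at y) (axis i 1)"
    have "continuous_on (snd c ` fst c) ?h" using f_C2[OF c(1)] by simp
    then have "isCont ?h ?x" using x(1) continuous_on_eq_continuous_at[OF chart_open(2)[OF c(1)]] by blast
    then have "(?h \<longlongrightarrow> ?h ?x) (nhds ?x)" using tendsto_at_iff_tendsto_nhds[of ?h ?x] by (simp add: isCont_def)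
    moreover have "?h ?x = 0"
      using frechet_derivative_at[OF hessian_derivative[OF c p(1), of "axis j 1"], symmetric] H0 by simp
    ultimately have "((\<lambda>y. \<bar>?h y\<bar>) \<longlongrightarrow> 0) (nhds ?x)" using tendsto_rabs_zero by simp
    then show "\<forall>\<^sub>F y in nhds ?x. \<bar>?h y\<bar> < e" using e by (rule order_tendstoD(2))
  qed
  have "isCont ?F ?x" using differentiable_imp_continuous_within[OF f_diff[OF c(1) x(1)]] .
  then have "(?F \<longlongrightarrow> t0) (nhds ?x)" using tendsto_at_iff_tendsto_nhds[of ?F ?x] x(2) by (simp add: isCont_def)
  then have "((\<lambda>y. Cl * (?F y - t0)) \<longlongrightarrow> Cl * (t0 - t0)) (nhds ?x)" by (intro tendsto_intros)
  then have "\<forall>\<^sub>F y in nhds ?x. Cl * (?F y - t0) < b' t0 / 2"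
    by (rule order_tendstoD(2)) (use b'_t0 in simp)
  from eventually_conj[OF ev this] obtain r' where r': "0 < r'"
    "\<And>y i j. dist y ?x < r' \<Longrightarrow> \<bar>frechet_derivative (\<lambda>y. ?dF y (axis j 1)) (at y) (axis i 1)\<bar> < e"
    "\<And>y. dist y ?x < r' \<Longrightarrow> Cl * (?F y - t0) < b' t0 / 2"
    by (auto simp: eventually_nhds_metric)
  define s where "s = min r (r' / 2)"
  have s: "0 < s" "s \<le> r" "s < r'" using r(1) r'(1) by (auto simp: s_def)
  have inball: "y \<in> snd c ` fst c \<and> dist y ?x < r' \<and> y \<in> cball ?x r" if "y \<in> cball ?x s" for y
    using that s r(2) by (auto simp: dist_commute)
  \<comment> \<open>A point y this close to the focal point has its nearest focal point z at
    distance R < s / 4. The ball of radius R around y then stays in the larger ball and its interior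
    misses the focal set.\<close>
  define U where "U = fst c \<inter> snd c -` ball ?x (s/4)"
  have "open U" unfolding U_def
    by (rule continuous_open_preimage[OF chart_continuous(1)[OF c(1)] chart_open(1)[OF c(1)]]) simp
  moreover have "p \<in> U" using c s by (simp add: U_def)
  ultimately obtain q where q: "q \<in> U" "t0 < f q" using p(2) by blast
  define y where "y = snd c q"
  have y: "dist ?x y < s/4" "t0 < ?F y" using q chart_inv_left[OF c(1)] by (auto simp: U_def y_def)
  let ?Z = "{z \<in> cball ?x s. ?F z = t0}"
  have Fc: "continuous_on (cball ?x s) ?F"
    using inball f_diff[OF c(1)] by (intro continuous_at_imp_continuous_on ballI differentiable_imp_continuous_within) auto
  have "closed ?Z"
    using continuous_closed_preimage[OF Fc closed_cball closed_singleton[of t0]] by (simp add: vimage_def Int_def)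
  then have "compact (cball ?x s \<inter> ?Z)" by (rule compact_Int_closed[OF compact_cball])
  moreover have "cball ?x s \<inter> ?Z = ?Z" by blast
  ultimately have compZ: "compact ?Z" by (simp only:)
  have neZ: "?Z \<noteq> {}"
  proof -
    have "?x \<in> ?Z" using x(2) s(1) by simp
    then show ?thesis by blast
  qed
  have contZ: "continuous_on ?Z (\<lambda>z. dist y z)" by (intro continuous_intros)
  obtain z where z: "z \<in> ?Z" "\<And>w. w \<in> ?Z \<Longrightarrow> dist y z \<le> dist y w"
    using continuous_attains_inf[OF compZ neZ contZ] by blast
  define R where "R = dist y z"
  have Rle: "R < s/4" using z(2)[of ?x] x(2) s y(1) by (auto simp: R_def dist_commute)
  have R: "0 < R" using z(1) y(2) by (auto simp: R_def)
  have sub: "w \<in> cball ?x s" if "w \<in> cball y R" for w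
    using dist_triangle[of ?x w y] that y(1) Rle s(1) by simp
  have low: "(\<kappa> * R)\<^sup>2 \<le> ?F y - t0" unfolding \<kappa>_def
  proof (rule focal_lower_ball[OF c(1) R])
    show "cball y R \<subseteq> snd c ` fst c" using sub inball by blast
    show "t0 < ?F w" if "w \<in> ball y R" for w
    proof -
      have "w \<in> cball y R" using that by simp
      then have "w \<notin> ?Z" using z(2)[of w] that by (auto simp: R_def)
      then have "?F w \<noteq> t0" using sub[OF \<open>w \<in> cball y R\<close>] by blast
      then show ?thesis using f_bounds(1)[of "chart_inv c w"] by simp
    qed
    show "Cl * (?F w - t0) \<le> b' t0 / 2" if "w \<in> cball y R" for w
      using r'(3)[of w] inball[OF sub[OF that]] by simp
    show "0 < b0" by (rule b0(1))
    show "b0 * norm v \<le> mnorm c w v" if "w \<in> cball y R" for w v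
      using b0(2) inball[OF sub[OF that]] by blast
  qed
  define v where "v = y - z"
  have nv: "norm v = R" by (simp add: v_def R_def dist_norm)
  have lin: "z + t *\<^sub>R v \<in> cball ?x s" if "0 \<le> t" "t \<le> 1" for t
  proof (rule sub)
    have "y - (z + t *\<^sub>R v) = (1 - t) *\<^sub>R v" by (simp add: v_def algebra_simps)
    then have "dist y (z + t *\<^sub>R v) = (1 - t) * R" using that by (simp add: dist_norm nv)
    also have "\<dots> \<le> 1 * R" using that R by (intro mult_right_mono) auto
    finally show "z + t *\<^sub>R v \<in> cball y R" by simp
  qed
  have zV: "z \<in> snd c ` fst c" using lin[of 0] inball by simp
  \<comment> \<open>First integration: the differential of f vanishes at the focal point z, and its
    components change slowly along the segment from z to y.\<close>
  have Dj: "\<bar>?dF (z + t *\<^sub>R v) (axis j 1)\<bar> \<le> n * e * R" if t: "0 \<le> t" "t \<le> 1" for t j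
  proof -
    let ?h = "\<lambda>y. ?dF y (axis j 1)"
    have "norm (?h (z + t *\<^sub>R v) - ?h (z + 0 *\<^sub>R v)) \<le> n * e * R * norm (t - 0)"
    proof (rule field_differentiable_bound[of "{0..t}" "\<lambda>t. ?h (z + t *\<^sub>R v)" "\<lambda>u. frechet_derivative ?h (at (z + u *\<^sub>R v)) v"])
      fix u assume u: "u \<in> {0..t}"
      then have zu: "z + u *\<^sub>R v \<in> cball ?x s" using lin t by simp
      have hd: "(?h has_derivative frechet_derivative ?h (at (z + u *\<^sub>R v))) (at (z + u *\<^sub>R v))"
        using C2_differentiable(2)[OF f_C2[OF c(1)]] inball[OF zu] by (simp add: frechet_derivative_works)
      have "((\<lambda>t. z + t *\<^sub>R v) has_vector_derivative v) (at u)" by (auto intro!: derivative_eq_intros)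
      from has_vector_derivative_chain[OF this hd]
      show "((\<lambda>t. ?h (z + t *\<^sub>R v)) has_real_derivative frechet_derivative ?h (at (z + u *\<^sub>R v)) v) (at u within {0..t})"
        by (simp add: has_real_derivative_iff_has_vector_derivative has_vector_derivative_at_within)
      have "\<bar>frechet_derivative ?h (at (z + u *\<^sub>R v)) v\<bar> \<le> real CARD('n) * e * norm v"
        by (rule linear_axis_bound[OF has_derivative_linear[OF hd]])
          (use r'(2) inball[OF zu] in \<open>auto intro: less_imp_le\<close>)
      then show "norm (frechet_derivative ?h (at (z + u *\<^sub>R v)) v) \<le> n * e * R" by (simp add: n_def nv)
    qed (use t in auto)
    moreover have "?h (z + 0 *\<^sub>R v) = 0" using f_gradient_zero(2)[OF c(1) zV] z(1) by simp
    moreover have "n * e * R * norm (t - 0) \<le> n * e * R * 1"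
      using t n e R by (intro mult_left_mono) auto
    ultimately show ?thesis by simp
  qed
  have "norm (?F (z + 1 *\<^sub>R v) - ?F (z + 0 *\<^sub>R v)) \<le> n * (n * e * R) * R * norm (1 - 0 :: real)"
  proof (rule field_differentiable_bound[of "{0..1}" "\<lambda>t. ?F (z + t *\<^sub>R v)" "\<lambda>t. ?dF (z + t *\<^sub>R v) v"])
    fix t :: real assume t: "t \<in> {0..1}"
    then have zt: "z + t *\<^sub>R v \<in> snd c ` fst c" using lin inball by simp
    show "((\<lambda>t. ?F (z + t *\<^sub>R v)) has_real_derivative ?dF (z + t *\<^sub>R v) v) (at t within {0..1})"
      by (rule has_field_derivative_at_within[OF f_line[OF c(1) zt]])
    have "\<bar>?dF (z + t *\<^sub>R v) v\<bar> \<le> real CARD('n) * (n * e * R) * norm v"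
      by (rule linear_axis_bound[OF has_derivative_linear[OF f_frechet[OF c(1) zt]]]) (use Dj t in auto)
    then show "norm (?dF (z + t *\<^sub>R v) v) \<le> n * (n * e * R) * R" by (simp add: n_def nv)
  qed auto
  moreover have "z + 1 *\<^sub>R v = y" by (simp add: v_def)
  ultimately have "?F y - t0 \<le> n * (n * e * R) * R" using z(1) by (simp add: abs_le_iff)
  also have "\<dots> = (\<kappa> * R)\<^sup>2 / 2" using n by (simp add: e_def power2_eq_square field_simps)
  finally have "(\<kappa> * R)\<^sup>2 \<le> (\<kappa> * R)\<^sup>2 / 2" using low by linarith
  then have "(\<kappa> * R)\<^sup>2 \<le> 0" by simp
  then show False using \<kappa> R by simp
qed

lemma focal_hessian_nonzero:
  assumes "f p = t0" shows "focal_hessian (chart_at A p) p \<noteq> 0"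
proof
  assume "focal_hessian (chart_at A p) p = 0"
  then have "trace (focal_hessian (chart_at A p) p) = 0" by (simp add: trace_def)
  then show False using laplacian_focal[OF assms] focal_laplacian_nonzero by simp
qed

text \<open>k is the codimension of the kernel of the Hessian at one focal point. The value a t0
  fixes the trace, so the number is the same at every other one.\<close>

lemma focal_index:
  assumes S: "submanifold_of_dim A (f -` {t0}) d1"
  obtains k where "1 \<le> k" "k \<le> real CARD('n) - real d1" "a t0 = k * b' t0 / 2"
proof -
  obtain p where p: "f p = t0" using f_surj[of t0] t01 by auto
  define c where "c = chart_at A p"
  have c: "c \<in> A" "p \<in> fst c" using chart_at by (auto simp: c_def)
  define K where "K = {v. focal_hessian c p *v v = 0}"
  have a: "a t0 = b' t0 / 2 * (real CARD('n) - real (dim K))"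
    using laplacian_focal[OF p] hessian_trace[OF c p] by (simp add: c_def K_def)
  have "dim K \<le> CARD('n)" using dim_subset_UNIV[of K] by simp
  moreover have "dim K \<noteq> CARD('n)" using a focal_laplacian_nonzero by auto
  ultimately have "dim K + 1 \<le> CARD('n)" by simp
  moreover have "d1 \<le> dim K" unfolding K_def by (rule focal_kernel_dim[OF c p S])
  ultimately show ?thesis using a by (intro that[of "real CARD('n) - real (dim K)"]) (auto simp: mult.commute)
qed

text \<open>A direction with positive Hessian, along which f - t0 grows like m t^2. Both v and - v
  are recorded because the evenness of f to leading order is what controls u at the focal
  set.\<close>

lemma focal_approach:
  assumes p: "f p = t0" and c: "c = chart_at A p"
  obtains v m where "0 < m"
    "((\<lambda>t. ((f \<circ> chart_inv c) (snd c p + t *\<^sub>R v) - t0) / t\<^sup>2) \<longlongrightarrow> m) (at_right 0)"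
    "((\<lambda>t. frechet_derivative (f \<circ> chart_inv c) (at (snd c p + t *\<^sub>R v)) v / t) \<longlongrightarrow> 2 * m) (at_right 0)"
    "((\<lambda>t. ((f \<circ> chart_inv c) (snd c p + t *\<^sub>R (- v)) - t0) / t\<^sup>2) \<longlongrightarrow> m) (at_right 0)"
proof -
  have c': "c \<in> A" "p \<in> fst c" using chart_at c by auto
  have "focal_hessian c p \<noteq> 0" using focal_hessian_nonzero[OF p] c by simp
  then obtain v where v: "0 < v \<bullet> (g c (snd c p) *v (focal_hessian c p *v v))"
    by (rule hessian_positive_direction[OF c' p])
  define m where "m = v \<bullet> (g c (snd c p) *v (focal_hessian c p *v v)) / 2"
  have "((\<lambda>t. (frechet_derivative (f \<circ> chart_inv c) (at (snd c p + t *\<^sub>R v)) v -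
      frechet_derivative (f \<circ> chart_inv c) (at (snd c p + 0 *\<^sub>R v)) v) / (t - 0)) \<longlongrightarrow> 2 * m) (at 0)"
    using hessian_line[OF c' p, of v] unfolding has_field_derivative_iff m_def by simp
  then have d: "((\<lambda>t. frechet_derivative (f \<circ> chart_inv c) (at (snd c p + t *\<^sub>R v)) v / t) \<longlongrightarrow> 2 * m) (at_right 0)"
    using f_gradient_zero(2)[OF c'(1) focal_x[OF c' p]] by (simp add: filterlim_at_split)
  have e: "focal_hessian c p *v (- v) = - (focal_hessian c p *v v)"
    using matrix_vector_mult_scaleR[of "focal_hessian c p" "-1" v] by simp
  have e2: "g c (snd c p) *v (- (focal_hessian c p *v v)) = - (g c (snd c p) *v (focal_hessian c p *v v))"
    using matrix_vector_mult_scaleR[of "g c (snd c p)" "-1" "focal_hessian c p *v v"] by simp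
  have m': "(- v) \<bullet> (g c (snd c p) *v (focal_hessian c p *v (- v))) / 2 = m"
    unfolding e e2 m_def by simp
  show ?thesis
  proof (rule that[of m v])
    show "0 < m" using v by (simp add: m_def)
    show "((\<lambda>t. ((f \<circ> chart_inv c) (snd c p + t *\<^sub>R v) - t0) / t\<^sup>2) \<longlongrightarrow> m) (at_right 0)"
      using focal_quadratic_limit[OF c' p, of v] unfolding m_def .
    show "((\<lambda>t. ((f \<circ> chart_inv c) (snd c p + t *\<^sub>R (- v)) - t0) / t\<^sup>2) \<longlongrightarrow> m) (at_right 0)"
      using focal_quadratic_limit[OF c' p, of "- v"] unfolding m' .
  qed (rule d)
qed


subsection \<open>Reduction to the boundary value problem\<close>

text \<open>Sharper than \<open>focal_boundary\<close>: with the Hessian known to be nonzero, every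
  focal point is approached by other levels. Applied to - f, it approximates points of level t1 by
  points of lower level.\<close>

lemma focal_not_interior:
  assumes p: "f p = t0" and U: "open U" "p \<in> U"
  shows "\<exists>y\<in>U. t0 < f y"
proof -
  define c where "c = chart_at A p"
  have c: "c \<in> A" "p \<in> fst c" using chart_at by (auto simp: c_def)
  note x = focal_x[OF c p]
  let ?F = "f \<circ> chart_inv c"
  obtain v m where m: "0 < m"
    "((\<lambda>t. (?F (snd c p + t *\<^sub>R v) - t0) / t\<^sup>2) \<longlongrightarrow> m) (at_right 0)"
    by (rule focal_approach[OF p c_def]) (rule that)
  have "\<forall>\<^sub>F t in at_right 0. 0 < (?F (snd c p + t *\<^sub>R v) - t0) / t\<^sup>2"
    using m(2,1) by (rule order_tendstoD(1))
  moreover have "\<forall>\<^sub>F t in at_right 0. chart_inv c (snd c p + t *\<^sub>R v) \<in> U"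
  proof -
    have "isCont (chart_inv c) (snd c p + 0 *\<^sub>R v)"
      using bspec[OF iffD1[OF continuous_on_eq_continuous_at[OF chart_open(2)[OF c(1)]] chart_continuous(2)[OF c(1)]] x(1)] by simp
    moreover have "isCont (\<lambda>t. snd c p + t *\<^sub>R v) 0" by (intro continuous_intros)
    ultimately have "isCont (\<lambda>t. chart_inv c (snd c p + t *\<^sub>R v)) 0"
      using isCont_o2[where f = "\<lambda>t. snd c p + t *\<^sub>R v" and g = "chart_inv c"] by blast
    then have "((\<lambda>t. chart_inv c (snd c p + t *\<^sub>R v)) \<longlongrightarrow> p) (at_right 0)"
      using chart_inv_left[OF c] by (simp add: isCont_def filterlim_at_split)
    then show ?thesis using U by (rule topological_tendstoD)
  qed
  ultimately have "\<forall>\<^sub>F t in at_right 0. 0 < (?F (snd c p + t *\<^sub>R v) - t0) / t\<^sup>2 \<and> chart_inv c (snd c p + t *\<^sub>R v) \<in> U"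
    by (rule eventually_conj)
  then obtain t where "0 < (?F (snd c p + t *\<^sub>R v) - t0) / t\<^sup>2" "chart_inv c (snd c p + t *\<^sub>R v) \<in> U"
    using eventually_happens'[OF trivial_limit_at_right_real] by blast
  then show ?thesis by (intro bexI[of _ "chart_inv c (snd c p + t *\<^sub>R v)"]) (auto simp: zero_less_divide_iff)
qed

text \<open>Below t1, monotonicity in both directions gives equality. On the level t1, where descent
  cannot start, a strict inequality would persist by continuity at a nearby point of lower level and
  contradict monotonicity.\<close>

lemma setdist_level:
  assumes "f x = f y" shows "\<rho> x = \<rho> y"
proof -
  interpret neg: isopar A g "\<lambda>p. - f p" "- t1" "- t0" "\<lambda>s. - a (- s)" "\<lambda>s. b (- s)" "\<lambda>s. - b' (- s)" Cl
    by (rule uminus_isopar)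
  have le: "\<rho> x \<le> \<rho> y" if xy: "f x = f y" for x y
  proof (cases "f x < t1")
    case True
    then show ?thesis by (intro setdist_mono) (use xy in auto)
  next
    case False
    then have fx: "f x = t1" using f_bounds[of x] by simp
    show ?thesis
    proof (rule ccontr)
      assume no: "\<not> \<rho> x \<le> \<rho> y"
      have "open {z. \<rho> y < \<rho> z}"
        by (intro open_Collect_less continuous_intros setdist_continuous[OF focal_nonempty])
      moreover have "x \<in> {z. \<rho> y < \<rho> z}" using no by simp
      ultimately obtain z where "\<rho> y < \<rho> z" "- t1 < - f z"
        using neg.focal_not_interior[of x "{z. \<rho> y < \<rho> z}"] fx by auto
      then show False using setdist_mono[of z y] xy fx f_bounds(2)[of z] by simp
    qed
  qed
  show ?thesis by (rule antisym[OF le[OF assms] le[OF assms[symmetric]]])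
qed

section \<open>The profile of a function of f\<close>

context
  fixes u :: "'m \<Rightarrow> real" and \<psi> :: "real \<Rightarrow> real"
  assumes u_C2: "\<And>c. c \<in> A \<Longrightarrow> Ck_on (Suc (Suc 0)) (snd c ` fst c) (u \<circ> chart_inv c)"
    and u_psi: "\<And>x. u x = \<psi> (f x)"
begin

lemma u_diff: "c \<in> A \<Longrightarrow> x \<in> snd c ` fst c \<Longrightarrow> (u \<circ> chart_inv c) differentiable (at x)"
  using C2_differentiable(1)[OF u_C2] .

lemma u_frechet:
  "c \<in> A \<Longrightarrow> x \<in> snd c ` fst c \<Longrightarrow>
    ((u \<circ> chart_inv c) has_derivative frechet_derivative (u \<circ> chart_inv c) (at x)) (at x)"
  using u_diff by (simp add: frechet_derivative_works)

lemma direction_continuous: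
  assumes "c \<in> A"
  shows "continuous_on (snd c ` fst c) (\<lambda>y. frechet_derivative (f \<circ> chart_inv c) (at y) w)"
    "continuous_on (snd c ` fst c) (\<lambda>y. frechet_derivative (u \<circ> chart_inv c) (at y) w)"
  using C2_differentiable(2)[OF f_C2[OF assms]] C2_differentiable(2)[OF u_C2[OF assms]]
  by (auto intro!: continuous_at_imp_continuous_on differentiable_imp_continuous_within)

text \<open>f maps a compact space continuously onto the interval, so it is a quotient map: the
  preimage of a closed set under \<open>\<psi>\<close> is the f-image of a compact set.\<close>

lemma psi_continuous: "continuous_on {t0..t1} \<psi>"
proof (subst continuous_on_closed_vimage[OF closed_atLeastAtMost], intro allI impI)
  fix C :: "real set" assume C: "closed C"
  have uc: "continuous_on UNIV u"
    by (rule differentiable_charts_continuous) (use u_diff in blast)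
  have "closed (u -` C)" by (rule closed_vimage[OF C uc])
  then have "compact (UNIV \<inter> u -` C)" using compact_manifold compact_Int_closed by blast
  then have "compact (f ` (u -` C))"
    by (intro compact_continuous_image continuous_on_subset[OF f_cont]) auto
  moreover have "f ` (u -` C) = \<psi> -` C \<inter> {t0..t1}"
    using u_psi f_bounds f_surj by (force simp: image_iff)
  ultimately show "closed (\<psi> -` C \<inter> {t0..t1})" using compact_imp_closed by simp
qed

lemma psi_deriv:
  assumes s: "t0 < s" "s < t1"
  shows "(\<psi> has_real_derivative deriv \<psi> s) (at s)"
proof -
  obtain p where p: "f p = s" using f_surj[of s] s by auto
  define c where "c = chart_at A p"
  have c: "c \<in> A" "p \<in> fst c" using chart_at by (auto simp: c_def)
  let ?F = "f \<circ> chart_inv c"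
  have x: "snd c p \<in> snd c ` fst c" "?F (snd c p) = s" using c p chart_inv_left[OF c] by auto
  define X where "X = coord_gradient (g c) ?F (snd c p)"
  have nz: "frechet_derivative ?F (at (snd c p)) X \<noteq> 0"
    using gradient_identity(2)[OF c(1) x(1)] b_pos[OF s] x(2) by (simp add: X_def)
  have "(\<psi> has_real_derivative frechet_derivative (u \<circ> chart_inv c) (at (snd c p)) X / frechet_derivative ?F (at (snd c p)) X) (at (?F (snd c p)))"
    by (rule has_real_derivative_factor[OF chart_open(2)[OF c(1)] x(1) f_frechet[OF c(1)] direction_continuous(1)[OF c(1)] nz
        u_frechet[OF c(1) x(1)]]) (simp_all add: u_psi)
  then show ?thesis unfolding x(2) by (metis DERIV_imp_deriv)
qed

lemma u_chain:
  assumes c: "c \<in> A" "x \<in> snd c ` fst c" and s: "t0 < (f \<circ> chart_inv c) x" "(f \<circ> chart_inv c) x < t1"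
  shows "frechet_derivative (u \<circ> chart_inv c) (at x) w =
    deriv \<psi> ((f \<circ> chart_inv c) x) * frechet_derivative (f \<circ> chart_inv c) (at x) w"
proof -
  let ?F = "f \<circ> chart_inv c"
  have e: "u \<circ> chart_inv c = \<psi> \<circ> ?F" by (auto simp: u_psi)
  have "(\<psi> has_derivative (*) (deriv \<psi> (?F x))) (at (?F x))"
    using psi_deriv[OF s] by (simp add: has_field_derivative_def)
  from diff_chain_at[OF f_frechet[OF c] this]
  have "((u \<circ> chart_inv c) has_derivative (\<lambda>w. deriv \<psi> (?F x) * frechet_derivative ?F (at x) w)) (at x)"
    unfolding e by (simp add: o_def)
  from frechet_derivative_at[OF this] show ?thesis by metis
qed

lemma regular_open:
  assumes c: "c \<in> A"
  shows "open {y \<in> snd c ` fst c. t0 < (f \<circ> chart_inv c) y \<and> (f \<circ> chart_inv c) y < t1}"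
proof -
  have "continuous_on (snd c ` fst c) (f \<circ> chart_inv c)"
    using f_diff[OF c] by (intro continuous_at_imp_continuous_on ballI differentiable_imp_continuous_within)
  from continuous_open_preimage[OF this chart_open(2)[OF c] open_greaterThanLessThan[of t0 t1]]
  show ?thesis by (simp add: vimage_def Int_def)
qed

text \<open>The factorisation through f once more, now for the quotient of the derivatives of u and
  f in a fixed direction X. Near the point this quotient is the first derivative of
  \<open>\<psi>\<close> evaluated at f.\<close>

lemma psi_deriv2:
  assumes s: "t0 < s" "s < t1"
  shows "(deriv \<psi> has_real_derivative deriv (deriv \<psi>) s) (at s)"
proof -
  obtain p where p: "f p = s" using f_surj[of s] s by auto
  define c where "c = chart_at A p"
  have c: "c \<in> A" "p \<in> fst c" using chart_at by (auto simp: c_def)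
  let ?F = "f \<circ> chart_inv c" and ?U = "u \<circ> chart_inv c" and ?V = "snd c ` fst c"
  have x: "snd c p \<in> ?V" "?F (snd c p) = s" using c p chart_inv_left[OF c] by auto
  define X where "X = coord_gradient (g c) ?F (snd c p)"
  let ?dF = "\<lambda>y. frechet_derivative ?F (at y) X" and ?dU = "\<lambda>y. frechet_derivative ?U (at y) X"
  have nz: "?dF (snd c p) \<noteq> 0"
    using gradient_identity(2)[OF c(1) x(1)] b_pos[OF s] x(2) by (simp add: X_def)
  define V where "V = {y \<in> ?V. t0 < ?F y \<and> ?F y < t1} \<inter> (?V \<inter> ?dF -` (- {0}))"
  have "open V"
    unfolding V_def
    by (rule open_Int[OF regular_open[OF c(1)] continuous_open_preimage[OF direction_continuous(1)[OF c(1)] chart_open(2)[OF c(1)]]]) auto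
  moreover have "snd c p \<in> V" unfolding V_def using x s nz by simp
  ultimately have V: "open V" "snd c p \<in> V" by auto
  have "(\<lambda>y. ?dU y / ?dF y) differentiable (at (snd c p))"
    using C2_differentiable(2)[OF f_C2[OF c(1)] x(1)] C2_differentiable(2)[OF u_C2[OF c(1)] x(1)] nz
    by (intro differentiable_divide)
  then obtain h' where h': "((\<lambda>y. ?dU y / ?dF y) has_derivative h') (at (snd c p))" by (auto simp: differentiable_def)
  have "(deriv \<psi> has_real_derivative h' X / ?dF (snd c p)) (at (?F (snd c p)))"
  proof (rule has_real_derivative_factor[where F = ?F and F' = "\<lambda>y. frechet_derivative ?F (at y)" and w = X and p = "deriv \<psi>"
        and u = "\<lambda>y. ?dU y / ?dF y" and u' = h' and x = "snd c p", OF V])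
    show "?dF (snd c p) \<noteq> 0" by (rule nz)
    show "((\<lambda>y. ?dU y / ?dF y) has_derivative h') (at (snd c p))" by (rule h')
    show "(?F has_derivative frechet_derivative ?F (at y)) (at y)" if "y \<in> V" for y
      using f_frechet[OF c(1)] that by (simp add: V_def)
    show "continuous_on V ?dF"
      by (rule continuous_on_subset[OF direction_continuous(1)[OF c(1)]]) (auto simp: V_def)
    show "?dU y / ?dF y = deriv \<psi> (?F y)" if "y \<in> V" for y
      using u_chain[OF c(1), of y X] that by (simp add: V_def)
  qed
  then show ?thesis unfolding x(2) by (metis DERIV_imp_deriv)
qed

lemma laplace_psi:
  assumes s: "t0 < f p" "f p < t1"
  shows "laplace_beltrami A g u p = b (f p) * deriv (deriv \<psi>) (f p) + a (f p) * deriv \<psi> (f p)"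
proof -
  define c where "c = chart_at A p"
  have c: "c \<in> A" "p \<in> fst c" using chart_at by (auto simp: c_def)
  let ?F = "f \<circ> chart_inv c" and ?U = "u \<circ> chart_inv c"
  have x: "snd c p \<in> snd c ` fst c" "?F (snd c p) = f p" using c chart_inv_left[OF c] by auto
  define V where "V = {y \<in> snd c ` fst c. t0 < ?F y \<and> ?F y < t1}"
  have V: "open V" "snd c p \<in> V" unfolding V_def using regular_open[OF c(1)] x s by auto
  have grad: "coord_gradient (g c) ?U y = deriv \<psi> (?F y) *\<^sub>R coord_gradient (g c) ?F y" if y: "y \<in> V" for y
  proof -
    have yV: "y \<in> snd c ` fst c" "t0 < ?F y" "?F y < t1" using y by (auto simp: V_def)
    show ?thesis
    proof (rule coord_gradient_eqI[where G = "g c", OF u_diff[OF c(1) yV(1)] metric_spd[OF c(1) yV(1)]])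
      fix w
      have "w \<bullet> (g c y *v (deriv \<psi> (?F y) *\<^sub>R coord_gradient (g c) ?F y))
          = deriv \<psi> (?F y) * (w \<bullet> (g c y *v coord_gradient (g c) ?F y))"
        by (simp only: matrix_vector_mult_scaleR inner_scaleR_right)
      also have "\<dots> = frechet_derivative ?U (at y) w"
        using coord_gradient_inner[where G = "g c" and w = w, OF f_diff[OF c(1) yV(1)] metric_spd[OF c(1) yV(1)]]
          u_chain[OF c(1) yV, of w] by simp
      finally show "w \<bullet> (g c y *v (deriv \<psi> (?F y) *\<^sub>R coord_gradient (g c) ?F y)) = frechet_derivative ?U (at y) w" .
    qed
  qed
  have "(deriv \<psi> has_derivative (*) (deriv (deriv \<psi>) (f p))) (at (?F (snd c p)))"
    using psi_deriv2[OF s] unfolding x(2) by (simp add: has_field_derivative_def)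
  from diff_chain_at[OF f_frechet[OF c(1) x(1)] this]
  have h: "((\<lambda>y. deriv \<psi> (?F y)) has_derivative
      (\<lambda>w. deriv (deriv \<psi>) (f p) * frechet_derivative ?F (at (snd c p)) w)) (at (snd c p))" by (simp add: o_def)
  have "coord_divergence (g c) (coord_gradient (g c) ?U) (snd c p) =
      deriv \<psi> (?F (snd c p)) * coord_divergence (g c) (coord_gradient (g c) ?F) (snd c p)
      + frechet_derivative (\<lambda>y. deriv \<psi> (?F y)) (at (snd c p)) (coord_gradient (g c) ?F (snd c p))"
    by (rule coord_divergence_scale[OF V grad gradient_differentiable(3)[OF c(1) x(1) f_C2[OF c(1)]] _
        spd_det[OF metric_spd[OF c(1) x(1)]]]) (use h in \<open>auto simp: differentiable_def\<close>)
  also have "frechet_derivative (\<lambda>y. deriv \<psi> (?F y)) (at (snd c p)) (coord_gradient (g c) ?F (snd c p))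
      = deriv (deriv \<psi>) (f p) * b (f p)"
    using frechet_derivative_at[OF h, symmetric] gradient_identity(2)[OF c(1) x(1)] x(2) by simp
  also have "coord_divergence (g c) (coord_gradient (g c) ?F) (snd c p) = a (f p)"
    using lap_f[of p] by (simp add: laplace_beltrami_def Let_def c_def[symmetric] o_def)
  finally show ?thesis using x(2) by (simp add: laplace_beltrami_def Let_def c_def[symmetric] mult.commute o_def)
qed

text \<open>Across a focal point \<open>f - t0\<close> is even to leading order, so \<open>u = \<psi> \<circ> f\<close> has zero derivative there.\<close>

lemma psi_deriv_focal_limit: "((\<lambda>\<sigma>. sqrt \<sigma> * deriv \<psi> (t0 + \<sigma>)) \<longlongrightarrow> 0) (at_right 0)"
proof -
  obtain p where p: "f p = t0" using f_surj[of t0] t01 by auto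
  define c where "c = chart_at A p"
  have c: "c \<in> A" "p \<in> fst c" using chart_at by (auto simp: c_def)
  note x = focal_x[OF c p]
  let ?F = "f \<circ> chart_inv c" and ?U = "u \<circ> chart_inv c"
  obtain v m where m: "0 < m"
    and l1: "((\<lambda>t. (?F (snd c p + t *\<^sub>R v) - t0) / t\<^sup>2) \<longlongrightarrow> m) (at_right 0)"
    and l2: "((\<lambda>t. frechet_derivative ?F (at (snd c p + t *\<^sub>R v)) v / t) \<longlongrightarrow> 2 * m) (at_right 0)"
    and l3: "((\<lambda>t. (?F (snd c p + t *\<^sub>R (- v)) - t0) / t\<^sup>2) \<longlongrightarrow> m) (at_right 0)"
    by (rule focal_approach[OF p c_def]) (rule that)
  let ?l = "\<lambda>t. snd c p + t *\<^sub>R v"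
  define h where "h = (\<lambda>t. ?F (?l t) - t0)"
  obtain r where r: "0 < r" "\<And>t. \<bar>t\<bar> < r \<Longrightarrow> ?l t \<in> snd c ` fst c" using focal_line[OF c p] by blast
  have l0: "((\<lambda>t. ?l t) \<longlongrightarrow> snd c p) (nhds 0)" by (auto intro!: tendsto_eq_intros filterlim_ident)
  have hd: "isCont h t" if "\<bar>t\<bar> < r" for t
    using DERIV_isCont[OF DERIV_diff[OF f_line[OF c(1) r(2)[OF that]] DERIV_const[of t0]]] by (simp add: h_def)
  have h0: "h 0 = 0" using x(2) by (simp add: h_def)
  have "\<forall>\<^sub>F t in at_right 0. 0 < h t / t\<^sup>2" unfolding h_def using l1 m by (rule order_tendstoD(1))
  moreover have "\<forall>\<^sub>F t in at_right 0. 0 < h (- t) / t\<^sup>2"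
    using order_tendstoD(1)[OF l3 m] by (simp add: h_def)
  ultimately have "\<forall>\<^sub>F t in at_right 0. 0 < h t \<and> 0 < h (- t)"
    by eventually_elim (auto simp: zero_less_divide_iff)
  then obtain r1 where r1: "0 < r1" "\<And>t. 0 < t \<Longrightarrow> t < r1 \<Longrightarrow> 0 < h t \<and> 0 < h (- t)"
    unfolding eventually_at_right_field by auto
  \<comment> \<open>Intermediate value theorem on one side of the focal point; g selects the
    side.\<close>
  have hit: "\<exists>t. 0 < t \<and> t \<le> T \<and> h (g * t) = \<sigma>"
    if T: "0 < T" "T < r" and g: "g = 1 \<or> g = -1" and \<sigma>: "0 < \<sigma>" "\<sigma> \<le> h (g * T)" for T \<sigma> g
  proof -
    have "continuous_on {0..T} (\<lambda>t. h (g * t))"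
    proof (intro continuous_at_imp_continuous_on ballI)
      fix t assume "t \<in> {0..T}"
      then have "\<bar>g * t\<bar> < r" using g T by auto
      moreover have "isCont (\<lambda>t. g * t) t" by (intro continuous_intros)
      ultimately show "isCont (\<lambda>t. h (g * t)) t" using isCont_o2[where f = "\<lambda>t. g * t" and g = h] hd by blast
    qed
    then have "\<exists>t\<ge>0. t \<le> T \<and> h (g * t) = \<sigma>"
      using T \<sigma> h0 by (intro IVT'[of "\<lambda>t. h (g * t)"]) auto
    then obtain t where t: "0 \<le> t" "t \<le> T" "h (g * t) = \<sigma>" by blast
    then have "t \<noteq> 0" using \<sigma>(1) h0 by auto
    then show ?thesis using t by (intro exI[of _ t]) auto
  qed
  define z where "z = (\<lambda>t. ?U (?l t))"
  have zh: "z t = \<psi> (t0 + h t)" for t by (simp add: z_def h_def u_psi)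
  define z0 where "z0 = frechet_derivative ?U (at (snd c p)) v"
  have zd: "(z has_real_derivative z0) (at 0)"
  proof -
    have "((\<lambda>t. snd c p + t *\<^sub>R v) has_vector_derivative v) (at 0)" by (auto intro!: derivative_eq_intros)
    from has_vector_derivative_chain[OF this, of ?U "frechet_derivative ?U (at (snd c p))"] u_frechet[OF c(1) x(1)]
    show ?thesis by (simp add: has_real_derivative_iff_has_vector_derivative z_def z0_def)
  qed
  \<comment> \<open>Some t and - t' on opposite sides lie on the same level of f and carry the same
    value of u, whereas a nonzero derivative would separate these values by z 0.\<close>
  have z0: "z0 = 0"
  proof (rule ccontr)
    assume "z0 \<noteq> 0"
    then obtain g :: real where g: "0 < g * z0" by (metis mult_neg_neg mult_pos_pos neg_less_0_iff_less neqE zero_less_one)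
    have gz: "((\<lambda>t. g * z t) has_real_derivative g * z0) (at 0)" by (rule DERIV_cmult[OF zd])
    obtain d1 where d1: "0 < d1" "\<And>k. 0 < k \<Longrightarrow> k < d1 \<Longrightarrow> g * z 0 < g * z k"
      using DERIV_pos_inc_right[OF gz g] by auto
    obtain d2 where d2: "0 < d2" "\<And>k. 0 < k \<Longrightarrow> k < d2 \<Longrightarrow> g * z (- k) < g * z 0"
      using DERIV_pos_inc_left[OF gz g] by auto
    define T where "T = min (min r r1) (min d1 d2) / 2"
    have T: "0 < T" "T < r" "T < r1" "T < d1" "T < d2" using r(1) r1(1) d1(1) d2(1) by (auto simp: T_def)
    define \<sigma> where "\<sigma> = min (h T) (h (- T))"
    have \<sigma>: "0 < \<sigma>" "\<sigma> \<le> h (1 * T)" "\<sigma> \<le> h (-1 * T)" using r1(2)[OF T(1,3)] by (auto simp: \<sigma>_def)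
    obtain t where t: "0 < t" "t \<le> T" "h (1 * t) = \<sigma>" using hit[OF T(1,2) _ \<sigma>(1,2)] by blast
    obtain t' where t': "0 < t'" "t' \<le> T" "h (-1 * t') = \<sigma>" using hit[OF T(1,2) _ \<sigma>(1,3)] by blast
    have "z t = z (- t')" using t(3) t'(3) by (simp add: zh)
    then show False using d1(2)[of t] d2(2)[of t'] t t' T by simp
  qed
  have dU: "((\<lambda>t. frechet_derivative ?U (at (?l t)) v) \<longlongrightarrow> 0) (at_right 0)"
  proof -
    let ?k = "\<lambda>y. frechet_derivative ?U (at y) v"
    have "isCont ?k (?l 0)"
      using bspec[OF iffD1[OF continuous_on_eq_continuous_at[OF chart_open(2)[OF c(1)]] direction_continuous(2)[OF c(1)]] x(1)] by simp
    moreover have "isCont ?l 0" by (intro continuous_intros)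
    ultimately have "isCont (\<lambda>t. ?k (?l t)) 0" using isCont_o2[where f = ?l and g = ?k] by blast
    then show ?thesis using z0 by (simp add: isCont_def filterlim_at_split z0_def)
  qed
  \<comment> \<open>Along the line sqrt (f - t0) is of order t and the derivative of f is of order t
    as well. The chain rule thus turns the decay of the derivative of u into the claim at \<sigma> =
    h t.\<close>
  have "((\<lambda>t. sqrt (h t / t\<^sup>2) * (frechet_derivative ?U (at (?l t)) v) / (frechet_derivative ?F (at (?l t)) v / t))
      \<longlongrightarrow> sqrt m * 0 / (2 * m)) (at_right 0)"
    unfolding h_def using m by (intro tendsto_intros l1 l2 dU) auto
  then have lim: "((\<lambda>t. sqrt (h t / t\<^sup>2) * (frechet_derivative ?U (at (?l t)) v) / (frechet_derivative ?F (at (?l t)) v / t))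
      \<longlongrightarrow> 0) (at_right 0)" by simp
  have "(h \<longlongrightarrow> 0) (at_right 0)" using hd[of 0] r(1) h0 by (simp add: isCont_def filterlim_at_split)
  then have hsmall: "\<forall>\<^sub>F t in at_right 0. h t < t1 - t0" by (rule order_tendstoD(2)) (use t01 in simp)
  have dFpos: "\<forall>\<^sub>F t in at_right 0. 0 < frechet_derivative ?F (at (?l t)) v / t"
    by (rule order_tendstoD(1)[OF l2]) (use m in simp)
  have rr: "\<forall>\<^sub>F t in at_right 0. 0 < t \<and> t < r \<and> 0 < h t"
    using r1 r(1) by (intro eventually_at_rightI[of 0 "min r r1"]) auto
  have ev: "\<forall>\<^sub>F t in at_right 0. sqrt (h t) * deriv \<psi> (t0 + h t) =
      sqrt (h t / t\<^sup>2) * (frechet_derivative ?U (at (?l t)) v) / (frechet_derivative ?F (at (?l t)) v / t)"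
    using hsmall dFpos rr
  proof eventually_elim
    case (elim t)
    have Ft: "?F (?l t) = t0 + h t" by (simp add: h_def)
    have lt: "?l t \<in> snd c ` fst c" using r(2) elim by simp
    have "frechet_derivative ?U (at (?l t)) v = deriv \<psi> (t0 + h t) * frechet_derivative ?F (at (?l t)) v"
      using u_chain[OF c(1) lt, of v] elim unfolding Ft by simp
    moreover have "frechet_derivative ?F (at (?l t)) v \<noteq> 0" using elim by auto
    moreover have "sqrt (h t / t\<^sup>2) = sqrt (h t) / t" using elim by (simp add: real_sqrt_divide)
    ultimately show ?case using elim by simp
  qed
  have main: "((\<lambda>t. sqrt (h t) * deriv \<psi> (t0 + h t)) \<longlongrightarrow> 0) (at_right 0)"
    using lim ev by (simp add: filterlim_cong[OF refl refl ev])
  \<comment> \<open>The limit in t becomes a limit in \<sigma>, because every small \<sigma> is a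
    value of h at some small t.\<close>
  show ?thesis
  proof (rule tendstoI)
    fix e :: real assume e: "0 < e"
    obtain d where d: "0 < d" "\<And>t. 0 < t \<Longrightarrow> t < d \<Longrightarrow> dist (sqrt (h t) * deriv \<psi> (t0 + h t)) 0 < e"
      using tendstoD[OF main e] unfolding eventually_at_right_field by auto
    define T where "T = min (min r r1) d / 2"
    have T: "0 < T" "T < r" "T < r1" "T < d" using r(1) r1(1) d(1) by (auto simp: T_def)
    have "dist (sqrt \<sigma> * deriv \<psi> (t0 + \<sigma>)) 0 < e" if \<sigma>: "0 < \<sigma>" "\<sigma> < h T" for \<sigma>
    proof -
      obtain t where "0 < t" "t \<le> T" "h (1 * t) = \<sigma>" using hit[OF T(1,2), of 1 \<sigma>] \<sigma> by auto
      then show ?thesis using d(2)[of t] T by simp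
    qed
    moreover have "0 < h T" using r1(2)[OF T(1,3)] by simp
    ultimately show "\<forall>\<^sub>F \<sigma> in at_right 0. dist (sqrt \<sigma> * deriv \<psi> (t0 + \<sigma>)) 0 < e"
      unfolding eventually_at_right_field by auto
  qed
qed

end

section \<open>Reduction to two singular ends\<close>

text \<open>The integrating factor of the divergence form: the exponential of a primitive of a / b,
  which is continuous on the open interval where b is positive.\<close>

lemma weight_exists:
  obtains W where "\<And>s. 0 < s \<Longrightarrow> s < t1 - t0 \<Longrightarrow> (W has_real_derivative a (t0 + s) / b (t0 + s) * W s) (at s)"
    "\<And>s. 0 < (W s :: real)"
proof -
  have ac: "isCont (\<lambda>s. a (t0 + s)) s" if s: "0 < s" "s < t1 - t0" for s
  proof -
    have "((\<lambda>r. a (t0 + r) - a (t0 + s)) \<longlongrightarrow> 0) (at s)"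
    proof (rule Lim_null_comparison)
      have "((\<lambda>r. Cl * \<bar>r - s\<bar>) \<longlongrightarrow> Cl * \<bar>s - s\<bar>) (at s)" by (intro tendsto_intros)
      then show "((\<lambda>r. Cl * \<bar>r - s\<bar>) \<longlongrightarrow> 0) (at s)" by simp
      have "\<forall>\<^sub>F r in at s. r \<in> {0<..<t1 - t0}" using s by (intro eventually_at_in_open') auto
      then show "\<forall>\<^sub>F r in at s. norm (a (t0 + r) - a (t0 + s)) \<le> Cl * \<bar>r - s\<bar>"
      proof eventually_elim
        case (elim r)
        then show ?case using a_lip[of "t0 + r" "t0 + s"] s by simp
      qed
    qed
    then show ?thesis by (simp add: isCont_def LIM_zero_iff)
  qed
  have bc: "isCont (\<lambda>s. b (t0 + s)) s" if s: "0 < s" "s < t1 - t0" for s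
  proof -
    have "isCont b (t0 + s)" using b_deriv[of "t0 + s"] s by (simp add: at_within_Icc_at DERIV_isCont)
    moreover have "isCont ((+) t0) s" by (intro continuous_intros)
    ultimately show ?thesis using isCont_o2[where f = "(+) t0" and g = b] by blast
  qed
  have "isCont (\<lambda>s. a (t0 + s) / b (t0 + s)) s" if s: "0 < s" "s < t1 - t0" for s
    using b_pos[of "t0 + s"] s by (intro continuous_intros ac bc) auto
  then obtain P where P: "\<And>s. 0 < s \<Longrightarrow> s < t1 - t0 \<Longrightarrow> (P has_vector_derivative a (t0 + s) / b (t0 + s)) (at s)"
    using einterval_antiderivative[of "0" "ereal (t1 - t0)" "\<lambda>s. a (t0 + s) / b (t0 + s)"] t01 by auto
  have "((\<lambda>s. exp (P s)) has_real_derivative a (t0 + s) / b (t0 + s) * exp (P s)) (at s)"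
    if "0 < s" "s < t1 - t0" for s
    using P[OF that] by (auto intro!: derivative_eq_intros simp: has_real_derivative_iff_has_vector_derivative[symmetric])
  then show ?thesis by (intro that[of "\<lambda>s. exp (P s)"]) auto
qed

text \<open>The left end comes from f and the right end from - f, with one weight W shared through
  reflection. Regularity is required in the C^2 form that the reduction uses.\<close>

theorem small_coupling_rigidity:
  assumes S1: "submanifold_of_dim A (f -` {t0}) d1" and S2: "submanifold_of_dim A (f -` {t1}) d2"
    and q: "1 < q" and K: "2 \<le> K" "real CARD('n) - real d1 \<le> K" "real CARD('n) - real d2 \<le> K"
    and sub: "K * (q - 1) < 2 * (q + 1)"
  shows "\<exists>lam0>0. \<forall>lam u. 0 < lam \<longrightarrow> lam < lam0 \<longrightarrow>
    (\<forall>c\<in>A. Ck_on (Suc (Suc 0)) (snd c ` fst c) (u \<circ> chart_inv c)) \<longrightarrow> (\<forall>x. u x > 0) \<longrightarrow>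
    f_invariant A g t0 f u \<longrightarrow>
    (\<forall>x. - laplace_beltrami A g u x + lam * u x = lam * u x powr q) \<longrightarrow> (\<forall>x. u x = 1)"
proof -
  interpret neg: isopar A g "\<lambda>p. - f p" "- t1" "- t0" "\<lambda>s. - a (- s)" "\<lambda>s. b (- s)" "\<lambda>s. - b' (- s)" Cl
    by (rule uminus_isopar)
  define L where "L = t1 - t0"
  have L: "0 < L" using t01 by (simp add: L_def)
  obtain k0 where k0: "1 \<le> k0" "k0 \<le> real CARD('n) - real d1" "a t0 = k0 * b' t0 / 2"
    using focal_index[OF S1] by blast
  have S2': "submanifold_of_dim A ((\<lambda>p. - f p) -` {- t1}) d2"
    using S2 by (simp add: vimage_def)
  obtain k1 where k1: "1 \<le> k1" "k1 \<le> real CARD('n) - real d2" "- a t1 = k1 * - b' t1 / 2"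
    using neg.focal_index[OF S2'] by auto
  obtain W where W: "\<And>s. 0 < s \<Longrightarrow> s < L \<Longrightarrow> (W has_real_derivative a (t0 + s) / b (t0 + s) * W s) (at s)"
    "\<And>s. 0 < W s" using weight_exists by (auto simp: L_def)
  have bd: "((\<lambda>s. b (t0 + s)) has_real_derivative b' (t0 + s)) (at s)" if "0 < s" "s < L" for s
  proof -
    have "(b has_real_derivative b' (t0 + s)) (at (t0 + s))"
      using b_deriv[of "t0 + s"] that by (simp add: L_def at_within_Icc_at)
    then show ?thesis by (simp add: DERIV_shift add.commute)
  qed
  have b_end: "((\<lambda>s. b (t0 + s)) \<longlongrightarrow> 0) (at_right 0)" "((\<lambda>s. b (t0 + (L - s))) \<longlongrightarrow> 0) (at_right 0)"
  proof -
    have "continuous_on {0..L} (\<lambda>s. b (t0 + s))" "continuous_on {0..L} (\<lambda>s. b (t0 + (L - s)))"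
      by (rule continuous_on_compose2[OF b_continuous]; auto intro!: continuous_intros simp: L_def)+
    then have "((\<lambda>s. b (t0 + s)) \<longlongrightarrow> b (t0 + 0)) (at 0 within {0..L})"
      "((\<lambda>s. b (t0 + (L - s))) \<longlongrightarrow> b (t0 + (L - 0))) (at 0 within {0..L})"
      using L unfolding continuous_on_def by fastforce+
    moreover have "b t1 = 0" using neg.b_t0 by simp
    ultimately show "((\<lambda>s. b (t0 + s)) \<longlongrightarrow> 0) (at_right 0)" "((\<lambda>s. b (t0 + (L - s))) \<longlongrightarrow> 0) (at_right 0)"
      using b_t0 L by (simp_all add: at_within_Icc_at_right L_def)
  qed
  have "\<exists>\<delta> c0 C0. left_end (\<lambda>s. a (t0 + s)) (\<lambda>s. b (t0 + s)) (\<lambda>s. b' (t0 + s)) W (b' t0) k0 \<delta> c0 C0 L"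
  proof (rule left_end_exists[OF L b'_t0 k0(1) Cl_nonneg W])
    show "0 < b (t0 + s)" if "0 < s" "s < L" for s using b_pos that by (simp add: L_def)
    show "\<bar>a (t0 + s) - k0 * b' t0 / 2\<bar> \<le> Cl * s" if "0 < s" "s < L" for s
      using a_lip[of "t0 + s" t0] that t01 k0(3) by (simp add: L_def)
    show "\<bar>b' (t0 + s) - b' t0\<bar> \<le> Cl * s" if "0 < s" "s < L" for s
      using b'_lip[of "t0 + s" t0] that t01 by (simp add: L_def)
  qed (use bd b_end in auto)
  then obtain \<delta>0 c0 C0 where E0: "left_end (\<lambda>s. a (t0 + s)) (\<lambda>s. b (t0 + s)) (\<lambda>s. b' (t0 + s)) W (b' t0) k0 \<delta>0 c0 C0 L"
    by blast
  have b1: "0 < - b' t1" using neg.b'_t0 by simp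
  have "\<exists>\<delta> c0 C0. left_end (\<lambda>s. - a (t0 + (L - s))) (\<lambda>s. b (t0 + (L - s))) (\<lambda>s. - b' (t0 + (L - s)))
      (\<lambda>s. W (L - s)) (- b' t1) k1 \<delta> c0 C0 L"
  proof (rule left_end_exists[OF L b1 k1(1) Cl_nonneg])
    have t1: "t0 + (L - s) = t1 - s" for s by (simp add: L_def)
    fix s assume s: "0 < s" "s < L"
    show "((\<lambda>s. W (L - s)) has_real_derivative - a (t0 + (L - s)) / b (t0 + (L - s)) * W (L - s)) (at s)"
      using DERIV_reflect[OF W(1)[of "L - s"]] s by simp
    show "((\<lambda>s. b (t0 + (L - s))) has_real_derivative - b' (t0 + (L - s))) (at s)"
      using DERIV_reflect[OF bd[of "L - s"]] s by simp
    show "0 < W (L - s)" by (rule W(2))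
    show "0 < b (t0 + (L - s))" using b_pos s by (simp add: L_def)
    have s': "t0 \<le> t1 - s" "t1 - s \<le> t1" using s by (auto simp: L_def)
    show "\<bar>- a (t0 + (L - s)) - k1 * - b' t1 / 2\<bar> \<le> Cl * s"
      using a_lip[OF s', of t1] t01 s unfolding t1 k1(3)[symmetric] by (simp add: abs_minus_commute)
    show "\<bar>- b' (t0 + (L - s)) - - b' t1\<bar> \<le> Cl * s"
      using b'_lip[OF s', of t1] t01 s unfolding t1 by (simp add: abs_minus_commute)
  qed (rule b_end(2))
  then obtain \<delta>1 c1 C1 where E1: "left_end (\<lambda>s. - a (t0 + (L - s))) (\<lambda>s. b (t0 + (L - s))) (\<lambda>s. - b' (t0 + (L - s)))
      (\<lambda>s. W (L - s)) (- b' t1) k1 \<delta>1 c1 C1 L" by blast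
  interpret ode: two_ended "\<lambda>s. a (t0 + s)" "\<lambda>s. b (t0 + s)" "\<lambda>s. b' (t0 + s)" W "b' t0" k0 \<delta>0 c0 C0 "- b' t1" k1 \<delta>1 c1 C1 L
    by (rule two_ended.intro[OF E0 E1])
  have "k0 \<le> K" "k1 \<le> K" using k0(2) k1(2) K(2,3) by auto
  from ode.ode_rigidity[OF q this K(1) sub] obtain lam0 where lam0: "0 < lam0"
    and rigid: "\<And>lam \<psi> \<psi>1 \<psi>2. 0 < lam \<Longrightarrow> lam < lam0 \<Longrightarrow> ode.solution q lam \<psi> \<psi>1 \<psi>2 \<Longrightarrow> \<forall>s\<in>{0..L}. \<psi> s = 1"
    by blast
  have main: "u x = 1" if lam: "0 < lam" "lam < lam0"
    and C2: "\<And>c. c \<in> A \<Longrightarrow> Ck_on (Suc (Suc 0)) (snd c ` fst c) (u \<circ> chart_inv c)" and pos: "\<And>x. u x > 0"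
    and inv: "f_invariant A g t0 f u"
    and eq: "\<And>x. - laplace_beltrami A g u x + lam * u x = lam * u x powr q" for lam u x
  proof -
    obtain \<phi> where \<phi>: "\<And>x. u x = \<phi> (\<rho> x)" using inv by (auto simp: f_invariant_def)
    \<comment> \<open>The value at a chosen point of each level; that the choice is immaterial is
      the constancy of the distance on levels.\<close>
    define \<psi> where "\<psi> = (\<lambda>s. u (SOME x. f x = s))"
    have u_psi: "u x = \<psi> (f x)" for x
    proof -
      have "f (SOME y. f y = f x) = f x" by (rule someI[of _ x]) simp
      from setdist_level[OF this] show ?thesis unfolding \<psi>_def \<phi> by simp
    qed
    have pd: "(\<psi> has_real_derivative deriv \<psi> s) (at s)" if "t0 < s" "s < t1" for s
      by (rule psi_deriv[where u = u and \<psi> = \<psi>]) (use C2 u_psi that in auto)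
    have pd2: "(deriv \<psi> has_real_derivative deriv (deriv \<psi>) s) (at s)" if "t0 < s" "s < t1" for s
      by (rule psi_deriv2[where u = u and \<psi> = \<psi>]) (use C2 u_psi that in auto)
    have "ode.solution q lam (\<lambda>s. \<psi> (t0 + s)) (\<lambda>s. deriv \<psi> (t0 + s)) (\<lambda>s. deriv (deriv \<psi>) (t0 + s))"
      unfolding ode.solution_def
    proof (intro conjI ballI allI impI)
      show "continuous_on {0..L} (\<lambda>s. \<psi> (t0 + s))"
        by (rule continuous_on_compose2[OF psi_continuous[OF C2 u_psi]]) (auto simp: L_def intro!: continuous_intros)
      show "0 < \<psi> (t0 + s)" if sL: "s \<in> {0..L}" for s
      proof -
        obtain p where "f p = t0 + s" using f_surj[of "t0 + s"] sL by (auto simp: L_def)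
        then show ?thesis using pos[of p] u_psi[of p] by simp
      qed
      show "((\<lambda>s. sqrt s * deriv \<psi> (t0 + s)) \<longlongrightarrow> 0) (at_right 0)"
        by (rule psi_deriv_focal_limit[OF C2 u_psi])
      have u_psi': "u x = (\<lambda>s. \<psi> (- s)) (- f x)" for x by (simp add: u_psi)
      \<comment> \<open>The condition at t1 is the focal limit for - f, whose profile is the
        reflected \<open>\<psi>\<close> and whose focal level is - t1.\<close>
      have "((\<lambda>s. sqrt s * deriv (\<lambda>s. \<psi> (- s)) (- t1 + s)) \<longlongrightarrow> 0) (at_right 0)"
        by (rule neg.psi_deriv_focal_limit[OF C2 u_psi'])
      moreover have "\<forall>\<^sub>F s in at_right 0. - (sqrt s * deriv (\<lambda>s. \<psi> (- s)) (- t1 + s)) = sqrt s * deriv \<psi> (t0 + (L - s))"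
      proof (rule eventually_at_rightI[OF _ L])
        fix s assume s: "s \<in> {0<..<L}"
        have "(\<psi> has_real_derivative deriv \<psi> (t1 - s)) (at (0 - (- t1 + s)))"
          using pd[of "t1 - s"] s by (simp add: L_def)
        from DERIV_reflect[OF this] have "((\<lambda>s. \<psi> (- s)) has_real_derivative - deriv \<psi> (t1 - s)) (at (- t1 + s))" by simp
        then have "deriv (\<lambda>s. \<psi> (- s)) (- t1 + s) = - deriv \<psi> (t1 - s)" by (rule DERIV_imp_deriv)
        then show "- (sqrt s * deriv (\<lambda>s. \<psi> (- s)) (- t1 + s)) = sqrt s * deriv \<psi> (t0 + (L - s))" by (simp add: L_def)
      qed
      ultimately show "((\<lambda>s. sqrt s * deriv \<psi> (t0 + (L - s))) \<longlongrightarrow> 0) (at_right 0)"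
        using Lim_transform_eventually[OF tendsto_minus] by fastforce
      fix s assume "0 < s" "s < L"
      then have s: "t0 < t0 + s" "t0 + s < t1" by (auto simp: L_def)
      have shift: "((\<lambda>s. t0 + s) has_real_derivative 1) (at s)" by (auto intro!: derivative_eq_intros)
      show "((\<lambda>s. \<psi> (t0 + s)) has_real_derivative deriv \<psi> (t0 + s)) (at s)"
        using DERIV_chain2[where f = \<psi> and g = "\<lambda>s. t0 + s", OF pd[OF s] shift] by simp
      show "((\<lambda>s. deriv \<psi> (t0 + s)) has_real_derivative deriv (deriv \<psi>) (t0 + s)) (at s)"
        using DERIV_chain2[where f = "deriv \<psi>" and g = "\<lambda>s. t0 + s", OF pd2[OF s] shift] by simp
      obtain p where p: "f p = t0 + s" using f_surj[of "t0 + s"] s by auto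
      have "laplace_beltrami A g u p = b (t0 + s) * deriv (deriv \<psi>) (t0 + s) + a (t0 + s) * deriv \<psi> (t0 + s)"
        using laplace_psi[OF C2 u_psi, of p] p s by simp
      then show "b (t0 + s) * deriv (deriv \<psi>) (t0 + s) + a (t0 + s) * deriv \<psi> (t0 + s)
          + lam * (\<psi> (t0 + s) powr q - \<psi> (t0 + s)) = 0"
        using eq[of p] u_psi[of p] p by (simp add: algebra_simps)
    qed
    from bspec[OF rigid[OF lam this], of "f x - t0"] have "\<psi> (t0 + (f x - t0)) = 1" using f_bounds[of x] by (simp add: L_def)
    then show "u x = 1" using u_psi[of x] by simp
  qed
  show ?thesis using lam0 main by (intro exI[of _ lam0]) blast
qed

end

section \<open>Lipschitz data from smoothness, and the conclusion\<close>

lemma real_frechet_derivative: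
  fixes F :: "real \<Rightarrow> real"
  assumes "F differentiable (at s)"
  shows "(F has_real_derivative frechet_derivative F (at s) 1) (at s)"
proof -
  obtain D where D: "(F has_real_derivative D) (at s)" using assms by (auto simp: real_differentiable_def)
  from frechet_derivative_at[OF D[unfolded has_field_derivative_def]] have "frechet_derivative F (at s) = (*) D" ..
  then show ?thesis using D by simp
qed

lemma Ck_on_real_lipschitz:
  fixes F :: "real \<Rightarrow> real"
  assumes F: "Ck_on (Suc 0) T F" and T: "{t0..t1} \<subseteq> T"
  obtains C where "\<And>s r. s \<in> {t0..t1} \<Longrightarrow> r \<in> {t0..t1} \<Longrightarrow> \<bar>F s - F r\<bar> \<le> C * \<bar>s - r\<bar>"
proof -
  let ?D = "\<lambda>s. frechet_derivative F (at s) 1"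
  have d: "(F has_real_derivative ?D s) (at s)" if "s \<in> T" for s
    by (rule real_frechet_derivative) (use F that in auto)
  have "continuous_on {t0..t1} (\<lambda>s. \<bar>?D s\<bar>)"
    using F T by (intro continuous_intros) (auto intro: continuous_on_subset)
  then have "bounded ((\<lambda>s. \<bar>?D s\<bar>) ` {t0..t1})"
    by (intro compact_imp_bounded compact_continuous_image compact_Icc)
  then obtain C where "\<forall>x\<in>(\<lambda>s. \<bar>?D s\<bar>) ` {t0..t1}. norm x \<le> C" unfolding bounded_iff ..
  then have C: "\<bar>?D s\<bar> \<le> C" if "s \<in> {t0..t1}" for s using that by fastforce
  show ?thesis
  proof (rule that[of C])
    fix s r assume sr: "s \<in> {t0..t1}" "r \<in> {t0..t1}"
    have "norm (F s - F r) \<le> C * norm (s - r)"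
      by (rule field_differentiable_bound[of "{t0..t1}" F ?D])
        (use sr C T d in \<open>auto intro!: has_field_derivative_at_within[OF d]\<close>)
    then show "\<bar>F s - F r\<bar> \<le> C * \<bar>s - r\<bar>" by simp
  qed
qed

text \<open>The derivatives of the smooth extension are continuous on a neighbourhood, hence bounded
  on the compact interval. The values of F' at the end points come from that extension.\<close>

lemma smooth_on_interval:
  fixes F :: "real \<Rightarrow> real"
  assumes "smooth_on {t0..t1} F"
  obtains F' C where
    "\<And>s. s \<in> {t0..t1} \<Longrightarrow> (F has_real_derivative F' s) (at s within {t0..t1})"
    "\<And>s r. s \<in> {t0..t1} \<Longrightarrow> r \<in> {t0..t1} \<Longrightarrow> \<bar>F s - F r\<bar> \<le> C * \<bar>s - r\<bar>"
    "\<And>s r. s \<in> {t0..t1} \<Longrightarrow> r \<in> {t0..t1} \<Longrightarrow> \<bar>F' s - F' r\<bar> \<le> C * \<bar>s - r\<bar>"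
proof -
  obtain T E where T: "open T" "{t0..t1} \<subseteq> T" and E: "\<And>k. Ck_on k T E" "\<And>x. x \<in> {t0..t1} \<Longrightarrow> E x = F x"
    using assms unfolding smooth_on_def by blast
  let ?D = "\<lambda>s. frechet_derivative E (at s) 1"
  obtain C1 where C1: "\<And>s r. s \<in> {t0..t1} \<Longrightarrow> r \<in> {t0..t1} \<Longrightarrow> \<bar>E s - E r\<bar> \<le> C1 * \<bar>s - r\<bar>"
    using Ck_on_real_lipschitz[OF E(1) T(2)] by blast
  have "Ck_on (Suc 0) T ?D" using E(1)[of "Suc (Suc 0)"] by simp
  then obtain C2 where C2: "\<And>s r. s \<in> {t0..t1} \<Longrightarrow> r \<in> {t0..t1} \<Longrightarrow> \<bar>?D s - ?D r\<bar> \<le> C2 * \<bar>s - r\<bar>"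
    using Ck_on_real_lipschitz[OF _ T(2)] by blast
  show ?thesis
  proof (rule that[of ?D "max C1 C2"])
    fix s assume s: "s \<in> {t0..t1}"
    then have "s \<in> T" using T(2) by blast
    then have "(E has_real_derivative ?D s) (at s)"
      using E(1)[of "Suc 0"] by (intro real_frechet_derivative) auto
    then have "(E has_real_derivative ?D s) (at s within {t0..t1})" by (rule has_field_derivative_at_within)
    then show "(F has_real_derivative ?D s) (at s within {t0..t1})"
      by (rule has_field_derivative_transform_within[OF _ zero_less_one s]) (use E(2) in auto)
    fix r assume r: "r \<in> {t0..t1}"
    have "C1 * \<bar>s - r\<bar> \<le> max C1 C2 * \<bar>s - r\<bar>" "C2 * \<bar>s - r\<bar> \<le> max C1 C2 * \<bar>s - r\<bar>"
      by (intro mult_right_mono; simp)+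
    then show "\<bar>F s - F r\<bar> \<le> max C1 C2 * \<bar>s - r\<bar>" "\<bar>?D s - ?D r\<bar> \<le> max C1 C2 * \<bar>s - r\<bar>"
      using C1[OF s r] C2[OF s r] E(2)[OF s] E(2)[OF r] by auto
  qed
qed

theorem theorem1p2:
  fixes A :: "('m::{t2_space, second_countable_topology}, 'n::finite) chart set"
    and g :: "('m, 'n) chart \<Rightarrow> real ^ 'n \<Rightarrow> real ^ 'n ^ 'n"
    and f :: "'m \<Rightarrow> real" and t0 t1 \<alpha> q :: real and d1 d2 :: nat
  assumes "closed_connected_riemannian_manifold A g"
    and "CARD('n) \<ge> 3"
    and "proper_isoparametric A g t0 t1 d1 d2 f"
    and "0 < \<alpha>" and "\<alpha> < 1"
    and "1 < q" and "ereal q < critical_exponent CARD('n) (min d1 d2)"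
  shows "\<exists>lam0>0. \<forall>(lam::real) (u :: 'm \<Rightarrow> real).
    0 < lam \<longrightarrow> lam < lam0 \<longrightarrow>
    Ck_holder_fun 2 \<alpha> A u \<longrightarrow> (\<forall>x. u x > 0) \<longrightarrow> f_invariant A g t0 f u \<longrightarrow>
    (\<forall>x. - laplace_beltrami A g u x + lam * u x = lam * u x powr q) \<longrightarrow>
    (\<forall>x. u x = 1)"
proof -
  interpret closed_connected_riemannian_manifold A g by (rule assms(1))
  obtain a b where f: "smooth_fun A f" "\<not> f constant_on UNIV" "range f = {t0..t1}"
    and ab: "smooth_on {t0..t1} a" "smooth_on {t0..t1} b"
    and fb: "\<And>x. gradient_norm_sq A g f x = b (f x)" and fa: "\<And>x. laplace_beltrami A g f x = a (f x)"
    using assms(3) unfolding proper_isoparametric_def isoparametric_def by blast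
  have S: "submanifold_of_dim A (f -` {t0}) d1" "submanifold_of_dim A (f -` {t1}) d2"
    and d: "d1 + 2 \<le> CARD('n)" "d2 + 2 \<le> CARD('n)"
    using assms(3) unfolding proper_isoparametric_def by auto
  obtain a' Ca where a: "\<And>s r. s \<in> {t0..t1} \<Longrightarrow> r \<in> {t0..t1} \<Longrightarrow> \<bar>a s - a r\<bar> \<le> Ca * \<bar>s - r\<bar>"
    using smooth_on_interval[OF ab(1)] by metis
  obtain b' Cb where b: "\<And>s. s \<in> {t0..t1} \<Longrightarrow> (b has_real_derivative b' s) (at s within {t0..t1})"
    "\<And>s r. s \<in> {t0..t1} \<Longrightarrow> r \<in> {t0..t1} \<Longrightarrow> \<bar>b' s - b' r\<bar> \<le> Cb * \<bar>s - r\<bar>"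
    using smooth_on_interval[OF ab(2)] by metis
  have mx: "Ca * \<bar>s - r\<bar> \<le> max Ca Cb * \<bar>s - r\<bar>" "Cb * \<bar>s - r\<bar> \<le> max Ca Cb * \<bar>s - r\<bar>" for s r
    by (intro mult_right_mono; simp)+
  interpret isopar A g f t0 t1 a b b' "max Ca Cb"
  proof
    show "t0 < t1"
    proof (rule ccontr)
      assume "\<not> t0 < t1"
      moreover have "f x \<in> {t0..t1}" for x unfolding f(3)[symmetric] by (rule rangeI)
      ultimately have "f x = t0" for x using atLeastAtMost_iff[of "f x" t0 t1] by fastforce
      then show False using f(2) by (auto simp: constant_on_def)
    qed
    show "Ck_on (Suc (Suc 0)) (snd c ` fst c) (f \<circ> chart_inv c)" if "c \<in> A" for c
      using f(1) that unfolding smooth_fun_def by (intro smooth_on_imp_Ck_on chart_open(2)) auto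
    fix s r assume s: "t0 \<le> s" "s \<le> t1" "t0 \<le> r" "r \<le> t1"
    show "\<bar>b' s - b' r\<bar> \<le> max Ca Cb * \<bar>s - r\<bar>" using b(2)[of s r] s mx(2)[of s r] by simp
    show "\<bar>a s - a r\<bar> \<le> max Ca Cb * \<bar>s - r\<bar>" using a[of s r] s mx(1)[of s r] by simp
  qed (use f fa fb b(1) in auto)
  define d where "d = min d1 d2"
  \<comment> \<open>The larger of the two codimensions. It is the more restrictive one for q, which
    is why the critical exponent is taken at the smaller dimension.\<close>
  define K where "K = real CARD('n) - real d"
  have dn: "d + 2 \<le> CARD('n)" using d by (simp add: d_def)
  then have K: "2 \<le> K" "real CARD('n) - real d1 \<le> K" "real CARD('n) - real d2 \<le> K"
    by (auto simp: K_def d_def)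
  \<comment> \<open>For K > 2 this is q < (K + 2) / (K - 2) with the denominator cleared; for K = 2
    the exponent is infinite and the inequality holds for every q.\<close>
  have "K * (q - 1) < 2 * (q + 1)"
  proof (cases "CARD('n) = d + 2")
    case True
    then show ?thesis by (simp add: K_def)
  next
    case False
    then have "2 < K" using dn by (simp add: K_def)
    moreover have "q < (K + 2) / (K - 2)" using assms(7) False by (simp add: critical_exponent_def d_def K_def)
    ultimately have "q * (K - 2) < K + 2" by (simp add: pos_less_divide_eq)
    then show ?thesis by (simp add: algebra_simps)
  qed
  from small_coupling_rigidity[OF S assms(6) K this] obtain lam0 where lam0: "0 < lam0" and
    main: "\<forall>lam u. 0 < lam \<longrightarrow> lam < lam0 \<longrightarrow>
    (\<forall>c\<in>A. Ck_on (Suc (Suc 0)) (snd c ` fst c) (u \<circ> chart_inv c)) \<longrightarrow> (\<forall>x. u x > 0) \<longrightarrow>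
    f_invariant A g t0 f u \<longrightarrow>
    (\<forall>x. - laplace_beltrami A g u x + lam * u x = lam * u x powr q) \<longrightarrow> (\<forall>x. u x = 1)" by blast
  have "\<forall>c\<in>A. Ck_on (Suc (Suc 0)) (snd c ` fst c) (u \<circ> chart_inv c)" if "Ck_holder_fun 2 \<alpha> A u" for u
    using that Ck_holder_on_imp_Ck_on assms(4) unfolding Ck_holder_fun_def numeral_2_eq_2 by blast
  then show ?thesis using lam0 main by (intro exI[of _ lam0]) simp
qed

end
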